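(* (Mackey's Formula) Let $\mathcal{R}$ be a condensed ring, let $\mathcal{G}$ be a condensed group, and let $\mathcal{H},\mathcal{K}\leq\mathcal{G}$ be condensed subgroups such that $\mathcal{H}$ is open in $\mathcal{G}$ (or $\mathcal{K}$ is open in $\mathcal{G}$). Let $\mathcal{M}$ be a right $\mathcal{R}[\mathcal{H}]$-module. Then there is an isomorphism of $\mathcal{R}[\mathcal{K}]$-modules $$\mathrm{Res}^{\mathcal{G}}_{\mathcal{K}}\,\mathrm{Ind}^{\mathcal{G}}_{\mathcal{H}}\mathcal{M}\;\cong\bigoplus_{g\in(\mathcal{H}\backslash\mathcal{G}/\mathcal{K})( * )}\mathrm{Ind}^{\mathcal{K}}_{\mathcal{K}\cap g^{-1}\mathcal{H}g}\,\mathrm{Res}^{g^{-1}\mathcal{H}g}_{\mathcal{K}\cap g^{-1}\mathcal{H}g}\bigl(\mathcal{M}\otimes_{\mathcal{R}[\mathcal{H}]}\mathcal{R}[\mathcal{H}g]\bigr).$$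
   Context: Set-theoretic issues are ignored. All rings are associative with $1$, not necessarily commutative. A condensed set/group/ring/abelian group is a sheaf of sets/groups/rings/abelian groups on the category $\mathbf{CHED}$ of compact Hausdorff extremally disconnected spaces, with finite jointly surjective families as covers; equivalently a contravariant functor $\mathcal{T}$ with $\mathcal{T}(\varnothing)=*$ and $\mathcal{T}(S_1\sqcup S_2)\cong\mathcal{T}(S_1)\times\mathcal{T}(S_2)$. For a ($T1$) topological space $T$, $\underline{T}=C(-,T)$ is the associated condensed set. $\mathcal{T}( * )$ is the underlying set/group/ring. A condensed subgroup $\mathcal{H}\leq\mathcal{G}$ is a condensed group with an injective map of condensed groups $\mathcal{H}\hookrightarrow\mathcal{G}$ (injective on each $S$). $\mathcal{H}$ is open in $\mathcal{G}$ if for every $S\in\mathbf{CHED}$ and every map $\underline{S}\to\mathcal{G}$, the pullback $\underline{S}\times_{\mathcal{G}}\mathcal{H}$ is representable by an open subset of $S$ (i.e. equals $\underline{P}$ for some open $P\subseteq S$). The double quotient $\mathcal{H}\backslash\mathcal{G}/\mathcal{K}$ is the condensed set $S\mapsto\mathcal{H}(S)\backslash\mathcal{G}(S)/\mathcal{K}(S)$. Intersections of subgroups are formed pointwise. For $g\in\mathcal{G}( * )$, $g^{-1}\mathcal{H}g\leq\mathcal{G}$ is the conjugate subgroup $S\mapsto g^{-1}\mathcal{H}(S)g$, and $\mathcal{H}g\subseteq\mathcal{G}$ is the condensed subset $S\mapsto\mathcal{H}(S)g$, which has a left $\mathcal{H}$-action and a right $g^{-1}\mathcal{H}g$-action by multiplication.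 In the direct sum, each double coset in $(\mathcal{H}\backslash\mathcal{G}/\mathcal{K})( * )$ is represented by a lift $g\in\mathcal{G}( * )$. For condensed modules over a condensed ring $\mathcal{A}$ (appropriately sided), $(\mathcal{M}\otimes_{\mathcal{A}}\mathcal{N})(S)=\mathcal{M}(S)\otimes_{\mathcal{A}(S)}\mathcal{N}(S)$, and $\otimes$ means $\otimes_{\underline{\mathbb{Z}}}$. For a condensed set $\mathcal{X}$, $\mathbb{Z}[\mathcal{X}]$ is the free condensed abelian group on $\mathcal{X}$ (the sheafification of $S\mapsto\mathbb{Z}[\mathcal{X}(S)]$), and $\mathcal{R}[\mathcal{X}]=\mathcal{R}\otimes\mathbb{Z}[\mathcal{X}]$; for a condensed group this is the condensed group ring, and $\mathcal{R}[\mathcal{H}g]$ is an $\mathcal{R}[\mathcal{H}]$-$\mathcal{R}[g^{-1}\mathcal{H}g]$-bimodule. For $\mathcal{H}\leq\mathcal{G}$, the induced module of a right $\mathcal{R}[\mathcal{H}]$-module $\mathcal{M}$ is the right $\mathcal{R}[\mathcal{G}]$-module $\mathrm{Ind}^{\mathcal{G}}_{\mathcal{H}}\mathcal{M}=\mathcal{M}\otimes_{\mathcal{R}[\mathcal{H}]}\mathcal{R}[\mathcal{G}]$, and $\mathrm{Res}^{\mathcal{G}}_{\mathcal{H}}\mathcal{N}$ is an $\mathcal{R}[\mathcal{G}]$-module $\mathcal{N}$ viewed as an $\mathcal{R}[\mathcal{H}]$-module via $\mathcal{R}[\mathcal{H}]\hookrightarrow\mathcal{R}[\mathcal{G}]$.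 *)

theory Defs
  imports
    "HOL-Analysis.T1_Spaces"
    "HOL-Algebra.Ring"
    "HOL-Algebra.Module"
    "HOL-Algebra.Coset"
    "HOL-Algebra.Free_Abelian_Groups"
begin

section \<open>Condensed sets, groups and rings\<close>

text \<open>
  The test spaces are the compact Hausdorff extremally disconnected spaces whose points lie in the
  type \<open>'s\<close>. The type variable plays the role of the usual cardinality bound on the site.
\<close>

definition CHED :: "'s topology set" where
  "CHED = {S. compact_space S \<and> Hausdorff_space S \<and>
              (\<forall>U. openin S U \<longrightarrow> openin S (S closure_of U))}"

text \<open>
  \<open>sec X S\<close> is the set (group, ring, module) \<open>X(S)\<close>, with its structure, and
  \<open>res X S T f\<close> is the map \<open>X(T) \<rightarrow> X(S)\<close> induced by a continuous map \<open>f : S \<rightarrow> T\<close>.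
\<close>

record ('s, 'a, 'x) presheaf =
  sec :: "'s topology \<Rightarrow> 'x"
  res :: "'s topology \<Rightarrow> 's topology \<Rightarrow> ('s \<Rightarrow> 's) \<Rightarrow> 'a \<Rightarrow> 'a"

type_synonym ('s, 'a) set_presheaf = "('s, 'a, 'a partial_object) presheaf"
type_synonym ('s, 'a) group_presheaf = "('s, 'a, 'a monoid) presheaf"
type_synonym ('s, 'a) ring_presheaf = "('s, 'a, 'a ring) presheaf"
type_synonym ('s, 'r, 'm) module_presheaf = "('s, 'm, ('r, 'm) module) presheaf"

text \<open>Only the values of \<open>f\<close> on the points of \<open>S\<close> matter, hence the second clause.\<close>

definition functorial :: "('s, 'a, ('a, 'z) partial_object_scheme) presheaf \<Rightarrow> bool" where
  "functorial X \<longleftrightarrow>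
     (\<forall>S\<in>CHED. \<forall>T\<in>CHED. \<forall>f. continuous_map S T f \<longrightarrow>
        res X S T f \<in> carrier (sec X T) \<rightarrow> carrier (sec X S)) \<and>
     (\<forall>S\<in>CHED. \<forall>T\<in>CHED. \<forall>f f'. continuous_map S T f \<longrightarrow> continuous_map S T f' \<longrightarrow>
        (\<forall>s\<in>topspace S. f s = f' s) \<longrightarrow>
        (\<forall>x\<in>carrier (sec X T). res X S T f x = res X S T f' x)) \<and>
     (\<forall>S\<in>CHED. \<forall>x\<in>carrier (sec X S). res X S S id x = x) \<and>
     (\<forall>S\<in>CHED. \<forall>T\<in>CHED. \<forall>U\<in>CHED. \<forall>f h. continuous_map S T f \<longrightarrow> continuous_map T U h \<longrightarrow>
        (\<forall>x\<in>carrier (sec X U). res X S U (h \<circ> f) x = res X S T f (res X T U h x)))"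

text \<open>Restriction from \<open>S\<close> to the subspace \<open>U\<close>, along the inclusion.\<close>

definition restr :: "('s, 'a, 'x) presheaf \<Rightarrow> 's topology \<Rightarrow> 's set \<Rightarrow> 'a \<Rightarrow> 'a" where
  "restr X S U = res X (subtopology S U) S id"

text \<open>
  The decompositions \<open>S = S\<^sub>1 \<squnion> S\<^sub>2\<close> are, up to homeomorphism, the partitions of \<open>S\<close>
  into two open subsets.
\<close>

definition condensed_set :: "('s, 'a, ('a, 'z) partial_object_scheme) presheaf \<Rightarrow> bool" where
  "condensed_set X \<longleftrightarrow>
     functorial X \<and>
     (\<exists>a. carrier (sec X (discrete_topology {})) = {a}) \<and>
     (\<forall>S\<in>CHED. \<forall>P Q. openin S P \<longrightarrow> openin S Q \<longrightarrow> P \<inter> Q = {} \<longrightarrow> P \<union> Q = topspace S \<longrightarrow>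
        bij_betw (\<lambda>x. (restr X S P x, restr X S Q x))
          (carrier (sec X S))
          (carrier (sec X (subtopology S P)) \<times> carrier (sec X (subtopology S Q))))"

definition condensed_group :: "('s, 'a, ('a, 'z) monoid_scheme) presheaf \<Rightarrow> bool" where
  "condensed_group G \<longleftrightarrow>
     condensed_set G \<and>
     (\<forall>S\<in>CHED. group (sec G S)) \<and>
     (\<forall>S\<in>CHED. \<forall>T\<in>CHED. \<forall>f. continuous_map S T f \<longrightarrow> res G S T f \<in> hom (sec G T) (sec G S))"

definition condensed_ring :: "('s, 'a, ('a, 'z) ring_scheme) presheaf \<Rightarrow> bool" where
  "condensed_ring R \<longleftrightarrow>
     condensed_set R \<and>
     (\<forall>S\<in>CHED. ring (sec R S)) \<and>
     (\<forall>S\<in>CHED. \<forall>T\<in>CHED. \<forall>f. continuous_map S T f \<longrightarrow>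
        res R S T f \<in> ring_hom (sec R T) (sec R S))"

definition condensed_map ::
  "('s, 'a, ('a, 'y) partial_object_scheme) presheaf \<Rightarrow>
   ('s, 'b, ('b, 'z) partial_object_scheme) presheaf \<Rightarrow> ('s topology \<Rightarrow> 'a \<Rightarrow> 'b) \<Rightarrow> bool" where
  "condensed_map X Y \<phi> \<longleftrightarrow>
     (\<forall>S\<in>CHED. \<phi> S \<in> carrier (sec X S) \<rightarrow> carrier (sec Y S)) \<and>
     (\<forall>S\<in>CHED. \<forall>T\<in>CHED. \<forall>f. continuous_map S T f \<longrightarrow>
        (\<forall>x\<in>carrier (sec X T). \<phi> S (res X S T f x) = res Y S T f (\<phi> T x)))"

text \<open>The condensed set \<open>C(-, X)\<close> of a topological space \<open>X\<close>.\<close>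

definition underline :: "'x topology \<Rightarrow> ('s, 's \<Rightarrow> 'x) set_presheaf" where
  "underline X =
     \<lparr>sec = (\<lambda>S. \<lparr>carrier = {f \<in> extensional (topspace S). continuous_map S X f}\<rparr>),
      res = (\<lambda>S T f h. compose (topspace S) h f)\<rparr>"

text \<open>The one-point test space.\<close>

definition pt :: "'s topology" where
  "pt = discrete_topology {undefined}"


section \<open>Condensed subgroups and cosets\<close>

text \<open>
  Condensed subsets and subgroups of \<open>G\<close> are families of subsets \<open>X S\<close> of \<open>G(S)\<close>.
\<close>

definition sub_presheaf ::
  "('s, 'a, ('a, 'z) partial_object_scheme) presheaf \<Rightarrow> ('s topology \<Rightarrow> 'a set) \<Rightarrow>
   ('s, 'a, ('a, 'z) partial_object_scheme) presheaf" where
  "sub_presheaf G X = G\<lparr>sec := (\<lambda>S. (sec G S)\<lparr>carrier := X S\<rparr>)\<rparr>"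

definition condensed_subgroup ::
  "('s, 'a, ('a, 'z) monoid_scheme) presheaf \<Rightarrow> ('s topology \<Rightarrow> 'a set) \<Rightarrow> bool" where
  "condensed_subgroup G H \<longleftrightarrow>
     (\<forall>S\<in>CHED. subgroup (H S) (sec G S)) \<and> condensed_group (sub_presheaf G H)"

text \<open>
  The pullback of \<open>H\<close> along \<open>\<phi>\<close> consists of the pairs \<open>(f, \<phi> f)\<close> with \<open>\<phi> f\<close> in \<open>H\<close>; it is
  regarded as a condensed subset of \<open>underline S\<close> through its first component.
\<close>

definition open_in_condensed ::
  "('s, 'a, ('a, 'z) partial_object_scheme) presheaf \<Rightarrow> ('s topology \<Rightarrow> 'a set) \<Rightarrow> bool" where
  "open_in_condensed G H \<longleftrightarrow>
     (\<forall>S\<in>(CHED :: 's topology set). \<forall>\<phi>. condensed_map (underline S) G \<phi> \<longrightarrow>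
        (\<exists>P. openin S P \<and>
           (\<forall>T\<in>CHED. {f \<in> carrier (sec (underline S) T). \<phi> T f \<in> H T} =
                     carrier (sec (underline (subtopology S P)) T))))"

definition whole ::
  "('s, 'a, ('a, 'z) partial_object_scheme) presheaf \<Rightarrow> 's topology \<Rightarrow> 'a set" where
  "whole G S = carrier (sec G S)"

text \<open>The image in \<open>G(S)\<close> of an element of \<open>G(*)\<close>.\<close>

definition const_sec :: "('s, 'a, 'x) presheaf \<Rightarrow> 'a \<Rightarrow> 's topology \<Rightarrow> 'a" where
  "const_sec G g S = res G S pt (\<lambda>_. undefined) g"

definition translate ::
  "('s, 'a, ('a, 'z) monoid_scheme) presheaf \<Rightarrow> ('s topology \<Rightarrow> 'a set) \<Rightarrow> 'a \<Rightarrow>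
   's topology \<Rightarrow> 'a set" where
  "translate G H g S = H S #>\<^bsub>sec G S\<^esub> const_sec G g S"

definition conjugate ::
  "('s, 'a, ('a, 'z) monoid_scheme) presheaf \<Rightarrow> ('s topology \<Rightarrow> 'a set) \<Rightarrow> 'a \<Rightarrow>
   's topology \<Rightarrow> 'a set" where
  "conjugate G H g S =
     inv\<^bsub>sec G S\<^esub> (const_sec G g S) <#\<^bsub>sec G S\<^esub> (H S #>\<^bsub>sec G S\<^esub> const_sec G g S)"

definition intersection ::
  "('s topology \<Rightarrow> 'a set) \<Rightarrow> ('s topology \<Rightarrow> 'a set) \<Rightarrow> 's topology \<Rightarrow> 'a set" where
  "intersection H K S = H S \<inter> K S"

text \<open>
  The sections over \<open>S\<close> are the double cosets \<open>H(S) x K(S)\<close>. A double coset over \<open>T\<close> pulls back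
  along \<open>f : S \<rightarrow> T\<close> to the double coset of the pullback of any of its elements.
\<close>

definition double_quotient ::
  "('s, 'a, ('a, 'z) monoid_scheme) presheaf \<Rightarrow> ('s topology \<Rightarrow> 'a set) \<Rightarrow>
   ('s topology \<Rightarrow> 'a set) \<Rightarrow> ('s, 'a set) set_presheaf" where
  "double_quotient G H K =
     \<lparr>sec = (\<lambda>S. \<lparr>carrier = (\<lambda>x. (H S #>\<^bsub>sec G S\<^esub> x) <#>\<^bsub>sec G S\<^esub> K S) ` carrier (sec G S)\<rparr>),
      res = (\<lambda>S T f D. (H S <#>\<^bsub>sec G S\<^esub> (res G S T f ` D)) <#>\<^bsub>sec G S\<^esub> K S)\<rparr>"


section \<open>Modules and tensor products\<close>

text \<open>
  The record \<open>module\<close> is used for left and for right modules over a ring that need not be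
  commutative. For a right module, \<open>smult M a m\<close> is \<open>m \<cdot> a\<close>.
\<close>

definition right_module ::
  "('a, 'y) ring_scheme \<Rightarrow> ('a, 'm, 'z) module_scheme \<Rightarrow> bool" where
  "right_module A M \<longleftrightarrow>
     abelian_group M \<and>
     (\<forall>a\<in>carrier A. \<forall>m\<in>carrier M. smult M a m \<in> carrier M) \<and>
     (\<forall>a\<in>carrier A. \<forall>b\<in>carrier A. \<forall>m\<in>carrier M.
        smult M (a \<oplus>\<^bsub>A\<^esub> b) m = smult M a m \<oplus>\<^bsub>M\<^esub> smult M b m) \<and>
     (\<forall>a\<in>carrier A. \<forall>m\<in>carrier M. \<forall>n\<in>carrier M.
        smult M a (m \<oplus>\<^bsub>M\<^esub> n) = smult M a m \<oplus>\<^bsub>M\<^esub> smult M a n) \<and>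
     (\<forall>a\<in>carrier A. \<forall>b\<in>carrier A. \<forall>m\<in>carrier M.
        smult M (a \<otimes>\<^bsub>A\<^esub> b) m = smult M b (smult M a m)) \<and>
     (\<forall>m\<in>carrier M. smult M \<one>\<^bsub>A\<^esub> m = m)"

text \<open>
  A bimodule has its left action in \<open>smult\<close>; \<open>rsmult N n b\<close> is \<open>n \<cdot> b\<close>.
\<close>

record ('a, 'b, 'n) bimodule = "('a, 'n) module" +
  rsmult :: "'n \<Rightarrow> 'b \<Rightarrow> 'n"

text \<open>
  The module with underlying abelian group \<open>Q\<close>, written multiplicatively, and action \<open>act\<close>. The
  ring multiplication and unit of the record \<open>module\<close> carry no meaning for modules.
\<close>

definition module_of :: "('m, 'z) monoid_scheme \<Rightarrow> ('a \<Rightarrow> 'm \<Rightarrow> 'm) \<Rightarrow> ('a, 'm) module" where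
  "module_of Q act =
     \<lparr>carrier = carrier Q, monoid.mult = undefined, monoid.one = undefined,
      ring.zero = \<one>\<^bsub>Q\<^esub>, ring.add = monoid.mult Q, module.smult = act\<rparr>"

type_synonym ('m, 'n) tensor = "('m \<times> 'n \<Rightarrow>\<^sub>0 int) set"

inductive_set tensor_rels ::
  "('a, 'x) ring_scheme \<Rightarrow> ('a, 'm, 'y) module_scheme \<Rightarrow> ('a, 'n, 'z) module_scheme \<Rightarrow>
   ('m \<times> 'n \<Rightarrow>\<^sub>0 int) set"
  for A M N where
  add_left: "\<lbrakk>m \<in> carrier M; m' \<in> carrier M; n \<in> carrier N\<rbrakk> \<Longrightarrow>
     frag_of (m \<oplus>\<^bsub>M\<^esub> m', n) - frag_of (m, n) - frag_of (m', n) \<in> tensor_rels A M N"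
| add_right: "\<lbrakk>m \<in> carrier M; n \<in> carrier N; n' \<in> carrier N\<rbrakk> \<Longrightarrow>
     frag_of (m, n \<oplus>\<^bsub>N\<^esub> n') - frag_of (m, n) - frag_of (m, n') \<in> tensor_rels A M N"
| balanced: "\<lbrakk>m \<in> carrier M; a \<in> carrier A; n \<in> carrier N\<rbrakk> \<Longrightarrow>
     frag_of (smult M a m, n) - frag_of (m, smult N a n) \<in> tensor_rels A M N"

definition tensor_null ::
  "('a, 'x) ring_scheme \<Rightarrow> ('a, 'm, 'y) module_scheme \<Rightarrow> ('a, 'n, 'z) module_scheme \<Rightarrow>
   ('m \<times> 'n \<Rightarrow>\<^sub>0 int) set" where
  "tensor_null A M N =
     generate (free_Abelian_group (carrier M \<times> carrier N)) (tensor_rels A M N)"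

definition tensor_group ::
  "('a, 'x) ring_scheme \<Rightarrow> ('a, 'm, 'y) module_scheme \<Rightarrow> ('a, 'n, 'z) module_scheme \<Rightarrow>
   ('m, 'n) tensor monoid" where
  "tensor_group A M N =
     free_Abelian_group (carrier M \<times> carrier N) Mod tensor_null A M N"

definition pure_tensor ::
  "('a, 'x) ring_scheme \<Rightarrow> ('a, 'm, 'y) module_scheme \<Rightarrow> ('a, 'n, 'z) module_scheme \<Rightarrow>
   'm \<Rightarrow> 'n \<Rightarrow> ('m, 'n) tensor" where
  "pure_tensor A M N m n =
     tensor_null A M N #>\<^bsub>free_Abelian_group (carrier M \<times> carrier N)\<^esub> frag_of (m, n)"

text \<open>
  The value at \<open>t\<close> of the homomorphism into the abelian group \<open>B\<close> that a balanced biadditive map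
  \<open>f\<close> induces on the tensor product: \<open>t\<close> is a coset of formal sums, and the value is computed from
  any of them.
\<close>

definition tensor_lift ::
  "('b, 'z) monoid_scheme \<Rightarrow> ('m \<Rightarrow> 'n \<Rightarrow> 'b) \<Rightarrow> ('m, 'n) tensor \<Rightarrow> 'b" where
  "tensor_lift B f t =
     (THE b. \<exists>c\<in>t. b = finprod B (\<lambda>p. f (fst p) (snd p) [^]\<^bsub>B\<^esub> Poly_Mapping.lookup c p)
                                  (Poly_Mapping.keys c))"


section \<open>Condensed modules\<close>

definition condensed_right_module ::
  "('s, 'a) ring_presheaf \<Rightarrow> ('s, 'a, 'm) module_presheaf \<Rightarrow> bool" where
  "condensed_right_module A M \<longleftrightarrow>
     condensed_set M \<and>
     (\<forall>S\<in>CHED. right_module (sec A S) (sec M S)) \<and>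
     (\<forall>S\<in>CHED. \<forall>T\<in>CHED. \<forall>f. continuous_map S T f \<longrightarrow>
        (\<forall>m\<in>carrier (sec M T). \<forall>n\<in>carrier (sec M T).
           res M S T f (m \<oplus>\<^bsub>sec M T\<^esub> n) = res M S T f m \<oplus>\<^bsub>sec M S\<^esub> res M S T f n) \<and>
        (\<forall>a\<in>carrier (sec A T). \<forall>m\<in>carrier (sec M T).
           res M S T f (smult (sec M T) a m) = smult (sec M S) (res A S T f a) (res M S T f m)))"

definition condensed_module_isomorphic ::
  "('s, 'a) ring_presheaf \<Rightarrow> ('s, 'a, 'm) module_presheaf \<Rightarrow> ('s, 'a, 'n) module_presheaf \<Rightarrow> bool"
  where
  "condensed_module_isomorphic A M N \<longleftrightarrow>
     (\<exists>\<phi>. condensed_map M N \<phi> \<and>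
       (\<forall>S\<in>CHED.
          bij_betw (\<phi> S) (carrier (sec M S)) (carrier (sec N S)) \<and>
          (\<forall>m\<in>carrier (sec M S). \<forall>m'\<in>carrier (sec M S).
             \<phi> S (m \<oplus>\<^bsub>sec M S\<^esub> m') = \<phi> S m \<oplus>\<^bsub>sec N S\<^esub> \<phi> S m') \<and>
          (\<forall>a\<in>carrier (sec A S). \<forall>m\<in>carrier (sec M S).
             \<phi> S (smult (sec M S) a m) = smult (sec N S) a (\<phi> S m))))"

text \<open>
  The pointwise direct sum is already a sheaf, because the sheaf condition only involves finite
  products.
\<close>

definition condensed_direct_sum ::
  "'i set \<Rightarrow> ('i \<Rightarrow> ('s, 'a, 'm) module_presheaf) \<Rightarrow> ('s, 'a, 'i \<Rightarrow> 'm) module_presheaf" where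
  "condensed_direct_sum I N =
     \<lparr>sec = (\<lambda>S. module_of (sum_group I (\<lambda>i. add_monoid (sec (N i) S)))
                             (\<lambda>a x. \<lambda>i\<in>I. smult (sec (N i) S) a (x i))),
      res = (\<lambda>S T f x. \<lambda>i\<in>I. res (N i) S T f (x i))\<rparr>"

definition condensed_tensor ::
  "('s, 'a) ring_presheaf \<Rightarrow>
   ('s, 'm, ('a, 'm, 'y) module_scheme) presheaf \<Rightarrow>
   ('s, 'n, ('a, 'n, 'z) module_scheme) presheaf \<Rightarrow> ('s, ('m, 'n) tensor) group_presheaf" where
  "condensed_tensor A M N =
     \<lparr>sec = (\<lambda>S. tensor_group (sec A S) (sec M S) (sec N S)),
      res = (\<lambda>S T f.
        tensor_lift (tensor_group (sec A S) (sec M S) (sec N S))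
          (\<lambda>m n. pure_tensor (sec A S) (sec M S) (sec N S) (res M S T f m) (res N S T f n)))\<rparr>"

text \<open>The tensor product with a bimodule, as a right module.\<close>

definition condensed_tensor_bimodule ::
  "('s, 'a) ring_presheaf \<Rightarrow> ('s, 'a, 'm) module_presheaf \<Rightarrow>
   ('s, 'n, ('a, 'b, 'n) bimodule) presheaf \<Rightarrow> ('s, 'b, ('m, 'n) tensor) module_presheaf" where
  "condensed_tensor_bimodule A M N =
     \<lparr>sec = (\<lambda>S. module_of (sec (condensed_tensor A M N) S)
        (\<lambda>b. tensor_lift (sec (condensed_tensor A M N) S)
           (\<lambda>m n. pure_tensor (sec A S) (sec M S) (sec N S) m (rsmult (sec N S) n b)))),
      res = res (condensed_tensor A M N)\<rparr>"


section \<open>Sheafification\<close>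

text \<open>
  Every cover of an extremally disconnected \<open>S\<close> is refined by a finite partition into clopen
  subsets. The sections over \<open>S\<close> of the sheafification of \<open>F\<close> are therefore the families of germs
  at the points of \<open>S\<close> that are locally, on clopen subsets, given by a section of \<open>F\<close>.
  A germ is the set of all pairs \<open>(U, a)\<close> representing it.
\<close>

definition clopen_nhd :: "'s topology \<Rightarrow> 's \<Rightarrow> 's set \<Rightarrow> bool" where
  "clopen_nhd S s U \<longleftrightarrow> openin S U \<and> closedin S U \<and> s \<in> U"

definition germ ::
  "('s, 'a, ('a, 'z) partial_object_scheme) presheaf \<Rightarrow> 's topology \<Rightarrow> 's \<Rightarrow> 's set \<Rightarrow> 'a \<Rightarrow>
   ('s set \<times> 'a) set" where
  "germ F S s U a =
     {(V, b). clopen_nhd S s V \<and> b \<in> carrier (sec F (subtopology S V)) \<and>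
        (\<exists>W. clopen_nhd S s W \<and> W \<subseteq> U \<inter> V \<and>
           restr F (subtopology S U) W a = restr F (subtopology S V) W b)}"

type_synonym ('s, 'a) germs = "'s \<Rightarrow> ('s set \<times> 'a) set"

text \<open>
  The maps induced on sheafifications by natural operations \<open>op\<close> on presheaves, of one and of two
  arguments, with values in \<open>F\<close>.
\<close>

definition sheafify_op1 ::
  "('s, 'c, ('c, 'z) partial_object_scheme) presheaf \<Rightarrow> ('s topology \<Rightarrow> 'a \<Rightarrow> 'c) \<Rightarrow>
   's topology \<Rightarrow> ('s, 'a) germs \<Rightarrow> ('s, 'c) germs" where
  "sheafify_op1 F op S \<sigma> =
     (\<lambda>s\<in>topspace S. THE \<gamma>. \<exists>U a. (U, a) \<in> \<sigma> s \<and> \<gamma> = germ F S s U (op (subtopology S U) a))"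

definition sheafify_op2 ::
  "('s, 'c, ('c, 'z) partial_object_scheme) presheaf \<Rightarrow> ('s topology \<Rightarrow> 'a \<Rightarrow> 'b \<Rightarrow> 'c) \<Rightarrow>
   's topology \<Rightarrow> ('s, 'a) germs \<Rightarrow> ('s, 'b) germs \<Rightarrow> ('s, 'c) germs" where
  "sheafify_op2 F op S \<sigma> \<tau> =
     (\<lambda>s\<in>topspace S. THE \<gamma>. \<exists>U a b. (U, a) \<in> \<sigma> s \<and> (U, b) \<in> \<tau> s \<and>
        \<gamma> = germ F S s U (op (subtopology S U) a b))"

definition sheafify_unit ::
  "('s, 'a, ('a, 'z) partial_object_scheme) presheaf \<Rightarrow> 's topology \<Rightarrow> 'a \<Rightarrow> ('s, 'a) germs" where
  "sheafify_unit F S a = (\<lambda>s\<in>topspace S. germ F S s (topspace S) a)"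

definition sheafify ::
  "('s, 'a, ('a, 'z) monoid_scheme) presheaf \<Rightarrow> ('s, ('s, 'a) germs) group_presheaf" where
  "sheafify F =
     \<lparr>sec = (\<lambda>S. \<lparr>carrier = {\<sigma> \<in> extensional (topspace S). \<forall>s\<in>topspace S.
                      \<exists>U a. clopen_nhd S s U \<and> a \<in> carrier (sec F (subtopology S U)) \<and>
                            (\<forall>t\<in>U. \<sigma> t = germ F S t U a)},
                   monoid.mult = sheafify_op2 F (\<lambda>T. monoid.mult (sec F T)) S,
                   monoid.one = sheafify_unit F S \<one>\<^bsub>sec F S\<^esub>\<rparr>),
      res = (\<lambda>S T f \<sigma>. \<lambda>s\<in>topspace S. THE \<gamma>. \<exists>U a. (U, a) \<in> \<sigma> (f s) \<and>
        (let V = {x \<in> topspace S. f x \<in> U}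
         in \<gamma> = germ F S s V (res F (subtopology S V) (subtopology T U) f a)))\<rparr>"


section \<open>Free condensed abelian groups and group rings\<close>

definition free_presheaf ::
  "('s, 'a, ('a, 'z) partial_object_scheme) presheaf \<Rightarrow> ('s, 'a \<Rightarrow>\<^sub>0 int) group_presheaf" where
  "free_presheaf X =
     \<lparr>sec = (\<lambda>S. free_Abelian_group (carrier (sec X S))),
      res = (\<lambda>S T f. frag_extend (\<lambda>x. frag_of (res X S T f x)))\<rparr>"

definition free_condensed ::
  "('s, 'a, ('a, 'z) partial_object_scheme) presheaf \<Rightarrow>
   ('s, ('s, 'a \<Rightarrow>\<^sub>0 int) germs) group_presheaf" where
  "free_condensed X = sheafify (free_presheaf X)"

text \<open>The condensed ring \<open>C(-, \<int>)\<close>, for the discrete topology on the integers.\<close>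

definition condensed_int :: "('s, 's \<Rightarrow> int) ring_presheaf" where
  "condensed_int =
     \<lparr>sec = (\<lambda>S. \<lparr>carrier = carrier (sec (underline (discrete_topology (UNIV :: int set))) S),
                   monoid.mult = (\<lambda>f h. \<lambda>s\<in>topspace S. f s * h s),
                   monoid.one = (\<lambda>s\<in>topspace S. 1),
                   ring.zero = (\<lambda>s\<in>topspace S. 0),
                   ring.add = (\<lambda>f h. \<lambda>s\<in>topspace S. f s + h s)\<rparr>),
      res = res (underline (discrete_topology (UNIV :: int set)))\<rparr>"

text \<open>
  A condensed abelian group \<open>F\<close> is a module over \<open>condensed_int\<close> in a unique way: \<open>f \<in> C(S, \<int>)\<close>
  acts as multiplication by \<open>n\<close> on the clopen subset of \<open>S\<close> where \<open>f\<close> has the value \<open>n\<close>.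
\<close>

definition int_action ::
  "('s, 'a, ('a, 'z) monoid_scheme) presheaf \<Rightarrow> 's topology \<Rightarrow> ('s \<Rightarrow> int) \<Rightarrow> 'a \<Rightarrow> 'a" where
  "int_action F S f x =
     (THE y. y \<in> carrier (sec F S) \<and>
        (\<forall>n. let U = {s \<in> topspace S. f s = n}
             in restr F S U y = restr F S U x [^]\<^bsub>sec F (subtopology S U)\<^esub> n))"

definition int_module ::
  "('s, 'a, ('a, 'z) monoid_scheme) presheaf \<Rightarrow> ('s, 's \<Rightarrow> int, 'a) module_presheaf" where
  "int_module F = \<lparr>sec = (\<lambda>S. module_of (sec F S) (int_action F S)), res = res F\<rparr>"

definition additive_group ::
  "('s, 'a) ring_presheaf \<Rightarrow> ('s, 'a) group_presheaf" where
  "additive_group R = \<lparr>sec = (\<lambda>S. add_monoid (sec R S)), res = res R\<rparr>"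

text \<open>
  From here on \<open>X\<close>, \<open>Y\<close>, \<open>W\<close> stand for condensed subsets of a fixed condensed group \<open>G\<close>, and
  \<open>R[X]\<close> is the tensor product over \<open>condensed_int\<close> of \<open>R\<close> and the free condensed abelian
  group on \<open>X\<close>.
\<close>

type_synonym ('s, 'r, 'g) lin = "('r, ('s, 'g \<Rightarrow>\<^sub>0 int) germs) tensor"

definition lin ::
  "('s, 'r) ring_presheaf \<Rightarrow> ('s, 'g) group_presheaf \<Rightarrow> ('s topology \<Rightarrow> 'g set) \<Rightarrow>
   ('s, ('s, 'r, 'g) lin) group_presheaf" where
  "lin R G X =
     condensed_tensor condensed_int
       (int_module (additive_group R)) (int_module (free_condensed (sub_presheaf G X)))"

definition lin_pure ::
  "('s, 'r) ring_presheaf \<Rightarrow> ('s, 'g) group_presheaf \<Rightarrow> ('s topology \<Rightarrow> 'g set) \<Rightarrow>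
   's topology \<Rightarrow> 'r \<Rightarrow> ('s, 'g \<Rightarrow>\<^sub>0 int) germs \<Rightarrow> ('s, 'r, 'g) lin" where
  "lin_pure R G X S =
     pure_tensor (sec condensed_int S)
       (sec (int_module (additive_group R)) S)
       (sec (int_module (free_condensed (sub_presheaf G X))) S)"

text \<open>The map \<open>R[X] \<rightarrow> R[W]\<close> induced by an inclusion \<open>X \<subseteq> W\<close>.\<close>

definition lin_incl ::
  "('s, 'r) ring_presheaf \<Rightarrow> ('s, 'g) group_presheaf \<Rightarrow> ('s topology \<Rightarrow> 'g set) \<Rightarrow>
   's topology \<Rightarrow> ('s, 'r, 'g) lin \<Rightarrow> ('s, 'r, 'g) lin" where
  "lin_incl R G W S =
     tensor_lift (sec (lin R G W) S)
       (\<lambda>r a. lin_pure R G W S r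
          (sheafify_op1 (free_presheaf (sub_presheaf G W)) (\<lambda>_ c. c) S a))"

text \<open>
  The products \<open>\<int>[X] \<times> \<int>[Y] \<rightarrow> \<int>[W]\<close> and \<open>R[X] \<times> R[Y] \<rightarrow> R[W]\<close> that extend the multiplication
  of \<open>G\<close> when \<open>X Y \<subseteq> W\<close>; on pure tensors the latter is \<open>(r \<otimes> a) (r' \<otimes> a') = r r' \<otimes> a a'\<close>.
\<close>

definition free_mult ::
  "('s, 'g) group_presheaf \<Rightarrow> ('s topology \<Rightarrow> 'g set) \<Rightarrow> 's topology \<Rightarrow>
   ('s, 'g \<Rightarrow>\<^sub>0 int) germs \<Rightarrow> ('s, 'g \<Rightarrow>\<^sub>0 int) germs \<Rightarrow> ('s, 'g \<Rightarrow>\<^sub>0 int) germs" where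
  "free_mult G W =
     sheafify_op2 (free_presheaf (sub_presheaf G W))
       (\<lambda>T. \<lambda>c d. frag_extend (\<lambda>x. frag_extend (\<lambda>y. frag_of (x \<otimes>\<^bsub>sec G T\<^esub> y)) d) c)"

definition lin_mult ::
  "('s, 'r) ring_presheaf \<Rightarrow> ('s, 'g) group_presheaf \<Rightarrow> ('s topology \<Rightarrow> 'g set) \<Rightarrow>
   's topology \<Rightarrow> ('s, 'r, 'g) lin \<Rightarrow> ('s, 'r, 'g) lin \<Rightarrow> ('s, 'r, 'g) lin" where
  "lin_mult R G W S t u =
     tensor_lift (sec (lin R G W) S)
       (\<lambda>r a. tensor_lift (sec (lin R G W) S)
          (\<lambda>r' a'. lin_pure R G W S (r \<otimes>\<^bsub>sec R S\<^esub> r') (free_mult G W S a a')) u) t"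

definition group_ring ::
  "('s, 'r) ring_presheaf \<Rightarrow> ('s, 'g) group_presheaf \<Rightarrow> ('s topology \<Rightarrow> 'g set) \<Rightarrow>
   ('s, ('s, 'r, 'g) lin) ring_presheaf" where
  "group_ring R G H =
     \<lparr>sec = (\<lambda>S. \<lparr>carrier = carrier (sec (lin R G H) S),
                   monoid.mult = lin_mult R G H S,
                   monoid.one = lin_pure R G H S \<one>\<^bsub>sec R S\<^esub>
                     (sheafify_unit (free_presheaf (sub_presheaf G H)) S (frag_of \<one>\<^bsub>sec G S\<^esub>)),
                   ring.zero = \<one>\<^bsub>sec (lin R G H) S\<^esub>,
                   ring.add = monoid.mult (sec (lin R G H) S)\<rparr>),
      res = res (lin R G H)\<rparr>"

text \<open>
  \<open>R[X]\<close> as a bimodule over any group rings \<open>R[H]\<close> and \<open>R[H']\<close> such that \<open>H X \<subseteq> X\<close> and \<open>X H' \<subseteq> X\<close>.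
\<close>

definition lin_bimodule ::
  "('s, 'r) ring_presheaf \<Rightarrow> ('s, 'g) group_presheaf \<Rightarrow> ('s topology \<Rightarrow> 'g set) \<Rightarrow>
   ('s, ('s, 'r, 'g) lin, (('s, 'r, 'g) lin, ('s, 'r, 'g) lin, ('s, 'r, 'g) lin) bimodule) presheaf"
  where
  "lin_bimodule R G X =
     \<lparr>sec = (\<lambda>S. \<lparr>carrier = carrier (sec (lin R G X) S),
                   monoid.mult = undefined, monoid.one = undefined,
                   ring.zero = \<one>\<^bsub>sec (lin R G X) S\<^esub>,
                   ring.add = monoid.mult (sec (lin R G X) S),
                   smult = lin_mult R G X S,
                   rsmult = lin_mult R G X S\<rparr>),
      res = res (lin R G X)\<rparr>"

text \<open>Induction of a right \<open>R[L]\<close>-module to \<open>R[W]\<close>, for condensed subgroups \<open>L \<le> W\<close> of \<open>G\<close>.\<close>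

definition Ind ::
  "('s, 'r) ring_presheaf \<Rightarrow> ('s, 'g) group_presheaf \<Rightarrow>
   ('s topology \<Rightarrow> 'g set) \<Rightarrow> ('s topology \<Rightarrow> 'g set) \<Rightarrow>
   ('s, ('s, 'r, 'g) lin, 'm) module_presheaf \<Rightarrow>
   ('s, ('s, 'r, 'g) lin, ('m, ('s, 'r, 'g) lin) tensor) module_presheaf" where
  "Ind R G W L N = condensed_tensor_bimodule (group_ring R G L) N (lin_bimodule R G W)"

text \<open>
  Restriction of an \<open>R[W]\<close>-module along \<open>R[L] \<rightarrow> R[W]\<close>. The argument \<open>L\<close> only indicates over
  which group ring the result is considered.
\<close>

definition Res ::
  "('s, 'r) ring_presheaf \<Rightarrow> ('s, 'g) group_presheaf \<Rightarrow>
   ('s topology \<Rightarrow> 'g set) \<Rightarrow> ('s topology \<Rightarrow> 'g set) \<Rightarrow>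
   ('s, ('s, 'r, 'g) lin, 'm) module_presheaf \<Rightarrow>
   ('s, ('s, 'r, 'g) lin, 'm) module_presheaf" where
  "Res R G W L N =
     N\<lparr>sec := (\<lambda>S. (sec N S)\<lparr>smult := (\<lambda>a. smult (sec N S) (lin_incl R G W S a))\<rparr>)\<rparr>"

end

theory Submission
  imports Defs
begin

text \<open>
  If \<open>H\<close> or \<open>K\<close> is open, then every section of \<open>G\<close> over \<open>S\<close> is, on suitable clopen neighbourhoods
  \<open>V\<close> of the points of \<open>S\<close>, of the form \<open>h g k\<close> with \<open>h \<in> H(V)\<close>, \<open>k \<in> K(V)\<close> and \<open>g\<close> the constant section
  representing the double coset of its value at the point. By compactness the elements
  \<open>r h g k\<close>, supported on \<open>V\<close> and zero elsewhere, generate \<open>R[G](S)\<close>, and homomorphisms out of \<open>R[G](S)\<close>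
  may be prescribed on them as long as they are compatible with clopen partitions of \<open>V\<close>.
  Therefore \<open>m \<otimes> r h g k \<mapsto> (m \<otimes> r h g) \<otimes> k\<close>, with values in the summand of \<open>g\<close>, defines a map out of
  \<open>M \<otimes> R[G]\<close>. It does not depend on the choice of \<open>h\<close> and \<open>k\<close>, because elements of
  \<open>K \<inter> g\<^sup>-\<^sup>1 H g\<close> move across the outer tensor sign, and it is inverse to the sum of the multiplication maps
  \<open>(m \<otimes> a) \<otimes> b \<mapsto> m \<otimes> a b\<close>, which are visibly natural and \<open>R[K]\<close>-linear.
\<close>

section \<open>Homomorphisms and generators\<close>

text \<open>Elements of \<open>R[G](S)\<close> are germs of formal sums inside a tensor product and
  have no normal form, so maps out of it cannot be written down element by element. Prescribing them
  on elements with clopen support rests on a presentation, \<open>Zfree_universal\<close>. If a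
  combination of such elements vanishes, then near each point every support in it may be taken full
  or empty, the combination becomes one formal sum of sections, and its zero germ makes that sum
  literally zero on a smaller neighbourhood. The prescribed values cancel there, and clopen
  induction carries the cancellation to all of \<open>S\<close>. The coefficients from
  \<open>R\<close> add one condition: a value may depend on \<open>r\<close> only through its
  restriction to the support. This condition encodes the tensor product over locally constant
  integer functions. The tensor products of the statement are formed separately over each
  \<open>S\<close>, so the comparison is made over a fixed \<open>S\<close>; linearity and
  naturality of the constructed map are then inherited from the multiplication maps, whose images
  generate.\<close>

definition generates :: "('a, 'x) monoid_scheme \<Rightarrow> 'a set \<Rightarrow> bool" where
  "generates A Q \<longleftrightarrow> Q \<subseteq> carrier A \<and> carrier A = generate A Q"

lemma hom_inv:
  assumes "group A" "group B" "h \<in> hom A B" "x \<in> carrier A"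
  shows "h (inv\<^bsub>A\<^esub> x) = inv\<^bsub>B\<^esub> (h x)"
  using group_hom.hom_inv[of A B h x] assms by (auto simp: group_hom_def group_hom_axioms_def)

lemma generates_induct [consumes 3, case_names one gen inv mult]:
  assumes "group A" "generates A Q" "x \<in> carrier A"
    and "P \<one>\<^bsub>A\<^esub>" "\<And>q. q \<in> Q \<Longrightarrow> P q"
    and "\<And>x. x \<in> carrier A \<Longrightarrow> P x \<Longrightarrow> P (inv\<^bsub>A\<^esub> x)"
    and "\<And>x y. x \<in> carrier A \<Longrightarrow> y \<in> carrier A \<Longrightarrow> P x \<Longrightarrow> P y \<Longrightarrow> P (x \<otimes>\<^bsub>A\<^esub> y)"
  shows "P x"
proof -
  interpret group A by fact
  have sub: "Q \<subseteq> carrier A" and "x \<in> generate A Q"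
    using assms by (auto simp: generates_def)
  from this(2) show ?thesis
  proof induction
    case (incl h) then show ?case using assms by auto
  next
    case (inv h) then show ?case using assms(5,6) sub by auto
  next
    case (eng h1 h2) then show ?case using assms(7) generate_in_carrier[OF sub] by auto
  qed (use assms in auto)
qed

lemma hom_eq_on_generators:
  assumes "group A" "group B" "generates A Q" "h \<in> hom A B" "h' \<in> hom A B"
    and "\<And>q. q \<in> Q \<Longrightarrow> h q = h' q" and "x \<in> carrier A"
  shows "h x = h' x"
  using assms(1,3,7)
proof (induction rule: generates_induct)
  case one then show ?case using hom_one assms by metis
next
  case (inv x) then show ?case using hom_inv assms by metis
next
  case (mult x y) then show ?case using hom_mult assms by metis
qed (use assms in auto)

lemma generates_image:
  assumes "group A" "group B" "h \<in> hom A B" "generates A Q" "x \<in> carrier A"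
  shows "h x \<in> generate B (h ` Q)"
proof -
  interpret group_hom A B h using assms by (auto simp: group_hom_def group_hom_axioms_def)
  show ?thesis using generate_img[of Q] assms by (auto simp: generates_def)
qed

lemma generatesI:
  assumes "group A" "generates A Q" "Q' \<subseteq> carrier A" "Q \<subseteq> generate A Q'"
  shows "generates A Q'"
proof -
  interpret group A by fact
  have "generate A Q \<subseteq> generate A Q'"
    by (rule generate_subgroup_incl[OF assms(4)]) (rule generate_is_subgroup[OF assms(3)])
  then show ?thesis using assms generate_incl[OF assms(3)] by (auto simp: generates_def)
qed

text \<open>Two elements with the same image under \<open>p\<close> differ by an element of its
  kernel, which \<open>\<Phi>\<close> kills, so \<open>\<Phi>\<close> takes one value on each fibre.
  Stated for a surjection rather than a quotient, because the groups to be mapped out of later are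
  not literally quotients.\<close>

lemma factor_hom:
  assumes F: "group F" and A: "group A" and B: "group B"
    and p: "p \<in> hom F A" and \<Phi>: "\<Phi> \<in> hom F B" and surj: "carrier A \<subseteq> p ` carrier F"
    and ker: "\<And>c. c \<in> carrier F \<Longrightarrow> p c = \<one>\<^bsub>A\<^esub> \<Longrightarrow> \<Phi> c = \<one>\<^bsub>B\<^esub>"
  obtains h where "h \<in> hom A B" "\<And>c. c \<in> carrier F \<Longrightarrow> h (p c) = \<Phi> c"
proof -
  interpret F: group F by fact
  interpret A: group A by fact
  interpret B: group B by fact
  have eq: "\<Phi> c = \<Phi> d" if "c \<in> carrier F" "d \<in> carrier F" "p c = p d" for c d
  proof -
    have "p (c \<otimes>\<^bsub>F\<^esub> inv\<^bsub>F\<^esub> d) = p c \<otimes>\<^bsub>A\<^esub> inv\<^bsub>A\<^esub> p d"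
      using that hom_mult[OF p] hom_inv[OF F A p] by simp
    then have "p (c \<otimes>\<^bsub>F\<^esub> inv\<^bsub>F\<^esub> d) = \<one>\<^bsub>A\<^esub>" using that hom_in_carrier[OF p] by simp
    then have "\<Phi> (c \<otimes>\<^bsub>F\<^esub> inv\<^bsub>F\<^esub> d) = \<one>\<^bsub>B\<^esub>" using that by (simp add: ker)
    then have "\<Phi> c \<otimes>\<^bsub>B\<^esub> inv\<^bsub>B\<^esub> \<Phi> d = \<one>\<^bsub>B\<^esub>"
      using that hom_mult[OF \<Phi>] hom_inv[OF F B \<Phi>] by simp
    then show ?thesis using that hom_in_carrier[OF \<Phi>]
      by (metis B.inv_closed B.inv_equality B.inv_inv)
  qed
  define r where "r y = (SOME c. c \<in> carrier F \<and> p c = y)" for y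
  have r: "r y \<in> carrier F \<and> p (r y) = y" if "y \<in> carrier A" for y
    unfolding r_def by (rule someI_ex) (use that surj in blast)
  have h: "\<Phi> (r (p c)) = \<Phi> c" if "c \<in> carrier F" for c
    using eq r that hom_in_carrier[OF p] by blast
  have "(\<lambda>y. \<Phi> (r y)) \<in> hom A B"
  proof (rule homI)
    fix x y assume x: "x \<in> carrier A" and y: "y \<in> carrier A"
    have "\<Phi> (r (p (r x \<otimes>\<^bsub>F\<^esub> r y))) = \<Phi> (r x \<otimes>\<^bsub>F\<^esub> r y)" using r x y by (intro h) auto
    then show "\<Phi> (r (x \<otimes>\<^bsub>A\<^esub> y)) = \<Phi> (r x) \<otimes>\<^bsub>B\<^esub> \<Phi> (r y)"
      using r x y hom_mult[OF p, of "r x" "r y"] hom_mult[OF \<Phi>, of "r x" "r y"] by simp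
  qed (use r hom_in_carrier[OF \<Phi>] in auto)
  then show ?thesis using h that by blast
qed

text \<open>The universal map from a free abelian group to a multiplicatively written one, in the
  shape in which it occurs inside \<open>tensor_lift\<close>, so that the facts below apply there
  directly.\<close>

definition frag_eval :: "('b, 'z) monoid_scheme \<Rightarrow> ('p \<Rightarrow> 'b) \<Rightarrow> ('p \<Rightarrow>\<^sub>0 int) \<Rightarrow> 'b" where
  "frag_eval B f c = finprod B (\<lambda>p. f p [^]\<^bsub>B\<^esub> Poly_Mapping.lookup c p) (Poly_Mapping.keys c)"

text \<open>The supports of \<open>c\<close>, \<open>d\<close> and \<open>c + d\<close> differ
  because of cancellation; over one finite set containing all of them the exponents simply add,
  which gives additivity of \<open>frag_eval\<close>.\<close>

lemma frag_eval_superset: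
  assumes "comm_group B" "finite Q" "Poly_Mapping.keys c \<subseteq> Q" "f ` Q \<subseteq> carrier B"
  shows "frag_eval B f c = finprod B (\<lambda>p. f p [^]\<^bsub>B\<^esub> Poly_Mapping.lookup c p) Q"
proof -
  interpret comm_group B by fact
  show ?thesis unfolding frag_eval_def
    by (rule finprod_mono_neutral_cong_left)
       (use assms in \<open>auto simp: in_keys_iff image_subset_iff\<close>)
qed

lemma frag_eval_hom:
  assumes "comm_group B" "\<And>p. p \<in> P \<Longrightarrow> f p \<in> carrier B"
  shows "frag_eval B f \<in> hom (free_Abelian_group P) B"
proof (rule homI)
  interpret comm_group B by fact
  fix c assume "c \<in> carrier (free_Abelian_group P)"
  then show "frag_eval B f c \<in> carrier B"
    unfolding frag_eval_def using assms by (intro finprod_closed) auto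
next
  interpret comm_group B by fact
  fix c d assume cd: "c \<in> carrier (free_Abelian_group P)" "d \<in> carrier (free_Abelian_group P)"
  let ?Q = "Poly_Mapping.keys c \<union> Poly_Mapping.keys d"
  have f: "f ` ?Q \<subseteq> carrier B" using assms cd by auto
  note eq = frag_eval_superset[OF assms(1) _ _ f]
  have "frag_eval B f (c + d) = finprod B (\<lambda>p. f p [^]\<^bsub>B\<^esub> Poly_Mapping.lookup (c + d) p) ?Q"
    using Poly_Mapping.keys_add[of c d] by (intro eq) auto
  also have "\<dots> = finprod B (\<lambda>p. f p [^]\<^bsub>B\<^esub> Poly_Mapping.lookup c p \<otimes>\<^bsub>B\<^esub> f p [^]\<^bsub>B\<^esub> Poly_Mapping.lookup d p) ?Q"
    using f by (intro finprod_cong) (auto simp: lookup_add Pi_iff image_subset_iff int_pow_mult simp_implies_def)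
  also have "\<dots> = frag_eval B f c \<otimes>\<^bsub>B\<^esub> frag_eval B f d"
    using f by (subst (1 2) eq) (auto intro!: finprod_multf)
  finally show "frag_eval B f (c \<otimes>\<^bsub>free_Abelian_group P\<^esub> d) = frag_eval B f c \<otimes>\<^bsub>B\<^esub> frag_eval B f d"
    by simp
qed

lemma frag_eval_of [simp]:
  assumes "comm_group B" "f p \<in> carrier B"
  shows "frag_eval B f (frag_of p) = f p"
proof -
  interpret comm_group B by fact
  show ?thesis using assms by (simp add: frag_eval_def)
qed

lemma frag_eval_0 [simp]:
  assumes "comm_group B"
  shows "frag_eval B f 0 = \<one>\<^bsub>B\<^esub>"
proof -
  interpret comm_group B by fact
  show ?thesis by (simp add: frag_eval_def)
qed

lemma free_Abelian_group_generates: "generates (free_Abelian_group P) (frag_of ` P)"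
proof -
  interpret group "free_Abelian_group P" by simp
  have *: "frag_of ` P \<subseteq> carrier (free_Abelian_group P)" by auto
  have sg: "subgroup (generate (free_Abelian_group P) (frag_of ` P)) (free_Abelian_group P)"
    by (rule generate_is_subgroup[OF *])
  have "c \<in> generate (free_Abelian_group P) (frag_of ` P)" if "Poly_Mapping.keys c \<subseteq> P" for c :: "'a \<Rightarrow>\<^sub>0 int"
  proof (rule free_Abelian_group_induct[OF that])
    show "0 \<in> generate (free_Abelian_group P) (frag_of ` P)"
      using generate.one[of "free_Abelian_group P"] by simp
  next
    fix x y :: "'a \<Rightarrow>\<^sub>0 int"
    assume 2: "Poly_Mapping.keys x \<subseteq> P" "Poly_Mapping.keys y \<subseteq> P"
      "x \<in> generate (free_Abelian_group P) (frag_of ` P)" "y \<in> generate (free_Abelian_group P) (frag_of ` P)"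
    then have "x \<otimes>\<^bsub>free_Abelian_group P\<^esub> inv\<^bsub>free_Abelian_group P\<^esub> y \<in> generate (free_Abelian_group P) (frag_of ` P)"
      using sg by (meson subgroup.m_closed subgroup.m_inv_closed)
    then show "x - y \<in> generate (free_Abelian_group P) (frag_of ` P)" using 2 by simp
  next
    fix a assume "a \<in> P"
    then show "frag_of a \<in> generate (free_Abelian_group P) (frag_of ` P)" by (intro generate.incl imageI)
  qed
  then have "carrier (free_Abelian_group P) \<subseteq> generate (free_Abelian_group P) (frag_of ` P)" by auto
  then show ?thesis using * generate_incl[OF *] unfolding generates_def by blast
qed

section \<open>Tensor products\<close>

text \<open>These closure conditions put the defining relations into the free group, so tensor
  products can be used before any ring or module law for \<open>R[X]\<close> is established.\<close>

definition tensorable ::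
  "('a, 'x) ring_scheme \<Rightarrow> ('a, 'm, 'y) module_scheme \<Rightarrow> ('a, 'n, 'z) module_scheme \<Rightarrow> bool" where
  "tensorable A M N \<longleftrightarrow>
     (\<forall>m\<in>carrier M. \<forall>m'\<in>carrier M. m \<oplus>\<^bsub>M\<^esub> m' \<in> carrier M) \<and>
     (\<forall>n\<in>carrier N. \<forall>n'\<in>carrier N. n \<oplus>\<^bsub>N\<^esub> n' \<in> carrier N) \<and>
     (\<forall>a\<in>carrier A. \<forall>m\<in>carrier M. smult M a m \<in> carrier M) \<and>
     (\<forall>a\<in>carrier A. \<forall>n\<in>carrier N. smult N a n \<in> carrier N)"

definition balanced_map ::
  "('a, 'x) ring_scheme \<Rightarrow> ('a, 'm, 'y) module_scheme \<Rightarrow> ('a, 'n, 'z) module_scheme \<Rightarrow>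
   ('b, 'w) monoid_scheme \<Rightarrow> ('m \<Rightarrow> 'n \<Rightarrow> 'b) \<Rightarrow> bool" where
  "balanced_map A M N B f \<longleftrightarrow>
     (\<forall>m\<in>carrier M. f m \<in> hom (add_monoid N) B) \<and>
     (\<forall>n\<in>carrier N. (\<lambda>m. f m n) \<in> hom (add_monoid M) B) \<and>
     (\<forall>m\<in>carrier M. \<forall>a\<in>carrier A. \<forall>n\<in>carrier N. f (smult M a m) n = f m (smult N a n))"

context
  fixes A :: "('a, 'x) ring_scheme" and M :: "('a, 'm, 'y) module_scheme"
    and N :: "('a, 'n, 'z) module_scheme"
  assumes T: "tensorable A M N"
begin

private abbreviation "Fr \<equiv> free_Abelian_group (carrier M \<times> carrier N)"

private lemma rels_subset: "tensor_rels A M N \<subseteq> carrier Fr"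
proof
  fix c assume "c \<in> tensor_rels A M N"
  then show "c \<in> carrier Fr"
  proof cases
    case (add_left m m' n)
    then show ?thesis using T unfolding tensorable_def carrier_free_Abelian_group_iff
      by (auto dest!: subsetD[OF Poly_Mapping.keys_diff] split: if_splits)
  next
    case (add_right m n n')
    then show ?thesis using T unfolding tensorable_def carrier_free_Abelian_group_iff
      by (auto dest!: subsetD[OF Poly_Mapping.keys_diff] split: if_splits)
  next
    case (balanced m a n)
    then show ?thesis using T unfolding tensorable_def carrier_free_Abelian_group_iff
      by (auto dest!: subsetD[OF Poly_Mapping.keys_diff] split: if_splits)
  qed
qed

private lemma null_subgroup: "subgroup (tensor_null A M N) Fr"
  unfolding tensor_null_def by (rule group.generate_is_subgroup) (use rels_subset in auto)

private lemma null_normal: "tensor_null A M N \<lhd> Fr"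
  by (rule comm_group.subgroup_imp_normal[OF abelian_free_Abelian_group null_subgroup])

lemma comm_group_tensor: "comm_group (tensor_group A M N)"
  unfolding tensor_group_def
  by (rule comm_group.abelian_FactGroup[OF abelian_free_Abelian_group null_subgroup])

private lemma coset_hom: "(\<lambda>c. tensor_null A M N #>\<^bsub>Fr\<^esub> c) \<in> hom Fr (tensor_group A M N)"
  unfolding tensor_group_def by (rule normal.r_coset_hom_Mod[OF null_normal])

private lemma tensor_carrier:
  "carrier (tensor_group A M N) = (\<lambda>c. tensor_null A M N #>\<^bsub>Fr\<^esub> c) ` carrier Fr"
  by (auto simp: tensor_group_def FactGroup_def RCOSETS_def)

private lemma coset_rel:
  assumes "c \<in> tensor_rels A M N"
  shows "tensor_null A M N #>\<^bsub>Fr\<^esub> c = \<one>\<^bsub>tensor_group A M N\<^esub>"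
proof -
  have "c \<in> tensor_null A M N" unfolding tensor_null_def using assms by (rule generate.incl)
  then have "tensor_null A M N #>\<^bsub>Fr\<^esub> c = tensor_null A M N"
    using null_subgroup group_free_Abelian_group
    by (metis subgroup.rcos_const)
  then show ?thesis by (simp add: tensor_group_def FactGroup_def)
qed

lemma pure_tensor_closed:
  "m \<in> carrier M \<Longrightarrow> n \<in> carrier N \<Longrightarrow> pure_tensor A M N m n \<in> carrier (tensor_group A M N)"
  unfolding pure_tensor_def by (rule hom_in_carrier[OF coset_hom]) auto

private lemma coset_diff:
  assumes "c \<in> carrier Fr" "d \<in> carrier Fr" "c - d \<in> carrier Fr"
  shows "tensor_null A M N #>\<^bsub>Fr\<^esub> c = (tensor_null A M N #>\<^bsub>Fr\<^esub> (c - d)) \<otimes>\<^bsub>tensor_group A M N\<^esub> (tensor_null A M N #>\<^bsub>Fr\<^esub> d)"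
  using hom_mult[OF coset_hom assms(3,2)] by simp

lemma pure_tensor_balanced_map: "balanced_map A M N (tensor_group A M N) (pure_tensor A M N)"
proof -
  let ?q = "\<lambda>c. tensor_null A M N #>\<^bsub>Fr\<^esub> c"
  interpret TG: comm_group "tensor_group A M N" by (rule comm_group_tensor)
  have eq: "?q (frag_of a) = ?q (frag_of b) \<otimes>\<^bsub>tensor_group A M N\<^esub> ?q (frag_of c)"
    if "frag_of a - frag_of b - frag_of c \<in> tensor_rels A M N"
      "a \<in> carrier M \<times> carrier N" "b \<in> carrier M \<times> carrier N" "c \<in> carrier M \<times> carrier N" for a b c
  proof -
    have 1: "?q (frag_of a - frag_of b - frag_of c) = \<one>\<^bsub>tensor_group A M N\<^esub>" by (rule coset_rel) fact
    have 2: "frag_of b + frag_of c \<in> carrier Fr"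
      using group.is_monoid[OF group_free_Abelian_group, of "carrier M \<times> carrier N"] that
      by (metis frag_of_in_free_Abelian_group monoid.m_closed mult_free_Abelian_group)
    have "frag_of a - (frag_of b + frag_of c) \<in> carrier Fr"
      using subsetD[OF rels_subset that(1)] by (simp add: diff_diff_add)
    then have "?q (frag_of a) = ?q (frag_of a - (frag_of b + frag_of c)) \<otimes>\<^bsub>tensor_group A M N\<^esub> ?q (frag_of b + frag_of c)"
      using that 2 by (intro coset_diff) auto
    moreover have "?q (frag_of b + frag_of c) = ?q (frag_of b) \<otimes>\<^bsub>tensor_group A M N\<^esub> ?q (frag_of c)"
      using hom_mult[OF coset_hom, of "frag_of b" "frag_of c"] that by simp
    moreover have "?q (frag_of b + frag_of c) \<in> carrier (tensor_group A M N)"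
      using 2 by (rule hom_in_carrier[OF coset_hom])
    ultimately show ?thesis using 1 by (simp add: diff_diff_add)
  qed
  have eq': "?q (frag_of a) = ?q (frag_of b)"
    if "frag_of a - frag_of b \<in> tensor_rels A M N"
      "a \<in> carrier M \<times> carrier N" "b \<in> carrier M \<times> carrier N" for a b
  proof -
    have "?q (frag_of a) = ?q (frag_of a - frag_of b) \<otimes>\<^bsub>tensor_group A M N\<^esub> ?q (frag_of b)"
      by (rule coset_diff[OF _ _ subsetD[OF rels_subset that(1)]])
        (use that(2,3) in \<open>simp_all del: carrier_free_Abelian_group_iff\<close>)
    then show ?thesis using coset_rel[OF that(1)] hom_in_carrier[OF coset_hom, of "frag_of b"] that by simp
  qed
  have cl: "m \<oplus>\<^bsub>M\<^esub> m' \<in> carrier M" if "m \<in> carrier M" "m' \<in> carrier M" for m m'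
    using T that by (auto simp: tensorable_def)
  have cl': "m \<oplus>\<^bsub>N\<^esub> m' \<in> carrier N" if "m \<in> carrier N" "m' \<in> carrier N" for m m'
    using T that by (auto simp: tensorable_def)
  show ?thesis unfolding balanced_map_def
  proof (intro conjI ballI)
    fix m assume m: "m \<in> carrier M"
    show "pure_tensor A M N m \<in> hom (add_monoid N) (tensor_group A M N)"
    proof (rule homI)
      fix x y assume "x \<in> carrier (add_monoid N)" "y \<in> carrier (add_monoid N)"
      then show "pure_tensor A M N m (x \<otimes>\<^bsub>add_monoid N\<^esub> y) =
          pure_tensor A M N m x \<otimes>\<^bsub>tensor_group A M N\<^esub> pure_tensor A M N m y"
        using m cl' unfolding pure_tensor_def by (intro eq) (auto intro: tensor_rels.intros)
    qed (use m pure_tensor_closed in auto)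
  next
    fix n assume n: "n \<in> carrier N"
    show "(\<lambda>m. pure_tensor A M N m n) \<in> hom (add_monoid M) (tensor_group A M N)"
    proof (rule homI)
      fix x y assume "x \<in> carrier (add_monoid M)" "y \<in> carrier (add_monoid M)"
      then show "pure_tensor A M N (x \<otimes>\<^bsub>add_monoid M\<^esub> y) n =
          pure_tensor A M N x n \<otimes>\<^bsub>tensor_group A M N\<^esub> pure_tensor A M N y n"
        using n cl unfolding pure_tensor_def by (intro eq) (auto intro: tensor_rels.intros)
    qed (use n pure_tensor_closed in auto)
  next
    fix m a n assume "m \<in> carrier M" "a \<in> carrier A" "n \<in> carrier N"
    then show "pure_tensor A M N (smult M a m) n = pure_tensor A M N m (smult N a n)"
      using T unfolding pure_tensor_def tensorable_def by (intro eq' tensor_rels.intros) auto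
  qed
qed

lemma tensor_generates:
  "generates (tensor_group A M N) {pure_tensor A M N m n |m n. m \<in> carrier M \<and> n \<in> carrier N}"
  (is "generates _ ?Q")
proof -
  interpret TG: comm_group "tensor_group A M N" by (rule comm_group_tensor)
  have Q: "?Q \<subseteq> carrier (tensor_group A M N)" using pure_tensor_closed by auto
  have "t \<in> generate (tensor_group A M N) ?Q" if t: "t \<in> carrier (tensor_group A M N)" for t
  proof -
    obtain c where c: "c \<in> carrier Fr" "t = tensor_null A M N #>\<^bsub>Fr\<^esub> c" using t tensor_carrier by auto
    have "t \<in> generate (tensor_group A M N) ((\<lambda>c. tensor_null A M N #>\<^bsub>Fr\<^esub> c) ` (frag_of ` (carrier M \<times> carrier N)))"
      unfolding c(2)
      by (rule generates_image[OF _ _ coset_hom free_Abelian_group_generates c(1)]) (auto simp: TG.is_group)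
    moreover have "(\<lambda>c. tensor_null A M N #>\<^bsub>Fr\<^esub> c) ` (frag_of ` (carrier M \<times> carrier N)) = ?Q"
      by (auto simp: pure_tensor_def image_iff)
    ultimately show ?thesis by simp
  qed
  then show ?thesis using Q TG.generate_incl[OF Q] by (auto simp: generates_def)
qed

text \<open>Evaluation of formal sums kills all three kinds of relation, hence the subgroup they
  generate, and is therefore constant on its cosets. This is what makes the description in the
  definition of \<open>tensor_lift\<close> denote.\<close>

lemma tensor_lift:
  assumes B: "comm_group B" and f: "balanced_map A M N B f"
  shows tensor_lift_hom: "tensor_lift B f \<in> hom (tensor_group A M N) B"
    and tensor_lift_pure:
      "\<And>m n. m \<in> carrier M \<Longrightarrow> n \<in> carrier N \<Longrightarrow> tensor_lift B f (pure_tensor A M N m n) = f m n"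
proof -
  interpret B: comm_group B by fact
  let ?q = "\<lambda>c. tensor_null A M N #>\<^bsub>Fr\<^esub> c"
  let ?e = "frag_eval B (\<lambda>p. f (fst p) (snd p))"
  have fc: "f m n \<in> carrier B" if "m \<in> carrier M" "n \<in> carrier N" for m n
    using f that by (auto simp: balanced_map_def hom_def)
  have e: "?e \<in> hom Fr B" using fc by (intro frag_eval_hom B) auto
  have e_of: "?e (frag_of (m, n)) = f m n" if "m \<in> carrier M" "n \<in> carrier N" for m n
    using fc that by (simp add: B)
  have e_diff: "?e (c - d) = ?e c \<otimes>\<^bsub>B\<^esub> inv\<^bsub>B\<^esub> ?e d" if "c \<in> carrier Fr" "d \<in> carrier Fr" for c d
  proof -
    have "?e (c \<otimes>\<^bsub>Fr\<^esub> inv\<^bsub>Fr\<^esub> d) = ?e c \<otimes>\<^bsub>B\<^esub> ?e (inv\<^bsub>Fr\<^esub> d)"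
      using that by (intro hom_mult[OF e] group.inv_closed) auto
    then show ?thesis using that hom_inv[OF _ B.is_group e that(2)] by simp
  qed
  have diff_cl: "c - d \<in> carrier Fr" if "c \<in> carrier Fr" "d \<in> carrier Fr" for c d :: "'m \<times> 'n \<Rightarrow>\<^sub>0 int"
    using that Poly_Mapping.keys_diff[of c d] by auto
  have rel: "?e c = \<one>\<^bsub>B\<^esub>" if "c \<in> tensor_rels A M N" for c
    using that
  proof cases
    case (add_left m m' n)
    have "m \<oplus>\<^bsub>M\<^esub> m' \<in> carrier M" using T add_left by (auto simp: tensorable_def)
    moreover have "f (m \<oplus>\<^bsub>M\<^esub> m') n = f m n \<otimes>\<^bsub>B\<^esub> f m' n" using f add_left by (auto simp: balanced_map_def hom_def)
    ultimately show ?thesis using add_left fc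
      by (simp add: e_diff diff_cl e_of del: carrier_free_Abelian_group_iff)
        (metis B.inv_mult B.m_assoc B.m_comm B.m_closed B.r_inv B.inv_closed)
  next
    case (add_right m n n')
    have "n \<oplus>\<^bsub>N\<^esub> n' \<in> carrier N" using T add_right by (auto simp: tensorable_def)
    moreover have "f m (n \<oplus>\<^bsub>N\<^esub> n') = f m n \<otimes>\<^bsub>B\<^esub> f m n'" using f add_right by (auto simp: balanced_map_def hom_def)
    ultimately show ?thesis using add_right fc
      by (simp add: e_diff diff_cl e_of del: carrier_free_Abelian_group_iff)
        (metis B.inv_mult B.m_assoc B.m_comm B.m_closed B.r_inv B.inv_closed)
  next
    case (balanced m a n)
    have "smult M a m \<in> carrier M" "smult N a n \<in> carrier N" using T balanced by (auto simp: tensorable_def)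
    moreover have "f (smult M a m) n = f m (smult N a n)" using f balanced by (auto simp: balanced_map_def)
    ultimately show ?thesis using balanced fc
      by (simp add: e_diff diff_cl e_of del: carrier_free_Abelian_group_iff)
  qed
  interpret e: group_hom Fr B ?e using e B.is_group by (auto simp: group_hom_def group_hom_axioms_def)
  have null: "?e c = \<one>\<^bsub>B\<^esub>" if "c \<in> tensor_null A M N" for c
  proof -
    have "tensor_rels A M N \<subseteq> kernel Fr B ?e" using rel rels_subset unfolding kernel_def by blast
    then have "tensor_null A M N \<subseteq> kernel Fr B ?e" unfolding tensor_null_def
      by (rule group.generate_subgroup_incl[OF group_free_Abelian_group _ e.subgroup_kernel])
    then show ?thesis using that by (auto simp: kernel_def)
  qed
  have lift: "tensor_lift B f (?q c) = ?e c" if c: "c \<in> carrier Fr" for c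
  proof -
    have *: "?e d = ?e c" if d: "d \<in> ?q c" for d
    proof -
      obtain n where n: "n \<in> tensor_null A M N" "d = n \<otimes>\<^bsub>Fr\<^esub> c" using d by (auto simp: r_coset_def)
      have "n \<in> carrier Fr" using n null_subgroup subgroup.subset by blast
      then show ?thesis using n c null[OF n(1)] hom_mult[OF e, of n c] e.hom_closed by simp
    qed
    have c': "c \<in> ?q c" by (rule group.rcos_self[OF group_free_Abelian_group c null_subgroup])
    have "(THE b. \<exists>d\<in>?q c. b = ?e d) = ?e c" by (rule the_equality) (use * c' in blast)+
    then show ?thesis by (simp add: tensor_lift_def frag_eval_def)
  qed
  show "tensor_lift B f \<in> hom (tensor_group A M N) B"
  proof (rule homI)
    fix s t assume "s \<in> carrier (tensor_group A M N)" "t \<in> carrier (tensor_group A M N)"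
    then obtain c d where cd: "c \<in> carrier Fr" "d \<in> carrier Fr" "s = ?q c" "t = ?q d"
      using tensor_carrier by auto
    have "s \<otimes>\<^bsub>tensor_group A M N\<^esub> t = ?q (c + d)" using hom_mult[OF coset_hom cd(1,2)] cd by simp
    moreover have "c + d \<in> carrier Fr" using cd Poly_Mapping.keys_add[of c d] by auto
    ultimately show "tensor_lift B f (s \<otimes>\<^bsub>tensor_group A M N\<^esub> t) = tensor_lift B f s \<otimes>\<^bsub>B\<^esub> tensor_lift B f t"
      using cd hom_mult[OF e cd(1,2)] by (simp add: lift del: carrier_free_Abelian_group_iff)
  next
    fix s assume "s \<in> carrier (tensor_group A M N)"
    then obtain c where c: "c \<in> carrier Fr" "s = ?q c" using tensor_carrier by auto
    show "tensor_lift B f s \<in> carrier B" unfolding c(2) lift[OF c(1)] by (rule hom_in_carrier[OF e c(1)])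
  qed
  show "tensor_lift B f (pure_tensor A M N m n) = f m n" if "m \<in> carrier M" "n \<in> carrier N" for m n
  proof -
    have "frag_of (m, n) \<in> carrier Fr" using that by simp
    from lift[OF this] e_of[OF that] show ?thesis by (simp add: pure_tensor_def)
  qed
qed

text \<open>For fixed \<open>m\<close>, tensoring with \<open>m\<close> is a homomorphism in
  \<open>n\<close>, so it carries generators of \<open>N\<close> to generators of its image.\<close>

lemma tensor_generates_right:
  assumes N: "group (add_monoid N)" and Q: "generates (add_monoid N) Q"
  shows "generates (tensor_group A M N) {pure_tensor A M N m n |m n. m \<in> carrier M \<and> n \<in> Q}"
proof (rule generatesI[OF _ tensor_generates])
  interpret TG: comm_group "tensor_group A M N" by (rule comm_group_tensor)
  show "group (tensor_group A M N)" by (rule TG.is_group)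
  show "{pure_tensor A M N m n |m n. m \<in> carrier M \<and> n \<in> Q} \<subseteq> carrier (tensor_group A M N)"
    using Q pure_tensor_closed by (auto simp: generates_def)
  show "{pure_tensor A M N m n |m n. m \<in> carrier M \<and> n \<in> carrier N}
    \<subseteq> generate (tensor_group A M N) {pure_tensor A M N m n |m n. m \<in> carrier M \<and> n \<in> Q}"
  proof clarify
    fix m n assume m: "m \<in> carrier M" and n: "n \<in> carrier N"
    have "pure_tensor A M N m \<in> hom (add_monoid N) (tensor_group A M N)"
      using pure_tensor_balanced_map m by (auto simp: balanced_map_def)
    from generates_image[OF N TG.is_group this Q] n
    have "pure_tensor A M N m n \<in> generate (tensor_group A M N) (pure_tensor A M N m ` Q)" by simp
    moreover have "pure_tensor A M N m ` Q \<subseteq> {pure_tensor A M N m n |m n. m \<in> carrier M \<and> n \<in> Q}"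
      using m by auto
    ultimately show "pure_tensor A M N m n \<in> generate (tensor_group A M N) {pure_tensor A M N m n |m n. m \<in> carrier M \<and> n \<in> Q}"
      using TG.mono_generate by blast
  qed
qed

text \<open>The right factor is assumed to be reduced already: \<open>Q'\<close> comes from
  \<open>tensor_generates_right\<close>, and only the left factor changes here. Chaining the two
  gives generators on both sides.\<close>

lemma tensor_generates_left:
  assumes M: "group (add_monoid M)" and Q: "generates (add_monoid M) Q"
    and Q': "generates (tensor_group A M N) {pure_tensor A M N m n |m n. m \<in> carrier M \<and> n \<in> Q'}"
    and Q'N: "Q' \<subseteq> carrier N"
  shows "generates (tensor_group A M N) {pure_tensor A M N m n |m n. m \<in> Q \<and> n \<in> Q'}"
proof (rule generatesI[OF _ Q'])
  interpret TG: comm_group "tensor_group A M N" by (rule comm_group_tensor)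
  show "group (tensor_group A M N)" by (rule TG.is_group)
  show "{pure_tensor A M N m n |m n. m \<in> Q \<and> n \<in> Q'} \<subseteq> carrier (tensor_group A M N)"
    using Q Q'N pure_tensor_closed by (auto simp: generates_def)
  show "{pure_tensor A M N m n |m n. m \<in> carrier M \<and> n \<in> Q'}
    \<subseteq> generate (tensor_group A M N) {pure_tensor A M N m n |m n. m \<in> Q \<and> n \<in> Q'}"
  proof clarify
    fix m n assume m: "m \<in> carrier M" and n: "n \<in> Q'"
    have "(\<lambda>m. pure_tensor A M N m n) \<in> hom (add_monoid M) (tensor_group A M N)"
      using pure_tensor_balanced_map n Q'N by (auto simp: balanced_map_def)
    from generates_image[OF M TG.is_group this Q] m
    have "pure_tensor A M N m n \<in> generate (tensor_group A M N) ((\<lambda>m. pure_tensor A M N m n) ` Q)" by simp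
    moreover have "(\<lambda>m. pure_tensor A M N m n) ` Q \<subseteq> {pure_tensor A M N m n |m n. m \<in> Q \<and> n \<in> Q'}"
      using n by auto
    ultimately show "pure_tensor A M N m n \<in> generate (tensor_group A M N) {pure_tensor A M N m n |m n. m \<in> Q \<and> n \<in> Q'}"
      using TG.mono_generate by blast
  qed
qed

end

lemma carrier_module_of [simp]: "carrier (module_of Q act) = carrier Q"
  and add_module_of [simp]: "ring.add (module_of Q act) = monoid.mult Q"
  and zero_module_of [simp]: "ring.zero (module_of Q act) = monoid.one Q"
  and smult_module_of [simp]: "module.smult (module_of Q act) = act"
  by (simp_all add: module_of_def)

section \<open>Clopen subsets of extremally disconnected spaces\<close>

definition clopen :: "'s topology \<Rightarrow> 's set \<Rightarrow> bool" where
  "clopen S U \<longleftrightarrow> openin S U \<and> closedin S U"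

lemma clopen_nhd_iff: "clopen_nhd S s U \<longleftrightarrow> clopen S U \<and> s \<in> U"
  by (auto simp: clopen_nhd_def clopen_def)

lemma clopen_subset: "clopen S U \<Longrightarrow> U \<subseteq> topspace S"
  by (auto simp: clopen_def openin_subset)

lemma clopen_simps [simp]: "clopen S {}" "clopen S (topspace S)"
  by (auto simp: clopen_def)

lemma clopen_Int: "clopen S U \<Longrightarrow> clopen S V \<Longrightarrow> clopen S (U \<inter> V)"
  and clopen_Un: "clopen S U \<Longrightarrow> clopen S V \<Longrightarrow> clopen S (U \<union> V)"
  and clopen_Diff: "clopen S U \<Longrightarrow> clopen S V \<Longrightarrow> clopen S (U - V)"
  by (auto simp: clopen_def openin_diff closedin_diff)

lemma clopen_subtopology: "clopen S U \<Longrightarrow> clopen (subtopology S U) W \<longleftrightarrow> clopen S W \<and> W \<subseteq> U"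
  by (auto simp: clopen_def openin_open_subtopology closedin_closed_subtopology)

lemma topspace_sub_clopen: "clopen S U \<Longrightarrow> topspace (subtopology S U) = U"
  using clopen_subset[of S U] by auto

definition pull :: "('s \<Rightarrow> 't) \<Rightarrow> 's topology \<Rightarrow> 't set \<Rightarrow> 's set" where
  "pull f S U = {s \<in> topspace S. f s \<in> U}"

lemma clopen_pull: "continuous_map S T f \<Longrightarrow> clopen T U \<Longrightarrow> clopen S (pull f S U)"
  by (auto simp: clopen_def pull_def openin_continuous_map_preimage closedin_continuous_map_preimage)

lemma pull_Int: "pull f S (U \<inter> V) = pull f S U \<inter> pull f S V"
  and pull_mono: "U \<subseteq> V \<Longrightarrow> pull f S U \<subseteq> pull f S V"
  by (auto simp: pull_def)

text \<open>Closures taken inside \<open>U\<close> are intersections of \<open>U\<close> with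
  closures in \<open>S\<close>, so they are open because \<open>U\<close> is; compactness comes from
  \<open>U\<close> being closed.\<close>

lemma sub_CHED:
  assumes S: "S \<in> CHED" and U: "clopen S U"
  shows "subtopology S U \<in> CHED"
proof -
  have "openin (subtopology S U) (subtopology S U closure_of W)" if "openin (subtopology S U) W" for W
  proof -
    have W: "openin S W" "W \<subseteq> U" using that U by (auto simp: openin_open_subtopology clopen_def)
    have "subtopology S U closure_of W = U \<inter> S closure_of W"
      using W by (simp add: closure_of_subtopology Int_absorb1)
    moreover have "openin S (S closure_of W)" using S W by (auto simp: CHED_def)
    ultimately show ?thesis using U by (auto simp: openin_open_subtopology clopen_def)
  qed
  then show ?thesis using S U
    by (auto simp: CHED_def clopen_def Hausdorff_space_subtopology closedin_compact_space compact_space_subtopology)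
qed

lemma discrete_CHED: "finite A \<Longrightarrow> discrete_topology A \<in> CHED"
  by (simp add: CHED_def compact_space_discrete_topology closure_of_subset_topspace[of "discrete_topology A", simplified])

lemma pt_CHED: "pt \<in> CHED"
  unfolding pt_def by (rule discrete_CHED) simp

text \<open>The point is separated from the compact complement of \<open>P\<close> by disjoint open
  sets \<open>U\<close> and \<open>V\<close>. Extremal disconnectedness makes the closure of
  \<open>U\<close> open, and it still avoids \<open>V\<close>.\<close>

lemma clopen_base:
  assumes S: "S \<in> CHED" and P: "openin S P" "s \<in> P"
  obtains U where "clopen S U" "s \<in> U" "U \<subseteq> P"
proof -
  have *: "compact_space S" "Hausdorff_space S" using S by (auto simp: CHED_def)
  have s: "s \<in> topspace S" using P openin_subset by blast
  have "compactin S {s}" "compactin S (topspace S - P)"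
    using * P s by (auto intro: closedin_compact_space closedin_diff closedin_Hausdorff_singleton)
  moreover have "disjnt {s} (topspace S - P)" using P by (auto simp: disjnt_def)
  ultimately obtain U V where UV: "openin S U" "openin S V" "{s} \<subseteq> U" "topspace S - P \<subseteq> V" "disjnt U V"
    using Hausdorff_space_compact_separation[OF *(2)] by metis
  have "clopen S (S closure_of U)" using S UV by (auto simp: CHED_def clopen_def)
  moreover have "s \<in> S closure_of U" using UV closure_of_subset openin_subset by (metis insert_subset subsetD)
  moreover have "S closure_of U \<subseteq> topspace S - V"
    using UV openin_subset[of S U] by (intro closure_of_minimal) (auto simp: disjnt_def closedin_diff)
  ultimately show ?thesis using that UV by blast
qed

text \<open>Compactness in the form used throughout. The local hypothesis speaks of all clopen
  subsets of a neighbourhood, because a finite cover has to be cut into disjoint pieces before the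
  union step applies.\<close>

lemma clopen_induct [consumes 2, case_names empty union local]:
  assumes S: "S \<in> CHED" and V: "clopen S V"
    and 0: "Q {}"
    and un: "\<And>V1 V2. clopen S V1 \<Longrightarrow> clopen S V2 \<Longrightarrow> V1 \<inter> V2 = {} \<Longrightarrow> Q V1 \<Longrightarrow> Q V2 \<Longrightarrow> Q (V1 \<union> V2)"
    and loc: "\<And>s. s \<in> topspace S \<Longrightarrow>
       \<exists>W. clopen S W \<and> s \<in> W \<and> (\<forall>W'. clopen S W' \<longrightarrow> W' \<subseteq> W \<longrightarrow> Q W')"
  shows "Q V"
proof -
  obtain w where w: "\<And>s. s \<in> topspace S \<Longrightarrow> clopen S (w s) \<and> s \<in> w s \<and> (\<forall>W'. clopen S W' \<longrightarrow> W' \<subseteq> w s \<longrightarrow> Q W')"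
    using loc by metis
  have "compactin S (topspace S)" using S by (auto simp: CHED_def compact_space_def)
  then obtain \<F> where F: "finite \<F>" "\<F> \<subseteq> w ` topspace S" "topspace S \<subseteq> \<Union>\<F>"
    using w compactinD[of S "topspace S" "w ` topspace S"] unfolding clopen_def by blast
  \<comment> \<open>One member \<open>W\<close> of the cover is peeled off at a time:
    \<open>V' - W\<close> is covered by the rest, and \<open>V' \<inter> W\<close> is small enough
    for the local hypothesis.\<close>
  have cov: "Q V'" if "finite \<G>" "\<G> \<subseteq> w ` topspace S" "clopen S V'" "V' \<subseteq> \<Union>\<G>" for \<G> V'
    using that
  proof (induction \<G> arbitrary: V' rule: finite_induct)
    case empty then show ?case using 0 by auto
  next
    case (insert W \<G>)
    have W: "clopen S W" "\<forall>W'. clopen S W' \<longrightarrow> W' \<subseteq> W \<longrightarrow> Q W'" using insert w by auto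
    have "Q (V' - W)" using insert.prems W by (intro insert.IH clopen_Diff) auto
    moreover have "Q (V' \<inter> W)" using W insert.prems by (auto intro: clopen_Int)
    ultimately have "Q ((V' - W) \<union> (V' \<inter> W))"
      using W insert.prems by (intro un clopen_Diff clopen_Int) auto
    moreover have "(V' - W) \<union> (V' \<inter> W) = V'" by auto
    ultimately show ?case by simp
  qed
  show ?thesis using cov[OF F(1,2) V] clopen_subset[OF V] F(3) by blast
qed

section \<open>Presheaves restricted to clopen subsets\<close>

text \<open>All subsets are measured in one ambient \<open>S\<close>, so that iterated subspaces,
  and the different codings of restriction that they produce, stay out of sight.\<close>

definition rs :: "('s, 'a, 'x) presheaf \<Rightarrow> 's topology \<Rightarrow> 's set \<Rightarrow> 's set \<Rightarrow> 'a \<Rightarrow> 'a" where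
  "rs X S U W = res X (subtopology S W) (subtopology S U) id"

definition fres :: "('s, 'a, 'x) presheaf \<Rightarrow> 's topology \<Rightarrow> 's topology \<Rightarrow> ('s \<Rightarrow> 's) \<Rightarrow> 's set \<Rightarrow> 'a \<Rightarrow> 'a" where
  "fres X S T f U = res X (subtopology S (pull f S U)) (subtopology T U) f"

abbreviation car :: "('s, 'a, ('a, 'z) partial_object_scheme) presheaf \<Rightarrow> 's topology \<Rightarrow> 's set \<Rightarrow> 'a set" where
  "car X S U \<equiv> carrier (sec X (subtopology S U))"

lemma restr_eq_rs: "W \<subseteq> U \<Longrightarrow> restr X (subtopology S U) W = rs X S U W"
  by (simp add: restr_def rs_def subtopology_subtopology Int_absorb1)

lemma restr_eq_rs_top: "restr X S W = rs X S (topspace S) W"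
  by (simp add: restr_def rs_def)

lemma continuous_map_sub_id: "W \<subseteq> U \<Longrightarrow> continuous_map (subtopology S W) (subtopology S U) id"
  by (auto simp: continuous_map_in_subtopology)

lemma continuous_map_pull: "continuous_map S T f \<Longrightarrow> continuous_map (subtopology S (pull f S U)) (subtopology T U) f"
  by (auto simp: continuous_map_in_subtopology continuous_map_from_subtopology pull_def)

context
  fixes X :: "('s, 'a, ('a, 'z) partial_object_scheme) presheaf"
  assumes X: "functorial X"
begin

lemma res_closed:
  "S \<in> CHED \<Longrightarrow> T \<in> CHED \<Longrightarrow> continuous_map S T f \<Longrightarrow> x \<in> carrier (sec X T) \<Longrightarrow> res X S T f x \<in> carrier (sec X S)"
  using X[unfolded functorial_def, THEN conjunct1] by (simp add: Pi_iff)

lemma res_cong: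
  "S \<in> CHED \<Longrightarrow> T \<in> CHED \<Longrightarrow> continuous_map S T f \<Longrightarrow> continuous_map S T f' \<Longrightarrow>
   (\<And>s. s \<in> topspace S \<Longrightarrow> f s = f' s) \<Longrightarrow> x \<in> carrier (sec X T) \<Longrightarrow> res X S T f x = res X S T f' x"
  by (rule X[unfolded functorial_def, THEN conjunct2, THEN conjunct1, rule_format]) assumption+

lemma res_id: "S \<in> CHED \<Longrightarrow> x \<in> carrier (sec X S) \<Longrightarrow> res X S S id x = x"
  using X[unfolded functorial_def, THEN conjunct2, THEN conjunct2, THEN conjunct1] by simp

lemma res_comp:
  "S \<in> CHED \<Longrightarrow> T \<in> CHED \<Longrightarrow> U \<in> CHED \<Longrightarrow> continuous_map S T f \<Longrightarrow> continuous_map T U h \<Longrightarrow>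
   x \<in> carrier (sec X U) \<Longrightarrow> res X S T f (res X T U h x) = res X S U (h \<circ> f) x"
  by (rule X[unfolded functorial_def, THEN conjunct2, THEN conjunct2, THEN conjunct2, rule_format, symmetric]) assumption+

lemma rs_closed: "S \<in> CHED \<Longrightarrow> clopen S U \<Longrightarrow> clopen S W \<Longrightarrow> W \<subseteq> U \<Longrightarrow> x \<in> car X S U \<Longrightarrow> rs X S U W x \<in> car X S W"
  unfolding rs_def by (intro res_closed sub_CHED continuous_map_sub_id)

lemma rs_self: "S \<in> CHED \<Longrightarrow> clopen S U \<Longrightarrow> x \<in> car X S U \<Longrightarrow> rs X S U U x = x"
  unfolding rs_def by (intro res_id sub_CHED)

lemma rs_rs:
  assumes "S \<in> CHED" "clopen S U" "clopen S V" "clopen S W" "W \<subseteq> V" "V \<subseteq> U" "x \<in> car X S U"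
  shows "rs X S V W (rs X S U V x) = rs X S U W x"
  using res_comp[of "subtopology S W" "subtopology S V" "subtopology S U" id id x] assms
  by (simp add: rs_def sub_CHED continuous_map_sub_id)

lemma fres_closed:
  "S \<in> CHED \<Longrightarrow> T \<in> CHED \<Longrightarrow> continuous_map S T f \<Longrightarrow> clopen T U \<Longrightarrow> x \<in> car X T U \<Longrightarrow>
   fres X S T f U x \<in> car X S (pull f S U)"
  unfolding fres_def by (intro res_closed sub_CHED continuous_map_pull clopen_pull)

lemma rs_fres:
  assumes "S \<in> CHED" "T \<in> CHED" "continuous_map S T f" "clopen T U" "clopen T W" "W \<subseteq> U" "x \<in> car X T U"
  shows "rs X S (pull f S U) (pull f S W) (fres X S T f U x) = fres X S T f W (rs X T U W x)"
proof -
  have 1: "rs X S (pull f S U) (pull f S W) (fres X S T f U x) = res X (subtopology S (pull f S W)) (subtopology T U) (f \<circ> id) x"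
    unfolding rs_def fres_def using assms
    by (intro res_comp sub_CHED continuous_map_pull clopen_pull continuous_map_sub_id pull_mono)
  have 2: "fres X S T f W (rs X T U W x) = res X (subtopology S (pull f S W)) (subtopology T U) (id \<circ> f) x"
    unfolding rs_def fres_def using assms
    by (intro res_comp sub_CHED continuous_map_pull clopen_pull continuous_map_sub_id)
  show ?thesis using 1 2 by simp
qed

end

section \<open>Germs\<close>

text \<open>The carrier of \<open>sheafify F\<close> over \<open>S\<close>, available also when
  \<open>F\<close> carries no group structure.\<close>

definition sections ::
  "('s, 'a, ('a, 'z) partial_object_scheme) presheaf \<Rightarrow> 's topology \<Rightarrow> ('s, 'a) germs set" where
  "sections F S = {\<sigma> \<in> extensional (topspace S). \<forall>s\<in>topspace S.
     \<exists>U a. clopen S U \<and> s \<in> U \<and> a \<in> car F S U \<and> (\<forall>t\<in>U. \<sigma> t = germ F S t U a)}"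

lemma sectionsI:
  assumes "\<sigma> \<in> extensional (topspace S)"
    and "\<And>s. s \<in> topspace S \<Longrightarrow> \<exists>U a. clopen S U \<and> s \<in> U \<and> a \<in> car F S U \<and> (\<forall>t\<in>U. \<sigma> t = germ F S t U a)"
  shows "\<sigma> \<in> sections F S"
  using assms by (auto simp: sections_def)

context
  fixes F :: "('s, 'a, ('a, 'z) partial_object_scheme) presheaf" and S :: "'s topology"
  assumes F: "functorial F" and S: "S \<in> CHED"
begin

lemma germ_iff:
  "(V, b) \<in> germ F S s U a \<longleftrightarrow> clopen S V \<and> s \<in> V \<and> b \<in> car F S V \<and>
     (\<exists>W. clopen S W \<and> s \<in> W \<and> W \<subseteq> U \<inter> V \<and> rs F S U W a = rs F S V W b)"
proof -
  have "restr F (subtopology S U) W a = restr F (subtopology S V) W b \<longleftrightarrow> rs F S U W a = rs F S V W b"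
    if "W \<subseteq> U \<inter> V" for W
    using that by (simp add: restr_eq_rs)
  then show ?thesis unfolding germ_def clopen_nhd_iff by auto
qed

lemma germ_eqI:
  assumes "clopen S U" "clopen S V" "a \<in> car F S U" "b \<in> car F S V"
    and W: "clopen S W" "s \<in> W" "W \<subseteq> U" "W \<subseteq> V" "rs F S U W a = rs F S V W b"
  shows "germ F S s U a = germ F S s V b"
proof -
  have *: "germ F S s U a \<subseteq> germ F S s V b"
    if "clopen S U" "clopen S V" "a \<in> car F S U" "b \<in> car F S V" "W \<subseteq> U" "W \<subseteq> V" "rs F S U W a = rs F S V W b"
    for U V a b
  proof clarify
    fix V' b' assume "(V', b') \<in> germ F S s U a"
    then obtain W' where b': "clopen S V'" "s \<in> V'" "b' \<in> car F S V'"
      and W': "clopen S W'" "s \<in> W'" "W' \<subseteq> U" "W' \<subseteq> V'" "rs F S U W' a = rs F S V' W' b'"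
      by (auto simp: germ_iff)
    let ?W = "W \<inter> W'"
    have c: "clopen S ?W" using W W' clopen_Int by blast
    have "rs F S V ?W b = rs F S W ?W (rs F S V W b)"
      using that W c by (subst rs_rs[OF F S]) auto
    also have "\<dots> = rs F S U ?W a" using that W c by (subst that(7)[symmetric], subst rs_rs[OF F S]) auto
    also have "\<dots> = rs F S W' ?W (rs F S U W' a)" using that W' c by (subst rs_rs[OF F S]) auto
    also have "\<dots> = rs F S V' ?W b'" using that W' c b' by (subst W'(5), subst rs_rs[OF F S]) auto
    finally show "(V', b') \<in> germ F S s V b"
      using b' c W W' that by (auto simp: germ_iff intro!: exI[of _ ?W])
  qed
  show ?thesis using *[of U V a b] *[of V U b a] assms by auto
qed

lemma germ_self: "clopen S U \<Longrightarrow> s \<in> U \<Longrightarrow> a \<in> car F S U \<Longrightarrow> (U, a) \<in> germ F S s U a"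
  by (auto simp: germ_iff)

lemma germ_mem:
  "clopen S U \<Longrightarrow> a \<in> car F S U \<Longrightarrow> (V, b) \<in> germ F S s U a \<Longrightarrow>
   clopen S V \<and> s \<in> V \<and> b \<in> car F S V \<and> germ F S s V b = germ F S s U a"
  unfolding germ_iff by (metis germ_eqI le_inf_iff)

lemma germ_eqD:
  assumes "clopen S U" "clopen S V" "s \<in> U" "s \<in> V" "a \<in> car F S U" "b \<in> car F S V"
    and "germ F S s U a = germ F S s V b"
  obtains W where "clopen S W" "s \<in> W" "W \<subseteq> U" "W \<subseteq> V" "rs F S U W a = rs F S V W b"
proof -
  have "(V, b) \<in> germ F S s U a" unfolding assms(7) using assms by (intro germ_self)
  then show ?thesis using that by (auto simp: germ_iff)
qed

lemma germ_rs:
  "clopen S U \<Longrightarrow> clopen S W \<Longrightarrow> W \<subseteq> U \<Longrightarrow> s \<in> W \<Longrightarrow> a \<in> car F S U \<Longrightarrow> germ F S s W (rs F S U W a) = germ F S s U a"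
  by (rule germ_eqI[where W = W]) (auto simp: rs_closed[OF F S] rs_rs[OF F S])

text \<open>The representative can be found inside any prescribed clopen neighbourhood; later
  \<open>P\<close> is a level set, or the domain of a representative of another section.\<close>

lemma sectionsE:
  assumes "\<sigma> \<in> sections F S" "s \<in> P" "clopen S P"
  obtains U a where "clopen S U" "s \<in> U" "U \<subseteq> P" "a \<in> car F S U" "\<And>t. t \<in> U \<Longrightarrow> \<sigma> t = germ F S t U a"
proof -
  have "s \<in> topspace S" using assms clopen_subset by blast
  then obtain U a where U: "clopen S U" "s \<in> U" "a \<in> car F S U" "\<And>t. t \<in> U \<Longrightarrow> \<sigma> t = germ F S t U a"
    using assms(1) unfolding sections_def by blast
  show ?thesis
    by (rule that[of "U \<inter> P" "rs F S U (U \<inter> P) a"])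
       (use U assms in \<open>auto simp: clopen_Int germ_rs rs_closed[OF F S]\<close>)
qed

end

lemma carrier_sheafify:
  "carrier (sec (sheafify F) S) = sections F S"
  unfolding sheafify_def sections_def by (simp add: clopen_nhd_iff conj_assoc)

lemma rs_sub: "V \<subseteq> U \<Longrightarrow> W \<subseteq> V \<Longrightarrow> rs F (subtopology S U) V W = rs F S V W"
  by (simp add: rs_def subtopology_subtopology Int_absorb1)

lemma car_sub: "V \<subseteq> U \<Longrightarrow> car F (subtopology S U) V = car F S V"
  by (simp add: subtopology_subtopology Int_absorb1)

lemma sections2E:
  assumes F1: "functorial F1" and F2: "functorial F2" and S: "S \<in> CHED"
    and "\<sigma> \<in> sections F1 S" "\<tau> \<in> sections F2 S" "s \<in> P" "clopen S P"
  obtains U a b where "clopen S U" "s \<in> U" "U \<subseteq> P" "a \<in> car F1 S U" "b \<in> car F2 S U"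
    "\<And>t. t \<in> U \<Longrightarrow> \<sigma> t = germ F1 S t U a" "\<And>t. t \<in> U \<Longrightarrow> \<tau> t = germ F2 S t U b"
proof -
  obtain U a where U: "clopen S U" "s \<in> U" "U \<subseteq> P" "a \<in> car F1 S U" "\<And>t. t \<in> U \<Longrightarrow> \<sigma> t = germ F1 S t U a"
    using sectionsE[OF F1 S assms(4) assms(6,7)] by blast
  obtain V b where V: "clopen S V" "s \<in> V" "V \<subseteq> U" "b \<in> car F2 S V" "\<And>t. t \<in> V \<Longrightarrow> \<tau> t = germ F2 S t V b"
    using sectionsE[OF F2 S assms(5) U(2,1)] by blast
  show ?thesis
  proof (rule that[of V "rs F1 S U V a" b])
    show "\<sigma> t = germ F1 S t V (rs F1 S U V a)" if "t \<in> V" for t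
      using germ_rs[OF F1 S U(1) V(1) V(3) that U(4)] U(5) V(3) that by auto
  qed (use U V rs_closed[OF F1 S U(1) V(1) V(3) U(4)] in auto)
qed

section \<open>Operations on sheafifications\<close>

text \<open>Naturality is asked for restrictions between clopen subsets of the fixed
  \<open>S\<close>, since germs over \<open>S\<close> see no other maps.\<close>

definition natural_op1 where
  "natural_op1 F F' S op \<longleftrightarrow> (\<forall>U a. clopen S U \<longrightarrow> a \<in> car F S U \<longrightarrow>
     op (subtopology S U) a \<in> car F' S U \<and>
     (\<forall>W. clopen S W \<longrightarrow> W \<subseteq> U \<longrightarrow>
        rs F' S U W (op (subtopology S U) a) = op (subtopology S W) (rs F S U W a)))"

definition natural_op2 where
  "natural_op2 F1 F2 F' S op \<longleftrightarrow> (\<forall>U a b. clopen S U \<longrightarrow> a \<in> car F1 S U \<longrightarrow> b \<in> car F2 S U \<longrightarrow>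
     op (subtopology S U) a b \<in> car F' S U \<and>
     (\<forall>W. clopen S W \<longrightarrow> W \<subseteq> U \<longrightarrow>
        rs F' S U W (op (subtopology S U) a b) = op (subtopology S W) (rs F1 S U W a) (rs F2 S U W b)))"

text \<open>Two representatives of a germ agree on some \<open>W\<close>; naturality makes their
  images under \<open>op\<close> agree there too, so the description in \<open>sheafify_op1\<close>
  has exactly one solution.\<close>

lemma sheafify_op1_germ:
  assumes F: "functorial F" and F': "functorial F'" and S: "S \<in> CHED" and nat: "natural_op1 F F' S op"
    and U: "clopen S U" "s \<in> U" and a: "a \<in> car F S U" and s: "\<sigma> s = germ F S s U a"
  shows "sheafify_op1 F' op S \<sigma> s = germ F' S s U (op (subtopology S U) a)"
proof -
  have "(THE \<gamma>. \<exists>U a. (U, a) \<in> \<sigma> s \<and> \<gamma> = germ F' S s U (op (subtopology S U) a)) =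
      germ F' S s U (op (subtopology S U) a)"
  proof (rule the_equality)
    show "\<exists>V b. (V, b) \<in> \<sigma> s \<and> germ F' S s U (op (subtopology S U) a) = germ F' S s V (op (subtopology S V) b)"
      using germ_self[OF F S U a] s by auto
  next
    fix \<gamma> assume "\<exists>V b. (V, b) \<in> \<sigma> s \<and> \<gamma> = germ F' S s V (op (subtopology S V) b)"
    then obtain V b where V: "(V, b) \<in> germ F S s U a" "\<gamma> = germ F' S s V (op (subtopology S V) b)"
      using s by auto
    have b: "clopen S V" "s \<in> V" "b \<in> car F S V" "germ F S s V b = germ F S s U a"
      using germ_mem[OF F S U(1) a V(1)] by auto
    obtain W where W: "clopen S W" "s \<in> W" "W \<subseteq> V" "W \<subseteq> U" "rs F S V W b = rs F S U W a"
      using germ_eqD[OF F S b(1) U(1) b(2) U(2) b(3) a b(4)] by blast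
    show "\<gamma> = germ F' S s U (op (subtopology S U) a)" unfolding V(2)
      by (rule germ_eqI[OF F' S b(1) U(1) _ _ W(1-4)])
        (use nat b U a W in \<open>auto simp: natural_op1_def\<close>)
  qed
  moreover have "s \<in> topspace S" using U clopen_subset by blast
  ultimately show ?thesis by (simp add: sheafify_op1_def)
qed

lemma sheafify_op2_germ:
  assumes F1: "functorial F1" and F2: "functorial F2" and F': "functorial F'"
    and S: "S \<in> CHED" and nat: "natural_op2 F1 F2 F' S op"
    and U: "clopen S U" "s \<in> U" and a: "a \<in> car F1 S U" and b: "b \<in> car F2 S U"
    and s: "\<sigma> s = germ F1 S s U a" and t: "\<tau> s = germ F2 S s U b"
  shows "sheafify_op2 F' op S \<sigma> \<tau> s = germ F' S s U (op (subtopology S U) a b)"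
proof -
  have "(THE \<gamma>. \<exists>U a b. (U, a) \<in> \<sigma> s \<and> (U, b) \<in> \<tau> s \<and> \<gamma> = germ F' S s U (op (subtopology S U) a b)) =
      germ F' S s U (op (subtopology S U) a b)"
  proof (rule the_equality)
    show "\<exists>V a' b'. (V, a') \<in> \<sigma> s \<and> (V, b') \<in> \<tau> s \<and>
        germ F' S s U (op (subtopology S U) a b) = germ F' S s V (op (subtopology S V) a' b')"
      using germ_self[OF F1 S U a] germ_self[OF F2 S U b] s t by auto
  next
    fix \<gamma> assume "\<exists>V a b. (V, a) \<in> \<sigma> s \<and> (V, b) \<in> \<tau> s \<and> \<gamma> = germ F' S s V (op (subtopology S V) a b)"
    then obtain V c d where V: "(V, c) \<in> germ F1 S s U a" "(V, d) \<in> germ F2 S s U b"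
        "\<gamma> = germ F' S s V (op (subtopology S V) c d)"
      using s t by auto
    have c: "clopen S V" "s \<in> V" "c \<in> car F1 S V" "germ F1 S s V c = germ F1 S s U a"
      using germ_mem[OF F1 S U(1) a V(1)] by auto
    have d: "d \<in> car F2 S V" "germ F2 S s V d = germ F2 S s U b"
      using germ_mem[OF F2 S U(1) b V(2)] by auto
    obtain W1 where W1: "clopen S W1" "s \<in> W1" "W1 \<subseteq> V" "W1 \<subseteq> U" "rs F1 S V W1 c = rs F1 S U W1 a"
      using germ_eqD[OF F1 S c(1) U(1) c(2) U(2) c(3) a c(4)] by blast
    obtain W2 where W2: "clopen S W2" "s \<in> W2" "W2 \<subseteq> V" "W2 \<subseteq> U" "rs F2 S V W2 d = rs F2 S U W2 b"
      using germ_eqD[OF F2 S c(1) U(1) c(2) U(2) d(1) b d(2)] by blast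
    let ?W = "W1 \<inter> W2"
    have W: "clopen S ?W" "s \<in> ?W" "?W \<subseteq> V" "?W \<subseteq> U" using W1 W2 by (auto simp: clopen_Int)
    have e1: "rs F1 S V ?W c = rs F1 S U ?W a"
      using rs_rs[OF F1 S c(1) W1(1) W(1) _ W1(3) c(3)] rs_rs[OF F1 S U(1) W1(1) W(1) _ W1(4) a] W1(5) by simp
    have e2: "rs F2 S V ?W d = rs F2 S U ?W b"
      using rs_rs[OF F2 S c(1) W2(1) W(1) _ W2(3) d(1)] rs_rs[OF F2 S U(1) W2(1) W(1) _ W2(4) b] W2(5) by simp
    show "\<gamma> = germ F' S s U (op (subtopology S U) a b)" unfolding V(3)
      by (rule germ_eqI[OF F' S c(1) U(1) _ _ W])
        (use nat c d U a b W e1 e2 in \<open>auto simp: natural_op2_def\<close>)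
  qed
  moreover have "s \<in> topspace S" using U clopen_subset by blast
  ultimately show ?thesis by (simp add: sheafify_op2_def)
qed

lemma sheafify_op1_sections:
  assumes F: "functorial F" and F': "functorial F'" and S: "S \<in> CHED" and nat: "natural_op1 F F' S op"
    and \<sigma>: "\<sigma> \<in> sections F S"
  shows "sheafify_op1 F' op S \<sigma> \<in> sections F' S"
proof (rule sectionsI)
  show "sheafify_op1 F' op S \<sigma> \<in> extensional (topspace S)" by (simp add: sheafify_op1_def)
  fix s assume s: "s \<in> topspace S"
  obtain U a where U: "clopen S U" "s \<in> U" "U \<subseteq> topspace S" "a \<in> car F S U" "\<And>t. t \<in> U \<Longrightarrow> \<sigma> t = germ F S t U a"
    using sectionsE[OF F S \<sigma> s clopen_simps(2)] by blast
  have "sheafify_op1 F' op S \<sigma> t = germ F' S t U (op (subtopology S U) a)" if "t \<in> U" for t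
    by (rule sheafify_op1_germ[where \<sigma> = \<sigma>, OF F F' S nat U(1) that U(4) U(5)[OF that]])
  moreover have "op (subtopology S U) a \<in> car F' S U" using nat U by (simp add: natural_op1_def)
  ultimately show "\<exists>U a. clopen S U \<and> s \<in> U \<and> a \<in> car F' S U \<and> (\<forall>t\<in>U. sheafify_op1 F' op S \<sigma> t = germ F' S t U a)"
    using U(1,2) by blast
qed

lemma sheafify_op2_sections:
  assumes F1: "functorial F1" and F2: "functorial F2" and F': "functorial F'"
    and S: "S \<in> CHED" and nat: "natural_op2 F1 F2 F' S op"
    and \<sigma>: "\<sigma> \<in> sections F1 S" and \<tau>: "\<tau> \<in> sections F2 S"
  shows "sheafify_op2 F' op S \<sigma> \<tau> \<in> sections F' S"
proof (rule sectionsI)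
  show "sheafify_op2 F' op S \<sigma> \<tau> \<in> extensional (topspace S)" by (simp add: sheafify_op2_def)
  fix s assume s: "s \<in> topspace S"
  obtain U a b where U: "clopen S U" "s \<in> U" "U \<subseteq> topspace S" "a \<in> car F1 S U" "b \<in> car F2 S U"
      "\<And>t. t \<in> U \<Longrightarrow> \<sigma> t = germ F1 S t U a" "\<And>t. t \<in> U \<Longrightarrow> \<tau> t = germ F2 S t U b"
    using sections2E[OF F1 F2 S \<sigma> \<tau> s clopen_simps(2)] by blast
  have "sheafify_op2 F' op S \<sigma> \<tau> t = germ F' S t U (op (subtopology S U) a b)" if "t \<in> U" for t
    by (rule sheafify_op2_germ[where \<sigma> = \<sigma> and \<tau> = \<tau>, OF F1 F2 F' S nat U(1) that U(4,5) U(6)[OF that] U(7)[OF that]])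
  moreover have "op (subtopology S U) a b \<in> car F' S U" using nat U by (simp add: natural_op2_def)
  ultimately show "\<exists>U a. clopen S U \<and> s \<in> U \<and> a \<in> car F' S U \<and> (\<forall>t\<in>U. sheafify_op2 F' op S \<sigma> \<tau> t = germ F' S t U a)"
    using U(1,2) by blast
qed

text \<open>If two representatives agree on \<open>W\<close>, their pullbacks agree on the preimage
  of \<open>W\<close>, so the pulled back germ does not depend on the representative.\<close>

lemma sheafify_res_germ:
  assumes F: "functorial F" and S: "S \<in> CHED" and T: "T \<in> CHED" and f: "continuous_map S T f"
    and s: "s \<in> topspace S" and U: "clopen T U" "f s \<in> U" and a: "a \<in> car F T U"
    and \<sigma>: "\<sigma> (f s) = germ F T (f s) U a"
  shows "res (sheafify F) S T f \<sigma> s = germ F S s (pull f S U) (fres F S T f U a)"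
proof -
  have "(THE \<gamma>. \<exists>U a. (U, a) \<in> \<sigma> (f s) \<and> (let V = {x \<in> topspace S. f x \<in> U}
         in \<gamma> = germ F S s V (res F (subtopology S V) (subtopology T U) f a))) =
      germ F S s (pull f S U) (fres F S T f U a)"
  proof (rule the_equality)
    show "\<exists>V b. (V, b) \<in> \<sigma> (f s) \<and> (let V' = {x \<in> topspace S. f x \<in> V}
         in germ F S s (pull f S U) (fres F S T f U a) = germ F S s V' (res F (subtopology S V') (subtopology T V) f b))"
      using germ_self[OF F T U a] \<sigma> by (auto simp: fres_def pull_def Let_def intro!: exI[of _ U] exI[of _ a])
  next
    fix \<gamma> assume "\<exists>V b. (V, b) \<in> \<sigma> (f s) \<and> (let V' = {x \<in> topspace S. f x \<in> V}
         in \<gamma> = germ F S s V' (res F (subtopology S V') (subtopology T V) f b))"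
    then obtain V b where V: "(V, b) \<in> germ F T (f s) U a" "\<gamma> = germ F S s (pull f S V) (fres F S T f V b)"
      using \<sigma> by (auto simp: Let_def pull_def fres_def)
    have b: "clopen T V" "f s \<in> V" "b \<in> car F T V" "germ F T (f s) V b = germ F T (f s) U a"
      using germ_mem[OF F T U(1) a V(1)] by auto
    obtain W where W: "clopen T W" "f s \<in> W" "W \<subseteq> V" "W \<subseteq> U" "rs F T V W b = rs F T U W a"
      using germ_eqD[OF F T b(1) U(1) b(2) U(2) b(3) a b(4)] by blast
    show "\<gamma> = germ F S s (pull f S U) (fres F S T f U a)" unfolding V(2)
    proof (rule germ_eqI[OF F S])
      show "rs F S (pull f S V) (pull f S W) (fres F S T f V b) = rs F S (pull f S U) (pull f S W) (fres F S T f U a)"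
        using rs_fres[OF F S T f b(1) W(1,3) b(3)] rs_fres[OF F S T f U(1) W(1,4) a] W(5) by simp
      show "s \<in> pull f S W" using W s by (simp add: pull_def)
    qed (use W b U a f S T F in \<open>simp_all add: clopen_pull pull_mono fres_closed\<close>)
  qed
  then show ?thesis using s by (simp add: sheafify_def)
qed

lemma sheafify_res_sections:
  assumes F: "functorial F" and S: "S \<in> CHED" and T: "T \<in> CHED" and f: "continuous_map S T f"
    and \<sigma>: "\<sigma> \<in> sections F T"
  shows "res (sheafify F) S T f \<sigma> \<in> sections F S"
proof (rule sectionsI)
  show "res (sheafify F) S T f \<sigma> \<in> extensional (topspace S)" by (simp add: sheafify_def)
  fix s assume s: "s \<in> topspace S"
  then have fs: "f s \<in> topspace T" using f by (auto simp: continuous_map_def)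
  obtain U a where U: "clopen T U" "f s \<in> U" "U \<subseteq> topspace T" "a \<in> car F T U" "\<And>t. t \<in> U \<Longrightarrow> \<sigma> t = germ F T t U a"
    using sectionsE[OF F T \<sigma> fs clopen_simps(2)] by blast
  have g: "res (sheafify F) S T f \<sigma> t = germ F S t (pull f S U) (fres F S T f U a)" if "t \<in> pull f S U" for t
    using that U(5)[of "f t"]
    by (intro sheafify_res_germ[OF F S T f _ U(1) _ U(4)]) (simp_all add: pull_def)
  show "\<exists>V b. clopen S V \<and> s \<in> V \<and> b \<in> car F S V \<and> (\<forall>t\<in>V. res (sheafify F) S T f \<sigma> t = germ F S t V b)"
  proof (intro exI conjI ballI)
    show "clopen S (pull f S U)" by (rule clopen_pull[OF f U(1)])
    show "s \<in> pull f S U" using s U(2) by (simp add: pull_def)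
    show "fres F S T f U a \<in> car F S (pull f S U)" by (rule fres_closed[OF F S T f U(1) U(4)])
  qed (rule g)
qed

lemma pull_id_sub: "clopen S U \<Longrightarrow> V \<subseteq> U \<Longrightarrow> pull id (subtopology S U) V = V"
  using clopen_subset[of S U] by (auto simp: pull_def)

lemma sheafify_restr_germ:
  assumes F: "functorial F" and S: "S \<in> CHED" and U: "clopen S U"
    and s: "s \<in> V" and V: "clopen S V" "V \<subseteq> U" and a: "a \<in> car F S V" and \<sigma>: "\<sigma> s = germ F S s V a"
  shows "restr (sheafify F) S U \<sigma> s = germ F (subtopology S U) s V a"
proof -
  have "restr (sheafify F) S U \<sigma> s =
      germ F (subtopology S U) s (pull id (subtopology S U) V) (fres F (subtopology S U) S id V a)"
    unfolding restr_def using assms clopen_subset[OF U]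
    by (intro sheafify_res_germ[OF F sub_CHED[OF S U] S]) auto
  moreover have "fres F (subtopology S U) S id V a = a"
    using rs_self[OF F S V(1) a] V U
    by (simp add: fres_def pull_id_sub rs_def subtopology_subtopology Int_absorb1)
  ultimately show ?thesis using U V by (simp add: pull_id_sub)
qed

text \<open>Restricting a section to \<open>U\<close> replaces its germs by germs over the subspace.
  A clopen neighbourhood in the subspace is one in \<open>S\<close>, so nothing is lost; this serves
  to recognise a section from its restrictions to level sets.\<close>

lemma germ_sub_eqD:
  assumes F: "functorial F" and S: "S \<in> CHED" and U: "clopen S U"
    and s: "s \<in> V" and V: "clopen S V" "V \<subseteq> U" and ab: "a \<in> car F S V" "b \<in> car F S V"
    and eq: "germ F (subtopology S U) s V a = germ F (subtopology S U) s V b"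
  shows "germ F S s V a = germ F S s V b"
proof -
  have V': "clopen (subtopology S U) V" using V U by (simp add: clopen_subtopology)
  have ab': "a \<in> car F (subtopology S U) V" "b \<in> car F (subtopology S U) V" using ab V by (simp_all add: car_sub)
  obtain W where W: "clopen (subtopology S U) W" "s \<in> W" "W \<subseteq> V" "rs F (subtopology S U) V W a = rs F (subtopology S U) V W b"
    by (rule germ_eqD[OF F sub_CHED[OF S U] V' V' s s ab' eq])
  show ?thesis
    by (rule germ_eqI[OF F S V(1) V(1) ab _ W(2,3,3)])
       (use W V U in \<open>auto simp: rs_sub clopen_subtopology\<close>)
qed

section \<open>Free condensed abelian groups\<close>

lemma sec_free_presheaf [simp]: "sec (free_presheaf E) S = free_Abelian_group (carrier (sec E S))"
  by (simp add: free_presheaf_def)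

lemma res_free_presheaf: "res (free_presheaf E) S T f = frag_extend (\<lambda>x. frag_of (res E S T f x))"
  by (simp add: free_presheaf_def)

lemma rs_free: "rs (free_presheaf E) S U W = frag_extend (\<lambda>x. frag_of (rs E S U W x))"
  by (simp add: rs_def[abs_def] res_free_presheaf)

lemma fres_free: "fres (free_presheaf E) S T f U = frag_extend (\<lambda>x. frag_of (fres E S T f U x))"
  by (simp add: fres_def[abs_def] res_free_presheaf)

lemma frag_extend_closed:
  "Poly_Mapping.keys c \<subseteq> P \<Longrightarrow> (\<And>x. x \<in> P \<Longrightarrow> Poly_Mapping.keys (f x) \<subseteq> Q) \<Longrightarrow> Poly_Mapping.keys (frag_extend f c) \<subseteq> Q"
  using keys_frag_extend[of f c] by blast

lemma frag_extend_hom: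
  "(\<And>x. x \<in> P \<Longrightarrow> Poly_Mapping.keys (f x) \<subseteq> Q) \<Longrightarrow> frag_extend f \<in> hom (free_Abelian_group P) (free_Abelian_group Q)"
  using frag_extend_closed[of _ P f Q] by (intro homI) (simp_all add: frag_extend_add)

lemma frag_extend_id: "frag_extend frag_of c = c"
  using frag_expansion[of c] by simp

lemma functorial_free:
  assumes E: "functorial E"
  shows "functorial (free_presheaf E)"
  unfolding functorial_def
proof (intro conjI ballI allI impI)
  fix S T :: "'a topology" and f assume "S \<in> CHED" "T \<in> CHED" "continuous_map S T f"
  from res_closed[OF E this]
  have "Poly_Mapping.keys (frag_extend (\<lambda>x. frag_of (res E S T f x)) c) \<subseteq> carrier (sec E S)"
    if "Poly_Mapping.keys c \<subseteq> carrier (sec E T)" for c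
    using that by (intro frag_extend_closed[where P = "carrier (sec E T)"]) auto
  then show "res (free_presheaf E) S T f \<in> carrier (sec (free_presheaf E) T) \<rightarrow> carrier (sec (free_presheaf E) S)"
    by (simp add: res_free_presheaf Pi_iff)
next
  fix S T :: "'a topology" and f f' c
  assume *: "S \<in> CHED" "T \<in> CHED" "continuous_map S T f" "continuous_map S T f'"
    "\<forall>s\<in>topspace S. f s = f' s" "c \<in> carrier (sec (free_presheaf E) T)"
  then show "res (free_presheaf E) S T f c = res (free_presheaf E) S T f' c"
    unfolding res_free_presheaf
    by (intro frag_extend_eq arg_cong[where f = frag_of] res_cong[OF E]) auto
next
  fix S :: "'a topology" and c assume "S \<in> CHED" "c \<in> carrier (sec (free_presheaf E) S)"
  then have "res (free_presheaf E) S S id c = frag_extend frag_of c"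
    unfolding res_free_presheaf by (intro frag_extend_eq) (auto simp: res_id[OF E])
  then show "res (free_presheaf E) S S id c = c" by (simp add: frag_extend_id)
next
  fix S T U :: "'a topology" and f h c
  assume *: "S \<in> CHED" "T \<in> CHED" "U \<in> CHED" "continuous_map S T f" "continuous_map T U h"
    "c \<in> carrier (sec (free_presheaf E) U)"
  have "res (free_presheaf E) S T f (res (free_presheaf E) T U h c) =
      frag_extend ((\<lambda>x. frag_of (res E S T f x)) \<circ> res E T U h) c"
    unfolding res_free_presheaf
    using frag_extend_compose[of "\<lambda>x. frag_of (res E S T f x)" "res E T U h" c] by (simp add: comp_def)
  also have "\<dots> = res (free_presheaf E) S U (h \<circ> f) c"
    unfolding res_free_presheaf using * by (intro frag_extend_eq) (auto simp: res_comp[OF E])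
  finally show "res (free_presheaf E) S U (h \<circ> f) c = res (free_presheaf E) S T f (res (free_presheaf E) T U h c)" ..
qed

abbreviation Zfree :: "('s, 'a, ('a, 'z) partial_object_scheme) presheaf \<Rightarrow> 's topology \<Rightarrow> ('s, 'a \<Rightarrow>\<^sub>0 int) germs monoid" where
  "Zfree E S \<equiv> sec (free_condensed E) S"

abbreviation fgerm where "fgerm E \<equiv> germ (free_presheaf E)"

text \<open>Extension by zero of a formal sum over \<open>U\<close>; the result is a section because
  a clopen \<open>U\<close> has an open complement.\<close>

definition loc :: "('s, 'a, ('a, 'z) partial_object_scheme) presheaf \<Rightarrow> 's topology \<Rightarrow> 's set \<Rightarrow>
    ('a \<Rightarrow>\<^sub>0 int) \<Rightarrow> ('s, 'a \<Rightarrow>\<^sub>0 int) germs" where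
  "loc E S U c = (\<lambda>s\<in>topspace S. if s \<in> U then fgerm E S s U c else fgerm E S s (topspace S) 0)"

text \<open>The section of \<open>\<int>[E]\<close> that is \<open>x\<close> on the clopen subset \<open>U\<close> and \<open>0\<close> elsewhere.\<close>

definition gen :: "('s, 'a, ('a, 'z) partial_object_scheme) presheaf \<Rightarrow> 's topology \<Rightarrow> 's set \<Rightarrow>
    'a \<Rightarrow> ('s, 'a \<Rightarrow>\<^sub>0 int) germs" where
  "gen E S U x = loc E S U (frag_of x)"

context
  fixes E :: "('s, 'a, ('a, 'z) partial_object_scheme) presheaf" and S :: "'s topology"
  assumes E: "functorial E" and S: "S \<in> CHED"
begin

private lemma F: "functorial (free_presheaf E)" by (rule functorial_free[OF E])

lemma carrier_Zfree: "carrier (Zfree E S) = sections (free_presheaf E) S"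
  by (simp add: free_condensed_def carrier_sheafify)

lemma Zfree_eqI:
  "\<sigma> \<in> carrier (Zfree E S) \<Longrightarrow> \<tau> \<in> carrier (Zfree E S) \<Longrightarrow> (\<And>s. s \<in> topspace S \<Longrightarrow> \<sigma> s = \<tau> s) \<Longrightarrow> \<sigma> = \<tau>"
  unfolding carrier_Zfree sections_def by (auto intro: extensionalityI)

lemma fgerm_0: "clopen S U \<Longrightarrow> s \<in> U \<Longrightarrow> fgerm E S s U 0 = fgerm E S s (topspace S) 0"
  using germ_rs[OF F S, of "topspace S" U s 0] clopen_subset[of S U] by (simp add: rs_free)

lemma natural_add:
  "natural_op2 (free_presheaf E) (free_presheaf E) (free_presheaf E) S (\<lambda>T. (\<otimes>\<^bsub>sec (free_presheaf E) T\<^esub>))"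
  unfolding natural_op2_def
  by (auto simp: rs_free frag_extend_add dest!: subsetD[OF Poly_Mapping.keys_add])

lemma Zfree_mult_germ:
  "clopen S U \<Longrightarrow> s \<in> U \<Longrightarrow> a \<in> car (free_presheaf E) S U \<Longrightarrow> b \<in> car (free_presheaf E) S U \<Longrightarrow>
   \<sigma> s = fgerm E S s U a \<Longrightarrow> \<tau> s = fgerm E S s U b \<Longrightarrow> (\<sigma> \<otimes>\<^bsub>Zfree E S\<^esub> \<tau>) s = fgerm E S s U (a + b)"
  using sheafify_op2_germ[OF F F F S natural_add, of U s a b \<sigma> \<tau>]
  by (simp add: free_condensed_def sheafify_def)

lemma Zfree_mult_closed:
  "\<sigma> \<in> carrier (Zfree E S) \<Longrightarrow> \<tau> \<in> carrier (Zfree E S) \<Longrightarrow> \<sigma> \<otimes>\<^bsub>Zfree E S\<^esub> \<tau> \<in> carrier (Zfree E S)"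
  using sheafify_op2_sections[OF F F F S natural_add, of \<sigma> \<tau>]
  unfolding carrier_Zfree by (simp add: free_condensed_def sheafify_def)

lemma Zfree_one: "\<one>\<^bsub>Zfree E S\<^esub> = (\<lambda>s\<in>topspace S. fgerm E S s (topspace S) 0)"
  by (simp add: free_condensed_def sheafify_def sheafify_unit_def)

lemma Zfree_one_germ: "clopen S U \<Longrightarrow> s \<in> U \<Longrightarrow> \<one>\<^bsub>Zfree E S\<^esub> s = fgerm E S s U 0"
  using fgerm_0[of U s] clopen_subset[of S U] by (auto simp: Zfree_one)

lemma loc_closed:
  assumes U: "clopen S U" and c: "c \<in> car (free_presheaf E) S U"
  shows "loc E S U c \<in> carrier (Zfree E S)"
  unfolding carrier_Zfree
proof (rule sectionsI)
  fix s assume s: "s \<in> topspace S"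
  show "\<exists>V a. clopen S V \<and> s \<in> V \<and> a \<in> car (free_presheaf E) S V \<and> (\<forall>t\<in>V. loc E S U c t = fgerm E S t V a)"
  proof (cases "s \<in> U")
    case True then show ?thesis using U c clopen_subset[OF U] by (auto simp: loc_def intro!: exI[of _ U])
  next
    case False
    have W: "clopen S (topspace S - U)" using clopen_Diff[OF clopen_simps(2) U] .
    have "loc E S U c t = fgerm E S t (topspace S - U) 0" if "t \<in> topspace S - U" for t
      using that fgerm_0[OF W that] by (simp add: loc_def)
    then show ?thesis using W False s by (intro exI[of _ "topspace S - U"] exI[of _ 0] conjI ballI) auto
  qed
qed (simp add: loc_def)

lemma loc_germ:
  "clopen S U \<Longrightarrow> s \<in> U \<Longrightarrow> loc E S U c s = fgerm E S s U c"
  "clopen S U \<Longrightarrow> s \<in> topspace S - U \<Longrightarrow> loc E S U c s = \<one>\<^bsub>Zfree E S\<^esub> s"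
  using clopen_subset[of S U] by (auto simp: loc_def Zfree_one)

lemma Zfree_E:
  assumes "\<sigma> \<in> carrier (Zfree E S)" "s \<in> P" "clopen S P"
  obtains U a where "clopen S U" "s \<in> U" "U \<subseteq> P" "a \<in> car (free_presheaf E) S U" "\<And>t. t \<in> U \<Longrightarrow> \<sigma> t = fgerm E S t U a"
  using sectionsE[OF F S] assms unfolding carrier_Zfree by blast

lemma Zfree_E2:
  assumes "\<sigma> \<in> carrier (Zfree E S)" "\<tau> \<in> carrier (Zfree E S)" "s \<in> P" "clopen S P"
  obtains U a b where "clopen S U" "s \<in> U" "U \<subseteq> P" "a \<in> car (free_presheaf E) S U" "b \<in> car (free_presheaf E) S U"
    "\<And>t. t \<in> U \<Longrightarrow> \<sigma> t = fgerm E S t U a" "\<And>t. t \<in> U \<Longrightarrow> \<tau> t = fgerm E S t U b"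
  using sections2E[OF F F S] assms unfolding carrier_Zfree by blast

lemma Zfree_at:
  assumes "\<sigma> \<in> carrier (Zfree E S)" "s \<in> topspace S"
  obtains U a where "clopen S U" "s \<in> U" "a \<in> car (free_presheaf E) S U" "\<sigma> s = fgerm E S s U a"
proof (rule Zfree_E[OF assms clopen_simps(2)])
  fix U a
  assume *: "clopen S U" "s \<in> U" "U \<subseteq> topspace S" "a \<in> car (free_presheaf E) S U" "\<And>t. t \<in> U \<Longrightarrow> \<sigma> t = fgerm E S t U a"
  show thesis by (rule that[OF *(1,2,4) *(5)[OF *(2)]])
qed

lemma Zfree_at2:
  assumes "\<sigma> \<in> carrier (Zfree E S)" "\<tau> \<in> carrier (Zfree E S)" "s \<in> topspace S"
  obtains U a b where "clopen S U" "s \<in> U" "a \<in> car (free_presheaf E) S U" "b \<in> car (free_presheaf E) S U"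
    "\<sigma> s = fgerm E S s U a" "\<tau> s = fgerm E S s U b"
proof (rule Zfree_E2[OF assms clopen_simps(2)])
  fix U a b
  assume *: "clopen S U" "s \<in> U" "U \<subseteq> topspace S" "a \<in> car (free_presheaf E) S U" "b \<in> car (free_presheaf E) S U"
    "\<And>t. t \<in> U \<Longrightarrow> \<sigma> t = fgerm E S t U a" "\<And>t. t \<in> U \<Longrightarrow> \<tau> t = fgerm E S t U b"
  show thesis by (rule that[OF *(1,2,4,5) *(6)[OF *(2)] *(7)[OF *(2)]])
qed

text \<open>Sections with equal germs are equal, and finitely many sections have representatives on
  a common clopen neighbourhood, where each law is that of formal sums. Inverses come from
  sheafified negation.\<close>

lemma comm_group_Zfree: "comm_group (Zfree E S)"
proof (rule comm_groupI)
  fix \<sigma> \<tau> assume st: "\<sigma> \<in> carrier (Zfree E S)" "\<tau> \<in> carrier (Zfree E S)"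
  then show "\<sigma> \<otimes>\<^bsub>Zfree E S\<^esub> \<tau> \<in> carrier (Zfree E S)" by (rule Zfree_mult_closed)
  show "\<sigma> \<otimes>\<^bsub>Zfree E S\<^esub> \<tau> = \<tau> \<otimes>\<^bsub>Zfree E S\<^esub> \<sigma>"
  proof (rule Zfree_eqI)
    fix s assume "s \<in> topspace S"
    then obtain U a b where U: "clopen S U" "s \<in> U" "a \<in> car (free_presheaf E) S U" "b \<in> car (free_presheaf E) S U"
        "\<sigma> s = fgerm E S s U a" "\<tau> s = fgerm E S s U b"
      using Zfree_at2[OF st] by metis
    show "(\<sigma> \<otimes>\<^bsub>Zfree E S\<^esub> \<tau>) s = (\<tau> \<otimes>\<^bsub>Zfree E S\<^esub> \<sigma>) s"
      using Zfree_mult_germ[where \<sigma> = "\<sigma>" and \<tau> = "\<tau>", OF U] Zfree_mult_germ[where \<sigma> = "\<tau>" and \<tau> = "\<sigma>", OF U(1,2,4,3,6,5)] by (simp add: add.commute)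
  qed (use st Zfree_mult_closed in auto)
next
  show one: "\<one>\<^bsub>Zfree E S\<^esub> \<in> carrier (Zfree E S)"
    unfolding carrier_Zfree by (rule sectionsI) (auto simp: Zfree_one intro!: exI[of _ "topspace S"] exI[of _ "0 :: 'a \<Rightarrow>\<^sub>0 int"])
  fix \<sigma> assume s: "\<sigma> \<in> carrier (Zfree E S)"
  show "\<one>\<^bsub>Zfree E S\<^esub> \<otimes>\<^bsub>Zfree E S\<^esub> \<sigma> = \<sigma>"
  proof (rule Zfree_eqI)
    fix s assume "s \<in> topspace S"
    then obtain U a where U: "clopen S U" "s \<in> U" "a \<in> car (free_presheaf E) S U" "\<sigma> s = fgerm E S s U a"
      using Zfree_E[OF s _ clopen_simps(2)] by metis
    show "(\<one>\<^bsub>Zfree E S\<^esub> \<otimes>\<^bsub>Zfree E S\<^esub> \<sigma>) s = \<sigma> s"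
      using Zfree_mult_germ[where \<sigma> = "\<one>\<^bsub>Zfree E S\<^esub>" and \<tau> = "\<sigma>", OF U(1,2) _ U(3) Zfree_one_germ[OF U(1,2)] U(4)] U by simp
  qed (use s one Zfree_mult_closed in auto)
  have nat: "natural_op1 (free_presheaf E) (free_presheaf E) S (\<lambda>T. uminus)"
    unfolding natural_op1_def by (auto simp: rs_free frag_extend_minus)
  let ?\<tau> = "sheafify_op1 (free_presheaf E) (\<lambda>T. uminus) S \<sigma>"
  have t: "?\<tau> \<in> carrier (Zfree E S)"
    using sheafify_op1_sections[OF F F S nat] s by (simp add: carrier_Zfree)
  have "?\<tau> \<otimes>\<^bsub>Zfree E S\<^esub> \<sigma> = \<one>\<^bsub>Zfree E S\<^esub>"
  proof (rule Zfree_eqI)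
    fix s assume "s \<in> topspace S"
    then obtain U a where U: "clopen S U" "s \<in> U" "a \<in> car (free_presheaf E) S U" "\<sigma> s = fgerm E S s U a"
      using Zfree_E[OF s _ clopen_simps(2)] by metis
    show "(?\<tau> \<otimes>\<^bsub>Zfree E S\<^esub> \<sigma>) s = \<one>\<^bsub>Zfree E S\<^esub> s"
      using Zfree_mult_germ[where \<sigma> = "?\<tau>" and \<tau> = "\<sigma>", OF U(1,2) _ U(3) sheafify_op1_germ[where \<sigma> = \<sigma>, OF F F S nat U(1-4)] U(4)] U Zfree_one_germ[OF U(1,2)] by simp
  qed (use s t one Zfree_mult_closed in auto)
  then show "\<exists>\<tau>\<in>carrier (Zfree E S). \<tau> \<otimes>\<^bsub>Zfree E S\<^esub> \<sigma> = \<one>\<^bsub>Zfree E S\<^esub>" using t by blast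
next
  fix \<sigma> \<tau> \<rho> assume st: "\<sigma> \<in> carrier (Zfree E S)" "\<tau> \<in> carrier (Zfree E S)" "\<rho> \<in> carrier (Zfree E S)"
  show "\<sigma> \<otimes>\<^bsub>Zfree E S\<^esub> \<tau> \<otimes>\<^bsub>Zfree E S\<^esub> \<rho> = \<sigma> \<otimes>\<^bsub>Zfree E S\<^esub> (\<tau> \<otimes>\<^bsub>Zfree E S\<^esub> \<rho>)"
  proof (rule Zfree_eqI)
    fix s assume "s \<in> topspace S"
    then obtain V c where V: "clopen S V" "s \<in> V" "c \<in> car (free_presheaf E) S V" "\<And>t. t \<in> V \<Longrightarrow> \<rho> t = fgerm E S t V c"
      using Zfree_E[OF st(3) _ clopen_simps(2)] by metis
    obtain U a b where U: "clopen S U" "s \<in> U" "U \<subseteq> V" "a \<in> car (free_presheaf E) S U" "b \<in> car (free_presheaf E) S U"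
        "\<sigma> s = fgerm E S s U a" "\<tau> s = fgerm E S s U b"
      using Zfree_E2[OF st(1,2) V(2,1)] by metis
    let ?c = "rs (free_presheaf E) S V U c"
    have c: "?c \<in> car (free_presheaf E) S U" "\<rho> s = fgerm E S s U ?c"
      using rs_closed[OF F S V(1) U(1,3) V(3)] germ_rs[OF F S V(1) U(1,3,2) V(3)] V(4)[OF V(2)] by auto
    have ab: "a + b \<in> car (free_presheaf E) S U" "b + ?c \<in> car (free_presheaf E) S U"
      using U c Poly_Mapping.keys_add[of a b] Poly_Mapping.keys_add[of b ?c] by auto
    show "(\<sigma> \<otimes>\<^bsub>Zfree E S\<^esub> \<tau> \<otimes>\<^bsub>Zfree E S\<^esub> \<rho>) s = (\<sigma> \<otimes>\<^bsub>Zfree E S\<^esub> (\<tau> \<otimes>\<^bsub>Zfree E S\<^esub> \<rho>)) s"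
      using Zfree_mult_germ[where \<sigma> = "\<sigma> \<otimes>\<^bsub>Zfree E S\<^esub> \<tau>" and \<tau> = "\<rho>", OF U(1,2) ab(1) c(1) Zfree_mult_germ[where \<sigma> = "\<sigma>" and \<tau> = "\<tau>", OF U(1,2,4,5,6,7)] c(2)]
        Zfree_mult_germ[where \<sigma> = "\<sigma>" and \<tau> = "\<tau> \<otimes>\<^bsub>Zfree E S\<^esub> \<rho>", OF U(1,2,4) ab(2) U(6) Zfree_mult_germ[where \<sigma> = "\<tau>" and \<tau> = "\<rho>", OF U(1,2,5) c(1) U(7) c(2)]]
      by (simp add: add.assoc)
  qed (use st Zfree_mult_closed in auto)
qed

text \<open>The operation \<open>k\<close> on representatives may depend on the point, as it does
  when a section is cut off outside a clopen set.\<close>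

lemma Zfree_pointwise_hom:
  assumes h: "h \<in> carrier (Zfree E S) \<rightarrow> carrier (Zfree E S)"
    and "\<And>\<sigma> s U a. \<sigma> \<in> carrier (Zfree E S) \<Longrightarrow> clopen S U \<Longrightarrow> s \<in> U \<Longrightarrow> a \<in> car (free_presheaf E) S U \<Longrightarrow> \<sigma> s = fgerm E S s U a \<Longrightarrow> h \<sigma> s = fgerm E S s U (k s a)"
    and "\<And>s a b. k s (a + b) = k s a + k s b"
    and "\<And>s a P. Poly_Mapping.keys a \<subseteq> P \<Longrightarrow> Poly_Mapping.keys (k s a) \<subseteq> P"
  shows "h \<in> hom (Zfree E S) (Zfree E S)"
proof (rule homI)
  fix \<sigma> \<tau> assume st: "\<sigma> \<in> carrier (Zfree E S)" "\<tau> \<in> carrier (Zfree E S)"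
  show "h (\<sigma> \<otimes>\<^bsub>Zfree E S\<^esub> \<tau>) = h \<sigma> \<otimes>\<^bsub>Zfree E S\<^esub> h \<tau>"
  proof (rule Zfree_eqI)
    fix s assume "s \<in> topspace S"
    then obtain U a b where U: "clopen S U" "s \<in> U" "a \<in> car (free_presheaf E) S U" "b \<in> car (free_presheaf E) S U"
        "\<sigma> s = fgerm E S s U a" "\<tau> s = fgerm E S s U b"
      using Zfree_at2[OF st] by metis
    have ab: "a + b \<in> car (free_presheaf E) S U" using U Poly_Mapping.keys_add[of a b] by auto
    show "h (\<sigma> \<otimes>\<^bsub>Zfree E S\<^esub> \<tau>) s = (h \<sigma> \<otimes>\<^bsub>Zfree E S\<^esub> h \<tau>) s"
      using assms(2)[OF Zfree_mult_closed[OF st] U(1,2) ab Zfree_mult_germ[where \<sigma> = "\<sigma>" and \<tau> = "\<tau>", OF U]]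
        Zfree_mult_germ[where \<sigma> = "h \<sigma>" and \<tau> = "h \<tau>", OF U(1,2) _ _ assms(2)[OF st(1) U(1,2,3,5)] assms(2)[OF st(2) U(1,2,4,6)]] assms(3,4) U
      by simp
  qed (use st h Zfree_mult_closed in auto)
qed (use h in auto)

text \<open>The inverse is known only through the group law. A representative \<open>b\<close> of it
  satisfies \<open>b + a = 0\<close> on a smaller neighbourhood, which determines its germ.\<close>

lemma Zfree_inv_germ:
  assumes "\<sigma> \<in> carrier (Zfree E S)" "clopen S U" "s \<in> U" "a \<in> car (free_presheaf E) S U" "\<sigma> s = fgerm E S s U a"
  shows "(inv\<^bsub>Zfree E S\<^esub> \<sigma>) s = fgerm E S s U (- a)"
proof -
  interpret comm_group "Zfree E S" by (rule comm_group_Zfree)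
  obtain V b where V: "clopen S V" "s \<in> V" "V \<subseteq> U" "b \<in> car (free_presheaf E) S V" "(inv\<^bsub>Zfree E S\<^esub> \<sigma>) s = fgerm E S s V b"
    using Zfree_E[OF inv_closed[OF assms(1)] assms(3,2)] by metis
  have V': "\<sigma> s = fgerm E S s V (rs (free_presheaf E) S U V a)"
    using germ_rs[OF F S assms(2) V(1,3,2) assms(4)] assms(5) by simp
  have a: "rs (free_presheaf E) S U V a \<in> car (free_presheaf E) S V" (is "?a \<in> _")
    using rs_closed[OF F S assms(2) V(1,3) assms(4)] .
  have ab: "b + ?a \<in> car (free_presheaf E) S V" using a V(4) Poly_Mapping.keys_add[of b ?a] by auto
  have "fgerm E S s V (b + ?a) = fgerm E S s V 0"
    using Zfree_mult_germ[where \<sigma> = "inv\<^bsub>Zfree E S\<^esub> \<sigma>" and \<tau> = "\<sigma>", OF V(1,2,4) a V(5) V'] l_inv[OF assms(1)] Zfree_one_germ[OF V(1,2)] by simp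
  then obtain W where W: "clopen S W" "s \<in> W" "W \<subseteq> V" "rs (free_presheaf E) S V W (b + ?a) = rs (free_presheaf E) S V W 0"
    using germ_eqD[OF F S V(1) V(1) V(2) V(2) ab, of 0] by auto
  then have "rs (free_presheaf E) S V W b = - rs (free_presheaf E) S V W ?a"
    by (simp add: rs_free frag_extend_add eq_neg_iff_add_eq_0)
  also have "\<dots> = - rs (free_presheaf E) S U W a" using rs_rs[OF F S assms(2) V(1) W(1,3) V(3) assms(4)] by simp
  finally have "rs (free_presheaf E) S V W b = rs (free_presheaf E) S U W (- a)" by (simp add: rs_free frag_extend_minus)
  then show ?thesis unfolding V(5) using assms V W
    by (intro germ_eqI[OF F S V(1) assms(2) V(4) _ W(1,2,3)]) auto
qed

lemma loc_hom:
  assumes U: "clopen S U"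
  shows "loc E S U \<in> hom (free_Abelian_group (car E S U)) (Zfree E S)"
proof (rule homI)
  fix c d assume cd: "c \<in> carrier (free_Abelian_group (car E S U))" "d \<in> carrier (free_Abelian_group (car E S U))"
  interpret comm_group "Zfree E S" by (rule comm_group_Zfree)
  have 1: "c + d \<in> car (free_presheaf E) S U" using cd Poly_Mapping.keys_add[of c d] by auto
  show "loc E S U (c \<otimes>\<^bsub>free_Abelian_group (car E S U)\<^esub> d) = loc E S U c \<otimes>\<^bsub>Zfree E S\<^esub> loc E S U d"
  proof (rule Zfree_eqI)
    fix s assume s: "s \<in> topspace S"
    show "loc E S U (c \<otimes>\<^bsub>free_Abelian_group (car E S U)\<^esub> d) s = (loc E S U c \<otimes>\<^bsub>Zfree E S\<^esub> loc E S U d) s"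
    proof (cases "s \<in> U")
      case True
      then show ?thesis using Zfree_mult_germ[where \<sigma> = "loc E S U c" and \<tau> = "loc E S U d", OF U True _ _ loc_germ(1)[OF U True] loc_germ(1)[OF U True]] cd
        by (simp add: loc_germ(1)[OF U])
    next
      case False
      let ?V = "topspace S - U"
      have V: "clopen S ?V" "s \<in> ?V" using clopen_Diff[OF clopen_simps(2) U] s False by auto
      have "loc E S U x s = fgerm E S s ?V 0" for x
        using loc_germ(2)[OF U V(2)] Zfree_one_germ[OF V] by simp
      then show ?thesis using Zfree_mult_germ[OF V, of 0 0 "loc E S U c" "loc E S U d"] by simp
    qed
  qed (use cd 1 loc_closed[OF U] in auto)
qed (use loc_closed[OF U] in auto)

lemma gen_closed: "clopen S U \<Longrightarrow> x \<in> car E S U \<Longrightarrow> gen E S U x \<in> carrier (Zfree E S)"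
  unfolding gen_def by (rule loc_closed) auto

lemma loc_rs_germ:
  "clopen S U \<Longrightarrow> clopen S W \<Longrightarrow> W \<subseteq> U \<Longrightarrow> s \<in> W \<Longrightarrow> c \<in> car (free_presheaf E) S U \<Longrightarrow>
   loc E S U c s = fgerm E S s W (rs (free_presheaf E) S U W c)"
  using germ_rs[OF F S, of U W s c] loc_germ(1)[of U s] by auto

text \<open>The basic relation between generators; \<open>Zfree_universal\<close> shows that all
  relations follow from relations of this kind.\<close>

lemma gen_union:
  assumes U: "clopen S U" "clopen S V" "U \<inter> V = {}" and x: "x \<in> car E S (U \<union> V)"
  shows "gen E S (U \<union> V) x = gen E S U (rs E S (U \<union> V) U x) \<otimes>\<^bsub>Zfree E S\<^esub> gen E S V (rs E S (U \<union> V) V x)"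
proof (rule Zfree_eqI)
  have UV: "clopen S (U \<union> V)" using U clopen_Un by auto
  have r: "rs E S (U \<union> V) U x \<in> car E S U" "rs E S (U \<union> V) V x \<in> car E S V"
    using rs_closed[OF E S UV _ _ x] U by auto
  show "gen E S (U \<union> V) x \<in> carrier (Zfree E S)" using gen_closed[OF UV x] .
  show "gen E S U (rs E S (U \<union> V) U x) \<otimes>\<^bsub>Zfree E S\<^esub> gen E S V (rs E S (U \<union> V) V x) \<in> carrier (Zfree E S)"
    using r U by (intro Zfree_mult_closed gen_closed)
  fix s assume s: "s \<in> topspace S"
  have lr: "gen E S (U \<union> V) x s = fgerm E S s W (frag_of (rs E S (U \<union> V) W x))" if "clopen S W" "s \<in> W" "W \<subseteq> U \<union> V" for W
    using loc_rs_germ[OF UV that(1,3,2)] x by (simp add: gen_def rs_free)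
  consider "s \<in> U" | "s \<in> V" | "s \<in> topspace S - (U \<union> V)" using s by auto
  then show "gen E S (U \<union> V) x s = (gen E S U (rs E S (U \<union> V) U x) \<otimes>\<^bsub>Zfree E S\<^esub> gen E S V (rs E S (U \<union> V) V x)) s"
  proof cases
    case 1
    have "gen E S V (rs E S (U \<union> V) V x) s = fgerm E S s U 0"
      using loc_germ(2)[OF U(2), of s] 1 U s Zfree_one_germ[OF U(1) 1] by (auto simp: gen_def)
    then show ?thesis
      using lr[OF U(1) 1] Zfree_mult_germ[OF U(1) 1, of "frag_of (rs E S (U \<union> V) U x)" 0] r loc_germ(1)[OF U(1) 1]
      by (simp add: gen_def)
  next
    case 2
    have "gen E S U (rs E S (U \<union> V) U x) s = fgerm E S s V 0"
      using loc_germ(2)[OF U(1), of s] 2 U s Zfree_one_germ[OF U(2) 2] by (auto simp: gen_def)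
    then show ?thesis
      using lr[OF U(2) 2] Zfree_mult_germ[OF U(2) 2, of 0 "frag_of (rs E S (U \<union> V) V x)"] r loc_germ(1)[OF U(2) 2]
      by (simp add: gen_def)
  next
    case 3
    have W: "clopen S (topspace S - (U \<union> V))" using clopen_Diff[OF clopen_simps(2) UV] .
    have "gen E S U (rs E S (U \<union> V) U x) s = fgerm E S s (topspace S - (U \<union> V)) 0"
       "gen E S V (rs E S (U \<union> V) V x) s = fgerm E S s (topspace S - (U \<union> V)) 0"
       "gen E S (U \<union> V) x s = fgerm E S s (topspace S - (U \<union> V)) 0"
      using loc_germ(2)[OF U(1), of s] loc_germ(2)[OF U(2), of s] loc_germ(2)[OF UV, of s] 3 Zfree_one_germ[OF W 3]
      by (auto simp: gen_def)
    then show ?thesis using Zfree_mult_germ[OF W 3, of 0 0] by simp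
  qed
qed

lemma gen_empty: "x \<in> car E S {} \<Longrightarrow> gen E S {} x = \<one>\<^bsub>Zfree E S\<^esub>"
  by (auto simp: gen_def loc_def Zfree_one)

end

section \<open>Generators of free condensed abelian groups\<close>

text \<open>
  Homomorphisms out of \<open>\<int>[E](S)\<close> and \<open>R[E](S)\<close> can be prescribed on such a basis.
\<close>

definition section_basis ::
  "('s, 'a, ('a, 'z) partial_object_scheme) presheaf \<Rightarrow> 's topology \<Rightarrow> ('s set \<times> 'a) set \<Rightarrow> bool" where
  "section_basis E S \<B> \<longleftrightarrow>
     (\<forall>U x. (U, x) \<in> \<B> \<longrightarrow> clopen S U \<and> x \<in> car E S U) \<and>
     (\<forall>U x W. (U, x) \<in> \<B> \<longrightarrow> clopen S W \<longrightarrow> W \<subseteq> U \<longrightarrow> (W, rs E S U W x) \<in> \<B>) \<and>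
     (\<forall>U x s. clopen S U \<longrightarrow> x \<in> car E S U \<longrightarrow> s \<in> U \<longrightarrow>
        (\<exists>W. clopen S W \<and> s \<in> W \<and> W \<subseteq> U \<and> (W, rs E S U W x) \<in> \<B>))"

definition all_sections :: "('s, 'a, ('a, 'z) partial_object_scheme) presheaf \<Rightarrow> 's topology \<Rightarrow> ('s set \<times> 'a) set" where
  "all_sections E S = {(U, x). clopen S U \<and> x \<in> car E S U}"

text \<open>Multiplication by the indicator function of \<open>V\<close>, as
  \<open>int_action_Zfree_ind\<close> confirms. Statements about a whole section are proved by
  clopen induction on the \<open>V\<close> to which it is cut.\<close>

definition cut ::
  "('s, 'a, ('a, 'z) partial_object_scheme) presheaf \<Rightarrow> 's topology \<Rightarrow> 's set \<Rightarrow>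
   ('s, 'a \<Rightarrow>\<^sub>0 int) germs \<Rightarrow> ('s, 'a \<Rightarrow>\<^sub>0 int) germs" where
  "cut E S V \<sigma> = (\<lambda>s\<in>topspace S. if s \<in> V then \<sigma> s else \<one>\<^bsub>Zfree E S\<^esub> s)"

context
  fixes E :: "('s, 'a, ('a, 'z) partial_object_scheme) presheaf" and S :: "'s topology"
  assumes E: "functorial E" and S: "S \<in> CHED"
begin

lemma section_basis_all: "section_basis E S (all_sections E S)"
  unfolding section_basis_def all_sections_def using rs_closed[OF E S] by blast

lemma cut_closed:
  assumes V: "clopen S V" and \<sigma>: "\<sigma> \<in> carrier (Zfree E S)"
  shows "cut E S V \<sigma> \<in> carrier (Zfree E S)"
  unfolding carrier_Zfree[OF E S]
proof (rule sectionsI)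
  fix s assume s: "s \<in> topspace S"
  show "\<exists>U a. clopen S U \<and> s \<in> U \<and> a \<in> car (free_presheaf E) S U \<and> (\<forall>t\<in>U. cut E S V \<sigma> t = fgerm E S t U a)"
  proof (cases "s \<in> V")
    case True
    obtain U a where U: "clopen S U" "s \<in> U" "U \<subseteq> V" "a \<in> car (free_presheaf E) S U" "\<And>t. t \<in> U \<Longrightarrow> \<sigma> t = fgerm E S t U a"
      using Zfree_E[OF E S \<sigma> True V] by blast
    have "cut E S V \<sigma> t = fgerm E S t U a" if "t \<in> U" for t
      using that U clopen_subset[OF V] by (auto simp: cut_def)
    then show ?thesis using U by blast
  next
    case False
    have W: "clopen S (topspace S - V)" using clopen_Diff[OF clopen_simps(2) V] .
    have "cut E S V \<sigma> t = fgerm E S t (topspace S - V) 0" if "t \<in> topspace S - V" for t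
      using that Zfree_one_germ[OF E S W that] by (simp add: cut_def)
    then show ?thesis using W False s by (intro exI[of _ "topspace S - V"] exI[of _ 0] conjI ballI) auto
  qed
qed (simp add: cut_def)

lemma cut_germ:
  "clopen S V \<Longrightarrow> s \<in> V \<Longrightarrow> cut E S V \<sigma> s = \<sigma> s"
  "s \<in> topspace S - V \<Longrightarrow> cut E S V \<sigma> s = \<one>\<^bsub>Zfree E S\<^esub> s"
  using clopen_subset[of S V] by (auto simp: cut_def)

lemma Zfree_mult_one:
  assumes "\<sigma> \<in> carrier (Zfree E S)" "\<tau> \<in> carrier (Zfree E S)" "s \<in> topspace S"
  shows "\<tau> s = \<one>\<^bsub>Zfree E S\<^esub> s \<Longrightarrow> (\<sigma> \<otimes>\<^bsub>Zfree E S\<^esub> \<tau>) s = \<sigma> s"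
    and "\<sigma> s = \<one>\<^bsub>Zfree E S\<^esub> s \<Longrightarrow> (\<sigma> \<otimes>\<^bsub>Zfree E S\<^esub> \<tau>) s = \<tau> s"
proof -
  obtain U a b where U: "clopen S U" "s \<in> U" "U \<subseteq> topspace S" "a \<in> car (free_presheaf E) S U" "b \<in> car (free_presheaf E) S U"
        "\<And>t. t \<in> U \<Longrightarrow> \<sigma> t = fgerm E S t U a" "\<And>t. t \<in> U \<Longrightarrow> \<tau> t = fgerm E S t U b"
    using Zfree_E2[OF E S assms(1,2) assms(3) clopen_simps(2)] by blast
  note one = Zfree_one_germ[OF E S U(1,2)]
  have 0: "0 \<in> car (free_presheaf E) S U" by simp
  show "(\<sigma> \<otimes>\<^bsub>Zfree E S\<^esub> \<tau>) s = \<sigma> s" if "\<tau> s = \<one>\<^bsub>Zfree E S\<^esub> s"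
    using Zfree_mult_germ[where \<sigma> = \<sigma> and \<tau> = \<tau>, OF E S U(1,2,4) 0 U(6)[OF U(2)]] that one U(6)[OF U(2)] by simp
  show "(\<sigma> \<otimes>\<^bsub>Zfree E S\<^esub> \<tau>) s = \<tau> s" if "\<sigma> s = \<one>\<^bsub>Zfree E S\<^esub> s"
    using Zfree_mult_germ[where \<sigma> = \<sigma> and \<tau> = \<tau>, OF E S U(1,2) 0 U(5) _ U(7)[OF U(2)]] that one U(7)[OF U(2)] by simp
qed

lemma cut_union:
  assumes "clopen S V" "clopen S W" "V \<inter> W = {}" "\<sigma> \<in> carrier (Zfree E S)"
  shows "cut E S (V \<union> W) \<sigma> = cut E S V \<sigma> \<otimes>\<^bsub>Zfree E S\<^esub> cut E S W \<sigma>"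
proof (rule Zfree_eqI[OF E S])
  show "cut E S (V \<union> W) \<sigma> \<in> carrier (Zfree E S)" using assms clopen_Un cut_closed by metis
  show "cut E S V \<sigma> \<otimes>\<^bsub>Zfree E S\<^esub> cut E S W \<sigma> \<in> carrier (Zfree E S)"
    using assms by (intro Zfree_mult_closed[OF E S] cut_closed)
  fix s assume s: "s \<in> topspace S"
  note m = Zfree_mult_one[OF cut_closed[OF assms(1,4)] cut_closed[OF assms(2,4)] s]
  show "cut E S (V \<union> W) \<sigma> s = (cut E S V \<sigma> \<otimes>\<^bsub>Zfree E S\<^esub> cut E S W \<sigma>) s"
    using m s assms(3) by (cases "s \<in> V"; cases "s \<in> W") (auto simp: cut_def)
qed

lemma cut_hom:
  assumes V: "clopen S V"
  shows "cut E S V \<in> hom (Zfree E S) (Zfree E S)"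
proof (rule Zfree_pointwise_hom[OF E S, where k = "\<lambda>s a. if s \<in> V then a else 0"])
  fix \<sigma> s U a
  assume *: "\<sigma> \<in> carrier (Zfree E S)" "clopen S U" "s \<in> U" "a \<in> car (free_presheaf E) S U" "\<sigma> s = fgerm E S s U a"
  then show "cut E S V \<sigma> s = fgerm E S s U (if s \<in> V then a else 0)"
    using clopen_subset[OF *(2)] Zfree_one_germ[OF E S *(2,3)] by (auto simp: cut_def)
qed (use cut_closed[OF V] in auto)

lemma cut_top: "\<sigma> \<in> carrier (Zfree E S) \<Longrightarrow> cut E S (topspace S) \<sigma> = \<sigma>"
  by (rule Zfree_eqI[OF E S]) (simp_all add: cut_closed cut_germ(1))

lemma cut_empty: "cut E S {} \<sigma> = \<one>\<^bsub>Zfree E S\<^esub>"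
  by (simp add: cut_def Zfree_one[OF E S] restrict_def fun_eq_iff)

lemma cut_eq_loc:
  assumes U: "clopen S U" and W: "clopen S W" "W \<subseteq> U" and a: "a \<in> car (free_presheaf E) S U"
    and \<sigma>: "\<sigma> \<in> carrier (Zfree E S)" "\<And>t. t \<in> U \<Longrightarrow> \<sigma> t = fgerm E S t U a"
  shows "cut E S W \<sigma> = loc E S W (rs (free_presheaf E) S U W a)"
proof (rule Zfree_eqI[OF E S])
  show "cut E S W \<sigma> \<in> carrier (Zfree E S)" by (rule cut_closed[OF W(1) \<sigma>(1)])
  show "loc E S W (rs (free_presheaf E) S U W a) \<in> carrier (Zfree E S)"
    by (rule loc_closed[OF E S W(1) rs_closed[OF functorial_free[OF E] S U W a]])
  fix s assume "s \<in> topspace S"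
  then show "cut E S W \<sigma> s = loc E S W (rs (free_presheaf E) S U W a) s"
    using loc_germ[OF E S W(1), of s] germ_rs[OF functorial_free[OF E] S U W _ a, of s] W(2) \<sigma>(2)[of s] by (auto simp: cut_def)
qed

lemma cut_gen:
  assumes U: "clopen S U" and V: "clopen S V" and x: "x \<in> car E S U"
  shows "cut E S V (gen E S U x) = gen E S (U \<inter> V) (rs E S U (U \<inter> V) x)"
proof (rule Zfree_eqI[OF E S])
  have UV: "clopen S (U \<inter> V)" using U V clopen_Int by blast
  have r: "rs E S U (U \<inter> V) x \<in> car E S (U \<inter> V)" by (rule rs_closed[OF E S U UV _ x]) auto
  show "cut E S V (gen E S U x) \<in> carrier (Zfree E S)" by (rule cut_closed[OF V gen_closed[OF E S U x]])
  show "gen E S (U \<inter> V) (rs E S U (U \<inter> V) x) \<in> carrier (Zfree E S)" by (rule gen_closed[OF E S UV r])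
  fix s assume s: "s \<in> topspace S"
  have fx: "frag_of x \<in> car (free_presheaf E) S U" using x by simp
  show "cut E S V (gen E S U x) s = gen E S (U \<inter> V) (rs E S U (U \<inter> V) x) s"
  proof (cases "s \<in> U \<inter> V")
    case True
    then show ?thesis using s loc_germ(1)[OF E S UV True] loc_rs_germ[OF E S U UV _ True fx]
      by (simp add: cut_def gen_def rs_free)
  next
    case False
    have "gen E S U x s = \<one>\<^bsub>Zfree E S\<^esub> s" if "s \<notin> U" using loc_germ(2)[OF E S U, of s] s that by (simp add: gen_def)
    then show ?thesis using s False loc_germ(2)[OF E S UV, of s] by (cases "s \<in> U") (simp_all add: cut_def gen_def)
  qed
qed

section \<open>Generators and relations for sections of free condensed abelian groups\<close>

context
  fixes \<B> assumes \<B>: "section_basis E S \<B>"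
begin

private lemma B1: "(U, x) \<in> \<B> \<Longrightarrow> clopen S U" "(U, x) \<in> \<B> \<Longrightarrow> x \<in> car E S U"
  and B2: "(U, x) \<in> \<B> \<Longrightarrow> clopen S W \<Longrightarrow> W \<subseteq> U \<Longrightarrow> (W, rs E S U W x) \<in> \<B>"
  using \<B> by (auto simp: section_basis_def)

private lemma B3:
  assumes "clopen S U" "x \<in> car E S U" "s \<in> U"
  obtains W where "clopen S W" "s \<in> W" "W \<subseteq> U" "(W, rs E S U W x) \<in> \<B>"
  using assms \<B> unfolding section_basis_def by metis

text \<open>Clopen induction on \<open>V\<close> for \<open>cut E S V \<sigma>\<close>. Near a point
  \<open>\<sigma>\<close> is given by one formal sum, and each of its finitely many terms falls into
  the basis after the neighbourhood is shrunk.\<close>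

lemma Zfree_generates: "generates (Zfree E S) {gen E S U x |U x. (U, x) \<in> \<B>}"
proof -
  interpret Z: comm_group "Zfree E S" by (rule comm_group_Zfree[OF E S])
  let ?Q = "{gen E S U x |U x. (U, x) \<in> \<B>}"
  have Q: "?Q \<subseteq> carrier (Zfree E S)" using B1 gen_closed[OF E S] by blast
  let ?G = "generate (Zfree E S) ?Q"
  have sg: "subgroup ?G (Zfree E S)" by (rule Z.generate_is_subgroup[OF Q])
  have "\<sigma> \<in> ?G" if \<sigma>: "\<sigma> \<in> carrier (Zfree E S)" for \<sigma>
  proof -
    have "cut E S (topspace S) \<sigma> \<in> ?G"
      using S clopen_simps(2)
    proof (induction rule: clopen_induct)
      case empty
      then show ?case unfolding cut_empty by (rule generate.one)
    next
      case (union V1 V2)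
      then show ?case unfolding cut_union[OF union(1,2,3) \<sigma>] by (intro generate.eng)
    next
      case (local s)
      obtain U a where U: "clopen S U" "s \<in> U" "U \<subseteq> topspace S" "a \<in> car (free_presheaf E) S U" "\<And>t. t \<in> U \<Longrightarrow> \<sigma> t = fgerm E S t U a"
        using Zfree_E[OF E S \<sigma> local clopen_simps(2)] by blast
      have a: "Poly_Mapping.keys a \<subseteq> car E S U" using U by simp
      \<comment> \<open>The condition covers all clopen \<open>W' \<subseteq> W\<close>, because the
        local step of the clopen induction asks for this and because a difference of formal sums
        requires intersecting two neighbourhoods.\<close>
      define P where "P c \<longleftrightarrow> Poly_Mapping.keys c \<subseteq> car E S U \<and>
        (\<exists>W. clopen S W \<and> s \<in> W \<and> W \<subseteq> U \<and> (\<forall>W'. clopen S W' \<longrightarrow> W' \<subseteq> W \<longrightarrow>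
         loc E S W' (rs (free_presheaf E) S U W' c) \<in> ?G))" for c
      have "P a" using a
      proof (induction rule: frag_induction)
        case zero
        have "loc E S W' (rs (free_presheaf E) S U W' 0) \<in> ?G" if "clopen S W'" for W'
          using hom_one[OF loc_hom[OF E S that]] Z.is_group
          by (simp add: rs_free generate.one)
        then show ?case unfolding P_def using U by auto
      next
        case (one x)
        obtain W where W: "clopen S W" "s \<in> W" "W \<subseteq> U" "(W, rs E S U W x) \<in> \<B>"
          by (rule B3[OF U(1) one U(2)])
        have "loc E S W' (rs (free_presheaf E) S U W' (frag_of x)) \<in> ?G" if W': "clopen S W'" "W' \<subseteq> W" for W'
        proof -
          have "rs E S W W' (rs E S U W x) = rs E S U W' x" by (rule rs_rs[OF E S U(1) W(1) W' W(3) one])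
          then have "(W', rs E S U W' x) \<in> \<B>" using B2[OF W(4) W'] by simp
          then have "gen E S W' (rs E S U W' x) \<in> ?Q" by blast
          then show ?thesis by (simp add: gen_def rs_free generate.incl)
        qed
        then show ?case unfolding P_def using W one by auto
      next
        case (diff c d)
        obtain W1 where W1: "clopen S W1" "s \<in> W1" "W1 \<subseteq> U" "\<forall>W'. clopen S W' \<longrightarrow> W' \<subseteq> W1 \<longrightarrow>
            loc E S W' (rs (free_presheaf E) S U W' c) \<in> ?G" using diff P_def by auto
        obtain W2 where W2: "clopen S W2" "s \<in> W2" "W2 \<subseteq> U" "\<forall>W'. clopen S W' \<longrightarrow> W' \<subseteq> W2 \<longrightarrow>
            loc E S W' (rs (free_presheaf E) S U W' d) \<in> ?G" using diff P_def by auto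
        have cd: "c \<in> car (free_presheaf E) S U" "d \<in> car (free_presheaf E) S U" using diff P_def by auto
        have "loc E S W' (rs (free_presheaf E) S U W' (c - d)) \<in> ?G" if W': "clopen S W'" "W' \<subseteq> W1 \<inter> W2" for W'
        proof -
          let ?F = "free_Abelian_group (car E S W')"
          have r: "rs (free_presheaf E) S U W' c \<in> carrier ?F" "rs (free_presheaf E) S U W' d \<in> carrier ?F"
            using rs_closed[OF functorial_free[OF E] S U(1) W'(1) _ cd(1)] rs_closed[OF functorial_free[OF E] S U(1) W'(1) _ cd(2)] W' W1 by auto
          have "rs (free_presheaf E) S U W' (c - d) = rs (free_presheaf E) S U W' c \<otimes>\<^bsub>?F\<^esub> inv\<^bsub>?F\<^esub> rs (free_presheaf E) S U W' d"
            using r by (simp add: rs_free frag_extend_diff)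
          then have "loc E S W' (rs (free_presheaf E) S U W' (c - d)) =
             loc E S W' (rs (free_presheaf E) S U W' c) \<otimes>\<^bsub>Zfree E S\<^esub> inv\<^bsub>Zfree E S\<^esub> loc E S W' (rs (free_presheaf E) S U W' d)"
            using hom_mult[OF loc_hom[OF E S W'(1)] r(1) group.inv_closed[OF group_free_Abelian_group r(2)]]
              hom_inv[OF group_free_Abelian_group Z.is_group loc_hom[OF E S W'(1)] r(2)] by simp
          moreover have "loc E S W' (rs (free_presheaf E) S U W' c) \<in> ?G" "loc E S W' (rs (free_presheaf E) S U W' d) \<in> ?G"
            using W1 W2 W' by auto
          ultimately show ?thesis using sg by (simp add: subgroup.m_closed subgroup.m_inv_closed)
        qed
        moreover have "Poly_Mapping.keys (c - d) \<subseteq> car E S U" using cd Poly_Mapping.keys_diff[of c d] by auto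
        moreover have "clopen S (W1 \<inter> W2)" "s \<in> W1 \<inter> W2" "W1 \<inter> W2 \<subseteq> U" using W1 W2 clopen_Int by auto
        ultimately show ?case unfolding P_def by blast
      qed
      then obtain W where W: "clopen S W" "s \<in> W" "W \<subseteq> U" "\<And>W'. clopen S W' \<Longrightarrow> W' \<subseteq> W \<Longrightarrow>
         loc E S W' (rs (free_presheaf E) S U W' a) \<in> ?G" unfolding P_def by auto
      have "cut E S W' \<sigma> \<in> ?G" if "clopen S W'" "W' \<subseteq> W" for W'
        using W(4)[OF that] cut_eq_loc[OF U(1) that(1) _ U(4) \<sigma> U(5)] that W(3) by auto
      then show ?case using W by blast
    qed
    then show ?thesis using cut_top[OF \<sigma>] by simp
  qed
  then show ?thesis unfolding generates_def using Q Z.generate_incl[OF Q] by blast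
qed

text \<open>The map \<open>p\<close> presents the sections as a quotient of formal sums over the
  basis, so \<open>factor_hom\<close> reduces the claim to showing that the prescribed values cancel
  whenever the sections do. To make clopen induction available, this is proved for the parts over
  all clopen sets.\<close>

lemma Zfree_universal:
  fixes B :: "('b, 'w) monoid_scheme" and \<phi> :: "'s set \<Rightarrow> 'a \<Rightarrow> 'b"
  assumes B: "comm_group B" and cl: "\<And>U x. (U, x) \<in> \<B> \<Longrightarrow> \<phi> U x \<in> carrier B"
    and add: "\<And>U V x. clopen S U \<Longrightarrow> clopen S V \<Longrightarrow> U \<inter> V = {} \<Longrightarrow> (U \<union> V, x) \<in> \<B> \<Longrightarrow>
      \<phi> (U \<union> V) x = \<phi> U (rs E S (U \<union> V) U x) \<otimes>\<^bsub>B\<^esub> \<phi> V (rs E S (U \<union> V) V x)"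
  obtains h where "h \<in> hom (Zfree E S) B" "\<And>U x. (U, x) \<in> \<B> \<Longrightarrow> h (gen E S U x) = \<phi> U x"
proof -
  interpret Z: comm_group "Zfree E S" by (rule comm_group_Zfree[OF E S])
  interpret B: comm_group B by fact
  let ?F = "free_Abelian_group \<B>"
  define p where "p = frag_eval (Zfree E S) (\<lambda>(U, x). gen E S U x)"
  \<comment> \<open>The value that a formal sum should receive after being cut off outside
    \<open>V\<close>; for \<open>V = topspace S\<close> it is the map to be factored.\<close>
  define \<Phi> where "\<Phi> V = frag_eval B (\<lambda>(U, x). \<phi> (U \<inter> V) (rs E S U (U \<inter> V) x))" for V
  have gcl: "gen E S U x \<in> carrier (Zfree E S)" if "(U, x) \<in> \<B>" for U x
    using gen_closed[OF E S] B1 that by blast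
  have bV: "(U \<inter> V, rs E S U (U \<inter> V) x) \<in> \<B>" if "(U, x) \<in> \<B>" "clopen S V" for U V x
    using B2[OF that(1), of "U \<inter> V"] clopen_Int[OF B1(1)[OF that(1)] that(2)] by blast
  have p: "p \<in> hom ?F (Zfree E S)" unfolding p_def using gcl
    by (intro frag_eval_hom[OF Z.comm_group_axioms]) auto
  have p_of: "p (frag_of (U, x)) = gen E S U x" if "(U, x) \<in> \<B>" for U x
    unfolding p_def using gcl[OF that] by (simp add: Z.comm_group_axioms)
  have \<Phi>: "\<Phi> V \<in> hom ?F B" if "clopen S V" for V unfolding \<Phi>_def using cl bV that
    by (intro frag_eval_hom[OF B]) auto
  have \<Phi>_of: "\<Phi> V (frag_of (U, x)) = \<phi> (U \<inter> V) (rs E S U (U \<inter> V) x)" if "(U, x) \<in> \<B>" "clopen S V" for U V x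
    unfolding \<Phi>_def using cl[OF bV[OF that]] by (simp add: B)
  \<comment> \<open>The empty set is the disjoint union of itself with itself, so additivity makes
    this value equal to its own square.\<close>
  have \<phi>0: "\<phi> {} y = \<one>\<^bsub>B\<^esub>" if "({}, y) \<in> \<B>" for y
  proof -
    have "\<phi> ({} \<union> {}) y = \<phi> {} (rs E S ({} \<union> {}) {} y) \<otimes>\<^bsub>B\<^esub> \<phi> {} (rs E S ({} \<union> {}) {} y)"
      using that by (intro add) auto
    then have "\<phi> {} y = \<phi> {} y \<otimes>\<^bsub>B\<^esub> \<phi> {} y" using rs_self[OF E S _ B1(2)[OF that]] by simp
    then show ?thesis using cl[OF that] by (metis B.l_cancel_one' )
  qed
  have ker: "\<Phi> (topspace S) c = \<one>\<^bsub>B\<^esub>" if c: "c \<in> carrier ?F" and pc: "p c = \<one>\<^bsub>Zfree E S\<^esub>" for c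
    using S clopen_simps(2)
  proof (induction rule: clopen_induct)
    case empty
    have "\<Phi> {} c = (\<lambda>_. \<one>\<^bsub>B\<^esub>) c"
    proof (rule hom_eq_on_generators[OF group_free_Abelian_group B.is_group free_Abelian_group_generates \<Phi> _ _ c])
      show "(\<lambda>_. \<one>\<^bsub>B\<^esub>) \<in> hom ?F B" by (auto simp: hom_def)
      fix q assume "q \<in> frag_of ` \<B>"
      then obtain U x where "q = frag_of (U, x)" "(U, x) \<in> \<B>" by auto
      then show "\<Phi> {} q = \<one>\<^bsub>B\<^esub>" using \<Phi>_of[of U x "{}"] \<phi>0 bV[of U x "{}"] by simp
    qed simp
    then show ?case by simp
  next
    case (union V1 V2)
    note V = clopen_Un[OF union(1,2)]
    have "\<Phi> (V1 \<union> V2) c = \<Phi> V1 c \<otimes>\<^bsub>B\<^esub> \<Phi> V2 c"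
    proof (rule hom_eq_on_generators[OF group_free_Abelian_group B.is_group free_Abelian_group_generates \<Phi>[OF V] _ _ c])
      show "(\<lambda>c. \<Phi> V1 c \<otimes>\<^bsub>B\<^esub> \<Phi> V2 c) \<in> hom ?F B"
      proof (rule homI)
        fix x y assume xy: "x \<in> carrier ?F" "y \<in> carrier ?F"
        show "\<Phi> V1 (x \<otimes>\<^bsub>?F\<^esub> y) \<otimes>\<^bsub>B\<^esub> \<Phi> V2 (x \<otimes>\<^bsub>?F\<^esub> y) = \<Phi> V1 x \<otimes>\<^bsub>B\<^esub> \<Phi> V2 x \<otimes>\<^bsub>B\<^esub> (\<Phi> V1 y \<otimes>\<^bsub>B\<^esub> \<Phi> V2 y)"
          unfolding hom_mult[OF \<Phi>[OF union(1)] xy] hom_mult[OF \<Phi>[OF union(2)] xy]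
          using hom_in_carrier[OF \<Phi>[OF union(1)]] hom_in_carrier[OF \<Phi>[OF union(2)]] xy
          by (simp add: B.m_ac del: carrier_free_Abelian_group_iff)
      qed (use hom_in_carrier[OF \<Phi>[OF union(1)]] hom_in_carrier[OF \<Phi>[OF union(2)]] in auto)
      fix q assume "q \<in> frag_of ` \<B>"
      then obtain U x where q: "q = frag_of (U, x)" "(U, x) \<in> \<B>" by auto
      have U: "clopen S U" "x \<in> car E S U" using B1 q by auto
      have u: "U \<inter> (V1 \<union> V2) = (U \<inter> V1) \<union> (U \<inter> V2)" by auto
      have c12: "clopen S (U \<inter> V1)" "clopen S (U \<inter> V2)" "clopen S (U \<inter> V1 \<union> U \<inter> V2)"
        using U union by (simp_all add: clopen_Int clopen_Un)
      have "\<phi> (U \<inter> V1 \<union> U \<inter> V2) (rs E S U (U \<inter> V1 \<union> U \<inter> V2) x) =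
         \<phi> (U \<inter> V1) (rs E S (U \<inter> V1 \<union> U \<inter> V2) (U \<inter> V1) (rs E S U (U \<inter> V1 \<union> U \<inter> V2) x)) \<otimes>\<^bsub>B\<^esub>
         \<phi> (U \<inter> V2) (rs E S (U \<inter> V1 \<union> U \<inter> V2) (U \<inter> V2) (rs E S U (U \<inter> V1 \<union> U \<inter> V2) x))"
        using c12 union(3) bV[OF q(2) V] u by (intro add) auto
      moreover have "rs E S (U \<inter> V1 \<union> U \<inter> V2) (U \<inter> V1) (rs E S U (U \<inter> V1 \<union> U \<inter> V2) x) = rs E S U (U \<inter> V1) x"
        by (rule rs_rs[OF E S U(1) c12(3) c12(1) _ _ U(2)]) auto
      moreover have "rs E S (U \<inter> V1 \<union> U \<inter> V2) (U \<inter> V2) (rs E S U (U \<inter> V1 \<union> U \<inter> V2) x) = rs E S U (U \<inter> V2) x"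
        by (rule rs_rs[OF E S U(1) c12(3) c12(2) _ _ U(2)]) auto
      ultimately show "\<Phi> (V1 \<union> V2) q = \<Phi> V1 q \<otimes>\<^bsub>B\<^esub> \<Phi> V2 q"
        unfolding q(1) \<Phi>_of[OF q(2) V] \<Phi>_of[OF q(2) union(1)] \<Phi>_of[OF q(2) union(2)] u by simp
    qed
    then show ?case using union by simp
  next
    case (local s)
    \<comment> \<open>Supports are clopen, so each of them either contains or misses a whole
      neighbourhood of \<open>s\<close>. The set \<open>W0\<close> achieves this for all keys of
      \<open>c\<close> at once.\<close>
    define w where "w p = (if s \<in> fst p then fst p else topspace S - fst p)" for p :: "'s set \<times> 'a"
    define W0 where "W0 = topspace S \<inter> (\<Inter>p\<in>Poly_Mapping.keys c. w p)"
    have keys: "Poly_Mapping.keys c \<subseteq> \<B>" using c by simp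
    have wk: "clopen S (w p) \<and> s \<in> w p" if "p \<in> \<B>" for p
      using that B1(1)[of "fst p" "snd p"] local clopen_Diff[OF clopen_simps(2)] by (auto simp: w_def)
    have "clopen S (topspace S \<inter> (\<Inter>p\<in>K. w p)) \<and> s \<in> topspace S \<inter> (\<Inter>p\<in>K. w p)" if "finite K" "K \<subseteq> \<B>" for K
      using that
    proof (induction K rule: finite_induct)
      case empty then show ?case using local by simp
    next
      case (insert p K)
      have "topspace S \<inter> (\<Inter>p\<in>insert p K. w p) = w p \<inter> (topspace S \<inter> (\<Inter>p\<in>K. w p))" by auto
      then show ?case using insert wk[of p] clopen_Int by auto
    qed
    then have W0: "clopen S W0" "s \<in> W0" unfolding W0_def using keys by auto
    define C where "C = {(U, x) \<in> \<B>. if s \<in> U then W0 \<subseteq> U else W0 \<inter> U = {}}"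
    have kC: "Poly_Mapping.keys c \<subseteq> C"
    proof
      fix q assume q: "q \<in> Poly_Mapping.keys c"
      then have "W0 \<subseteq> w q" by (auto simp: W0_def)
      then show "q \<in> C" using q keys by (cases q) (auto simp: C_def w_def split: if_splits)
    qed
    have CB: "C \<subseteq> \<B>" by (auto simp: C_def)
    \<comment> \<open>Sections with \<open>s \<in> U\<close> can be restricted to \<open>W0\<close>,
      and those with \<open>s \<notin> U\<close> vanish there, so \<open>p d\<close> has at
      \<open>s\<close> the germ of the single formal sum \<open>a d\<close>.\<close>
    define a where "a = frag_extend (\<lambda>(U, x). if s \<in> U then frag_of (rs E S U W0 x) else (0 :: 'a \<Rightarrow>\<^sub>0 int))"
    have a_cl: "a d \<in> car (free_presheaf E) S W0" if "Poly_Mapping.keys d \<subseteq> C" for d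
    proof -
      have "Poly_Mapping.keys (a d) \<subseteq> car E S W0" unfolding a_def
      proof (rule frag_extend_closed[OF that])
        fix q assume "q \<in> C"
        then show "Poly_Mapping.keys (case q of (U, x) \<Rightarrow> if s \<in> U then frag_of (rs E S U W0 x) else (0 :: 'a \<Rightarrow>\<^sub>0 int)) \<subseteq> car E S W0"
          using rs_closed[OF E S B1(1) W0(1) _ B1(2)] by (cases q) (auto simp: C_def split: if_splits)
      qed
      then show ?thesis by simp
    qed
    have germ_a: "p d s = fgerm E S s W0 (a d)" if "Poly_Mapping.keys d \<subseteq> C" for d
    proof -
      have "Poly_Mapping.keys d \<subseteq> C \<and> p d s = fgerm E S s W0 (a d)"
        using that
      proof (induction d rule: frag_induction)
        case zero
        have "p 0 = \<one>\<^bsub>Zfree E S\<^esub>" using hom_one[OF p group_free_Abelian_group Z.is_group] by simp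
        then show ?case using Zfree_one_germ[OF E S W0] by (simp add: a_def)
      next
        case (one q)
        obtain U x where q: "q = (U, x)" by (cases q)
        then have b: "(U, x) \<in> \<B>" using one CB by auto
        show ?case
        proof (cases "s \<in> U")
          case True
          then have "W0 \<subseteq> U" using one q by (auto simp: C_def)
          then have "gen E S U x s = fgerm E S s W0 (frag_of (rs E S U W0 x))"
            using loc_rs_germ[OF E S B1(1)[OF b] W0(1) _ W0(2), of "frag_of x"] B1(2)[OF b] by (simp add: gen_def rs_free)
          then show ?thesis using one q True by (simp add: a_def p_of[OF b])
        next
          case False
          then have "gen E S U x s = fgerm E S s W0 0"
            using loc_germ(2)[OF E S B1(1)[OF b], of s] local Zfree_one_germ[OF E S W0] by (simp add: gen_def)
          then show ?thesis using one q False by (simp add: a_def p_of[OF b])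
        qed
      next
        case (diff d e)
        have k: "d \<in> carrier ?F" "e \<in> carrier ?F" using diff CB by auto
        have "p (d \<otimes>\<^bsub>?F\<^esub> inv\<^bsub>?F\<^esub> e) = p d \<otimes>\<^bsub>Zfree E S\<^esub> inv\<^bsub>Zfree E S\<^esub> p e"
          using hom_mult[OF p k(1) group.inv_closed[OF group_free_Abelian_group k(2)]]
            hom_inv[OF group_free_Abelian_group Z.is_group p k(2)] by simp
        then have pd: "p (d - e) = p d \<otimes>\<^bsub>Zfree E S\<^esub> inv\<^bsub>Zfree E S\<^esub> p e" using k by simp
        have ac: "a d \<in> car (free_presheaf E) S W0" "a e \<in> car (free_presheaf E) S W0" "- a e \<in> car (free_presheaf E) S W0"
          using a_cl diff by simp_all
        have "(inv\<^bsub>Zfree E S\<^esub> p e) s = fgerm E S s W0 (- a e)"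
          using diff by (intro Zfree_inv_germ[where \<sigma> = "p e", OF E S hom_in_carrier[OF p k(2)] W0 ac(2)]) simp
        then have "p (d - e) s = fgerm E S s W0 (a d + - a e)" unfolding pd
          using diff by (intro Zfree_mult_germ[where \<sigma> = "p d" and \<tau> = "inv\<^bsub>Zfree E S\<^esub> p e", OF E S W0 ac(1,3)]) simp_all
        moreover have "a (d - e) = a d + - a e" by (simp add: a_def frag_extend_diff)
        moreover have "Poly_Mapping.keys (d - e) \<subseteq> C" using diff Poly_Mapping.keys_diff[of d e] by auto
        ultimately show ?case by simp
      qed
      then show ?thesis by simp
    qed
    have "fgerm E S s W0 (a c) = fgerm E S s W0 0"
      using germ_a[OF kC] pc Zfree_one_germ[OF E S W0] by simp
    \<comment> \<open>Vanishing of the germ means that the formal sum itself becomes zero on some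
      neighbourhood \<open>W\<close>. This is the only place where the assumption on
      \<open>p c\<close> enters.\<close>
    then obtain W where W: "clopen S W" "s \<in> W" "W \<subseteq> W0" "rs (free_presheaf E) S W0 W (a c) = rs (free_presheaf E) S W0 W 0"
      using germ_eqD[OF functorial_free[OF E] S W0(1) W0(1) W0(2) W0(2) a_cl[OF kC], of 0] by auto
    have "\<Phi> W' c = \<one>\<^bsub>B\<^esub>" if W': "clopen S W'" "W' \<subseteq> W" for W'
    proof -
      let ?C = "free_Abelian_group C" and ?D = "{x. (W', x) \<in> \<B>}"
      let ?r = "\<lambda>d. rs (free_presheaf E) S W0 W' (a d)"
      have W'0: "W' \<subseteq> W0" using W' W by auto
      have rr: "rs E S W0 W' (rs E S U W0 x) = rs E S U W' x" if "(U, x) \<in> C" "s \<in> U" for U x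
        using that by (intro rs_rs[OF E S _ W0(1) W'(1) W'0]) (auto simp: C_def dest: B1)
      have r_alt: "?r d = frag_extend (\<lambda>(U, x). if s \<in> U then frag_of (rs E S U W' x) else (0 :: 'a \<Rightarrow>\<^sub>0 int)) d" if "d \<in> carrier ?C" for d
      proof -
        have d: "Poly_Mapping.keys d \<subseteq> C" using that by simp
        show ?thesis using d
        proof (induction d rule: frag_induction)
          case (one q) then show ?case using rr by (cases q) (auto simp: a_def rs_free)
        qed (auto simp: a_def rs_free frag_extend_diff)
      qed
      have h1: "frag_extend (\<lambda>(U, x). if s \<in> U then frag_of (rs E S U W' x) else (0 :: 'a \<Rightarrow>\<^sub>0 int)) \<in> hom ?C (free_Abelian_group ?D)"
      proof (rule frag_extend_hom)
        fix q assume "q \<in> C"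
        then show "Poly_Mapping.keys (case q of (U, x) \<Rightarrow> if s \<in> U then frag_of (rs E S U W' x) else (0 :: 'a \<Rightarrow>\<^sub>0 int)) \<subseteq> ?D"
          using B2[of _ _ W'] W' W'0 by (cases q) (auto simp: C_def)
      qed
      have h2: "frag_eval B (\<phi> W') \<in> hom (free_Abelian_group ?D) B" using cl by (intro frag_eval_hom[OF B]) auto
      have h3: "\<Phi> W' \<in> hom ?C B" using \<Phi>[OF W'(1)] CB unfolding hom_def by auto
      \<comment> \<open>\<open>\<Phi> W'\<close> sees \<open>c\<close> only through its formal sum
        over \<open>W'\<close>, which is zero. Generators supported away from \<open>s\<close>
        contribute values over the empty set, which are trivial.\<close>
      have "\<Phi> W' c = (frag_eval B (\<phi> W') \<circ> frag_extend (\<lambda>(U, x). if s \<in> U then frag_of (rs E S U W' x) else (0 :: 'a \<Rightarrow>\<^sub>0 int))) c"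
      proof (rule hom_eq_on_generators[OF group_free_Abelian_group B.is_group free_Abelian_group_generates h3 hom_compose[OF h1 h2]])
        fix q assume "q \<in> frag_of ` C"
        then obtain U x where q: "q = frag_of (U, x)" "(U, x) \<in> C" by auto
        have b: "(U, x) \<in> \<B>" using q CB by auto
        show "\<Phi> W' q = (frag_eval B (\<phi> W') \<circ> frag_extend (\<lambda>(U, x). if s \<in> U then frag_of (rs E S U W' x) else (0 :: 'a \<Rightarrow>\<^sub>0 int))) q"
        proof (cases "s \<in> U")
          case True
          then have u: "U \<inter> W' = W'" using q W'0 by (auto simp: C_def)
          have "\<phi> W' (rs E S U W' x) \<in> carrier B" using cl bV[OF b W'(1)] u by simp
          then show ?thesis unfolding q(1) \<Phi>_of[OF b W'(1)] u using True by (simp add: B)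
        next
          case False
          then have u: "U \<inter> W' = {}" using q W'0 by (auto simp: C_def)
          show ?thesis unfolding q(1) \<Phi>_of[OF b W'(1)] u using False \<phi>0 bV[OF b W'(1)] u by (simp add: B)
        qed
      qed (use kC in simp)
      also have "\<dots> = frag_eval B (\<phi> W') (?r c)" using r_alt[of c] kC by simp
      also have "?r c = rs (free_presheaf E) S W W' (rs (free_presheaf E) S W0 W (a c))"
        using rs_rs[OF functorial_free[OF E] S W0(1) W(1) W'(1) W'(2) W(3) a_cl[OF kC]] by simp
      also have "\<dots> = 0" unfolding W(4) by (simp add: rs_free)
      finally show ?thesis by (simp add: B)
    qed
    then show ?case using W by blast
  qed
  have "carrier (Zfree E S) \<subseteq> p ` carrier ?F"
  proof -
    have sg: "subgroup (p ` carrier ?F) (Zfree E S)"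
      using group_hom.img_is_subgroup[of ?F "Zfree E S" p] p Z.is_group by (simp add: group_hom_def group_hom_axioms_def)
    have Q: "{gen E S U x |U x. (U, x) \<in> \<B>} \<subseteq> p ` carrier ?F"
    proof clarify
      fix U x assume "(U, x) \<in> \<B>"
      then show "gen E S U x \<in> p ` carrier ?F"
        by (intro image_eqI[of _ p "frag_of (U, x)"]) (simp_all add: p_of)
    qed
    show ?thesis using Z.generate_subgroup_incl[OF Q sg] Zfree_generates unfolding generates_def by simp
  qed
  from factor_hom[OF group_free_Abelian_group Z.is_group B.is_group p \<Phi>[OF clopen_simps(2)] this ker]
  obtain h where h: "h \<in> hom (Zfree E S) B" "\<And>c. c \<in> carrier ?F \<Longrightarrow> h (p c) = \<Phi> (topspace S) c" by blast
  have "h (gen E S U x) = \<phi> U x" if b: "(U, x) \<in> \<B>" for U x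
  proof -
    have "U \<inter> topspace S = U" using clopen_subset[OF B1(1)[OF b]] by auto
    then show ?thesis using h(2)[of "frag_of (U, x)"] b p_of[OF b] \<Phi>_of[OF b clopen_simps(2)] rs_self[OF E S B1[OF b]] by simp
  qed
  then show ?thesis using h(1) that by blast
qed

end

end

section \<open>The action of locally constant integer functions\<close>

text \<open>The sheaf condition is given for two clopen pieces and for the empty space. Injectivity
  of the two-piece map is the union step of clopen induction, and uniqueness of the section over the
  empty space is its start.\<close>

lemma condensed_eqI:
  fixes X :: "('s, 'a, ('a, 'z) partial_object_scheme) presheaf"
  assumes X: "condensed_set X" and S: "S \<in> CHED" and x: "x \<in> carrier (sec X S)" and y: "y \<in> carrier (sec X S)"
    and loc: "\<And>s. s \<in> topspace S \<Longrightarrow>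
      \<exists>W. clopen S W \<and> s \<in> W \<and> rs X S (topspace S) W x = rs X S (topspace S) W y"
  shows "x = y"
proof -
  have F: "functorial X" using X by (simp add: condensed_set_def)
  have xy: "x \<in> car X S (topspace S)" "y \<in> car X S (topspace S)" using x y by simp_all
  have "rs X S (topspace S) V x = rs X S (topspace S) V y" if "clopen S V" for V
    using S that
  proof (induction rule: clopen_induct)
    case empty
    have "subtopology S {} = discrete_topology {}" by simp
    then have "\<exists>a. car X S {} = {a}" using X unfolding condensed_set_def by simp
    moreover have "rs X S (topspace S) {} x \<in> car X S {}" "rs X S (topspace S) {} y \<in> car X S {}"
      using rs_closed[OF F S clopen_simps(2,1) _ xy(1)] rs_closed[OF F S clopen_simps(2,1) _ xy(2)] by auto
    ultimately show ?case by auto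
  next
    case (union V1 V2)
    let ?V = "V1 \<union> V2" and ?T = "subtopology S (V1 \<union> V2)"
    have V: "clopen S ?V" using union clopen_Un by blast
    have T: "?T \<in> CHED" by (rule sub_CHED[OF S V])
    have "openin ?T V1" "openin ?T V2" "V1 \<union> V2 = topspace ?T"
      using union V topspace_sub_clopen[OF V] by (auto simp: openin_open_subtopology clopen_def)
    then have "bij_betw (\<lambda>x. (restr X ?T V1 x, restr X ?T V2 x)) (carrier (sec X ?T))
        (carrier (sec X (subtopology ?T V1)) \<times> carrier (sec X (subtopology ?T V2)))"
      using X T union(3) unfolding condensed_set_def by blast
    then have inj: "inj_on (\<lambda>x. (rs X S ?V V1 x, rs X S ?V V2 x)) (car X S ?V)"
      by (simp add: restr_eq_rs bij_betw_def)
    have Vx: "?V \<subseteq> topspace S" using clopen_subset[OF V] .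
    have c: "rs X S (topspace S) ?V x \<in> car X S ?V" "rs X S (topspace S) ?V y \<in> car X S ?V"
      using rs_closed[OF F S clopen_simps(2) V Vx] xy by auto
    show ?case
    proof (rule inj_onD[OF inj _ c])
      have "rs X S ?V W (rs X S (topspace S) ?V z) = rs X S (topspace S) W z"
        if "z \<in> car X S (topspace S)" "clopen S W" "W \<subseteq> ?V" for z W
        using rs_rs[OF F S clopen_simps(2) V that(2,3) Vx that(1)] .
      then show "(rs X S ?V V1 (rs X S (topspace S) ?V x), rs X S ?V V2 (rs X S (topspace S) ?V x)) =
         (rs X S ?V V1 (rs X S (topspace S) ?V y), rs X S ?V V2 (rs X S (topspace S) ?V y))"
        using union xy by auto
    qed
  next
    case (local s)
    then obtain W where W: "clopen S W" "s \<in> W" "rs X S (topspace S) W x = rs X S (topspace S) W y" using loc by blast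
    have "rs X S (topspace S) W' x = rs X S (topspace S) W' y" if "clopen S W'" "W' \<subseteq> W" for W'
      using rs_rs[OF F S clopen_simps(2) W(1) that clopen_subset[OF W(1)] xy(1)]
        rs_rs[OF F S clopen_simps(2) W(1) that clopen_subset[OF W(1)] xy(2)] W(3) by simp
    then show ?case using W by blast
  qed
  from this[OF clopen_simps(2)] show ?thesis using rs_self[OF F S clopen_simps(2)] xy by simp
qed

lemma condensed_glue:
  fixes X :: "('s, 'a, ('a, 'z) partial_object_scheme) presheaf"
  assumes X: "condensed_set X" and S: "S \<in> CHED" and V: "clopen S V1" "clopen S V2" "V1 \<inter> V2 = {}"
    and y: "y1 \<in> car X S V1" "y2 \<in> car X S V2"
  obtains y where "y \<in> car X S (V1 \<union> V2)" "rs X S (V1 \<union> V2) V1 y = y1" "rs X S (V1 \<union> V2) V2 y = y2"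
proof -
  let ?V = "V1 \<union> V2" and ?T = "subtopology S (V1 \<union> V2)"
  have V': "clopen S ?V" using V clopen_Un by blast
  have T: "?T \<in> CHED" by (rule sub_CHED[OF S V'])
  have "openin ?T V1" "openin ?T V2" "V1 \<union> V2 = topspace ?T"
    using V V' topspace_sub_clopen[OF V'] by (auto simp: openin_open_subtopology clopen_def)
  then have "bij_betw (\<lambda>x. (restr X ?T V1 x, restr X ?T V2 x)) (carrier (sec X ?T))
      (carrier (sec X (subtopology ?T V1)) \<times> carrier (sec X (subtopology ?T V2)))"
    using X T V(3) unfolding condensed_set_def by blast
  then have "(\<lambda>x. (rs X S ?V V1 x, rs X S ?V V2 x)) ` car X S ?V = car X S V1 \<times> car X S V2"
    by (simp add: restr_eq_rs bij_betw_def car_sub)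
  then have "(y1, y2) \<in> (\<lambda>x. (rs X S ?V V1 x, rs X S ?V V2 x)) ` car X S ?V" using y by simp
  then show ?thesis using that by blast
qed

definition level :: "'s topology \<Rightarrow> ('s \<Rightarrow> int) \<Rightarrow> int \<Rightarrow> 's set" where
  "level S f n = {s \<in> topspace S. f s = n}"

lemma clopen_level: "f \<in> carrier (sec condensed_int S) \<Longrightarrow> clopen S (level S f n)"
proof -
  assume "f \<in> carrier (sec condensed_int S)"
  then have f: "continuous_map S (discrete_topology UNIV) f" by (simp add: condensed_int_def underline_def)
  have "clopen S (pull f S {n})" by (rule clopen_pull[OF f]) (simp add: clopen_def)
  then show ?thesis by (simp add: pull_def level_def)
qed

definition ind :: "'s topology \<Rightarrow> 's set \<Rightarrow> 's \<Rightarrow> int" where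
  "ind S V = (\<lambda>s\<in>topspace S. if s \<in> V then 1 else 0)"

lemma ind_closed:
  assumes V: "clopen S V"
  shows "ind S V \<in> carrier (sec condensed_int S)"
proof -
  have "continuous_map S (discrete_topology UNIV) (ind S V)"
    unfolding continuous_map_def
  proof (intro conjI allI impI)
    fix A :: "int set"
    have "{s \<in> topspace S. ind S V s \<in> A} =
        (if 1 \<in> A then V else {}) \<union> (if 0 \<in> A then topspace S - V else {})"
      using clopen_subset[OF V] by (auto simp: ind_def)
    moreover have "openin S V" "openin S (topspace S - V)" using V by (auto simp: clopen_def)
    ultimately show "openin S {s \<in> topspace S. ind S V s \<in> A}" by (auto intro: openin_Un)
  qed simp
  then show ?thesis by (simp add: condensed_int_def underline_def ind_def)
qed

text \<open>Uniqueness is kept as a hypothesis because it is obtained in two ways: from the sheaf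
  condition for a condensed group, and from germs for a sheafification.\<close>

lemma int_action_eqI:
  assumes "y \<in> carrier (sec F S)"
    and "\<And>n. rs F S (topspace S) (level S f n) y = rs F S (topspace S) (level S f n) x [^]\<^bsub>sec F (subtopology S (level S f n))\<^esub> n"
    and "\<And>y'. y' \<in> carrier (sec F S) \<Longrightarrow>
       (\<And>n. rs F S (topspace S) (level S f n) y' = rs F S (topspace S) (level S f n) y) \<Longrightarrow> y' = y"
  shows "int_action F S f x = y"
  unfolding int_action_def Let_def restr_eq_rs_top level_def[symmetric]
  by (rule the_equality) (use assms(1,2) in blast, rule assms(3), simp, use assms(2) in simp)

text \<open>Inside one level set the power with constant exponent is a solution, and over disjoint
  unions solutions are glued. Separatedness then gives uniqueness.\<close>

lemma condensed_int_action:
  fixes A :: "('s, 'a, ('a, 'z) monoid_scheme) presheaf"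
  assumes A: "condensed_group A" and S: "S \<in> CHED" and f: "f \<in> carrier (sec condensed_int S)"
    and x: "x \<in> carrier (sec A S)"
  shows int_action_closed: "int_action A S f x \<in> carrier (sec A S)"
    and int_action_rs: "\<And>n. rs A S (topspace S) (level S f n) (int_action A S f x) =
        rs A S (topspace S) (level S f n) x [^]\<^bsub>sec A (subtopology S (level S f n))\<^esub> n"
proof -
  have C: "condensed_set A" and F: "functorial A" using A by (simp_all add: condensed_group_def condensed_set_def)
  have grp: "group (sec A (subtopology S U))" if "clopen S U" for U
    using A sub_CHED[OF S that] by (simp add: condensed_group_def)
  have hom: "rs A S U W \<in> hom (sec A (subtopology S U)) (sec A (subtopology S W))" if "clopen S U" "clopen S W" "W \<subseteq> U" for U W
    using A sub_CHED[OF S that(1)] sub_CHED[OF S that(2)] continuous_map_sub_id[OF that(3)]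
    unfolding condensed_group_def rs_def by blast
  let ?L = "\<lambda>n. level S f n" and ?P = "\<lambda>U n. sec A (subtopology S U)"
  \<comment> \<open>Solvability over \<open>V\<close>. Intersecting the level sets with
    \<open>V\<close> makes the condition meaningful for every clopen \<open>V\<close>; for
    \<open>V = topspace S\<close> it is the defining condition of the action.\<close>
  define Q where "Q V \<longleftrightarrow> (\<exists>y\<in>car A S V. \<forall>n. rs A S V (V \<inter> ?L n) y =
      rs A S (topspace S) (V \<inter> ?L n) x [^]\<^bsub>sec A (subtopology S (V \<inter> ?L n))\<^esub> n)" for V
  have x': "x \<in> car A S (topspace S)" using x by simp
  have "Q (topspace S)"
    using S clopen_simps(2)
  proof (induction rule: clopen_induct)
    case empty
    have "subtopology S {} = discrete_topology {}" by simp
    then obtain a where a: "car A S {} = {a}" using C unfolding condensed_set_def by auto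
    interpret E: group "sec A (subtopology S {})" by (rule grp) simp
    have "rs A S {} {} a = a" using a by (intro rs_self[OF F S]) auto
    moreover have "rs A S (topspace S) {} x [^]\<^bsub>sec A (subtopology S {})\<^esub> n \<in> car A S {}" for n :: int
      by (intro E.int_pow_closed rs_closed[OF F S _ _ _ x']) auto
    ultimately show ?case unfolding Q_def using a by auto
  next
    case (union V1 V2)
    obtain y1 where y1: "y1 \<in> car A S V1" "\<And>n. rs A S V1 (V1 \<inter> ?L n) y1 =
      rs A S (topspace S) (V1 \<inter> ?L n) x [^]\<^bsub>sec A (subtopology S (V1 \<inter> ?L n))\<^esub> n" using union unfolding Q_def by auto
    obtain y2 where y2: "y2 \<in> car A S V2" "\<And>n. rs A S V2 (V2 \<inter> ?L n) y2 =
      rs A S (topspace S) (V2 \<inter> ?L n) x [^]\<^bsub>sec A (subtopology S (V2 \<inter> ?L n))\<^esub> n" using union unfolding Q_def by auto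
    let ?V = "V1 \<union> V2"
    have V: "clopen S ?V" using union clopen_Un by blast
    obtain y where y: "y \<in> car A S ?V" "rs A S ?V V1 y = y1" "rs A S ?V V2 y = y2"
      by (rule condensed_glue[OF C S union(1,2,3) y1(1) y2(1)])
    have "rs A S ?V (?V \<inter> ?L n) y = rs A S (topspace S) (?V \<inter> ?L n) x [^]\<^bsub>sec A (subtopology S (?V \<inter> ?L n))\<^esub> n" for n
    proof -
      let ?W = "?V \<inter> ?L n" and ?W1 = "V1 \<inter> ?L n" and ?W2 = "V2 \<inter> ?L n"
      have W: "clopen S ?W" "clopen S ?W1" "clopen S ?W2"
        using V union clopen_level[OF f, of n] by (simp_all add: clopen_Int)
      have Wt: "?W \<subseteq> topspace S" using clopen_subset[OF W(1)] .
      interpret W: group "sec A (subtopology S ?W)" by (rule grp) fact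
      let ?l = "rs A S ?V ?W y" and ?r = "rs A S (topspace S) ?W x [^]\<^bsub>sec A (subtopology S ?W)\<^esub> n"
      have xW: "rs A S (topspace S) ?W x \<in> car A S ?W" by (rule rs_closed[OF F S clopen_simps(2) W(1) Wt x'])
      have l: "?l \<in> car A S ?W" by (rule rs_closed[OF F S V W(1) _ y(1)]) auto
      have r: "?r \<in> car A S ?W" using xW by simp
      have part: "rs A S ?W U ?l = rs A S ?W U ?r"
        if U: "clopen S U" "U = V' \<inter> ?L n" "clopen S V'" "V' \<subseteq> ?V" "rs A S ?V V' y = y'" "rs A S V' (V' \<inter> ?L n) y' =
      rs A S (topspace S) (V' \<inter> ?L n) x [^]\<^bsub>sec A (subtopology S (V' \<inter> ?L n))\<^esub> n" for U V' y'
      proof -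
        have UW: "U \<subseteq> ?W" "U \<subseteq> V'" using U by auto
        have "rs A S ?W U ?l = rs A S ?V U y" by (rule rs_rs[OF F S V W(1) U(1) UW(1) _ y(1)]) auto
        also have "\<dots> = rs A S V' U y'" using rs_rs[OF F S V U(3,1) UW(2) U(4) y(1)] U(5) by simp
        also have "\<dots> = rs A S (topspace S) U x [^]\<^bsub>sec A (subtopology S U)\<^esub> n" using U(2,6) by simp
        also have "\<dots> = rs A S ?W U (rs A S (topspace S) ?W x) [^]\<^bsub>sec A (subtopology S U)\<^esub> n"
          using rs_rs[OF F S clopen_simps(2) W(1) U(1) UW(1) Wt x'] by simp
        also have "\<dots> = rs A S ?W U ?r"
          using hom_int_pow[OF hom[OF W(1) U(1) UW(1)] xW W.is_group grp[OF U(1)]] by simp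
        finally show ?thesis .
      qed
      have T: "subtopology S ?W \<in> CHED" by (rule sub_CHED[OF S W(1)])
      have tw: "topspace (subtopology S ?W) = ?W" by (rule topspace_sub_clopen[OF W(1)])
      show "?l = ?r"
      proof (rule condensed_eqI[OF C T l r])
        fix s assume "s \<in> topspace (subtopology S ?W)"
        then have "s \<in> ?W" using topspace_sub_clopen[OF W(1)] by simp
        then consider "s \<in> ?W1" | "s \<in> ?W2" by auto
        then show "\<exists>U. clopen (subtopology S ?W) U \<and> s \<in> U \<and>
            rs A (subtopology S ?W) (topspace (subtopology S ?W)) U ?l = rs A (subtopology S ?W) (topspace (subtopology S ?W)) U ?r"
        proof cases
          case 1
          have sub: "?W1 \<subseteq> ?W" by auto
          show ?thesis unfolding tw using 1 sub part[OF W(2) refl union(1) _ y(2) y1(2)]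
            by (intro exI[of _ ?W1]) (simp add: clopen_subtopology[OF W(1)] W(2) rs_sub)
        next
          case 2
          have sub: "?W2 \<subseteq> ?W" by auto
          show ?thesis unfolding tw using 2 sub part[OF W(3) refl union(2) _ y(3) y2(2)]
            by (intro exI[of _ ?W2]) (simp add: clopen_subtopology[OF W(1)] W(3) rs_sub)
        qed
      qed
    qed
    then show ?case unfolding Q_def using y(1) by blast
  next
    case (local s)
    let ?W = "?L (f s)"
    have W: "clopen S ?W" "s \<in> ?W" using clopen_level[OF f] local by (auto simp: level_def)
    have "Q W'" if W': "clopen S W'" "W' \<subseteq> ?W" for W'
    proof -
      interpret W: group "sec A (subtopology S W')" by (rule grp) fact
      have xW: "rs A S (topspace S) W' x \<in> car A S W'"
        by (rule rs_closed[OF F S clopen_simps(2) W'(1) clopen_subset[OF W'(1)] x'])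
      let ?y = "rs A S (topspace S) W' x [^]\<^bsub>sec A (subtopology S W')\<^esub> (f s)"
      have y: "?y \<in> car A S W'" using xW by simp
      have "rs A S W' (W' \<inter> ?L n) ?y = rs A S (topspace S) (W' \<inter> ?L n) x [^]\<^bsub>sec A (subtopology S (W' \<inter> ?L n))\<^esub> n" for n
      proof -
        have c: "clopen S (W' \<inter> ?L n)" using W' clopen_level[OF f] by (simp add: clopen_Int)
        have 1: "rs A S W' (W' \<inter> ?L n) ?y = rs A S (topspace S) (W' \<inter> ?L n) x [^]\<^bsub>sec A (subtopology S (W' \<inter> ?L n))\<^esub> (f s)"
          using hom_int_pow[OF hom[OF W'(1) c _] xW W.is_group grp[OF c]]
            rs_rs[OF F S clopen_simps(2) W'(1) c _ clopen_subset[OF W'(1)] x'] by auto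
        show ?thesis
        proof (cases "n = f s")
          \<comment> \<open>Different level sets are disjoint, so the condition lives over the empty
            space, where there is only one section and the exponent does not matter.\<close>
          case False
          then have e: "W' \<inter> ?L n = {}" using W'(2) by (auto simp: level_def)
          have "subtopology S {} = discrete_topology {}" by simp
          then obtain a where a: "car A S {} = {a}" using C unfolding condensed_set_def by auto
          interpret E: group "sec A (subtopology S {})" by (rule grp) simp
          have xe: "rs A S (topspace S) {} x \<in> car A S {}" by (rule rs_closed[OF F S _ _ _ x']) auto
          have "rs A S (topspace S) {} x [^]\<^bsub>sec A (subtopology S {})\<^esub> k = a" for k :: int
            using E.int_pow_closed[OF xe, of k] a by auto
          then show ?thesis using 1 unfolding e by simp
        qed (use 1 in simp)
      qed
      then show ?thesis unfolding Q_def using y by blast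
    qed
    then show ?case using W by blast
  qed
  then obtain y where y: "y \<in> carrier (sec A S)" "\<And>n. rs A S (topspace S) (topspace S \<inter> ?L n) y =
      rs A S (topspace S) (topspace S \<inter> ?L n) x [^]\<^bsub>sec A (subtopology S (topspace S \<inter> ?L n))\<^esub> n"
    unfolding Q_def by auto
  have "topspace S \<inter> ?L n = ?L n" for n by (auto simp: level_def)
  then have y2: "rs A S (topspace S) (?L n) y = rs A S (topspace S) (?L n) x [^]\<^bsub>sec A (subtopology S (?L n))\<^esub> n" for n
    using y(2)[of n] by simp
  have "int_action A S f x = y"
  proof (rule int_action_eqI[OF y(1) y2])
    fix y' assume y': "y' \<in> carrier (sec A S)" "\<And>n. rs A S (topspace S) (?L n) y' = rs A S (topspace S) (?L n) y"
    show "y' = y"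
      by (rule condensed_eqI[OF C S y'(1) y(1)]) (use y'(2) clopen_level[OF f] in \<open>auto simp: level_def intro!: exI[of _ "?L (f _)"]\<close>)
  qed
  then show "int_action A S f x \<in> carrier (sec A S)"
    "\<And>n. rs A S (topspace S) (?L n) (int_action A S f x) = rs A S (topspace S) (?L n) x [^]\<^bsub>sec A (subtopology S (?L n))\<^esub> n"
    using y(1) y2 by simp_all
qed

section \<open>The integer action on free condensed abelian groups, germ by germ\<close>

context
  fixes E :: "('s, 'a, ('a, 'z) partial_object_scheme) presheaf"
  assumes E: "functorial E"
begin

lemma Zfree_pow_germ:
  fixes n :: int
  assumes S: "S \<in> CHED" and \<sigma>: "\<sigma> \<in> carrier (Zfree E S)" and U: "clopen S U" "s \<in> U"
    and a: "a \<in> car (free_presheaf E) S U" "\<sigma> s = fgerm E S s U a"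
  shows "(\<sigma> [^]\<^bsub>Zfree E S\<^esub> n) s = fgerm E S s U (frag_cmul n a)"
proof -
  interpret comm_group "Zfree E S" by (rule comm_group_Zfree[OF E S])
  have cm: "frag_cmul k a \<in> car (free_presheaf E) S U" for k
    using a(1) keys_cmul[of k a] by auto
  have nat: "(\<sigma> [^]\<^bsub>Zfree E S\<^esub> k) s = fgerm E S s U (frag_cmul (int k) a)" for k :: nat
  proof (induction k)
    case 0 then show ?case using Zfree_one_germ[OF E S U] by simp
  next
    case (Suc k)
    then show ?case
      using Zfree_mult_germ[where \<sigma> = "\<sigma> [^]\<^bsub>Zfree E S\<^esub> k" and \<tau> = \<sigma>, OF E S U cm a(1) Suc a(2)]
      by (simp add: frag_cmul_distrib add.commute)
  qed
  show ?thesis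
  proof (cases "n < 0")
    case True
    have "(inv\<^bsub>Zfree E S\<^esub> (\<sigma> [^]\<^bsub>Zfree E S\<^esub> nat (- n))) s = fgerm E S s U (- frag_cmul (int (nat (- n))) a)"
      using nat by (intro Zfree_inv_germ[OF E S _ U cm]) (simp_all add: \<sigma>)
    moreover have "- frag_cmul (int (nat (- n))) a = frag_cmul n a" using True by simp
    moreover have "\<sigma> [^]\<^bsub>Zfree E S\<^esub> n = inv\<^bsub>Zfree E S\<^esub> (\<sigma> [^]\<^bsub>Zfree E S\<^esub> nat (- n))"
      unfolding int_pow_def2 using True by (simp only: if_True)
    ultimately show ?thesis by (simp only:)
  next
    case False
    then have "\<sigma> [^]\<^bsub>Zfree E S\<^esub> n = \<sigma> [^]\<^bsub>Zfree E S\<^esub> nat n" and n: "int (nat n) = n"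
      unfolding int_pow_def2 by (simp_all only: if_False)
    then show ?thesis using nat[of "nat n"] by (simp only:)
  qed
qed

text \<open>The germ at \<open>s\<close> is multiplied by the integer \<open>f s\<close>. This gives
  a section because representatives can be chosen inside a level set, where the factor is
  constant.\<close>

lemma int_action_Zfree:
  assumes S: "S \<in> CHED" and f: "f \<in> carrier (sec condensed_int S)" and \<sigma>: "\<sigma> \<in> carrier (Zfree E S)"
  shows int_action_Zfree_closed: "int_action (free_condensed E) S f \<sigma> \<in> carrier (Zfree E S)"
    and int_action_Zfree_germ: "\<And>s U a. clopen S U \<Longrightarrow> s \<in> U \<Longrightarrow> a \<in> car (free_presheaf E) S U \<Longrightarrow>
      \<sigma> s = fgerm E S s U a \<Longrightarrow> int_action (free_condensed E) S f \<sigma> s = fgerm E S s U (frag_cmul (f s) a)"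
proof -
  define y where "y = (\<lambda>s\<in>topspace S. sheafify_op1 (free_presheaf E) (\<lambda>_. frag_cmul (f s)) S \<sigma> s)"
  have nat: "natural_op1 (free_presheaf E) (free_presheaf E) S (\<lambda>_. frag_cmul k)" for k
    unfolding natural_op1_def by (simp add: rs_free frag_extend_cmul) (meson keys_cmul order_trans)
  have y_germ: "y s = fgerm E S s U (frag_cmul (f s) a)"
    if "clopen S U" "s \<in> U" "a \<in> car (free_presheaf E) S U" "\<sigma> s = fgerm E S s U a" for s U a
    using sheafify_op1_germ[where \<sigma> = \<sigma>, OF functorial_free[OF E] functorial_free[OF E] S nat that, of "f s"] clopen_subset[OF that(1)] that(2)
    by (auto simp: y_def)
  have cm: "frag_cmul k a \<in> car (free_presheaf E) S U" if "a \<in> car (free_presheaf E) S U" for k a U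
    using that keys_cmul[of k a] by auto
  have y: "y \<in> carrier (Zfree E S)"
    unfolding carrier_Zfree[OF E S]
  proof (rule sectionsI)
    fix s assume s: "s \<in> topspace S"
    have L: "s \<in> level S f (f s)" using s by (simp add: level_def)
    obtain U a where U: "clopen S U" "s \<in> U" "U \<subseteq> level S f (f s)" "a \<in> car (free_presheaf E) S U" "\<And>t. t \<in> U \<Longrightarrow> \<sigma> t = fgerm E S t U a"
      using Zfree_E[OF E S \<sigma> L clopen_level[OF f]] by blast
    have g: "y t = fgerm E S t U (frag_cmul (f s) a)" if "t \<in> U" for t
      using y_germ[OF U(1) that U(4) U(5)[OF that]] that U(3) by (auto simp: level_def)
    show "\<exists>U a. clopen S U \<and> s \<in> U \<and> a \<in> car (free_presheaf E) S U \<and> (\<forall>t\<in>U. y t = fgerm E S t U a)"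
      using U(1,2) cm[OF U(4)] g by blast
  qed (simp add: y_def)
  have rest: "rs (free_condensed E) S (topspace S) V \<tau> s = fgerm E (subtopology S V) s U a"
    if "clopen S V" "clopen S U" "s \<in> U" "U \<subseteq> V" "a \<in> car (free_presheaf E) S U" "\<tau> s = fgerm E S s U a" for V U s a \<tau>
    using sheafify_restr_germ[where \<sigma> = \<tau>, OF functorial_free[OF E] S that(1,3,2,4,5,6)] by (simp add: free_condensed_def restr_eq_rs_top)
  have rest_cl: "rs (free_condensed E) S (topspace S) V \<tau> \<in> carrier (Zfree E (subtopology S V))"
    if "clopen S V" "\<tau> \<in> carrier (Zfree E S)" for V \<tau>
    using sheafify_res_sections[OF functorial_free[OF E] sub_CHED[OF S that(1)] S continuous_map_id_subt, of \<tau>] that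
    by (simp add: carrier_sheafify rs_def free_condensed_def)
  have "int_action (free_condensed E) S f \<sigma> = y"
  proof (rule int_action_eqI[OF y])
    fix n
    let ?L = "level S f n" and ?T = "subtopology S (level S f n)"
    have L: "clopen S ?L" by (rule clopen_level[OF f])
    have T: "?T \<in> CHED" by (rule sub_CHED[OF S L])
    interpret T: comm_group "Zfree E ?T" by (rule comm_group_Zfree[OF E T])
    show "rs (free_condensed E) S (topspace S) ?L y = rs (free_condensed E) S (topspace S) ?L \<sigma> [^]\<^bsub>Zfree E ?T\<^esub> n"
    proof (rule Zfree_eqI[OF E T rest_cl[OF L y]])
      show "rs (free_condensed E) S (topspace S) ?L \<sigma> [^]\<^bsub>Zfree E ?T\<^esub> n \<in> carrier (Zfree E ?T)"
        using rest_cl[OF L \<sigma>] by simp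
      fix s assume "s \<in> topspace ?T"
      then have s: "s \<in> ?L" using topspace_sub_clopen[OF L] by simp
      obtain U a where U: "clopen S U" "s \<in> U" "U \<subseteq> ?L" "a \<in> car (free_presheaf E) S U" "\<And>t. t \<in> U \<Longrightarrow> \<sigma> t = fgerm E S t U a"
        using Zfree_E[OF E S \<sigma> s L] by blast
      have fs: "f s = n" using s by (simp add: level_def)
      have U': "clopen ?T U" "a \<in> car (free_presheaf E) ?T U"
        using U L by (simp_all add: clopen_subtopology car_sub Int_absorb1 subtopology_subtopology)
      have "(rs (free_condensed E) S (topspace S) ?L \<sigma> [^]\<^bsub>Zfree E ?T\<^esub> n) s = fgerm E ?T s U (frag_cmul n a)"
        by (rule Zfree_pow_germ[where \<sigma> = "rs (free_condensed E) S (topspace S) ?L \<sigma>", OF T rest_cl[OF L \<sigma>] U'(1) U(2) U'(2) rest[where \<tau> = \<sigma>, OF L U(1,2,3,4) U(5)[OF U(2)]]])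
      moreover have "rs (free_condensed E) S (topspace S) ?L y s = fgerm E ?T s U (frag_cmul n a)"
        using rest[where \<tau> = y, OF L U(1,2,3) cm[OF U(4)] y_germ[OF U(1,2,4) U(5)[OF U(2)]]] fs by simp
      ultimately show "rs (free_condensed E) S (topspace S) ?L y s = (rs (free_condensed E) S (topspace S) ?L \<sigma> [^]\<^bsub>Zfree E ?T\<^esub> n) s"
        by simp
    qed
  next
    fix y' assume y': "y' \<in> carrier (Zfree E S)"
      "\<And>n. rs (free_condensed E) S (topspace S) (level S f n) y' = rs (free_condensed E) S (topspace S) (level S f n) y"
    show "y' = y"
    proof (rule Zfree_eqI[OF E S y'(1) y])
      fix s assume "s \<in> topspace S"
      then have s: "s \<in> level S f (f s)" by (simp add: level_def)
      note L = clopen_level[OF f, of "f s"]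
      obtain U a b where U: "clopen S U" "s \<in> U" "U \<subseteq> level S f (f s)" "a \<in> car (free_presheaf E) S U" "b \<in> car (free_presheaf E) S U"
        "\<And>t. t \<in> U \<Longrightarrow> y' t = fgerm E S t U a" "\<And>t. t \<in> U \<Longrightarrow> y t = fgerm E S t U b"
        using Zfree_E2[OF E S y'(1) y s L] by blast
      have "fgerm E (subtopology S (level S f (f s))) s U a = fgerm E (subtopology S (level S f (f s))) s U b"
        using rest[where \<tau> = y', OF L U(1,2,3,4) U(6)[OF U(2)]] rest[where \<tau> = y, OF L U(1,2,3,5) U(7)[OF U(2)]] y'(2)[of "f s"] by simp
      then have "fgerm E S s U a = fgerm E S s U b" by (rule germ_sub_eqD[OF functorial_free[OF E] S L U(2,1,3,4,5)])
      then show "y' s = y s" using U by simp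
    qed
  qed
  then show "int_action (free_condensed E) S f \<sigma> \<in> carrier (Zfree E S)"
    and "\<And>s U a. clopen S U \<Longrightarrow> s \<in> U \<Longrightarrow> a \<in> car (free_presheaf E) S U \<Longrightarrow>
      \<sigma> s = fgerm E S s U a \<Longrightarrow> int_action (free_condensed E) S f \<sigma> s = fgerm E S s U (frag_cmul (f s) a)"
    using y y_germ by simp_all
qed

lemma int_action_Zfree_ind:
  assumes S: "S \<in> CHED" and V: "clopen S V" and \<sigma>: "\<sigma> \<in> carrier (Zfree E S)"
  shows "int_action (free_condensed E) S (ind S V) \<sigma> = cut E S V \<sigma>"
proof (rule Zfree_eqI[OF E S int_action_Zfree_closed[OF S ind_closed[OF V] \<sigma>] cut_closed[OF E S V \<sigma>]])
  fix s assume s: "s \<in> topspace S"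
  obtain U a where U: "clopen S U" "s \<in> U" "a \<in> car (free_presheaf E) S U" "\<sigma> s = fgerm E S s U a"
    by (rule Zfree_at[OF E S \<sigma> s])
  show "int_action (free_condensed E) S (ind S V) \<sigma> s = cut E S V \<sigma> s"
    using int_action_Zfree_germ[OF S ind_closed[OF V] \<sigma> U] s U(4) Zfree_one_germ[OF E S U(1,2)]
    by (simp add: ind_def cut_def)
qed

lemma cut_int_action_Zfree:
  assumes S: "S \<in> CHED" and f: "f \<in> carrier (sec condensed_int S)" and \<sigma>: "\<sigma> \<in> carrier (Zfree E S)"
    and V: "clopen S V" "V \<subseteq> level S f n"
  shows "cut E S V (int_action (free_condensed E) S f \<sigma>) = cut E S V \<sigma> [^]\<^bsub>Zfree E S\<^esub> n"
proof -
  interpret comm_group "Zfree E S" by (rule comm_group_Zfree[OF E S])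
  note c = cut_closed[OF E S V(1)]
  note cl = int_action_Zfree_closed[OF S f \<sigma>]
  show ?thesis
  proof (rule Zfree_eqI[OF E S c[OF cl] int_pow_closed[OF c[OF \<sigma>]]])
    fix s assume s: "s \<in> topspace S"
    obtain U a where U: "clopen S U" "s \<in> U" "a \<in> car (free_presheaf E) S U" "\<sigma> s = fgerm E S s U a"
      by (rule Zfree_at[OF E S \<sigma> s])
    show "cut E S V (int_action (free_condensed E) S f \<sigma>) s = (cut E S V \<sigma> [^]\<^bsub>Zfree E S\<^esub> n) s"
    proof (cases "s \<in> V")
      case True
      have "f s = n" using True V(2) by (auto simp: level_def)
      then show ?thesis
        using Zfree_pow_germ[where \<sigma> = "cut E S V \<sigma>", OF S c[OF \<sigma>] U(1,2,3)] int_action_Zfree_germ[OF S f \<sigma> U] U(4)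
          cut_germ(1)[OF E S V(1) True] by simp
    next
      case False
      have "(cut E S V \<sigma> [^]\<^bsub>Zfree E S\<^esub> n) s = fgerm E S s U (frag_cmul n 0)"
        using cut_germ(2)[OF E S, of s V] False s Zfree_one_germ[OF E S U(1,2)]
        by (intro Zfree_pow_germ[OF S c[OF \<sigma>] U(1,2)]) auto
      then show ?thesis using cut_germ(2)[OF E S, of s V] False s Zfree_one_germ[OF E S U(1,2)] by simp
    qed
  qed
qed

end

section \<open>The condensed modules \<open>R[X]\<close>\<close>

text \<open>The simplifier turns \<open>add_monoid (module_of Q act)\<close> into the following copy of \<open>Q\<close>.\<close>

context
  fixes Q :: "('m, 'z) monoid_scheme" and u :: 'w
begin

private abbreviation "Q' \<equiv> \<lparr>carrier = carrier Q, monoid.mult = monoid.mult Q, one = \<one>\<^bsub>Q\<^esub>, \<dots> = u\<rparr>"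

lemma hom_copy [simp]: "hom Q' B = hom Q B"
  by (simp add: hom_def)

lemma generate_copy [simp]: "generate Q' P = generate Q P"
proof -
  have inv: "inv\<^bsub>Q'\<^esub> x = inv\<^bsub>Q\<^esub> x" for x by (simp add: m_inv_def)
  have "x \<in> generate Q P" if "x \<in> generate Q' P" for x
    using that by induction (simp_all add: inv generate.intros)
  moreover have "x \<in> generate Q' P" if "x \<in> generate Q P" for x
    using that
  proof induction
    case one then show ?case using generate.one[of Q' P] by simp
  next
    case (incl h) then show ?case by (rule generate.incl)
  next
    case (inv h) then show ?case using generate.inv[of h P Q'] by (simp add: m_inv_def)
  next
    case (eng h1 h2) then show ?case using generate.eng[of h1 Q' P h2] by simp
  qed
  ultimately show ?thesis by blast
qed

lemma generates_copy [simp]: "generates Q' P \<longleftrightarrow> generates Q P"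
  unfolding generates_def by simp

lemma group_copy [simp]: "group Q' \<longleftrightarrow> group Q"
  unfolding group_def monoid_def group_axioms_def Units_def by simp

end

lemma balanced_map_module_of:
  "balanced_map A (module_of P act) (module_of Q act') B f \<longleftrightarrow>
     (\<forall>m\<in>carrier P. f m \<in> hom Q B) \<and> (\<forall>n\<in>carrier Q. (\<lambda>m. f m n) \<in> hom P B) \<and>
     (\<forall>m\<in>carrier P. \<forall>a\<in>carrier A. \<forall>n\<in>carrier Q. f (act a m) n = f m (act' a n))"
  unfolding balanced_map_def by simp

lemma carrier_sub_presheaf [simp]: "carrier (sec (sub_presheaf G X) S) = X S"
  and res_sub_presheaf [simp]: "res (sub_presheaf G X) = res G"
  by (simp_all add: sub_presheaf_def)

lemma rs_sub_presheaf [simp]: "rs (sub_presheaf G X) = rs G"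
  and fres_sub_presheaf [simp]: "fres (sub_presheaf G X) = fres G"
  by (simp_all add: rs_def[abs_def] fres_def[abs_def])

lemma sec_additive_group [simp]: "sec (additive_group R) S = add_monoid (sec R S)"
  and res_additive_group [simp]: "res (additive_group R) = res R"
  by (simp_all add: additive_group_def)

lemma rs_additive_group [simp]: "rs (additive_group R) = rs R"
  by (simp add: rs_def[abs_def])

lemma sec_int_module [simp]: "sec (int_module F) S = module_of (sec F S) (int_action F S)"
  and res_int_module [simp]: "res (int_module F) = res F"
  by (simp_all add: int_module_def)

lemma condensed_group_additive:
  assumes R: "condensed_ring R"
  shows "condensed_group (additive_group R)"
proof -
  have car: "carrier (sec (additive_group R) S) = carrier (sec R S)" for S by simp
  have "condensed_set (additive_group R) = condensed_set R"
    unfolding condensed_set_def functorial_def restr_def car res_additive_group by (rule refl)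
  then have "condensed_set (additive_group R)" using R by (simp add: condensed_ring_def)
  moreover have "group (add_monoid (sec R S))" if "S \<in> CHED" for S
  proof -
    interpret ring "sec R S" using R that by (simp add: condensed_ring_def)
    show ?thesis by (rule a_group)
  qed
  moreover have "res R S T f \<in> hom (add_monoid (sec R T)) (add_monoid (sec R S))"
    if "S \<in> CHED" "T \<in> CHED" "continuous_map S T f" for S T f
  proof -
    have "res R S T f \<in> ring_hom (sec R T) (sec R S)" using R that by (simp add: condensed_ring_def)
    then show ?thesis by (auto simp: ring_hom_def hom_def)
  qed
  ultimately show ?thesis by (simp add: condensed_group_def)
qed

lemma functorial_ring: "condensed_ring R \<Longrightarrow> functorial R"
  by (simp add: condensed_ring_def condensed_set_def)

lemma functorial_group: "condensed_group G \<Longrightarrow> functorial G"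
  by (simp add: condensed_group_def condensed_set_def)

lemma ring_sec: "condensed_ring R \<Longrightarrow> S \<in> CHED \<Longrightarrow> ring (sec R S)"
  by (simp add: condensed_ring_def)

lemma group_sec: "condensed_group G \<Longrightarrow> S \<in> CHED \<Longrightarrow> group (sec G S)"
  by (simp add: condensed_group_def)

lemma rs_ring_hom:
  assumes "condensed_ring R" "S \<in> CHED" "clopen S U" "clopen S W" "W \<subseteq> U"
  shows "rs R S U W \<in> ring_hom (sec R (subtopology S U)) (sec R (subtopology S W))"
  using assms sub_CHED[OF assms(2,3)] sub_CHED[OF assms(2,4)] continuous_map_sub_id[OF assms(5)]
  unfolding condensed_ring_def rs_def by blast

lemma rs_group_hom:
  assumes "condensed_group G" "S \<in> CHED" "clopen S U" "clopen S W" "W \<subseteq> U"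
  shows "rs G S U W \<in> hom (sec G (subtopology S U)) (sec G (subtopology S W))"
  using assms sub_CHED[OF assms(2,3)] sub_CHED[OF assms(2,4)] continuous_map_sub_id[OF assms(5)]
  unfolding condensed_group_def rs_def by blast

lemma res_ring_hom:
  "condensed_ring R \<Longrightarrow> S \<in> CHED \<Longrightarrow> T \<in> CHED \<Longrightarrow> continuous_map S T f \<Longrightarrow> res R S T f \<in> ring_hom (sec R T) (sec R S)"
  unfolding condensed_ring_def by blast

lemma res_group_hom:
  "condensed_group G \<Longrightarrow> S \<in> CHED \<Longrightarrow> T \<in> CHED \<Longrightarrow> continuous_map S T f \<Longrightarrow> res G S T f \<in> hom (sec G T) (sec G S)"
  unfolding condensed_group_def by blast

lemma fres_group_hom:
  assumes "condensed_group G" "S \<in> CHED" "T \<in> CHED" "continuous_map S T f" "clopen T U"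
  shows "fres G S T f U \<in> hom (sec G (subtopology T U)) (sec G (subtopology S (pull f S U)))"
  unfolding fres_def using assms by (intro res_group_hom sub_CHED continuous_map_pull clopen_pull)

lemma sec_lin [simp]:
  "sec (lin R G X) S = tensor_group (sec condensed_int S)
     (module_of (add_monoid (sec R S)) (int_action (additive_group R) S))
     (module_of (Zfree (sub_presheaf G X) S) (int_action (free_condensed (sub_presheaf G X)) S))"
  by (simp add: lin_def condensed_tensor_def)

section \<open>Homomorphisms out of \<open>R[X]\<close> and their dependence on the
  coefficient\<close>

abbreviation Rtop :: "('s, 'r) ring_presheaf \<Rightarrow> 's topology \<Rightarrow> 's set \<Rightarrow> 'r \<Rightarrow> 'r" where
  "Rtop R S \<equiv> rs R S (topspace S)"

text \<open>
  Such maps are balanced over \<open>condensed_int\<close>, since a locally constant function is an integer on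
  each part of a clopen partition.
\<close>

definition local_bihom ::
  "('s, 'r) ring_presheaf \<Rightarrow> ('s, 'a, ('a, 'z) partial_object_scheme) presheaf \<Rightarrow> 's topology \<Rightarrow>
   ('b, 'w) monoid_scheme \<Rightarrow> ('r \<Rightarrow> ('s, 'a \<Rightarrow>\<^sub>0 int) germs \<Rightarrow> 'b) \<Rightarrow> bool" where
  "local_bihom R E S B g \<longleftrightarrow>
     (\<forall>r\<in>carrier (sec R S). g r \<in> hom (Zfree E S) B) \<and>
     (\<forall>a\<in>carrier (Zfree E S). (\<lambda>r. g r a) \<in> hom (add_monoid (sec R S)) B) \<and>
     (\<forall>V. clopen S V \<longrightarrow> (\<forall>r\<in>carrier (sec R S). \<forall>r'\<in>carrier (sec R S).
        Rtop R S V r = Rtop R S V r' \<longrightarrow>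
        (\<forall>a\<in>carrier (Zfree E S). g r (cut E S V a) = g r' (cut E S V a))))"

lemma local_bihom_balanced:
  assumes R: "condensed_ring R" and E: "functorial E" and S: "S \<in> CHED" and B: "comm_group B"
    and g: "local_bihom R E S B g"
  shows "balanced_map (sec condensed_int S)
    (module_of (add_monoid (sec R S)) (int_action (additive_group R) S))
    (module_of (Zfree E S) (int_action (free_condensed E) S)) B g"
proof -
  interpret B: comm_group B by fact
  interpret Z: comm_group "Zfree E S" by (rule comm_group_Zfree[OF E S])
  interpret R: ring "sec R S" by (rule ring_sec[OF R S])
  note A = condensed_group_additive[OF R]
  have "g (int_action (additive_group R) S f r) a = g r (int_action (free_condensed E) S f a)"
    if r: "r \<in> carrier (sec R S)" and f: "f \<in> carrier (sec condensed_int S)" and a: "a \<in> carrier (Zfree E S)" for r f a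
  proof -
    let ?fr = "int_action (additive_group R) S f r" and ?fa = "int_action (free_condensed E) S f a"
    have r': "r \<in> carrier (sec (additive_group R) S)" using r by simp
    have fr: "?fr \<in> carrier (sec R S)" using int_action_closed[OF A S f r'] by simp
    have fa: "?fa \<in> carrier (Zfree E S)" by (rule int_action_Zfree_closed[OF E S f a])
    have h: "g ?fr \<in> hom (Zfree E S) B" "g r \<in> hom (Zfree E S) B" using g r fr by (auto simp: local_bihom_def)
    have "g ?fr (cut E S V a) = g r (cut E S V ?fa)" if "clopen S V" for V
      using S that
    proof (induction rule: clopen_induct)
      case empty
      show ?case using hom_one[OF h(1)] hom_one[OF h(2)] by (simp add: cut_empty[OF E S])
    next
      case (union V1 V2)
      then show ?case
        using hom_mult[OF h(1) cut_closed[OF E S _ a] cut_closed[OF E S _ a]] hom_mult[OF h(2) cut_closed[OF E S _ fa] cut_closed[OF E S _ fa]]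
        by (simp add: cut_union[OF E S _ _ _ a] cut_union[OF E S _ _ _ fa])
    next
      case (local s)
      let ?n = "f s" and ?W = "level S f (f s)"
      have W: "clopen S ?W" "s \<in> ?W" using clopen_level[OF f] local by (auto simp: level_def)
      have "g ?fr (cut E S V a) = g r (cut E S V ?fa)" if V: "clopen S V" "V \<subseteq> ?W" for V
      proof -
        let ?nr = "r [^]\<^bsub>add_monoid (sec R S)\<^esub> ?n"
        have nr: "?nr \<in> carrier (sec R S)" using r R.a_group group.int_pow_closed by fastforce
        have cl: "?W \<subseteq> topspace S" "V \<subseteq> topspace S" using V W clopen_subset by auto
        note F = functorial_ring[OF R]
        have hW: "Rtop R S U \<in> hom (add_monoid (sec R S)) (add_monoid (sec R (subtopology S U)))" if "clopen S U" for U
          using rs_ring_hom[OF R S clopen_simps(2) that clopen_subset[OF that]] by (auto simp: ring_hom_def hom_def)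
        have grp: "group (add_monoid (sec R (subtopology S U)))" if "clopen S U" for U
        proof -
          interpret ring "sec R (subtopology S U)" by (rule ring_sec[OF R sub_CHED[OF S that]])
          show ?thesis by (rule a_group)
        qed
        have "Rtop R S ?W ?fr = Rtop R S ?W r [^]\<^bsub>add_monoid (sec R (subtopology S ?W))\<^esub> ?n"
          using int_action_rs[OF A S f r', of ?n] by simp
        also have "\<dots> = Rtop R S ?W ?nr"
          using hom_int_pow[OF hW[OF W(1)] _ R.a_group grp[OF W(1)], of r ?n] r by simp
        finally have e: "Rtop R S ?W ?fr = Rtop R S ?W ?nr" .
        have "Rtop R S V ?fr = Rtop R S V ?nr"
          using rs_rs[OF F S clopen_simps(2) W(1) V cl(1), of ?fr] rs_rs[OF F S clopen_simps(2) W(1) V cl(1), of ?nr] fr nr e by simp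
        \<comment> \<open>On \<open>V\<close> the section \<open>f r\<close> agrees with the
          multiple of \<open>r\<close> by the integer \<open>f s\<close>. The locality clause
          permits the replacement, and additivity in each variable then moves the integer
          across.\<close>
        then have "g ?fr (cut E S V a) = g ?nr (cut E S V a)"
          using g fr nr a V(1) unfolding local_bihom_def by blast
        also have "\<dots> = g r (cut E S V a) [^]\<^bsub>B\<^esub> ?n"
        proof -
          have "(\<lambda>r. g r (cut E S V a)) \<in> hom (add_monoid (sec R S)) B"
            using g cut_closed[OF E S V(1) a] by (simp add: local_bihom_def)
          from hom_int_pow[OF this _ R.a_group B.is_group, of r ?n] r show ?thesis by simp
        qed
        also have "\<dots> = g r (cut E S V a [^]\<^bsub>Zfree E S\<^esub> ?n)"
          using hom_int_pow[OF h(2) cut_closed[OF E S V(1) a] Z.is_group B.is_group] by simp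
        also have "\<dots> = g r (cut E S V ?fa)" using cut_int_action_Zfree[OF E S f a V] by simp
        finally show ?thesis .
      qed
      then show ?case using W by blast
    qed
    from this[OF clopen_simps(2)] show ?thesis using cut_top[OF E S a] cut_top[OF E S fa] by simp
  qed
  then show ?thesis using g unfolding balanced_map_module_of local_bihom_def by simp
qed

lemma tensorable_lin:
  assumes R: "condensed_ring R" and E: "functorial E" and S: "S \<in> CHED"
  shows "tensorable (sec condensed_int S)
    (module_of (add_monoid (sec R S)) (int_action (additive_group R) S))
    (module_of (Zfree E S) (int_action (free_condensed E) S))"
proof -
  interpret R: ring "sec R S" by (rule ring_sec[OF R S])
  show ?thesis unfolding tensorable_def
    using Zfree_mult_closed[OF E S] int_action_Zfree_closed[OF E S] int_action_closed[OF condensed_group_additive[OF R] S]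
    by simp
qed

definition lgen ::
  "('s, 'r) ring_presheaf \<Rightarrow> ('s, 'g) group_presheaf \<Rightarrow> ('s topology \<Rightarrow> 'g set) \<Rightarrow>
   's topology \<Rightarrow> 'r \<Rightarrow> 's set \<Rightarrow> 'g \<Rightarrow> ('s, 'r, 'g) lin" where
  "lgen R G X S r U x = lin_pure R G X S r (gen (sub_presheaf G X) S U x)"

context
  fixes R :: "('s, 'r) ring_presheaf" and G :: "('s, 'g) group_presheaf" and X :: "'s topology \<Rightarrow> 'g set"
    and S :: "'s topology"
  assumes R: "condensed_ring R" and X: "functorial (sub_presheaf G X)" and S: "S \<in> CHED"
begin

private abbreviation "Z \<equiv> Zfree (sub_presheaf G X) S"
private abbreviation "L \<equiv> sec (lin R G X) S"

private lemma lin_pure_eq: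
  "lin_pure R G X S = pure_tensor (sec condensed_int S)
     (module_of (add_monoid (sec R S)) (int_action (additive_group R) S))
     (module_of Z (int_action (free_condensed (sub_presheaf G X)) S))"
  by (simp add: lin_pure_def)

lemma comm_group_lin: "comm_group L"
  unfolding sec_lin by (rule comm_group_tensor[OF tensorable_lin[OF R X S]])

private lemma bal: "balanced_map (sec condensed_int S)
     (module_of (add_monoid (sec R S)) (int_action (additive_group R) S))
     (module_of Z (int_action (free_condensed (sub_presheaf G X)) S)) L (lin_pure R G X S)"
  unfolding lin_pure_eq sec_lin by (rule pure_tensor_balanced_map[OF tensorable_lin[OF R X S]])

lemma lin_pure_hom: "r \<in> carrier (sec R S) \<Longrightarrow> lin_pure R G X S r \<in> hom Z L"
  using bal by (simp add: balanced_map_module_of del: sec_lin)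

lemma lin_pure_hom_left: "a \<in> carrier Z \<Longrightarrow> (\<lambda>r. lin_pure R G X S r a) \<in> hom (add_monoid (sec R S)) L"
  using bal by (simp add: balanced_map_module_of del: sec_lin)

text \<open>Cutting at \<open>V\<close> is the action of the indicator function, and balancedness
  moves that action to the coefficient. There it yields a section that is \<open>r\<close> on
  \<open>V\<close> and zero on the complement, so only the restriction of \<open>r\<close> to
  \<open>V\<close> matters.\<close>

lemma lin_pure_local:
  assumes V: "clopen S V" and r: "r \<in> carrier (sec R S)" "r' \<in> carrier (sec R S)" "Rtop R S V r = Rtop R S V r'"
    and a: "a \<in> carrier Z"
  shows "lin_pure R G X S r (cut (sub_presheaf G X) S V a) = lin_pure R G X S r' (cut (sub_presheaf G X) S V a)"
proof -
  let ?A = "additive_group R" and ?i = "ind S V"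
  note i = ind_closed[OF V]
  note A = condensed_group_additive[OF R]
  have e: "lin_pure R G X S q (cut (sub_presheaf G X) S V a) = lin_pure R G X S (int_action ?A S ?i q) a"
    if "q \<in> carrier (sec R S)" for q
    using bal that a i int_action_Zfree_ind[OF X S V a] by (simp add: balanced_map_module_of del: sec_lin)
  have "int_action ?A S ?i r = int_action ?A S ?i r'"
  proof (rule condensed_eqI[of ?A S])
    show "condensed_set ?A" using A by (simp add: condensed_group_def)
    show c: "int_action ?A S ?i r \<in> carrier (sec ?A S)" "int_action ?A S ?i r' \<in> carrier (sec ?A S)"
      using int_action_closed[OF A S i] r by simp_all
    fix s assume s: "s \<in> topspace S"
    let ?n = "ind S V s"
    have W: "clopen S (level S ?i ?n)" "s \<in> level S ?i ?n" using clopen_level[OF i] s by (auto simp: level_def)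
    have "rs ?A S (topspace S) (level S ?i ?n) (int_action ?A S ?i r) = rs ?A S (topspace S) (level S ?i ?n) (int_action ?A S ?i r')"
    proof (cases "s \<in> V")
      case True
      then have "level S ?i ?n = V" using s clopen_subset[OF V] by (auto simp: level_def ind_def)
      then show ?thesis using int_action_rs[OF A S i, of r ?n] int_action_rs[OF A S i, of r' ?n] r by simp
    next
      case False
      then have "?n = 0" using s by (simp add: ind_def)
      then show ?thesis using int_action_rs[OF A S i, of r ?n] int_action_rs[OF A S i, of r' ?n] r by simp
    qed
    then show "\<exists>W. clopen S W \<and> s \<in> W \<and> rs ?A S (topspace S) W (int_action ?A S ?i r) = rs ?A S (topspace S) W (int_action ?A S ?i r')"
      using W by blast
  qed (use S in auto)
  then show ?thesis using e r by simp
qed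

lemma lin_pure_closed: "r \<in> carrier (sec R S) \<Longrightarrow> a \<in> carrier Z \<Longrightarrow> lin_pure R G X S r a \<in> carrier L"
  by (rule hom_in_carrier[OF lin_pure_hom])

lemma lin_generates_pure: "generates L {lin_pure R G X S r a |r a. r \<in> carrier (sec R S) \<and> a \<in> carrier Z}"
  using tensor_generates[OF tensorable_lin[OF R X S]] by (simp add: lin_pure_eq)

lemma lin_lift:
  assumes B: "comm_group B" and g: "local_bihom R (sub_presheaf G X) S B g"
  shows lin_lift_hom: "tensor_lift B g \<in> hom L B"
    and lin_lift_pure: "\<And>r a. r \<in> carrier (sec R S) \<Longrightarrow> a \<in> carrier Z \<Longrightarrow> tensor_lift B g (lin_pure R G X S r a) = g r a"
  using tensor_lift[OF tensorable_lin[OF R X S] B local_bihom_balanced[OF R X S B g]]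
  by (simp_all add: lin_pure_eq)

lemma gen_in: "clopen S U \<Longrightarrow> x \<in> X (subtopology S U) \<Longrightarrow> gen (sub_presheaf G X) S U x \<in> carrier Z"
  using gen_closed[OF X S] by simp

lemma lgen_closed: "r \<in> carrier (sec R S) \<Longrightarrow> clopen S U \<Longrightarrow> x \<in> X (subtopology S U) \<Longrightarrow> lgen R G X S r U x \<in> carrier L"
  unfolding lgen_def by (intro lin_pure_closed gen_in)

lemma lgen_hom: "clopen S U \<Longrightarrow> x \<in> X (subtopology S U) \<Longrightarrow> (\<lambda>r. lgen R G X S r U x) \<in> hom (add_monoid (sec R S)) L"
  unfolding lgen_def by (intro lin_pure_hom_left gen_in)

lemma lgen_union:
  assumes "r \<in> carrier (sec R S)" "clopen S U" "clopen S V" "U \<inter> V = {}" "x \<in> X (subtopology S (U \<union> V))"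
  shows "lgen R G X S r (U \<union> V) x = lgen R G X S r U (rs G S (U \<union> V) U x) \<otimes>\<^bsub>L\<^esub> lgen R G X S r V (rs G S (U \<union> V) V x)"
proof -
  have UV: "clopen S (U \<union> V)" using assms clopen_Un by blast
  have "rs G S (U \<union> V) U x \<in> X (subtopology S U)" "rs G S (U \<union> V) V x \<in> X (subtopology S V)"
    using rs_closed[OF X S UV assms(2), of x] rs_closed[OF X S UV assms(3), of x] assms(5) by auto
  then show ?thesis unfolding lgen_def
    using gen_union[OF X S assms(2-4), of x] assms hom_mult[OF lin_pure_hom[OF assms(1)] gen_in gen_in]
    by (simp del: sec_lin)
qed

lemma lgen_local:
  assumes "clopen S U" "r \<in> carrier (sec R S)" "r' \<in> carrier (sec R S)" "Rtop R S U r = Rtop R S U r'" "x \<in> X (subtopology S U)"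
  shows "lgen R G X S r U x = lgen R G X S r' U x"
proof -
  have "cut (sub_presheaf G X) S U (gen (sub_presheaf G X) S U x) = gen (sub_presheaf G X) S U x"
    using cut_gen[OF X S assms(1,1), of x] rs_self[OF X S assms(1), of x] assms(5) by simp
  then show ?thesis unfolding lgen_def using lin_pure_local[OF assms(1-4) gen_in[OF assms(1,5)]] by simp
qed

lemma lin_generates:
  assumes "section_basis (sub_presheaf G X) S \<B>"
  shows "generates L {lgen R G X S r U x |r U x. r \<in> carrier (sec R S) \<and> (U, x) \<in> \<B>}"
proof -
  let ?M = "module_of Z (int_action (free_condensed (sub_presheaf G X)) S)"
  have "generates L {lin_pure R G X S m n |m n. m \<in> carrier (sec R S) \<and> n \<in> {gen (sub_presheaf G X) S U x |U x. (U, x) \<in> \<B>}}"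
    using tensor_generates_right[OF tensorable_lin[OF R X S], of "{gen (sub_presheaf G X) S U x |U x. (U, x) \<in> \<B>}"]
      Zfree_generates[OF X S assms] comm_group.axioms(2)[OF comm_group_Zfree[OF X S]]
    by (simp add: lin_pure_eq)
  moreover have "{lin_pure R G X S m n |m n. m \<in> carrier (sec R S) \<and> n \<in> {gen (sub_presheaf G X) S U x |U x. (U, x) \<in> \<B>}} =
      {lgen R G X S r U x |r U x. r \<in> carrier (sec R S) \<and> (U, x) \<in> \<B>}"
    unfolding lgen_def by blast
  ultimately show ?thesis by simp
qed

text \<open>For each coefficient \<open>r\<close> the free case supplies a homomorphism
  \<open>g r\<close>. Additivity and locality in \<open>r\<close> hold on generators, hence
  everywhere, and with them \<open>g\<close> factors through the tensor product.\<close>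

lemma lin_universal:
  fixes B :: "('b, 'w) monoid_scheme" and \<phi> :: "'r \<Rightarrow> 's set \<Rightarrow> 'g \<Rightarrow> 'b"
  assumes \<B>: "section_basis (sub_presheaf G X) S \<B>" and B: "comm_group B"
    and hom: "\<And>U x. (U, x) \<in> \<B> \<Longrightarrow> (\<lambda>r. \<phi> r U x) \<in> hom (add_monoid (sec R S)) B"
    and union: "\<And>r U V x. r \<in> carrier (sec R S) \<Longrightarrow> clopen S U \<Longrightarrow> clopen S V \<Longrightarrow> U \<inter> V = {} \<Longrightarrow> (U \<union> V, x) \<in> \<B> \<Longrightarrow>
      \<phi> r (U \<union> V) x = \<phi> r U (rs G S (U \<union> V) U x) \<otimes>\<^bsub>B\<^esub> \<phi> r V (rs G S (U \<union> V) V x)"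
    and local: "\<And>r r' U x. (U, x) \<in> \<B> \<Longrightarrow> r \<in> carrier (sec R S) \<Longrightarrow> r' \<in> carrier (sec R S) \<Longrightarrow> Rtop R S U r = Rtop R S U r' \<Longrightarrow>
      \<phi> r U x = \<phi> r' U x"
  obtains h where "h \<in> hom L B" "\<And>r U x. r \<in> carrier (sec R S) \<Longrightarrow> (U, x) \<in> \<B> \<Longrightarrow> h (lgen R G X S r U x) = \<phi> r U x"
proof -
  let ?E = "sub_presheaf G X"
  interpret B: comm_group B by fact
  interpret Z: comm_group Z by (rule comm_group_Zfree[OF X S])
  interpret R: ring "sec R S" by (rule ring_sec[OF R S])
  have B1: "clopen S U" "x \<in> X (subtopology S U)" if "(U, x) \<in> \<B>" for U x
    using \<B> that unfolding section_basis_def by auto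
  have B2: "(W, rs G S U W x) \<in> \<B>" if "(U, x) \<in> \<B>" "clopen S W" "W \<subseteq> U" for U x W
    using \<B> that unfolding section_basis_def by auto
  note gens = Zfree_generates[OF X S \<B>]
  have "\<exists>h. h \<in> hom Z B \<and> (\<forall>U x. (U, x) \<in> \<B> \<longrightarrow> h (gen ?E S U x) = \<phi> r U x)" if r: "r \<in> carrier (sec R S)" for r
  proof -
    have cl: "\<phi> r U x \<in> carrier B" if "(U, x) \<in> \<B>" for U x
      using hom_in_carrier[OF hom[OF that]] r by simp
    obtain h where "h \<in> hom Z B" "\<And>U x. (U, x) \<in> \<B> \<Longrightarrow> h (gen ?E S U x) = \<phi> r U x"
      by (rule Zfree_universal[OF X S \<B> B, of "\<phi> r"]) (use cl union r in auto)
    then show ?thesis by blast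
  qed
  then obtain g where g: "\<And>r. r \<in> carrier (sec R S) \<Longrightarrow> g r \<in> hom Z B"
    "\<And>r U x. r \<in> carrier (sec R S) \<Longrightarrow> (U, x) \<in> \<B> \<Longrightarrow> g r (gen ?E S U x) = \<phi> r U x" by metis
  have "local_bihom R ?E S B g" unfolding local_bihom_def
  proof (intro conjI ballI allI impI)
    fix a assume a: "a \<in> carrier Z"
    show "(\<lambda>r. g r a) \<in> hom (add_monoid (sec R S)) B"
    proof (rule homI)
      fix r r' assume r: "r \<in> carrier (add_monoid (sec R S))" "r' \<in> carrier (add_monoid (sec R S))"
      have h: "(\<lambda>a. g r a \<otimes>\<^bsub>B\<^esub> g r' a) \<in> hom Z B"
        using r g(1)[of r] g(1)[of r'] hom_in_carrier[OF g(1)[of r]] hom_in_carrier[OF g(1)[of r']]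
        by (intro homI) (auto simp: hom_mult B.m_ac)
      have "g (r \<oplus>\<^bsub>sec R S\<^esub> r') a = g r a \<otimes>\<^bsub>B\<^esub> g r' a"
      proof (rule hom_eq_on_generators[OF Z.is_group B.is_group gens g(1) h _ a])
        fix q assume "q \<in> {gen ?E S U x |U x. (U, x) \<in> \<B>}"
        then obtain U x where q: "q = gen ?E S U x" "(U, x) \<in> \<B>" by auto
        show "g (r \<oplus>\<^bsub>sec R S\<^esub> r') q = g r q \<otimes>\<^bsub>B\<^esub> g r' q"
          using hom_mult[OF hom[OF q(2)], of r r'] r q g(2) by simp
      qed (use r in auto)
      then show "g (r \<otimes>\<^bsub>add_monoid (sec R S)\<^esub> r') a = g r a \<otimes>\<^bsub>B\<^esub> g r' a" by simp
    qed (use hom_in_carrier[OF g(1) a] in simp)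
  next
    fix V r r' a assume V: "clopen S V" and r: "r \<in> carrier (sec R S)" "r' \<in> carrier (sec R S)" "Rtop R S V r = Rtop R S V r'"
      and a: "a \<in> carrier Z"
    have "(g r \<circ> cut ?E S V) a = (g r' \<circ> cut ?E S V) a"
    proof (rule hom_eq_on_generators[OF Z.is_group B.is_group gens _ _ _ a])
      show "g r \<circ> cut ?E S V \<in> hom Z B" "g r' \<circ> cut ?E S V \<in> hom Z B"
        using hom_compose[OF cut_hom[OF X S V] g(1)] r by auto
      fix q assume "q \<in> {gen ?E S U x |U x. (U, x) \<in> \<B>}"
      then obtain U x where q: "q = gen ?E S U x" "(U, x) \<in> \<B>" by auto
      have U: "clopen S U" "x \<in> car ?E S U" using B1[OF q(2)] by simp_all
      have UV: "clopen S (U \<inter> V)" using U V clopen_Int by blast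
      have b: "(U \<inter> V, rs G S U (U \<inter> V) x) \<in> \<B>" using B2[OF q(2) UV] by auto
      have c: "cut ?E S V q = gen ?E S (U \<inter> V) (rs G S U (U \<inter> V) x)" using cut_gen[OF X S U(1) V U(2)] q by simp
      \<comment> \<open>Coefficients that agree on \<open>V\<close> agree on
        \<open>U \<inter> V\<close>, the support of the cut generator.\<close>
      have "Rtop R S (U \<inter> V) r = Rtop R S (U \<inter> V) r'"
        using rs_rs[OF functorial_ring[OF R] S clopen_simps(2) V UV _ clopen_subset[OF V], of r]
          rs_rs[OF functorial_ring[OF R] S clopen_simps(2) V UV _ clopen_subset[OF V], of r'] r by simp
      then show "(g r \<circ> cut ?E S V) q = (g r' \<circ> cut ?E S V) q"
        using local[OF b r(1,2)] g(2)[OF _ b] r by (simp add: c)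
    qed
    then show "g r (cut ?E S V a) = g r' (cut ?E S V a)" by simp
  qed (use g in auto)
  from lin_lift[OF B this] g(2) gen_in B1 show ?thesis
    by (intro that[of "tensor_lift B g"]) (simp_all add: lgen_def del: sec_lin)
qed

end

lemma hom_pointwise_mult:
  assumes "comm_group B" "f \<in> hom A B" "g \<in> hom A B"
  shows "(\<lambda>x. f x \<otimes>\<^bsub>B\<^esub> g x) \<in> hom A B"
proof -
  interpret B: comm_group B by fact
  show ?thesis
    using assms(2,3) hom_in_carrier[OF assms(2)] hom_in_carrier[OF assms(3)]
    by (intro homI) (auto simp: hom_mult B.m_ac)
qed

lemma frag_extend_fun_add: "frag_extend (\<lambda>x. f x + g x) c = frag_extend f c + frag_extend g c"
  by (simp add: frag_extend_def frag_cmul_distrib2 sum.distrib)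

section \<open>Products of condensed modules \<open>R[X]\<close>\<close>

text \<open>A subpresheaf of \<open>G\<close>. Sheafification takes place after formal sums are
  formed, so this is the right notion for building \<open>R[X]\<close> uniformly from subgroups,
  translates, conjugates and intersections.\<close>

definition condensed_subset :: "('s, 'g, ('g, 'z) partial_object_scheme) presheaf \<Rightarrow> ('s topology \<Rightarrow> 'g set) \<Rightarrow> bool" where
  "condensed_subset G X \<longleftrightarrow> functorial (sub_presheaf G X) \<and> (\<forall>S\<in>CHED. X S \<subseteq> carrier (sec G S))"

definition mult_into :: "('s, 'g) group_presheaf \<Rightarrow> ('s topology \<Rightarrow> 'g set) \<Rightarrow> ('s topology \<Rightarrow> 'g set) \<Rightarrow>
    ('s topology \<Rightarrow> 'g set) \<Rightarrow> bool" where
  "mult_into G X Y W \<longleftrightarrow> (\<forall>S\<in>CHED. \<forall>x\<in>X S. \<forall>y\<in>Y S. x \<otimes>\<^bsub>sec G S\<^esub> y \<in> W S)"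

context
  fixes R :: "('s, 'r) ring_presheaf" and G :: "('s, 'g) group_presheaf" and X Y W :: "'s topology \<Rightarrow> 'g set"
    and S :: "'s topology"
  assumes R: "condensed_ring R" and G: "condensed_group G"
    and X: "condensed_subset G X" and Y: "condensed_subset G Y" and W: "condensed_subset G W"
    and XYW: "mult_into G X Y W" and S: "S \<in> CHED"
begin

private abbreviation "PX \<equiv> sub_presheaf G X"
private abbreviation "PY \<equiv> sub_presheaf G Y"
private abbreviation "PW \<equiv> sub_presheaf G W"
private abbreviation "LX \<equiv> sec (lin R G X) S"
private abbreviation "LY \<equiv> sec (lin R G Y) S"
private abbreviation "LW \<equiv> sec (lin R G W) S"

private lemma E: "functorial PX" "functorial PY" "functorial PW"
  using X Y W by (simp_all add: condensed_subset_def)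

private lemma free_XYW: "functorial (free_presheaf PX)" "functorial (free_presheaf PY)" "functorial (free_presheaf PW)"
  using E functorial_free by auto

private definition prd :: "'s topology \<Rightarrow> ('g \<Rightarrow>\<^sub>0 int) \<Rightarrow> ('g \<Rightarrow>\<^sub>0 int) \<Rightarrow> 'g \<Rightarrow>\<^sub>0 int" where
  "prd T c d = frag_extend (\<lambda>x. frag_extend (\<lambda>y. frag_of (x \<otimes>\<^bsub>sec G T\<^esub> y)) d) c"

private lemma free_mult_prd: "free_mult G W S = sheafify_op2 (free_presheaf PW) prd S"
  unfolding free_mult_def prd_def by simp

private lemma prd_add_left: "prd T (c + c') d = prd T c d + prd T c' d"
  by (simp add: prd_def frag_extend_add)

private lemma prd_add_right: "prd T c (d + d') = prd T c d + prd T c d'"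
  by (simp add: prd_def frag_extend_add frag_extend_fun_add)

private lemma prd_0: "prd T 0 d = 0" "prd T c 0 = 0"
  by (simp_all add: prd_def frag_extend_eq_0)

private lemma prd_closed:
  assumes "T \<in> CHED" "Poly_Mapping.keys c \<subseteq> X T" "Poly_Mapping.keys d \<subseteq> Y T"
  shows "Poly_Mapping.keys (prd T c d) \<subseteq> W T"
  unfolding prd_def
proof (rule frag_extend_closed[OF assms(2)])
  fix x assume x: "x \<in> X T"
  show "Poly_Mapping.keys (frag_extend (\<lambda>y. frag_of (x \<otimes>\<^bsub>sec G T\<^esub> y)) d) \<subseteq> W T"
    by (rule frag_extend_closed[OF assms(3)]) (use XYW assms(1) x in \<open>simp add: mult_into_def\<close>)
qed

private lemma mult_closed:
  "clopen S U \<Longrightarrow> x \<in> X (subtopology S U) \<Longrightarrow> y \<in> Y (subtopology S U) \<Longrightarrow> x \<otimes>\<^bsub>sec G (subtopology S U)\<^esub> y \<in> W (subtopology S U)"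
  using XYW sub_CHED[OF S] by (simp add: mult_into_def)

private lemma rs_mult_XY:
  assumes "clopen S U" "clopen S V" "V \<subseteq> U" "x \<in> X (subtopology S U)" "y \<in> Y (subtopology S U)"
  shows "rs G S U V (x \<otimes>\<^bsub>sec G (subtopology S U)\<^esub> y) = rs G S U V x \<otimes>\<^bsub>sec G (subtopology S V)\<^esub> rs G S U V y"
proof -
  have "x \<in> carrier (sec G (subtopology S U))" "y \<in> carrier (sec G (subtopology S U))"
    using X Y sub_CHED[OF S assms(1)] assms(4,5) unfolding condensed_subset_def by blast+
  then show ?thesis by (rule hom_mult[OF rs_group_hom[OF G S assms(1,2,3)]])
qed

private lemma nat: "natural_op2 (free_presheaf PX) (free_presheaf PY) (free_presheaf PW) S prd"
  unfolding natural_op2_def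
proof (intro allI impI conjI)
  fix U c d assume U: "clopen S U" and c: "c \<in> car (free_presheaf PX) S U" and d: "d \<in> car (free_presheaf PY) S U"
  show "prd (subtopology S U) c d \<in> car (free_presheaf PW) S U" using prd_closed[OF sub_CHED[OF S U]] c d by simp
  fix V assume V: "clopen S V" "V \<subseteq> U"
  let ?r = "frag_extend (\<lambda>x. frag_of (rs G S U V x))"
  have 1: "?r (prd (subtopology S U) (frag_of x) d) = prd (subtopology S V) (frag_of (rs G S U V x)) (?r d)"
    if x: "x \<in> X (subtopology S U)" for x
  proof -
    have "Poly_Mapping.keys d \<subseteq> Y (subtopology S U)" using d by simp
    then show ?thesis
    proof (induction d rule: frag_induction)
      case (one y) then show ?case using rs_mult_XY[OF U V x] by (simp add: prd_def)
    qed (simp_all add: prd_def frag_extend_diff)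
  qed
  have "Poly_Mapping.keys c \<subseteq> X (subtopology S U)" using c by simp
  then have "?r (prd (subtopology S U) c d) = prd (subtopology S V) (?r c) (?r d)"
  proof (induction c rule: frag_induction)
    case (one x) then show ?case using 1 by simp
  qed (simp_all add: prd_def frag_extend_diff)
  then show "rs (free_presheaf PW) S U V (prd (subtopology S U) c d) =
      prd (subtopology S V) (rs (free_presheaf PX) S U V c) (rs (free_presheaf PY) S U V d)"
    by (simp add: rs_free)
qed

private lemma fm_germ:
  assumes "clopen S U" "s \<in> U" "a \<in> car (free_presheaf PX) S U" "b \<in> car (free_presheaf PY) S U"
    "\<sigma> s = fgerm PX S s U a" "\<tau> s = fgerm PY S s U b"
  shows "free_mult G W S \<sigma> \<tau> s = fgerm PW S s U (prd (subtopology S U) a b)"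
  unfolding free_mult_prd by (rule sheafify_op2_germ[where \<sigma> = \<sigma> and \<tau> = \<tau>, OF free_XYW S nat assms])

private lemma fm_closed:
  "\<sigma> \<in> carrier (Zfree PX S) \<Longrightarrow> \<tau> \<in> carrier (Zfree PY S) \<Longrightarrow> free_mult G W S \<sigma> \<tau> \<in> carrier (Zfree PW S)"
  unfolding carrier_Zfree[OF E(1) S] carrier_Zfree[OF E(2) S] carrier_Zfree[OF E(3) S] free_mult_prd
  by (rule sheafify_op2_sections[OF free_XYW S nat])

private lemma at2:
  assumes "\<sigma> \<in> carrier (Zfree PX S)" "\<tau> \<in> carrier (Zfree PY S)" "s \<in> topspace S"
  obtains U a b where "clopen S U" "s \<in> U" "a \<in> car (free_presheaf PX) S U" "b \<in> car (free_presheaf PY) S U"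
    "\<sigma> s = fgerm PX S s U a" "\<tau> s = fgerm PY S s U b"
proof (rule sections2E[OF free_XYW(1,2) S _ _ assms(3) clopen_simps(2)])
  show "\<sigma> \<in> sections (free_presheaf PX) S" "\<tau> \<in> sections (free_presheaf PY) S"
    using assms carrier_Zfree[OF E(1) S] carrier_Zfree[OF E(2) S] by auto
  fix U a b
  assume *: "clopen S U" "s \<in> U" "U \<subseteq> topspace S" "a \<in> car (free_presheaf PX) S U" "b \<in> car (free_presheaf PY) S U"
    "\<And>t. t \<in> U \<Longrightarrow> \<sigma> t = fgerm PX S t U a" "\<And>t. t \<in> U \<Longrightarrow> \<tau> t = fgerm PY S t U b"
  show thesis by (rule that[OF *(1,2,4,5) *(6)[OF *(2)] *(7)[OF *(2)]])
qed

private lemma prd_car: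
  "clopen S U \<Longrightarrow> a \<in> car (free_presheaf PX) S U \<Longrightarrow> b \<in> car (free_presheaf PY) S U \<Longrightarrow>
   prd (subtopology S U) a b \<in> car (free_presheaf PW) S U"
  using prd_closed[OF sub_CHED[OF S]] by simp

private lemma fm_hom_right:
  assumes \<sigma>: "\<sigma> \<in> carrier (Zfree PX S)"
  shows "free_mult G W S \<sigma> \<in> hom (Zfree PY S) (Zfree PW S)"
proof (rule homI)
  fix \<tau> \<tau>' assume t: "\<tau> \<in> carrier (Zfree PY S)" "\<tau>' \<in> carrier (Zfree PY S)"
  show "free_mult G W S \<sigma> (\<tau> \<otimes>\<^bsub>Zfree PY S\<^esub> \<tau>') = free_mult G W S \<sigma> \<tau> \<otimes>\<^bsub>Zfree PW S\<^esub> free_mult G W S \<sigma> \<tau>'"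
  proof (rule Zfree_eqI[OF E(3) S])
    fix s assume s: "s \<in> topspace S"
    obtain V b b' where V: "clopen S V" "s \<in> V" "V \<subseteq> topspace S" "b \<in> car (free_presheaf PY) S V" "b' \<in> car (free_presheaf PY) S V"
      "\<And>t. t \<in> V \<Longrightarrow> \<tau> t = fgerm PY S t V b" "\<And>t. t \<in> V \<Longrightarrow> \<tau>' t = fgerm PY S t V b'"
      using Zfree_E2[OF E(2) S t s clopen_simps(2)] by blast
    obtain U a where U: "clopen S U" "s \<in> U" "U \<subseteq> V" "a \<in> car (free_presheaf PX) S U" "\<And>t. t \<in> U \<Longrightarrow> \<sigma> t = fgerm PX S t U a"
      using Zfree_E[OF E(1) S \<sigma> V(2,1)] by blast
    let ?r = "rs (free_presheaf PY) S V U"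
    have r: "?r b \<in> car (free_presheaf PY) S U" "?r b' \<in> car (free_presheaf PY) S U"
      by (rule rs_closed[OF free_XYW(2) S V(1) U(1,3) V(4)], rule rs_closed[OF free_XYW(2) S V(1) U(1,3) V(5)])
    have rb: "\<tau> s = fgerm PY S s U (?r b)" "\<tau>' s = fgerm PY S s U (?r b')"
      using germ_rs[OF free_XYW(2) S V(1) U(1,3,2) V(4)] germ_rs[OF free_XYW(2) S V(1) U(1,3,2) V(5)] V(6,7)[OF V(2)] by simp_all
    have rr: "?r b + ?r b' \<in> car (free_presheaf PY) S U" using r Poly_Mapping.keys_add[of "?r b" "?r b'"] by auto
    note m = Zfree_mult_germ[where \<sigma> = \<tau> and \<tau> = \<tau>', OF E(2) S U(1,2) r rb]
    note \<sigma>s = U(5)[OF U(2)]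
    show "free_mult G W S \<sigma> (\<tau> \<otimes>\<^bsub>Zfree PY S\<^esub> \<tau>') s = (free_mult G W S \<sigma> \<tau> \<otimes>\<^bsub>Zfree PW S\<^esub> free_mult G W S \<sigma> \<tau>') s"
      using fm_germ[where \<sigma> = \<sigma> and \<tau> = "\<tau> \<otimes>\<^bsub>Zfree PY S\<^esub> \<tau>'", OF U(1,2,4) rr \<sigma>s m]
        Zfree_mult_germ[where \<sigma> = "free_mult G W S \<sigma> \<tau>" and \<tau> = "free_mult G W S \<sigma> \<tau>'", OF E(3) S U(1,2)
          prd_car[OF U(1,4) r(1)] prd_car[OF U(1,4) r(2)]
          fm_germ[where \<sigma> = \<sigma> and \<tau> = \<tau>, OF U(1,2,4) r(1) \<sigma>s rb(1)] fm_germ[where \<sigma> = \<sigma> and \<tau> = \<tau>', OF U(1,2,4) r(2) \<sigma>s rb(2)]]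
      by (simp add: prd_add_right)
  qed (use fm_closed \<sigma> t Zfree_mult_closed[OF E(2) S] Zfree_mult_closed[OF E(3) S] in auto)
qed (use fm_closed \<sigma> in auto)

private lemma fm_hom_left:
  assumes \<tau>: "\<tau> \<in> carrier (Zfree PY S)"
  shows "(\<lambda>\<sigma>. free_mult G W S \<sigma> \<tau>) \<in> hom (Zfree PX S) (Zfree PW S)"
proof (rule homI)
  fix \<sigma> \<sigma>' assume t: "\<sigma> \<in> carrier (Zfree PX S)" "\<sigma>' \<in> carrier (Zfree PX S)"
  show "free_mult G W S (\<sigma> \<otimes>\<^bsub>Zfree PX S\<^esub> \<sigma>') \<tau> = free_mult G W S \<sigma> \<tau> \<otimes>\<^bsub>Zfree PW S\<^esub> free_mult G W S \<sigma>' \<tau>"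
  proof (rule Zfree_eqI[OF E(3) S])
    fix s assume s: "s \<in> topspace S"
    obtain V b b' where V: "clopen S V" "s \<in> V" "V \<subseteq> topspace S" "b \<in> car (free_presheaf PX) S V" "b' \<in> car (free_presheaf PX) S V"
      "\<And>t. t \<in> V \<Longrightarrow> \<sigma> t = fgerm PX S t V b" "\<And>t. t \<in> V \<Longrightarrow> \<sigma>' t = fgerm PX S t V b'"
      using Zfree_E2[OF E(1) S t s clopen_simps(2)] by blast
    obtain U a where U: "clopen S U" "s \<in> U" "U \<subseteq> V" "a \<in> car (free_presheaf PY) S U" "\<And>t. t \<in> U \<Longrightarrow> \<tau> t = fgerm PY S t U a"
      using Zfree_E[OF E(2) S \<tau> V(2,1)] by blast
    let ?r = "rs (free_presheaf PX) S V U"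
    have r: "?r b \<in> car (free_presheaf PX) S U" "?r b' \<in> car (free_presheaf PX) S U"
      by (rule rs_closed[OF free_XYW(1) S V(1) U(1,3) V(4)], rule rs_closed[OF free_XYW(1) S V(1) U(1,3) V(5)])
    have rb: "\<sigma> s = fgerm PX S s U (?r b)" "\<sigma>' s = fgerm PX S s U (?r b')"
      using germ_rs[OF free_XYW(1) S V(1) U(1,3,2) V(4)] germ_rs[OF free_XYW(1) S V(1) U(1,3,2) V(5)] V(6,7)[OF V(2)] by simp_all
    have rr: "?r b + ?r b' \<in> car (free_presheaf PX) S U" using r Poly_Mapping.keys_add[of "?r b" "?r b'"] by auto
    note m = Zfree_mult_germ[where \<sigma> = \<sigma> and \<tau> = \<sigma>', OF E(1) S U(1,2) r rb]
    note \<tau>s = U(5)[OF U(2)]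
    show "free_mult G W S (\<sigma> \<otimes>\<^bsub>Zfree PX S\<^esub> \<sigma>') \<tau> s = (free_mult G W S \<sigma> \<tau> \<otimes>\<^bsub>Zfree PW S\<^esub> free_mult G W S \<sigma>' \<tau>) s"
      using fm_germ[where \<sigma> = "\<sigma> \<otimes>\<^bsub>Zfree PX S\<^esub> \<sigma>'" and \<tau> = \<tau>, OF U(1,2) rr U(4) m \<tau>s]
        Zfree_mult_germ[where \<sigma> = "free_mult G W S \<sigma> \<tau>" and \<tau> = "free_mult G W S \<sigma>' \<tau>", OF E(3) S U(1,2)
          prd_car[OF U(1) r(1) U(4)] prd_car[OF U(1) r(2) U(4)]
          fm_germ[where \<sigma> = \<sigma> and \<tau> = \<tau>, OF U(1,2) r(1) U(4) rb(1) \<tau>s] fm_germ[where \<sigma> = \<sigma>' and \<tau> = \<tau>, OF U(1,2) r(2) U(4) rb(2) \<tau>s]]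
      by (simp add: prd_add_left)
  qed (use fm_closed \<tau> t Zfree_mult_closed[OF E(1) S] Zfree_mult_closed[OF E(3) S] in auto)
qed (use fm_closed \<tau> in auto)

private lemma fm_one:
  assumes "\<sigma> \<in> carrier (Zfree PX S)" "\<tau> \<in> carrier (Zfree PY S)" "s \<in> topspace S"
    and "\<sigma> s = \<one>\<^bsub>Zfree PX S\<^esub> s \<or> \<tau> s = \<one>\<^bsub>Zfree PY S\<^esub> s"
  shows "free_mult G W S \<sigma> \<tau> s = \<one>\<^bsub>Zfree PW S\<^esub> s"
proof -
  obtain U a b where U: "clopen S U" "s \<in> U" "a \<in> car (free_presheaf PX) S U" "b \<in> car (free_presheaf PY) S U"
    "\<sigma> s = fgerm PX S s U a" "\<tau> s = fgerm PY S s U b"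
    by (rule at2[OF assms(1-3)])
  have 0: "0 \<in> car (free_presheaf PX) S U" "0 \<in> car (free_presheaf PY) S U" by simp_all
  from assms(4) show ?thesis
  proof
    assume "\<sigma> s = \<one>\<^bsub>Zfree PX S\<^esub> s"
    then have "\<sigma> s = fgerm PX S s U 0" using Zfree_one_germ[OF E(1) S U(1,2)] by simp
    from fm_germ[where \<sigma> = \<sigma> and \<tau> = \<tau>, OF U(1,2) 0(1) U(4) this U(6)] show ?thesis
      using Zfree_one_germ[OF E(3) S U(1,2)] by (simp add: prd_0)
  next
    assume "\<tau> s = \<one>\<^bsub>Zfree PY S\<^esub> s"
    then have "\<tau> s = fgerm PY S s U 0" using Zfree_one_germ[OF E(2) S U(1,2)] by simp
    from fm_germ[where \<sigma> = \<sigma> and \<tau> = \<tau>, OF U(1,2,3) 0(2) U(5) this] show ?thesis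
      using Zfree_one_germ[OF E(3) S U(1,2)] by (simp add: prd_0)
  qed
qed

private lemma fm_cong:
  assumes "\<sigma> \<in> carrier (Zfree PX S)" "\<tau> \<in> carrier (Zfree PY S)" "s \<in> topspace S"
    and "\<sigma>' s = \<sigma> s" "\<tau>' s = \<tau> s"
  shows "free_mult G W S \<sigma>' \<tau>' s = free_mult G W S \<sigma> \<tau> s"
proof -
  obtain U a b where U: "clopen S U" "s \<in> U" "a \<in> car (free_presheaf PX) S U" "b \<in> car (free_presheaf PY) S U"
    "\<sigma> s = fgerm PX S s U a" "\<tau> s = fgerm PY S s U b"
    by (rule at2[OF assms(1-3)])
  show ?thesis
    using fm_germ[where \<sigma> = \<sigma> and \<tau> = \<tau>, OF U] fm_germ[where \<sigma> = \<sigma>' and \<tau> = \<tau>', OF U(1-4)] U assms by simp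
qed

text \<open>A product of sections vanishes wherever one factor does. Both forms serve the locality
  clause, which has to be checked in each of the two variables of the product.\<close>

private lemma fm_cut:
  assumes V: "clopen S V" and \<sigma>: "\<sigma> \<in> carrier (Zfree PX S)" and \<tau>: "\<tau> \<in> carrier (Zfree PY S)"
  shows fm_cut_right: "free_mult G W S \<sigma> (cut PY S V \<tau>) = cut PW S V (free_mult G W S \<sigma> \<tau>)"
    and fm_cut_left: "free_mult G W S (cut PX S V \<sigma>) \<tau> = cut PW S V (free_mult G W S \<sigma> \<tau>)"
proof -
  note c = cut_closed[OF E(1) S V \<sigma>] cut_closed[OF E(2) S V \<tau>]
  note cl = cut_closed[OF E(3) S V fm_closed[OF \<sigma> \<tau>]]
  show "free_mult G W S \<sigma> (cut PY S V \<tau>) = cut PW S V (free_mult G W S \<sigma> \<tau>)"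
  proof (rule Zfree_eqI[OF E(3) S fm_closed[OF \<sigma> c(2)] cl])
    fix s assume s: "s \<in> topspace S"
    show "free_mult G W S \<sigma> (cut PY S V \<tau>) s = cut PW S V (free_mult G W S \<sigma> \<tau>) s"
      using fm_cong[OF \<sigma> \<tau> s, of \<sigma> "cut PY S V \<tau>"] fm_one[OF \<sigma> c(2) s] s by (simp add: cut_def)
  qed
  show "free_mult G W S (cut PX S V \<sigma>) \<tau> = cut PW S V (free_mult G W S \<sigma> \<tau>)"
  proof (rule Zfree_eqI[OF E(3) S fm_closed[OF c(1) \<tau>] cl])
    fix s assume s: "s \<in> topspace S"
    show "free_mult G W S (cut PX S V \<sigma>) \<tau> s = cut PW S V (free_mult G W S \<sigma> \<tau>) s"
      using fm_cong[OF \<sigma> \<tau> s, of "cut PX S V \<sigma>" \<tau>] fm_one[OF c(1) \<tau> s] s by (simp add: cut_def)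
  qed
qed

text \<open>Outside the intersection of the supports one factor has zero germ; inside it both are
  single sections and multiply in \<open>G\<close>.\<close>

lemma free_mult_gen:
  assumes U: "clopen S U" "x \<in> X (subtopology S U)" and V: "clopen S V" "y \<in> Y (subtopology S V)"
  shows "free_mult G W S (gen PX S U x) (gen PY S V y) =
    gen PW S (U \<inter> V) (rs G S U (U \<inter> V) x \<otimes>\<^bsub>sec G (subtopology S (U \<inter> V))\<^esub> rs G S V (U \<inter> V) y)"
proof (rule Zfree_eqI[OF E(3) S])
  have UV: "clopen S (U \<inter> V)" using U V clopen_Int by blast
  have g: "gen PX S U x \<in> carrier (Zfree PX S)" "gen PY S V y \<in> carrier (Zfree PY S)"
    using gen_closed[OF E(1) S U(1)] gen_closed[OF E(2) S V(1)] U V by simp_all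
  have r: "rs G S U (U \<inter> V) x \<in> X (subtopology S (U \<inter> V))" "rs G S V (U \<inter> V) y \<in> Y (subtopology S (U \<inter> V))"
    using rs_closed[OF E(1) S U(1) UV, of x] rs_closed[OF E(2) S V(1) UV, of y] U V by simp_all
  show "free_mult G W S (gen PX S U x) (gen PY S V y) \<in> carrier (Zfree PW S)" by (rule fm_closed[OF g])
  show "gen PW S (U \<inter> V) (rs G S U (U \<inter> V) x \<otimes>\<^bsub>sec G (subtopology S (U \<inter> V))\<^esub> rs G S V (U \<inter> V) y) \<in> carrier (Zfree PW S)"
    using gen_closed[OF E(3) S UV] mult_closed[OF UV r] by simp
  fix s assume s: "s \<in> topspace S"
  show "free_mult G W S (gen PX S U x) (gen PY S V y) s =
    gen PW S (U \<inter> V) (rs G S U (U \<inter> V) x \<otimes>\<^bsub>sec G (subtopology S (U \<inter> V))\<^esub> rs G S V (U \<inter> V) y) s"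
  proof (cases "s \<in> U \<inter> V")
    case True
    have "gen PX S U x s = fgerm PX S s (U \<inter> V) (frag_of (rs G S U (U \<inter> V) x))"
      "gen PY S V y s = fgerm PY S s (U \<inter> V) (frag_of (rs G S V (U \<inter> V) y))"
      using loc_rs_germ[OF E(1) S U(1) UV _ True, of "frag_of x"] loc_rs_germ[OF E(2) S V(1) UV _ True, of "frag_of y"] U V
      by (simp_all add: gen_def rs_free)
    from fm_germ[where \<sigma> = "gen PX S U x" and \<tau> = "gen PY S V y", OF UV True _ _ this] r
    show ?thesis using loc_germ(1)[OF E(3) S UV True] by (simp add: gen_def prd_def)
  next
    case False
    then have "gen PX S U x s = \<one>\<^bsub>Zfree PX S\<^esub> s \<or> gen PY S V y s = \<one>\<^bsub>Zfree PY S\<^esub> s"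
      using loc_germ(2)[OF E(1) S U(1), of s] loc_germ(2)[OF E(2) S V(1), of s] s by (auto simp: gen_def)
    then show ?thesis using fm_one[OF g s] loc_germ(2)[OF E(3) S UV, of s] False s by (simp add: gen_def)
  qed
qed

section \<open>The product with coefficients in \<open>R\<close>\<close>

interpretation LW: comm_group LW by (rule comm_group_lin[OF R E(3) S])
interpretation RS: ring "sec R S" by (rule ring_sec[OF R S])

private lemma Rtop_mult:
  assumes "clopen S V" "r \<in> carrier (sec R S)" "r' \<in> carrier (sec R S)"
  shows "Rtop R S V (r \<otimes>\<^bsub>sec R S\<^esub> r') = Rtop R S V r \<otimes>\<^bsub>sec R (subtopology S V)\<^esub> Rtop R S V r'"
  using ring_hom_mult[OF rs_ring_hom[OF R S clopen_simps(2) assms(1) clopen_subset[OF assms(1)]], of r r'] assms by simp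

text \<open>The product on \<open>R[X] \<times> R[Y]\<close> is a lift of lifts. For a pure tensor
  on the left, this map is lifted in the right variable; the lifted value, as a function of the left
  pure tensor, is then lifted once more.\<close>

private definition inner where
  "inner r a = (\<lambda>r' a'. lin_pure R G W S (r \<otimes>\<^bsub>sec R S\<^esub> r') (free_mult G W S a a'))"

private lemma inner_local_bihom:
  assumes r: "r \<in> carrier (sec R S)" and a: "a \<in> carrier (Zfree PX S)"
  shows "local_bihom R PY S LW (inner r a)"
  unfolding local_bihom_def
proof (intro conjI ballI allI impI)
  fix r' assume r': "r' \<in> carrier (sec R S)"
  show "inner r a r' \<in> hom (Zfree PY S) LW"
    using hom_compose[OF fm_hom_right[OF a] lin_pure_hom[OF R E(3) S, of "r \<otimes>\<^bsub>sec R S\<^esub> r'"]] r r'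
    by (simp add: inner_def comp_def del: sec_lin)
next
  fix a' assume a': "a' \<in> carrier (Zfree PY S)"
  have "(\<lambda>r'. r \<otimes>\<^bsub>sec R S\<^esub> r') \<in> hom (add_monoid (sec R S)) (add_monoid (sec R S))"
    using r by (auto simp: hom_def RS.r_distr)
  from hom_compose[OF this lin_pure_hom_left[OF R E(3) S fm_closed[OF a a']]]
  show "(\<lambda>r'. inner r a r' a') \<in> hom (add_monoid (sec R S)) LW" by (simp add: inner_def comp_def del: sec_lin)
next
  fix V r1 r2 a'
  assume V: "clopen S V" and r': "r1 \<in> carrier (sec R S)" "r2 \<in> carrier (sec R S)" "Rtop R S V r1 = Rtop R S V r2"
    and a': "a' \<in> carrier (Zfree PY S)"
  have "Rtop R S V (r \<otimes>\<^bsub>sec R S\<^esub> r1) = Rtop R S V (r \<otimes>\<^bsub>sec R S\<^esub> r2)" using Rtop_mult[OF V r] r' by simp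
  then show "inner r a r1 (cut PY S V a') = inner r a r2 (cut PY S V a')"
    using lin_pure_local[OF R E(3) S V _ _ _ fm_closed[OF a a'], of "r \<otimes>\<^bsub>sec R S\<^esub> r1" "r \<otimes>\<^bsub>sec R S\<^esub> r2"] r r'
    by (simp add: inner_def fm_cut_right[OF V a a'])
qed

private lemma inner_lift:
  assumes r: "r \<in> carrier (sec R S)" and a: "a \<in> carrier (Zfree PX S)"
  shows "tensor_lift LW (inner r a) \<in> hom LY LW"
    and "\<And>r' a'. r' \<in> carrier (sec R S) \<Longrightarrow> a' \<in> carrier (Zfree PY S) \<Longrightarrow>
      tensor_lift LW (inner r a) (lin_pure R G Y S r' a') = lin_pure R G W S (r \<otimes>\<^bsub>sec R S\<^esub> r') (free_mult G W S a a')"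
  using lin_lift[OF R E(2) S LW.comm_group_axioms inner_local_bihom[OF r a]] by (simp_all add: inner_def del: sec_lin)

private lemma LY_eqI:
  assumes "h \<in> hom LY LW" "h' \<in> hom LY LW" "u \<in> carrier LY"
    "\<And>r a. r \<in> carrier (sec R S) \<Longrightarrow> a \<in> carrier (Zfree PY S) \<Longrightarrow> h (lin_pure R G Y S r a) = h' (lin_pure R G Y S r a)"
  shows "h u = h' u"
  by (rule hom_eq_on_generators[OF comm_group.axioms(2)[OF comm_group_lin[OF R E(2) S]] LW.is_group
      lin_generates_pure[OF R E(2) S] assms(1,2) _ assms(3)])
     (use assms(4) in blast)

text \<open>Each clause compares homomorphisms in \<open>u\<close>, so it can be tested on pure
  tensors, where the inner lift has an explicit value.\<close>

private lemma outer_local_bihom: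
  assumes u: "u \<in> carrier LY"
  shows "local_bihom R PX S LW (\<lambda>r a. tensor_lift LW (inner r a) u)"
  unfolding local_bihom_def
proof (intro conjI ballI allI impI)
  fix r assume r: "r \<in> carrier (sec R S)"
  show "(\<lambda>a. tensor_lift LW (inner r a) u) \<in> hom (Zfree PX S) LW"
  proof (rule homI)
    fix a a' assume a: "a \<in> carrier (Zfree PX S)" "a' \<in> carrier (Zfree PX S)"
    note aa = Zfree_mult_closed[OF E(1) S a]
    show "tensor_lift LW (inner r (a \<otimes>\<^bsub>Zfree PX S\<^esub> a')) u = tensor_lift LW (inner r a) u \<otimes>\<^bsub>LW\<^esub> tensor_lift LW (inner r a') u"
    proof (rule LY_eqI[OF inner_lift(1)[OF r aa] hom_pointwise_mult[OF LW.comm_group_axioms inner_lift(1)[OF r a(1)] inner_lift(1)[OF r a(2)]] u])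
      fix r' b assume r': "r' \<in> carrier (sec R S)" and b: "b \<in> carrier (Zfree PY S)"
      have rr: "r \<otimes>\<^bsub>sec R S\<^esub> r' \<in> carrier (sec R S)" using r r' by simp
      show "tensor_lift LW (inner r (a \<otimes>\<^bsub>Zfree PX S\<^esub> a')) (lin_pure R G Y S r' b) =
          tensor_lift LW (inner r a) (lin_pure R G Y S r' b) \<otimes>\<^bsub>LW\<^esub> tensor_lift LW (inner r a') (lin_pure R G Y S r' b)"
        unfolding inner_lift(2)[OF r aa r' b] inner_lift(2)[OF r a(1) r' b] inner_lift(2)[OF r a(2) r' b]
          hom_mult[OF fm_hom_left[OF b] a]
        by (rule hom_mult[OF lin_pure_hom[OF R E(3) S rr] fm_closed[OF a(1) b] fm_closed[OF a(2) b]])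
    qed
  qed (rule hom_in_carrier[OF inner_lift(1)[OF r] u])
next
  fix a assume a: "a \<in> carrier (Zfree PX S)"
  show "(\<lambda>r. tensor_lift LW (inner r a) u) \<in> hom (add_monoid (sec R S)) LW"
  proof (rule homI)
    fix r1 r2 assume "r1 \<in> carrier (add_monoid (sec R S))" "r2 \<in> carrier (add_monoid (sec R S))"
    then have r: "r1 \<in> carrier (sec R S)" "r2 \<in> carrier (sec R S)" "r1 \<oplus>\<^bsub>sec R S\<^esub> r2 \<in> carrier (sec R S)" by simp_all
    have "tensor_lift LW (inner (r1 \<oplus>\<^bsub>sec R S\<^esub> r2) a) u = tensor_lift LW (inner r1 a) u \<otimes>\<^bsub>LW\<^esub> tensor_lift LW (inner r2 a) u"
    proof (rule LY_eqI[OF inner_lift(1)[OF r(3) a] hom_pointwise_mult[OF LW.comm_group_axioms inner_lift(1)[OF r(1) a] inner_lift(1)[OF r(2) a]] u])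
      fix r' b assume r': "r' \<in> carrier (sec R S)" and b: "b \<in> carrier (Zfree PY S)"
      have rr: "r1 \<otimes>\<^bsub>sec R S\<^esub> r' \<in> carrier (add_monoid (sec R S))" "r2 \<otimes>\<^bsub>sec R S\<^esub> r' \<in> carrier (add_monoid (sec R S))"
        using r r' by simp_all
      show "tensor_lift LW (inner (r1 \<oplus>\<^bsub>sec R S\<^esub> r2) a) (lin_pure R G Y S r' b) =
          tensor_lift LW (inner r1 a) (lin_pure R G Y S r' b) \<otimes>\<^bsub>LW\<^esub> tensor_lift LW (inner r2 a) (lin_pure R G Y S r' b)"
        unfolding inner_lift(2)[OF r(3) a r' b] inner_lift(2)[OF r(1) a r' b] inner_lift(2)[OF r(2) a r' b] RS.l_distr[OF r(1,2) r']
        using hom_mult[OF lin_pure_hom_left[OF R E(3) S fm_closed[OF a b]] rr] by (simp del: sec_lin)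
    qed
    then show "tensor_lift LW (inner (r1 \<otimes>\<^bsub>add_monoid (sec R S)\<^esub> r2) a) u =
        tensor_lift LW (inner r1 a) u \<otimes>\<^bsub>LW\<^esub> tensor_lift LW (inner r2 a) u" by (simp del: sec_lin)
  next
    fix r assume "r \<in> carrier (add_monoid (sec R S))"
    then show "tensor_lift LW (inner r a) u \<in> carrier LW"
      using hom_in_carrier[OF inner_lift(1)[OF _ a] u, of r] by (simp del: sec_lin)
  qed
next
  fix V r1 r2 a
  assume V: "clopen S V" and r: "r1 \<in> carrier (sec R S)" "r2 \<in> carrier (sec R S)" "Rtop R S V r1 = Rtop R S V r2"
    and a: "a \<in> carrier (Zfree PX S)"
  note ca = cut_closed[OF E(1) S V a]
  show "tensor_lift LW (inner r1 (cut PX S V a)) u = tensor_lift LW (inner r2 (cut PX S V a)) u"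
  proof (rule LY_eqI[OF inner_lift(1)[OF r(1) ca] inner_lift(1)[OF r(2) ca] u])
    fix r' b assume r': "r' \<in> carrier (sec R S)" and b: "b \<in> carrier (Zfree PY S)"
    have "Rtop R S V (r1 \<otimes>\<^bsub>sec R S\<^esub> r') = Rtop R S V (r2 \<otimes>\<^bsub>sec R S\<^esub> r')" using Rtop_mult[OF V _ r'] r by simp
    then show "tensor_lift LW (inner r1 (cut PX S V a)) (lin_pure R G Y S r' b) = tensor_lift LW (inner r2 (cut PX S V a)) (lin_pure R G Y S r' b)"
      unfolding inner_lift(2)[OF r(1) ca r' b] inner_lift(2)[OF r(2) ca r' b] fm_cut_left[OF V a b]
      using r r' by (intro lin_pure_local[OF R E(3) S V _ _ _ fm_closed[OF a b]]) simp_all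
  qed
qed

private lemma lin_mult_eq: "lin_mult R G W S t u = tensor_lift LW (\<lambda>r a. tensor_lift LW (inner r a) u) t"
  by (simp add: lin_mult_def inner_def)

lemma lin_mult_hom_left: "u \<in> carrier LY \<Longrightarrow> (\<lambda>t. lin_mult R G W S t u) \<in> hom LX LW"
  using lin_lift_hom[OF R E(1) S LW.comm_group_axioms outer_local_bihom] unfolding lin_mult_eq by blast

private lemma lin_mult_pure_left:
  "u \<in> carrier LY \<Longrightarrow> r \<in> carrier (sec R S) \<Longrightarrow> a \<in> carrier (Zfree PX S) \<Longrightarrow>
   lin_mult R G W S (lin_pure R G X S r a) u = tensor_lift LW (inner r a) u"
  using lin_lift_pure[OF R E(1) S LW.comm_group_axioms outer_local_bihom] unfolding lin_mult_eq by blast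

lemma lin_mult_closed: "t \<in> carrier LX \<Longrightarrow> u \<in> carrier LY \<Longrightarrow> lin_mult R G W S t u \<in> carrier LW"
  using hom_in_carrier[OF lin_mult_hom_left] by blast

lemma lin_mult_hom_right:
  assumes t: "t \<in> carrier LX"
  shows "lin_mult R G W S t \<in> hom LY LW"
proof (rule homI)
  interpret LY: comm_group LY by (rule comm_group_lin[OF R E(2) S])
  fix u v assume u: "u \<in> carrier LY" and v: "v \<in> carrier LY"
  have uv: "u \<otimes>\<^bsub>LY\<^esub> v \<in> carrier LY" using u v by (rule LY.m_closed)
  show "lin_mult R G W S t (u \<otimes>\<^bsub>LY\<^esub> v) = lin_mult R G W S t u \<otimes>\<^bsub>LW\<^esub> lin_mult R G W S t v"
  proof (rule hom_eq_on_generators[OF comm_group.axioms(2)[OF comm_group_lin[OF R E(1) S]] LW.is_group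
      lin_generates_pure[OF R E(1) S] lin_mult_hom_left[OF uv]
      hom_pointwise_mult[OF LW.comm_group_axioms lin_mult_hom_left[OF u] lin_mult_hom_left[OF v]] _ t])
    fix q assume "q \<in> {lin_pure R G X S r a |r a. r \<in> carrier (sec R S) \<and> a \<in> carrier (Zfree PX S)}"
    then obtain r a where q: "q = lin_pure R G X S r a" and ra: "r \<in> carrier (sec R S)" "a \<in> carrier (Zfree PX S)" by blast
    show "lin_mult R G W S q (u \<otimes>\<^bsub>LY\<^esub> v) = lin_mult R G W S q u \<otimes>\<^bsub>LW\<^esub> lin_mult R G W S q v"
      unfolding q lin_mult_pure_left[OF uv ra] lin_mult_pure_left[OF u ra] lin_mult_pure_left[OF v ra]
      by (rule hom_mult[OF inner_lift(1)[OF ra] u v])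
  qed
qed (rule lin_mult_closed[OF t])

lemma lin_mult_lgen:
  assumes r: "r \<in> carrier (sec R S)" "r' \<in> carrier (sec R S)"
    and U: "clopen S U" "x \<in> X (subtopology S U)" and V: "clopen S V" "y \<in> Y (subtopology S V)"
  shows "lin_mult R G W S (lgen R G X S r U x) (lgen R G Y S r' V y) =
    lgen R G W S (r \<otimes>\<^bsub>sec R S\<^esub> r') (U \<inter> V)
      (rs G S U (U \<inter> V) x \<otimes>\<^bsub>sec G (subtopology S (U \<inter> V))\<^esub> rs G S V (U \<inter> V) y)"
proof -
  have g: "gen PX S U x \<in> carrier (Zfree PX S)" "gen PY S V y \<in> carrier (Zfree PY S)"
    using gen_closed[OF E(1) S U(1)] gen_closed[OF E(2) S V(1)] U V by simp_all
  have "lin_pure R G Y S r' (gen PY S V y) \<in> carrier LY" by (rule lin_pure_closed[OF R E(2) S r(2) g(2)])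
  then show ?thesis unfolding lgen_def
    using lin_mult_pure_left[OF _ r(1) g(1)] inner_lift(2)[OF r(1) g(1) r(2) g(2)] free_mult_gen[OF U V] by simp
qed

end

section \<open>Inclusions and pullbacks\<close>

context
  fixes R :: "('s, 'r) ring_presheaf" and G :: "('s, 'g) group_presheaf" and X W :: "'s topology \<Rightarrow> 'g set"
    and S :: "'s topology"
  assumes R: "condensed_ring R" and X: "condensed_subset G X" and W: "condensed_subset G W"
    and XW: "\<forall>S\<in>CHED. X S \<subseteq> W S" and S: "S \<in> CHED"
begin

private abbreviation "JX \<equiv> sub_presheaf G X"
private abbreviation "JW \<equiv> sub_presheaf G W"
private abbreviation "incl \<equiv> sheafify_op1 (free_presheaf JW) (\<lambda>_ c. c) S"

private lemma JE: "functorial JX" "functorial JW" using X W by (simp_all add: condensed_subset_def)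
private lemma JF: "functorial (free_presheaf JX)" "functorial (free_presheaf JW)" using JE functorial_free by auto

private lemma Jnat: "natural_op1 (free_presheaf JX) (free_presheaf JW) S (\<lambda>_ c. c)"
  unfolding natural_op1_def using XW[rule_format, OF sub_CHED[OF S]] order_trans by (simp add: rs_free) blast

private lemma incl_germ:
  assumes "clopen S U" "s \<in> U" "a \<in> car (free_presheaf JX) S U" "\<sigma> s = fgerm JX S s U a"
  shows "incl \<sigma> s = fgerm JW S s U a"
  by (rule sheafify_op1_germ[where \<sigma> = \<sigma>, OF JF S Jnat assms])

private lemma incl_closed: "\<sigma> \<in> carrier (Zfree JX S) \<Longrightarrow> incl \<sigma> \<in> carrier (Zfree JW S)"
  unfolding carrier_Zfree[OF JE(1) S] carrier_Zfree[OF JE(2) S] by (rule sheafify_op1_sections[OF JF S Jnat])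

private lemma car_incl: "clopen S U \<Longrightarrow> a \<in> car (free_presheaf JX) S U \<Longrightarrow> a \<in> car (free_presheaf JW) S U"
  using XW[rule_format, OF sub_CHED[OF S]] by auto

private lemma incl_hom: "incl \<in> hom (Zfree JX S) (Zfree JW S)"
proof (rule homI)
  fix \<sigma> \<tau> assume t: "\<sigma> \<in> carrier (Zfree JX S)" "\<tau> \<in> carrier (Zfree JX S)"
  show "incl (\<sigma> \<otimes>\<^bsub>Zfree JX S\<^esub> \<tau>) = incl \<sigma> \<otimes>\<^bsub>Zfree JW S\<^esub> incl \<tau>"
  proof (rule Zfree_eqI[OF JE(2) S])
    fix s assume s: "s \<in> topspace S"
    obtain U a b where U: "clopen S U" "s \<in> U" "a \<in> car (free_presheaf JX) S U" "b \<in> car (free_presheaf JX) S U"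
        "\<sigma> s = fgerm JX S s U a" "\<tau> s = fgerm JX S s U b"
      by (rule Zfree_at2[OF JE(1) S t s])
    have ab: "a + b \<in> car (free_presheaf JX) S U" using U(3,4) Poly_Mapping.keys_add[of a b] by auto
    show "incl (\<sigma> \<otimes>\<^bsub>Zfree JX S\<^esub> \<tau>) s = (incl \<sigma> \<otimes>\<^bsub>Zfree JW S\<^esub> incl \<tau>) s"
      using incl_germ[where \<sigma> = "\<sigma> \<otimes>\<^bsub>Zfree JX S\<^esub> \<tau>", OF U(1,2) ab Zfree_mult_germ[where \<sigma> = \<sigma> and \<tau> = \<tau>, OF JE(1) S U]]
        Zfree_mult_germ[where \<sigma> = "incl \<sigma>" and \<tau> = "incl \<tau>", OF JE(2) S U(1,2) car_incl[OF U(1,3)] car_incl[OF U(1,4)]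
          incl_germ[where \<sigma> = \<sigma>, OF U(1,2,3,5)] incl_germ[where \<sigma> = \<tau>, OF U(1,2,4,6)]] by simp
  qed (use incl_closed t Zfree_mult_closed[OF JE(1) S] Zfree_mult_closed[OF JE(2) S] in auto)
qed (rule incl_closed)

private lemma incl_one:
  assumes "s \<in> topspace S" "\<sigma> s = \<one>\<^bsub>Zfree JX S\<^esub> s"
  shows "incl \<sigma> s = \<one>\<^bsub>Zfree JW S\<^esub> s"
  using incl_germ[where \<sigma> = \<sigma>, OF clopen_simps(2) assms(1), of 0] assms
    Zfree_one_germ[OF JE(1) S clopen_simps(2) assms(1)] Zfree_one_germ[OF JE(2) S clopen_simps(2) assms(1)] by simp

private lemma incl_cut:
  assumes V: "clopen S V" and \<sigma>: "\<sigma> \<in> carrier (Zfree JX S)"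
  shows "incl (cut JX S V \<sigma>) = cut JW S V (incl \<sigma>)"
proof (rule Zfree_eqI[OF JE(2) S incl_closed[OF cut_closed[OF JE(1) S V \<sigma>]] cut_closed[OF JE(2) S V incl_closed[OF \<sigma>]]])
  fix s assume s: "s \<in> topspace S"
  obtain U a where U: "clopen S U" "s \<in> U" "a \<in> car (free_presheaf JX) S U" "\<sigma> s = fgerm JX S s U a"
    by (rule Zfree_at[OF JE(1) S \<sigma> s])
  show "incl (cut JX S V \<sigma>) s = cut JW S V (incl \<sigma>) s"
  proof (cases "s \<in> V")
    case True
    then show ?thesis
      using incl_germ[where \<sigma> = \<sigma>, OF U] incl_germ[where \<sigma> = "cut JX S V \<sigma>", OF U(1-3)] U(4) s by (simp add: cut_def)
  next
    case False
    then show ?thesis using incl_one[where \<sigma> = "cut JX S V \<sigma>", OF s] s by (simp add: cut_def)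
  qed
qed

private lemma incl_gen:
  assumes U: "clopen S U" and x: "x \<in> X (subtopology S U)"
  shows "incl (gen JX S U x) = gen JW S U x"
proof (rule Zfree_eqI[OF JE(2) S incl_closed])
  have x': "x \<in> W (subtopology S U)" using x XW[rule_format, OF sub_CHED[OF S U]] by blast
  show "gen JX S U x \<in> carrier (Zfree JX S)" "gen JW S U x \<in> carrier (Zfree JW S)"
    using gen_closed[OF JE(1) S U] gen_closed[OF JE(2) S U] x x' by simp_all
  fix s assume s: "s \<in> topspace S"
  show "incl (gen JX S U x) s = gen JW S U x s"
  proof (cases "s \<in> U")
    case True
    then show ?thesis
      using incl_germ[where \<sigma> = "gen JX S U x", OF U True, of "frag_of x"] loc_germ(1)[OF JE(1) S U True] loc_germ(1)[OF JE(2) S U True] x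
      by (simp add: gen_def)
  next
    case False
    then show ?thesis using incl_one[where \<sigma> = "gen JX S U x", OF s] loc_germ(2)[OF JE(1) S U, of s] loc_germ(2)[OF JE(2) S U, of s] s
      by (simp add: gen_def)
  qed
qed

private lemma incl_local_bihom: "local_bihom R JX S (sec (lin R G W) S) (\<lambda>r a. lin_pure R G W S r (incl a))"
  unfolding local_bihom_def
proof (intro conjI ballI allI impI)
  fix r assume "r \<in> carrier (sec R S)"
  from hom_compose[OF incl_hom lin_pure_hom[OF R JE(2) S this]]
  show "(\<lambda>a. lin_pure R G W S r (incl a)) \<in> hom (Zfree JX S) (sec (lin R G W) S)" by (simp add: comp_def del: sec_lin)
next
  fix a assume "a \<in> carrier (Zfree JX S)"
  then show "(\<lambda>r. lin_pure R G W S r (incl a)) \<in> hom (add_monoid (sec R S)) (sec (lin R G W) S)"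
    by (rule lin_pure_hom_left[OF R JE(2) S incl_closed])
next
  fix V r r' a assume *: "clopen S V" "r \<in> carrier (sec R S)" "r' \<in> carrier (sec R S)" "Rtop R S V r = Rtop R S V r'"
    "a \<in> carrier (Zfree JX S)"
  show "lin_pure R G W S r (incl (cut JX S V a)) = lin_pure R G W S r' (incl (cut JX S V a))"
    unfolding incl_cut[OF *(1,5)] by (rule lin_pure_local[OF R JE(2) S *(1-4) incl_closed[OF *(5)]])
qed

lemma lin_incl_hom: "lin_incl R G W S \<in> hom (sec (lin R G X) S) (sec (lin R G W) S)"
  using lin_lift_hom[OF R JE(1) S comm_group_lin[OF R JE(2) S] incl_local_bihom] unfolding lin_incl_def[abs_def] .

lemma lin_incl_lgen:
  "r \<in> carrier (sec R S) \<Longrightarrow> clopen S U \<Longrightarrow> x \<in> X (subtopology S U) \<Longrightarrow>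
   lin_incl R G W S (lgen R G X S r U x) = lgen R G W S r U x"
  using lin_lift_pure[OF R JE(1) S comm_group_lin[OF R JE(2) S] incl_local_bihom, of r "gen JX S U x"] gen_in[OF R JE(1) S, of U x]
    incl_gen[of U x] unfolding lin_incl_def lgen_def by simp

end

lemma pull_top: "continuous_map S T f \<Longrightarrow> pull f S (topspace T) = topspace S"
  by (auto simp: pull_def continuous_map_def)

lemma fres_top: "continuous_map S T f \<Longrightarrow> fres X S T f (topspace T) = res X S T f"
  by (simp add: fres_def pull_top)

section \<open>Pullback of \<open>R[X]\<close> along a continuous map\<close>

context
  fixes R :: "('s, 'r) ring_presheaf" and G :: "('s, 'g) group_presheaf" and X :: "'s topology \<Rightarrow> 'g set"
    and S T :: "'s topology" and f :: "'s \<Rightarrow> 's"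
  assumes R: "condensed_ring R" and X: "condensed_subset G X"
    and S: "S \<in> CHED" and T: "T \<in> CHED" and f: "continuous_map S T f"
begin

private abbreviation "KX \<equiv> sub_presheaf G X"
private abbreviation "fs \<equiv> res (free_condensed KX) S T f"

private lemma KE: "functorial KX" using X by (simp add: condensed_subset_def)
private lemma KF: "functorial (free_presheaf KX)" using KE functorial_free by auto

private lemma fS: "s \<in> topspace S \<Longrightarrow> f s \<in> topspace T" using f by (auto simp: continuous_map_def)

private lemma fs_germ:
  assumes "s \<in> topspace S" "clopen T U" "f s \<in> U" "a \<in> car (free_presheaf KX) T U" "\<sigma> (f s) = fgerm KX T (f s) U a"
  shows "fs \<sigma> s = fgerm KX S s (pull f S U) (fres (free_presheaf KX) S T f U a)"
  unfolding free_condensed_def by (rule sheafify_res_germ[where \<sigma> = \<sigma>, OF KF S T f assms])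

private lemma fs_closed: "\<sigma> \<in> carrier (Zfree KX T) \<Longrightarrow> fs \<sigma> \<in> carrier (Zfree KX S)"
  unfolding carrier_Zfree[OF KE S] carrier_Zfree[OF KE T] unfolding free_condensed_def
  by (rule sheafify_res_sections[OF KF S T f])

private lemma fs_hom: "fs \<in> hom (Zfree KX T) (Zfree KX S)"
proof (rule homI)
  fix \<sigma> \<tau> assume t: "\<sigma> \<in> carrier (Zfree KX T)" "\<tau> \<in> carrier (Zfree KX T)"
  show "fs (\<sigma> \<otimes>\<^bsub>Zfree KX T\<^esub> \<tau>) = fs \<sigma> \<otimes>\<^bsub>Zfree KX S\<^esub> fs \<tau>"
  proof (rule Zfree_eqI[OF KE S])
    fix s assume s: "s \<in> topspace S"
    obtain U a b where U: "clopen T U" "f s \<in> U" "a \<in> car (free_presheaf KX) T U" "b \<in> car (free_presheaf KX) T U"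
        "\<sigma> (f s) = fgerm KX T (f s) U a" "\<tau> (f s) = fgerm KX T (f s) U b"
      by (rule Zfree_at2[OF KE T t fS[OF s]])
    have ab: "a + b \<in> car (free_presheaf KX) T U" using U(3,4) Poly_Mapping.keys_add[of a b] by auto
    have P: "clopen S (pull f S U)" "s \<in> pull f S U" using clopen_pull[OF f U(1)] s U(2) by (simp_all add: pull_def)
    show "fs (\<sigma> \<otimes>\<^bsub>Zfree KX T\<^esub> \<tau>) s = (fs \<sigma> \<otimes>\<^bsub>Zfree KX S\<^esub> fs \<tau>) s"
      using fs_germ[where \<sigma> = "\<sigma> \<otimes>\<^bsub>Zfree KX T\<^esub> \<tau>", OF s U(1,2) ab Zfree_mult_germ[where \<sigma> = \<sigma> and \<tau> = \<tau>, OF KE T U]]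
        Zfree_mult_germ[where \<sigma> = "fs \<sigma>" and \<tau> = "fs \<tau>", OF KE S P fres_closed[OF KF S T f U(1,3)] fres_closed[OF KF S T f U(1,4)]
          fs_germ[where \<sigma> = \<sigma>, OF s U(1,2,3,5)] fs_germ[where \<sigma> = \<tau>, OF s U(1,2,4,6)]]
      by (simp add: fres_free frag_extend_add)
  qed (use fs_closed t Zfree_mult_closed[OF KE S] Zfree_mult_closed[OF KE T] in auto)
qed (rule fs_closed)

private lemma fs_one:
  assumes s: "s \<in> topspace S" and \<sigma>: "\<sigma> (f s) = \<one>\<^bsub>Zfree KX T\<^esub> (f s)"
  shows "fs \<sigma> s = \<one>\<^bsub>Zfree KX S\<^esub> s"
  using fs_germ[where \<sigma> = \<sigma>, OF s clopen_simps(2) fS[OF s], of 0] \<sigma>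
    Zfree_one_germ[OF KE T clopen_simps(2) fS[OF s]] Zfree_one_germ[OF KE S clopen_simps(2) s]
  by (simp add: fres_free pull_top[OF f])

private lemma fs_cut:
  assumes V: "clopen T V" and \<sigma>: "\<sigma> \<in> carrier (Zfree KX T)"
  shows "fs (cut KX T V \<sigma>) = cut KX S (pull f S V) (fs \<sigma>)"
proof (rule Zfree_eqI[OF KE S fs_closed[OF cut_closed[OF KE T V \<sigma>]] cut_closed[OF KE S clopen_pull[OF f V] fs_closed[OF \<sigma>]]])
  fix s assume s: "s \<in> topspace S"
  obtain U a where U: "clopen T U" "f s \<in> U" "a \<in> car (free_presheaf KX) T U" "\<sigma> (f s) = fgerm KX T (f s) U a"
    by (rule Zfree_at[OF KE T \<sigma> fS[OF s]])
  show "fs (cut KX T V \<sigma>) s = cut KX S (pull f S V) (fs \<sigma>) s"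
  proof (cases "f s \<in> V")
    case True
    then show ?thesis
      using fs_germ[where \<sigma> = \<sigma>, OF s U] fs_germ[where \<sigma> = "cut KX T V \<sigma>", OF s U(1-3)] U(4) s fS[OF s] by (simp add: cut_def pull_def)
  next
    case False
    then show ?thesis using fs_one[where \<sigma> = "cut KX T V \<sigma>", OF s] s fS[OF s] by (simp add: cut_def pull_def)
  qed
qed

private lemma fs_gen:
  assumes U: "clopen T U" and x: "x \<in> X (subtopology T U)"
  shows "fs (gen KX T U x) = gen KX S (pull f S U) (fres G S T f U x)"
proof (rule Zfree_eqI[OF KE S fs_closed])
  note P = clopen_pull[OF f U]
  have x': "fres G S T f U x \<in> X (subtopology S (pull f S U))" using fres_closed[OF KE S T f U, of x] x by simp
  show "gen KX T U x \<in> carrier (Zfree KX T)" "gen KX S (pull f S U) (fres G S T f U x) \<in> carrier (Zfree KX S)"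
    using gen_closed[OF KE T U] gen_closed[OF KE S P] x x' by simp_all
  fix s assume s: "s \<in> topspace S"
  show "fs (gen KX T U x) s = gen KX S (pull f S U) (fres G S T f U x) s"
  proof (cases "f s \<in> U")
    case True
    then have "s \<in> pull f S U" using s by (simp add: pull_def)
    then show ?thesis
      using fs_germ[where \<sigma> = "gen KX T U x", OF s U True, of "frag_of x"] loc_germ(1)[OF KE T U True] loc_germ(1)[OF KE S P] x
      by (simp add: gen_def fres_free)
  next
    case False
    then have "s \<in> topspace S - pull f S U" using s by (simp add: pull_def)
    then show ?thesis using fs_one[where \<sigma> = "gen KX T U x", OF s] loc_germ(2)[OF KE T U, of "f s"] loc_germ(2)[OF KE S P, of s] s fS[OF s] False
      by (simp add: gen_def)
  qed
qed

private lemma res_local_bihom: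
  "local_bihom R KX T (sec (lin R G X) S) (\<lambda>r a. lin_pure R G X S (res R S T f r) (fs a))"
  unfolding local_bihom_def
proof (intro conjI ballI allI impI)
  have rc: "res R S T f r \<in> carrier (sec R S)" if "r \<in> carrier (sec R T)" for r
    using ring_hom_closed[OF res_ring_hom[OF R S T f] that] .
  {
    fix r assume "r \<in> carrier (sec R T)"
    from hom_compose[OF fs_hom lin_pure_hom[OF R KE S rc[OF this]]]
    show "(\<lambda>a. lin_pure R G X S (res R S T f r) (fs a)) \<in> hom (Zfree KX T) (sec (lin R G X) S)"
      by (simp add: comp_def del: sec_lin)
  next
    fix a assume a: "a \<in> carrier (Zfree KX T)"
    have "res R S T f \<in> hom (add_monoid (sec R T)) (add_monoid (sec R S))"
      using res_ring_hom[OF R S T f] by (auto simp: ring_hom_def hom_def)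
    from hom_compose[OF this lin_pure_hom_left[OF R KE S fs_closed[OF a]]]
    show "(\<lambda>r. lin_pure R G X S (res R S T f r) (fs a)) \<in> hom (add_monoid (sec R T)) (sec (lin R G X) S)"
      by (simp add: comp_def del: sec_lin)
  next
    fix V r r' a assume *: "clopen T V" "r \<in> carrier (sec R T)" "r' \<in> carrier (sec R T)" "Rtop R T V r = Rtop R T V r'"
      "a \<in> carrier (Zfree KX T)"
    \<comment> \<open>Coefficients that agree on \<open>V\<close> have pullbacks that agree on the
      preimage of \<open>V\<close>, where the pullback of the cut section is supported.\<close>
    have "Rtop R S (pull f S V) (res R S T f q) = fres R S T f V (Rtop R T V q)" if "q \<in> carrier (sec R T)" for q
      using rs_fres[OF functorial_ring[OF R] S T f clopen_simps(2) *(1) clopen_subset[OF *(1)], of q] that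
      by (simp add: pull_top[OF f] fres_top[OF f])
    then have "Rtop R S (pull f S V) (res R S T f r) = Rtop R S (pull f S V) (res R S T f r')" using * by simp
    then show "lin_pure R G X S (res R S T f r) (fs (cut KX T V a)) = lin_pure R G X S (res R S T f r') (fs (cut KX T V a))"
      unfolding fs_cut[OF *(1,5)]
      by (rule lin_pure_local[OF R KE S clopen_pull[OF f *(1)] rc[OF *(2)] rc[OF *(3)] _ fs_closed[OF *(5)]])
  }
qed

private lemma res_lin: "res (lin R G X) S T f = tensor_lift (sec (lin R G X) S) (\<lambda>r a. lin_pure R G X S (res R S T f r) (fs a))"
  unfolding lin_pure_def sec_lin by (simp add: lin_def condensed_tensor_def)

lemma res_lin_hom: "res (lin R G X) S T f \<in> hom (sec (lin R G X) T) (sec (lin R G X) S)"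
  using lin_lift_hom[OF R KE T comm_group_lin[OF R KE S] res_local_bihom] unfolding res_lin .

lemma res_lin_lgen:
  "r \<in> carrier (sec R T) \<Longrightarrow> clopen T U \<Longrightarrow> x \<in> X (subtopology T U) \<Longrightarrow>
   res (lin R G X) S T f (lgen R G X T r U x) = lgen R G X S (res R S T f r) (pull f S U) (fres G S T f U x)"
  using lin_lift_pure[OF R KE T comm_group_lin[OF R KE S] res_local_bihom, of r "gen KX T U x"] gen_in[OF R KE T, of U x]
    fs_gen[of U x] unfolding res_lin lgen_def by simp

end

text \<open>From here on \<open>R[X]\<close> is handled through its generators \<open>lgen\<close>
  and its universal property; unfolding it into a tensor group would only expose the
  construction.\<close>

declare sec_lin [simp del]

lemma bihom_eq_on_generators:
  assumes A1: "group A1" "generates A1 Q1" and A2: "group A2" "generates A2 Q2" and B: "group B"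
    and f: "\<And>x. x \<in> carrier A1 \<Longrightarrow> f x \<in> hom A2 B" "\<And>y. y \<in> carrier A2 \<Longrightarrow> (\<lambda>x. f x y) \<in> hom A1 B"
    and f': "\<And>x. x \<in> carrier A1 \<Longrightarrow> f' x \<in> hom A2 B" "\<And>y. y \<in> carrier A2 \<Longrightarrow> (\<lambda>x. f' x y) \<in> hom A1 B"
    and eq: "\<And>p q. p \<in> Q1 \<Longrightarrow> q \<in> Q2 \<Longrightarrow> f p q = f' p q"
    and xy: "x \<in> carrier A1" "y \<in> carrier A2"
  shows "f x y = f' x y"
proof -
  have Q1: "Q1 \<subseteq> carrier A1" using A1 unfolding generates_def by blast
  have "f p y = f' p y" if "p \<in> Q1" for p
    by (rule hom_eq_on_generators[OF A2(1) B A2(2) f(1) f'(1) eq xy(2)]) (use that Q1 in auto)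
  then show ?thesis by (rule hom_eq_on_generators[OF A1(1) B A1(2) f(2)[OF xy(2)] f'(2)[OF xy(2)] _ xy(1)])
qed

section \<open>Associativity and naturality of the products\<close>

context
  fixes R :: "('s, 'r) ring_presheaf" and G :: "('s, 'g) group_presheaf"
  assumes R: "condensed_ring R" and G: "condensed_group G"
begin

private abbreviation "LG \<equiv> \<lambda>X S. sec (lin R G X) S"
private abbreviation "cs \<equiv> condensed_subset G"

private lemma cs_fun: "cs X \<Longrightarrow> functorial (sub_presheaf G X)" by (simp add: condensed_subset_def)

lemma group_lin: "condensed_subset G X \<Longrightarrow> S \<in> CHED \<Longrightarrow> group (sec (lin R G X) S)"
  using comm_group_lin[OF R cs_fun] by (simp add: comm_group.axioms(2))

definition lgens where
  "lgens X S = {lgen R G X S r U x |r U x. r \<in> carrier (sec R S) \<and> (U, x) \<in> all_sections (sub_presheaf G X) S}"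

lemma lin_generates_all: "condensed_subset G X \<Longrightarrow> S \<in> CHED \<Longrightarrow> generates (sec (lin R G X) S) (lgens X S)"
  unfolding lgens_def using lin_generates[OF R cs_fun _ section_basis_all[OF cs_fun]] by blast

lemma lgensE:
  assumes "p \<in> lgens X S"
  obtains r U x where "p = lgen R G X S r U x" "r \<in> carrier (sec R S)" "clopen S U" "x \<in> X (subtopology S U)"
  using assms unfolding lgens_def all_sections_def by auto

lemma mult_intoD:
  "mult_into G X Y W \<Longrightarrow> S \<in> CHED \<Longrightarrow> clopen S U \<Longrightarrow> x \<in> X (subtopology S U) \<Longrightarrow> y \<in> Y (subtopology S U) \<Longrightarrow>
   x \<otimes>\<^bsub>sec G (subtopology S U)\<^esub> y \<in> W (subtopology S U)"
  using sub_CHED by (auto simp: mult_into_def)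

lemma rs_in:
  "condensed_subset G X \<Longrightarrow> S \<in> CHED \<Longrightarrow> clopen S U \<Longrightarrow> clopen S V \<Longrightarrow> V \<subseteq> U \<Longrightarrow> x \<in> X (subtopology S U) \<Longrightarrow>
   rs G S U V x \<in> X (subtopology S V)"
  using rs_closed[OF cs_fun, of X S U V x] by simp

lemma cs_car: "condensed_subset G X \<Longrightarrow> S \<in> CHED \<Longrightarrow> clopen S U \<Longrightarrow> x \<in> X (subtopology S U) \<Longrightarrow> x \<in> carrier (sec G (subtopology S U))"
  using sub_CHED by (auto simp: condensed_subset_def)

lemma rs_mult:
  assumes "S \<in> CHED" "clopen S U" "clopen S V" "V \<subseteq> U" "x \<in> carrier (sec G (subtopology S U))" "y \<in> carrier (sec G (subtopology S U))"
  shows "rs G S U V (x \<otimes>\<^bsub>sec G (subtopology S U)\<^esub> y) = rs G S U V x \<otimes>\<^bsub>sec G (subtopology S V)\<^esub> rs G S U V y"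
  by (rule hom_mult[OF rs_group_hom[OF G assms(1-4)] assms(5,6)])

text \<open>Tested on generators, both sides live on the triple intersection of supports, and
  associativity of \<open>R\<close> and of \<open>G\<close> decides. The intermediate targets
  \<open>P\<close> and \<open>Q\<close> are separate because in the applications the two bracketings
  pass through different subsets of \<open>G\<close>.\<close>

lemma lin_mult_assoc:
  assumes cs: "condensed_subset G X" "condensed_subset G Y" "condensed_subset G V" "condensed_subset G P" "condensed_subset G Q" "condensed_subset G W"
    and m: "mult_into G X Y P" "mult_into G P V W" "mult_into G Y V Q" "mult_into G X Q W" and S: "S \<in> CHED"
    and t: "t \<in> carrier (sec (lin R G X) S)" and u: "u \<in> carrier (sec (lin R G Y) S)" and v: "v \<in> carrier (sec (lin R G V) S)"
  shows "lin_mult R G W S (lin_mult R G P S t u) v = lin_mult R G W S t (lin_mult R G Q S u v)"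
proof -
  interpret RS: ring "sec R S" by (rule ring_sec[OF R S])
  note gl = group_lin[OF cs(1) S] lin_generates_all[OF cs(1) S]
  have "lin_mult R G W S (lin_mult R G P S p u) v = lin_mult R G W S p (lin_mult R G Q S u v)" if p: "p \<in> lgens X S" for p
  proof (rule bihom_eq_on_generators[OF group_lin[OF cs(2) S] lin_generates_all[OF cs(2) S] group_lin[OF cs(3) S]
        lin_generates_all[OF cs(3) S] group_lin[OF cs(6) S] _ _ _ _ _ u v])
    have p': "p \<in> carrier (sec (lin R G X) S)" using gl(2) p by (auto simp: generates_def)
    obtain r U x where q: "p = lgen R G X S r U x" "r \<in> carrier (sec R S)" "clopen S U" "x \<in> X (subtopology S U)"
      by (rule lgensE[OF p])
    show "(\<lambda>v. lin_mult R G W S (lin_mult R G P S p u) v) \<in> hom (LG V S) (LG W S)" if "u \<in> carrier (LG Y S)" for u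
      by (rule lin_mult_hom_right[OF R G cs(4,3,6) m(2) S lin_mult_closed[OF R G cs(1,2,4) m(1) S p' that]])
    show "(\<lambda>u. lin_mult R G W S (lin_mult R G P S p u) v) \<in> hom (LG Y S) (LG W S)" if "v \<in> carrier (LG V S)" for v
      using hom_compose[OF lin_mult_hom_right[OF R G cs(1,2,4) m(1) S p'] lin_mult_hom_left[OF R G cs(4,3,6) m(2) S that]]
      by (simp add: comp_def)
    show "(\<lambda>v. lin_mult R G W S p (lin_mult R G Q S u v)) \<in> hom (LG V S) (LG W S)" if "u \<in> carrier (LG Y S)" for u
      using hom_compose[OF lin_mult_hom_right[OF R G cs(2,3,5) m(3) S that] lin_mult_hom_right[OF R G cs(1,5,6) m(4) S p']]
      by (simp add: comp_def)
    show "(\<lambda>u. lin_mult R G W S p (lin_mult R G Q S u v)) \<in> hom (LG Y S) (LG W S)" if "v \<in> carrier (LG V S)" for v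
      using hom_compose[OF lin_mult_hom_left[OF R G cs(2,3,5) m(3) S that] lin_mult_hom_right[OF R G cs(1,5,6) m(4) S p']]
      by (simp add: comp_def)
    fix p2 p3 assume "p2 \<in> lgens Y S" "p3 \<in> lgens V S"
    then obtain r2 U2 x2 r3 U3 x3 where
      q2: "p2 = lgen R G Y S r2 U2 x2" "r2 \<in> carrier (sec R S)" "clopen S U2" "x2 \<in> Y (subtopology S U2)" and
      q3: "p3 = lgen R G V S r3 U3 x3" "r3 \<in> carrier (sec R S)" "clopen S U3" "x3 \<in> V (subtopology S U3)"
      by (metis lgensE)
    let ?U12 = "U \<inter> U2" and ?U23 = "U2 \<inter> U3" and ?U = "U \<inter> U2 \<inter> U3"
    have c: "clopen S ?U12" "clopen S ?U23" "clopen S ?U" using q q2 q3 by (simp_all add: clopen_Int)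
    have s: "?U12 \<subseteq> U" "?U12 \<subseteq> U2" "?U23 \<subseteq> U2" "?U23 \<subseteq> U3" "?U \<subseteq> U" "?U \<subseteq> U2" "?U \<subseteq> U3" "?U \<subseteq> ?U12" "?U \<subseteq> ?U23" by auto
    note x12 = rs_in[OF cs(1) S q(3) c(1) s(1) q(4)] rs_in[OF cs(2) S q2(3) c(1) s(2) q2(4)]
    note x23 = rs_in[OF cs(2) S q2(3) c(2) s(3) q2(4)] rs_in[OF cs(3) S q3(3) c(2) s(4) q3(4)]
    note y12 = mult_intoD[OF m(1) S c(1) x12]
    note y23 = mult_intoD[OF m(3) S c(2) x23]
    note gx = rs_rs[OF functorial_group[OF G] S]
    interpret GU: group "sec G (subtopology S ?U)" by (rule group_sec[OF G sub_CHED[OF S c(3)]])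
    have e: "U \<inter> ?U23 = ?U" by auto
    have l: "lin_mult R G W S (lin_mult R G P S p p2) p3 =
       lgen R G W S (r \<otimes>\<^bsub>sec R S\<^esub> r2 \<otimes>\<^bsub>sec R S\<^esub> r3) ?U
         (rs G S ?U12 ?U (rs G S U ?U12 x \<otimes>\<^bsub>sec G (subtopology S ?U12)\<^esub> rs G S U2 ?U12 x2) \<otimes>\<^bsub>sec G (subtopology S ?U)\<^esub> rs G S U3 ?U x3)"
      unfolding q(1) q2(1) q3(1) lin_mult_lgen[OF R G cs(1,2,4) m(1) S q(2) q2(2) q(3,4) q2(3,4)]
      using q q2 by (intro lin_mult_lgen[OF R G cs(4,3,6) m(2) S _ q3(2) c(1) y12 q3(3,4)]) simp
    have r: "lin_mult R G W S p (lin_mult R G Q S p2 p3) =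
       lgen R G W S (r \<otimes>\<^bsub>sec R S\<^esub> (r2 \<otimes>\<^bsub>sec R S\<^esub> r3)) (U \<inter> ?U23)
         (rs G S U (U \<inter> ?U23) x \<otimes>\<^bsub>sec G (subtopology S (U \<inter> ?U23))\<^esub>
          rs G S ?U23 (U \<inter> ?U23) (rs G S U2 ?U23 x2 \<otimes>\<^bsub>sec G (subtopology S ?U23)\<^esub> rs G S U3 ?U23 x3))"
      unfolding q(1) q2(1) q3(1) lin_mult_lgen[OF R G cs(2,3,5) m(3) S q2(2) q3(2) q2(3,4) q3(3,4)]
      using q2 q3 by (intro lin_mult_lgen[OF R G cs(1,5,6) m(4) S q(2) _ q(3,4) c(2) y23]) simp
    have g: "x \<in> carrier (sec G (subtopology S U))" "x2 \<in> carrier (sec G (subtopology S U2))" "x3 \<in> carrier (sec G (subtopology S U3))"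
      using cs_car[OF cs(1) S q(3,4)] cs_car[OF cs(2) S q2(3,4)] cs_car[OF cs(3) S q3(3,4)] .
    have g12: "rs G S U ?U12 x \<in> carrier (sec G (subtopology S ?U12))" "rs G S U2 ?U12 x2 \<in> carrier (sec G (subtopology S ?U12))"
      using cs_car[OF cs(1) S c(1) x12(1)] cs_car[OF cs(2) S c(1) x12(2)] .
    have g23: "rs G S U2 ?U23 x2 \<in> carrier (sec G (subtopology S ?U23))" "rs G S U3 ?U23 x3 \<in> carrier (sec G (subtopology S ?U23))"
      using cs_car[OF cs(2) S c(2) x23(1)] cs_car[OF cs(3) S c(2) x23(2)] .
    have gU: "rs G S U ?U x \<in> carrier (sec G (subtopology S ?U))" "rs G S U2 ?U x2 \<in> carrier (sec G (subtopology S ?U))" "rs G S U3 ?U x3 \<in> carrier (sec G (subtopology S ?U))"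
      using rs_closed[OF functorial_group[OF G] S q(3) c(3) s(5) g(1)] rs_closed[OF functorial_group[OF G] S q2(3) c(3) s(6) g(2)]
        rs_closed[OF functorial_group[OF G] S q3(3) c(3) s(7) g(3)] .
    show "lin_mult R G W S (lin_mult R G P S p p2) p3 = lin_mult R G W S p (lin_mult R G Q S p2 p3)"
      unfolding l r e rs_mult[OF S c(1) c(3) s(8) g12] rs_mult[OF S c(2) c(3) s(9) g23]
        gx[OF q(3) c(1) c(3) s(8) s(1) g(1)] gx[OF q2(3) c(1) c(3) s(8) s(2) g(2)]
        gx[OF q2(3) c(2) c(3) s(9) s(3) g(2)] gx[OF q3(3) c(2) c(3) s(9) s(4) g(3)]
      using gU q q2 q3 by (simp add: GU.m_assoc RS.m_assoc)
  qed
  then show ?thesis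
    using hom_compose[OF lin_mult_hom_left[OF R G cs(1,2,4) m(1) S u] lin_mult_hom_left[OF R G cs(4,3,6) m(2) S v]]
      lin_mult_hom_left[OF R G cs(1,5,6) m(4) S lin_mult_closed[OF R G cs(2,3,5) m(3) S u v]]
    by (intro hom_eq_on_generators[OF gl(1) group_lin[OF cs(6) S] gl(2) _ _ _ t, of "\<lambda>t. lin_mult R G W S (lin_mult R G P S t u) v"
          "\<lambda>t. lin_mult R G W S t (lin_mult R G Q S u v)"]) (simp_all add: comp_def)
qed

text \<open>Used to erase the inclusion maps through which \<open>Res\<close> acts.\<close>

lemma lin_mult_incl:
  assumes cs: "condensed_subset G X" "condensed_subset G Y" "condensed_subset G Y'" "condensed_subset G W"
    and m: "mult_into G X Y' W" and YY': "\<forall>S\<in>CHED. Y S \<subseteq> Y' S" and S: "S \<in> CHED"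
    and t: "t \<in> carrier (sec (lin R G X) S)" and u: "u \<in> carrier (sec (lin R G Y) S)"
  shows "lin_mult R G W S t (lin_incl R G Y' S u) = lin_mult R G W S t u"
proof -
  have m': "mult_into G X Y W" using m YY' unfolding mult_into_def by blast
  note ih = lin_incl_hom[OF R cs(2,3) YY' S]
  show ?thesis
  proof (rule bihom_eq_on_generators[OF group_lin[OF cs(1) S] lin_generates_all[OF cs(1) S] group_lin[OF cs(2) S]
        lin_generates_all[OF cs(2) S] group_lin[OF cs(4) S] _ _ _ _ _ t u])
    show "(\<lambda>u. lin_mult R G W S t (lin_incl R G Y' S u)) \<in> hom (LG Y S) (LG W S)" if "t \<in> carrier (LG X S)" for t
      using hom_compose[OF ih lin_mult_hom_right[OF R G cs(1,3,4) m S that]] by (simp add: comp_def)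
    show "(\<lambda>t. lin_mult R G W S t (lin_incl R G Y' S u)) \<in> hom (LG X S) (LG W S)" if "u \<in> carrier (LG Y S)" for u
      by (rule lin_mult_hom_left[OF R G cs(1,3,4) m S hom_in_carrier[OF ih that]])
    show "(\<lambda>u. lin_mult R G W S t u) \<in> hom (LG Y S) (LG W S)" if "t \<in> carrier (LG X S)" for t
      by (rule lin_mult_hom_right[OF R G cs(1,2,4) m' S that])
    show "(\<lambda>t. lin_mult R G W S t u) \<in> hom (LG X S) (LG W S)" if "u \<in> carrier (LG Y S)" for u
      by (rule lin_mult_hom_left[OF R G cs(1,2,4) m' S that])
    fix p q assume "p \<in> lgens X S" "q \<in> lgens Y S"
    then obtain r U x r2 U2 x2 where
      q: "p = lgen R G X S r U x" "r \<in> carrier (sec R S)" "clopen S U" "x \<in> X (subtopology S U)" and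
      q2: "q = lgen R G Y S r2 U2 x2" "r2 \<in> carrier (sec R S)" "clopen S U2" "x2 \<in> Y (subtopology S U2)"
      by (metis lgensE)
    have x2': "x2 \<in> Y' (subtopology S U2)" using q2(4) YY'[rule_format, OF sub_CHED[OF S q2(3)]] by blast
    have "lin_incl R G Y' S q = lgen R G Y' S r2 U2 x2"
      unfolding q2(1) by (rule lin_incl_lgen[OF R cs(2,3) YY' S q2(2-4)])
    then show "lin_mult R G W S p (lin_incl R G Y' S q) = lin_mult R G W S p q"
      unfolding q(1) q2(1) lin_mult_lgen[OF R G cs(1,2,4) m' S q(2) q2(2) q(3,4) q2(3,4)]
      using lin_mult_lgen[OF R G cs(1,3,4) m S q(2) q2(2) q(3,4) q2(3) x2'] by simp
  qed
qed

lemma res_lin_mult: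
  assumes cs: "condensed_subset G X" "condensed_subset G Y" "condensed_subset G W" and m: "mult_into G X Y W"
    and S: "S \<in> CHED" and T: "T \<in> CHED" and f: "continuous_map S T f"
    and t: "t \<in> carrier (sec (lin R G X) T)" and u: "u \<in> carrier (sec (lin R G Y) T)"
  shows "res (lin R G W) S T f (lin_mult R G W T t u) = lin_mult R G W S (res (lin R G X) S T f t) (res (lin R G Y) S T f u)"
proof -
  note rh = res_lin_hom[OF R cs(1) S T f] res_lin_hom[OF R cs(2) S T f] res_lin_hom[OF R cs(3) S T f]
  show ?thesis
  proof (rule bihom_eq_on_generators[OF group_lin[OF cs(1) T] lin_generates_all[OF cs(1) T] group_lin[OF cs(2) T]
        lin_generates_all[OF cs(2) T] group_lin[OF cs(3) S] _ _ _ _ _ t u])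
    show "(\<lambda>u. res (lin R G W) S T f (lin_mult R G W T t u)) \<in> hom (LG Y T) (LG W S)" if "t \<in> carrier (LG X T)" for t
      using hom_compose[OF lin_mult_hom_right[OF R G cs m T that] rh(3)] by (simp add: comp_def)
    show "(\<lambda>t. res (lin R G W) S T f (lin_mult R G W T t u)) \<in> hom (LG X T) (LG W S)" if "u \<in> carrier (LG Y T)" for u
      using hom_compose[OF lin_mult_hom_left[OF R G cs m T that] rh(3)] by (simp add: comp_def)
    show "(\<lambda>u. lin_mult R G W S (res (lin R G X) S T f t) (res (lin R G Y) S T f u)) \<in> hom (LG Y T) (LG W S)" if "t \<in> carrier (LG X T)" for t
      using hom_compose[OF rh(2) lin_mult_hom_right[OF R G cs m S hom_in_carrier[OF rh(1) that]]] by (simp add: comp_def)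
    show "(\<lambda>t. lin_mult R G W S (res (lin R G X) S T f t) (res (lin R G Y) S T f u)) \<in> hom (LG X T) (LG W S)" if "u \<in> carrier (LG Y T)" for u
      using hom_compose[OF rh(1) lin_mult_hom_left[OF R G cs m S hom_in_carrier[OF rh(2) that]]] by (simp add: comp_def)
    fix p q assume "p \<in> lgens X T" "q \<in> lgens Y T"
    then obtain r U x r2 U2 x2 where
      q: "p = lgen R G X T r U x" "r \<in> carrier (sec R T)" "clopen T U" "x \<in> X (subtopology T U)" and
      q2: "q = lgen R G Y T r2 U2 x2" "r2 \<in> carrier (sec R T)" "clopen T U2" "x2 \<in> Y (subtopology T U2)"
      by (metis lgensE)
    let ?V = "U \<inter> U2"
    have V: "clopen T ?V" using q q2 clopen_Int by blast
    interpret RT: ring "sec R T" by (rule ring_sec[OF R T])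
    note rf = ring_hom_closed[OF res_ring_hom[OF R S T f]]
    have x: "x \<in> carrier (sec G (subtopology T U))" "x2 \<in> carrier (sec G (subtopology T U2))"
      using cs_car[OF cs(1) T q(3,4)] cs_car[OF cs(2) T q2(3,4)] .
    have xV: "rs G T U ?V x \<in> X (subtopology T ?V)" "rs G T U2 ?V x2 \<in> Y (subtopology T ?V)"
      using rs_in[OF cs(1) T q(3) V _ q(4)] rs_in[OF cs(2) T q2(3) V _ q2(4)] by auto
    have fx: "fres G S T f U x \<in> X (subtopology S (pull f S U))" "fres G S T f U2 x2 \<in> Y (subtopology S (pull f S U2))"
      using fres_closed[OF cs_fun[OF cs(1)] S T f q(3), of x] fres_closed[OF cs_fun[OF cs(2)] S T f q2(3), of x2] q(4) q2(4) by simp_all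
    have "res (lin R G W) S T f (lin_mult R G W T p q) = lgen R G W S (res R S T f (r \<otimes>\<^bsub>sec R T\<^esub> r2)) (pull f S ?V)
         (fres G S T f ?V (rs G T U ?V x \<otimes>\<^bsub>sec G (subtopology T ?V)\<^esub> rs G T U2 ?V x2))"
      unfolding q(1) q2(1) lin_mult_lgen[OF R G cs m T q(2) q2(2) q(3,4) q2(3,4)]
      using q q2 by (intro res_lin_lgen[OF R cs(3) S T f _ V mult_intoD[OF m T V xV]]) simp
    also have "res R S T f (r \<otimes>\<^bsub>sec R T\<^esub> r2) = res R S T f r \<otimes>\<^bsub>sec R S\<^esub> res R S T f r2"
      by (rule ring_hom_mult[OF res_ring_hom[OF R S T f] q(2) q2(2)])
    also have "fres G S T f ?V (rs G T U ?V x \<otimes>\<^bsub>sec G (subtopology T ?V)\<^esub> rs G T U2 ?V x2) =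
        fres G S T f ?V (rs G T U ?V x) \<otimes>\<^bsub>sec G (subtopology S (pull f S ?V))\<^esub> fres G S T f ?V (rs G T U2 ?V x2)"
      by (rule hom_mult[OF fres_group_hom[OF G S T f V] cs_car[OF cs(1) T V xV(1)] cs_car[OF cs(2) T V xV(2)]])
    also have "fres G S T f ?V (rs G T U ?V x) = rs G S (pull f S U) (pull f S ?V) (fres G S T f U x)"
      using rs_fres[OF functorial_group[OF G] S T f q(3) V _ x(1)] by simp
    also have "fres G S T f ?V (rs G T U2 ?V x2) = rs G S (pull f S U2) (pull f S ?V) (fres G S T f U2 x2)"
      using rs_fres[OF functorial_group[OF G] S T f q2(3) V _ x(2)] by simp
    finally show "res (lin R G W) S T f (lin_mult R G W T p q) = lin_mult R G W S (res (lin R G X) S T f p) (res (lin R G Y) S T f q)"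
      unfolding q(1) q2(1) res_lin_lgen[OF R cs(1) S T f q(2-4)] res_lin_lgen[OF R cs(2) S T f q2(2-4)]
        lin_mult_lgen[OF R G cs m S rf[OF q(2)] rf[OF q2(2)] clopen_pull[OF f q(3)] fx(1) clopen_pull[OF f q2(3)] fx(2)]
      by (simp add: pull_Int)
  qed
qed

end

lemma group_ring_simps [simp]:
  "carrier (sec (group_ring R G H) S) = carrier (sec (lin R G H) S)"
  "ring.add (sec (group_ring R G H) S) = monoid.mult (sec (lin R G H) S)"
  "res (group_ring R G H) = res (lin R G H)"
  by (simp_all add: group_ring_def)

lemma lin_bimodule_simps [simp]:
  "carrier (sec (lin_bimodule R G X) S) = carrier (sec (lin R G X) S)"
  "ring.add (sec (lin_bimodule R G X) S) = monoid.mult (sec (lin R G X) S)"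
  "ring.zero (sec (lin_bimodule R G X) S) = \<one>\<^bsub>sec (lin R G X) S\<^esub>"
  "smult (sec (lin_bimodule R G X) S) = lin_mult R G X S"
  "rsmult (sec (lin_bimodule R G X) S) = lin_mult R G X S"
  "res (lin_bimodule R G X) = res (lin R G X)"
  by (simp_all add: lin_bimodule_def)

section \<open>Tensor products with the modules \<open>R[X]\<close>\<close>

text \<open>What tensoring with \<open>R[X]\<close> uses of a right \<open>R[H]\<close>-module. It
  is phrased for pointwise data, so that the inner tensor product of the formula is an instance just
  like \<open>M\<close>.\<close>

locale right_group_module =
  fixes R :: "('s, 'r) ring_presheaf" and G :: "('s, 'g) group_presheaf" and H :: "'s topology \<Rightarrow> 'g set"
    and N :: "('s, ('s, 'r, 'g) lin, 'm) module_presheaf"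
  assumes R: "condensed_ring R" and G: "condensed_group G" and H: "condensed_subset G H"
    and N_add: "\<And>S. S \<in> CHED \<Longrightarrow> comm_group (add_monoid (sec N S))"
    and N_smult: "\<And>S a. S \<in> CHED \<Longrightarrow> a \<in> carrier (sec (lin R G H) S) \<Longrightarrow>
      smult (sec N S) a \<in> hom (add_monoid (sec N S)) (add_monoid (sec N S))"
    and N_res: "\<And>S T f. S \<in> CHED \<Longrightarrow> T \<in> CHED \<Longrightarrow> continuous_map S T f \<Longrightarrow>
      res N S T f \<in> hom (add_monoid (sec N T)) (add_monoid (sec N S))"
    and N_res_smult: "\<And>S T f a n. S \<in> CHED \<Longrightarrow> T \<in> CHED \<Longrightarrow> continuous_map S T f \<Longrightarrow> a \<in> carrier (sec (lin R G H) T) \<Longrightarrow>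
      n \<in> carrier (sec N T) \<Longrightarrow> res N S T f (smult (sec N T) a n) = smult (sec N S) (res (lin R G H) S T f a) (res N S T f n)"
begin

definition TM :: "('s topology \<Rightarrow> 'g set) \<Rightarrow> 's topology \<Rightarrow> ('m, ('s, 'r, 'g) lin) tensor monoid" where
  "TM X S = tensor_group (sec (group_ring R G H) S) (sec N S) (sec (lin_bimodule R G X) S)"

definition pm :: "('s topology \<Rightarrow> 'g set) \<Rightarrow> 's topology \<Rightarrow> 'm \<Rightarrow> ('s, 'r, 'g) lin \<Rightarrow> ('m, ('s, 'r, 'g) lin) tensor" where
  "pm X S = pure_tensor (sec (group_ring R G H) S) (sec N S) (sec (lin_bimodule R G X) S)"

text \<open>Right multiplication by an element of some \<open>R[Y]\<close>. Since
  \<open>tensor_lift\<close> refers only to its target, one function serves every source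
  \<open>X\<close> with \<open>X Y \<subseteq> Z\<close>: for \<open>X = Z\<close> it gives module
  actions, and for \<open>X = H g\<close>, \<open>Z = G\<close> it gives the multiplication
  map.\<close>

definition ract :: "('s topology \<Rightarrow> 'g set) \<Rightarrow> 's topology \<Rightarrow> ('s, 'r, 'g) lin \<Rightarrow>
    ('m, ('s, 'r, 'g) lin) tensor \<Rightarrow> ('m, ('s, 'r, 'g) lin) tensor" where
  "ract Z S b = tensor_lift (TM Z S) (\<lambda>m t. pm Z S m (lin_mult R G Z S t b))"

definition stable :: "('s topology \<Rightarrow> 'g set) \<Rightarrow> bool" where
  "stable X \<longleftrightarrow> condensed_subset G X \<and> mult_into G H X X"

lemma stableD: "stable X \<Longrightarrow> condensed_subset G X" "stable X \<Longrightarrow> mult_into G H X X"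
  "stable X \<Longrightarrow> functorial (sub_presheaf G X)"
  by (simp_all add: stable_def condensed_subset_def)

lemma N_smult_closed: "S \<in> CHED \<Longrightarrow> a \<in> carrier (sec (lin R G H) S) \<Longrightarrow> m \<in> carrier (sec N S) \<Longrightarrow> smult (sec N S) a m \<in> carrier (sec N S)"
  using hom_in_carrier[OF N_smult, of S a m] by simp

lemma tensorable_TM:
  assumes X: "stable X" and S: "S \<in> CHED"
  shows "tensorable (sec (group_ring R G H) S) (sec N S) (sec (lin_bimodule R G X) S)"
proof -
  interpret M: comm_group "add_monoid (sec N S)" by (rule N_add[OF S])
  interpret L: comm_group "sec (lin R G X) S" by (rule comm_group_lin[OF R stableD(3)[OF X] S])
  show ?thesis unfolding tensorable_def
    using M.m_closed L.m_closed N_smult_closed[OF S] lin_mult_closed[OF R G H stableD(1)[OF X] stableD(1)[OF X] stableD(2)[OF X] S]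
    by simp
qed

lemma comm_group_TM: "stable X \<Longrightarrow> S \<in> CHED \<Longrightarrow> comm_group (TM X S)"
  unfolding TM_def by (rule comm_group_tensor[OF tensorable_TM])

lemma group_TM: "stable X \<Longrightarrow> S \<in> CHED \<Longrightarrow> group (TM X S)"
  using comm_group_TM comm_group.axioms(2) by blast

lemma balanced_map_TM:
  "balanced_map (sec (group_ring R G H) S) (sec N S) (sec (lin_bimodule R G X) S) B f \<longleftrightarrow>
     (\<forall>m\<in>carrier (sec N S). f m \<in> hom (sec (lin R G X) S) B) \<and>
     (\<forall>t\<in>carrier (sec (lin R G X) S). (\<lambda>m. f m t) \<in> hom (add_monoid (sec N S)) B) \<and>
     (\<forall>m\<in>carrier (sec N S). \<forall>a\<in>carrier (sec (lin R G H) S). \<forall>t\<in>carrier (sec (lin R G X) S).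
        f (smult (sec N S) a m) t = f m (lin_mult R G X S a t))"
  unfolding balanced_map_def by simp

context
  fixes X and S :: "'s topology" assumes X: "stable X" and S: "S \<in> CHED"
begin

private lemma bal: "balanced_map (sec (group_ring R G H) S) (sec N S) (sec (lin_bimodule R G X) S) (TM X S) (pm X S)"
  unfolding TM_def pm_def by (rule pure_tensor_balanced_map[OF tensorable_TM[OF X S]])

lemma pm_hom: "m \<in> carrier (sec N S) \<Longrightarrow> pm X S m \<in> hom (sec (lin R G X) S) (TM X S)"
  using bal unfolding balanced_map_TM by blast

lemma pm_hom_left: "t \<in> carrier (sec (lin R G X) S) \<Longrightarrow> (\<lambda>m. pm X S m t) \<in> hom (add_monoid (sec N S)) (TM X S)"
  using bal unfolding balanced_map_TM by blast

lemma pm_balanced: "m \<in> carrier (sec N S) \<Longrightarrow> a \<in> carrier (sec (lin R G H) S) \<Longrightarrow> t \<in> carrier (sec (lin R G X) S) \<Longrightarrow>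
    pm X S (smult (sec N S) a m) t = pm X S m (lin_mult R G X S a t)"
  using bal unfolding balanced_map_TM by blast

lemma pm_closed: "m \<in> carrier (sec N S) \<Longrightarrow> t \<in> carrier (sec (lin R G X) S) \<Longrightarrow> pm X S m t \<in> carrier (TM X S)"
  by (rule hom_in_carrier[OF pm_hom])

lemma TM_generates_pure: "generates (TM X S) {pm X S m t |m t. m \<in> carrier (sec N S) \<and> t \<in> carrier (sec (lin R G X) S)}"
  using tensor_generates[OF tensorable_TM[OF X S]] unfolding TM_def pm_def by simp

lemma TM_generates:
  assumes Q: "generates (sec (lin R G X) S) Q"
  shows "generates (TM X S) {pm X S m t |m t. m \<in> carrier (sec N S) \<and> t \<in> Q}"
  unfolding TM_def pm_def
  by (rule tensor_generates_right[OF tensorable_TM[OF X S]])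
    (use Q group_lin[OF R G stableD(1)[OF X] S] in simp_all)

lemma TM_generates_left:
  assumes P: "generates (add_monoid (sec N S)) P" and Q: "generates (sec (lin R G X) S) Q"
  shows "generates (TM X S) {pm X S m t |m t. m \<in> P \<and> t \<in> Q}"
proof -
  have "Q \<subseteq> carrier (sec (lin R G X) S)" using Q unfolding generates_def by blast
  then have "Q \<subseteq> carrier (sec (lin_bimodule R G X) S)" by simp
  from tensor_generates_left[OF tensorable_TM[OF X S] comm_group.axioms(2)[OF N_add[OF S]] P _ this] TM_generates[OF Q]
  show ?thesis unfolding TM_def pm_def by simp
qed

lemma TM_lift:
  assumes B: "comm_group B"
    and f: "\<And>m. m \<in> carrier (sec N S) \<Longrightarrow> f m \<in> hom (sec (lin R G X) S) B"
      "\<And>t. t \<in> carrier (sec (lin R G X) S) \<Longrightarrow> (\<lambda>m. f m t) \<in> hom (add_monoid (sec N S)) B"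
      "\<And>m a t. m \<in> carrier (sec N S) \<Longrightarrow> a \<in> carrier (sec (lin R G H) S) \<Longrightarrow> t \<in> carrier (sec (lin R G X) S) \<Longrightarrow>
        f (smult (sec N S) a m) t = f m (lin_mult R G X S a t)"
  shows TM_lift_hom: "tensor_lift B f \<in> hom (TM X S) B"
    and TM_lift_pm: "\<And>m t. m \<in> carrier (sec N S) \<Longrightarrow> t \<in> carrier (sec (lin R G X) S) \<Longrightarrow> tensor_lift B f (pm X S m t) = f m t"
proof -
  have "balanced_map (sec (group_ring R G H) S) (sec N S) (sec (lin_bimodule R G X) S) B f"
    unfolding balanced_map_TM using f by blast
  from tensor_lift[OF tensorable_TM[OF X S] B this]
  show "tensor_lift B f \<in> hom (TM X S) B"
    "\<And>m t. m \<in> carrier (sec N S) \<Longrightarrow> t \<in> carrier (sec (lin R G X) S) \<Longrightarrow> tensor_lift B f (pm X S m t) = f m t"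
    unfolding TM_def pm_def by simp_all
qed

lemma TM_hom_eq:
  assumes "group B" "h \<in> hom (TM X S) B" "h' \<in> hom (TM X S) B" "z \<in> carrier (TM X S)"
    and "\<And>m t. m \<in> carrier (sec N S) \<Longrightarrow> t \<in> carrier (sec (lin R G X) S) \<Longrightarrow> h (pm X S m t) = h' (pm X S m t)"
  shows "h z = h' z"
  by (rule hom_eq_on_generators[OF group_TM[OF X S] assms(1) TM_generates_pure assms(2,3) _ assms(4)]) (use assms(5) in blast)

end

text \<open>Balancedness over \<open>R[H]\<close> is the associativity
  \<open>(a t) b = a (t b)\<close>.\<close>

lemma ract:
  assumes X: "stable X" and Z: "stable Z" and Y: "condensed_subset G Y" and m: "mult_into G X Y Z" and S: "S \<in> CHED"
    and b: "b \<in> carrier (sec (lin R G Y) S)"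
  shows ract_hom: "ract Z S b \<in> hom (TM X S) (TM Z S)"
    and ract_pm: "\<And>n t. n \<in> carrier (sec N S) \<Longrightarrow> t \<in> carrier (sec (lin R G X) S) \<Longrightarrow>
      ract Z S b (pm X S n t) = pm Z S n (lin_mult R G Z S t b)"
proof -
  note lh = lin_mult_hom_left[OF R G stableD(1)[OF X] Y stableD(1)[OF Z] m S b]
  have 1: "(\<lambda>t. pm Z S n (lin_mult R G Z S t b)) \<in> hom (sec (lin R G X) S) (TM Z S)" if "n \<in> carrier (sec N S)" for n
    using hom_compose[OF lh pm_hom[OF Z S that]] by (simp add: comp_def)
  have 2: "(\<lambda>n. pm Z S n (lin_mult R G Z S t b)) \<in> hom (add_monoid (sec N S)) (TM Z S)" if "t \<in> carrier (sec (lin R G X) S)" for t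
    by (rule pm_hom_left[OF Z S hom_in_carrier[OF lh that]])
  have 3: "pm Z S (smult (sec N S) a n) (lin_mult R G Z S t b) = pm Z S n (lin_mult R G Z S (lin_mult R G X S a t) b)"
    if "n \<in> carrier (sec N S)" "a \<in> carrier (sec (lin R G H) S)" "t \<in> carrier (sec (lin R G X) S)" for n a t
    using pm_balanced[OF Z S that(1,2) hom_in_carrier[OF lh that(3)]]
      lin_mult_assoc[OF R G H stableD(1)[OF X] Y stableD(1)[OF X] stableD(1)[OF Z] stableD(1)[OF Z] stableD(2)[OF X] m m stableD(2)[OF Z] S that(2,3) b]
    by simp
  show "ract Z S b \<in> hom (TM X S) (TM Z S)"
    unfolding ract_def by (rule TM_lift_hom[OF X S comm_group_TM[OF Z S] 1 2 3])
  show "\<And>n t. n \<in> carrier (sec N S) \<Longrightarrow> t \<in> carrier (sec (lin R G X) S) \<Longrightarrow>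
      ract Z S b (pm X S n t) = pm Z S n (lin_mult R G Z S t b)"
    unfolding ract_def by (rule TM_lift_pm[OF X S comm_group_TM[OF Z S] 1 2 3])
qed

lemma ract_hom_left:
  assumes X: "stable X" and Z: "stable Z" and Y: "condensed_subset G Y" and m: "mult_into G X Y Z" and S: "S \<in> CHED"
    and z: "z \<in> carrier (TM X S)"
  shows "(\<lambda>b. ract Z S b z) \<in> hom (sec (lin R G Y) S) (TM Z S)"
proof (rule homI)
  interpret L: comm_group "sec (lin R G Y) S" using Y by (intro comm_group_lin[OF R _ S]) (simp add: condensed_subset_def)
  fix b c assume b: "b \<in> carrier (sec (lin R G Y) S)" and c: "c \<in> carrier (sec (lin R G Y) S)"
  note bc = L.m_closed[OF b c]
  show "ract Z S (b \<otimes>\<^bsub>sec (lin R G Y) S\<^esub> c) z = ract Z S b z \<otimes>\<^bsub>TM Z S\<^esub> ract Z S c z"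
  proof (rule TM_hom_eq[OF X S group_TM[OF Z S] ract_hom[OF X Z Y m S bc]
      hom_pointwise_mult[OF comm_group_TM[OF Z S] ract_hom[OF X Z Y m S b] ract_hom[OF X Z Y m S c]] z])
    fix n t assume n: "n \<in> carrier (sec N S)" and t: "t \<in> carrier (sec (lin R G X) S)"
    note rh = lin_mult_hom_right[OF R G stableD(1)[OF X] Y stableD(1)[OF Z] m S t]
    show "ract Z S (b \<otimes>\<^bsub>sec (lin R G Y) S\<^esub> c) (pm X S n t) = ract Z S b (pm X S n t) \<otimes>\<^bsub>TM Z S\<^esub> ract Z S c (pm X S n t)"
      unfolding ract_pm[OF X Z Y m S bc n t] ract_pm[OF X Z Y m S b n t] ract_pm[OF X Z Y m S c n t] hom_mult[OF rh b c]
      by (rule hom_mult[OF pm_hom[OF Z S n] hom_in_carrier[OF rh b] hom_in_carrier[OF rh c]])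
  qed
qed (rule hom_in_carrier[OF ract_hom[OF X Z Y m S _] z])

lemma ract_ract:
  assumes X: "stable X" "stable Z" "stable Z'" and Y: "condensed_subset G Y" "condensed_subset G Y'" "condensed_subset G Y''"
    and m: "mult_into G X Y Z" "mult_into G Z Y' Z'" "mult_into G Y Y' Y''" "mult_into G X Y'' Z'" and S: "S \<in> CHED"
    and b: "b \<in> carrier (sec (lin R G Y) S)" "c \<in> carrier (sec (lin R G Y') S)" and z: "z \<in> carrier (TM X S)"
  shows "ract Z' S c (ract Z S b z) = ract Z' S (lin_mult R G Y'' S b c) z"
proof -
  note bc = lin_mult_closed[OF R G Y m(3) S b]
  have "(ract Z' S c \<circ> ract Z S b) z = ract Z' S (lin_mult R G Y'' S b c) z"
  proof (rule TM_hom_eq[OF X(1) S group_TM[OF X(3) S] hom_compose[OF ract_hom[OF X(1,2) Y(1) m(1) S b(1)] ract_hom[OF X(2,3) Y(2) m(2) S b(2)]]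
        ract_hom[OF X(1,3) Y(3) m(4) S bc] z])
    fix n t assume n: "n \<in> carrier (sec N S)" and t: "t \<in> carrier (sec (lin R G X) S)"
    note tb = lin_mult_closed[OF R G stableD(1)[OF X(1)] Y(1) stableD(1)[OF X(2)] m(1) S t b(1)]
    show "(ract Z' S c \<circ> ract Z S b) (pm X S n t) = ract Z' S (lin_mult R G Y'' S b c) (pm X S n t)"
      unfolding comp_apply ract_pm[OF X(1,2) Y(1) m(1) S b(1) n t] ract_pm[OF X(2,3) Y(2) m(2) S b(2) n tb] ract_pm[OF X(1,3) Y(3) m(4) S bc n t]
        lin_mult_assoc[OF R G stableD(1)[OF X(1)] Y(1,2) stableD(1)[OF X(2)] Y(3) stableD(1)[OF X(3)] m S t b] ..
  qed
  then show ?thesis by simp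
qed

lemma ract_incl:
  assumes X: "stable X" and Z: "stable Z" and Y: "condensed_subset G Y" "condensed_subset G Y'"
    and m: "mult_into G X Y' Z" and YY': "\<forall>S\<in>CHED. Y S \<subseteq> Y' S" and S: "S \<in> CHED"
    and b: "b \<in> carrier (sec (lin R G Y) S)" and z: "z \<in> carrier (TM X S)"
  shows "ract Z S (lin_incl R G Y' S b) z = ract Z S b z"
proof -
  have m': "mult_into G X Y Z" using m YY' unfolding mult_into_def by blast
  note ib = hom_in_carrier[OF lin_incl_hom[OF R Y YY' S] b]
  show ?thesis
  proof (rule TM_hom_eq[OF X S group_TM[OF Z S] ract_hom[OF X Z Y(2) m S ib] ract_hom[OF X Z Y(1) m' S b] z])
    fix n t assume n: "n \<in> carrier (sec N S)" and t: "t \<in> carrier (sec (lin R G X) S)"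
    show "ract Z S (lin_incl R G Y' S b) (pm X S n t) = ract Z S b (pm X S n t)"
      unfolding ract_pm[OF X Z Y(2) m S ib n t] ract_pm[OF X Z Y(1) m' S b n t]
        lin_mult_incl[OF R G stableD(1)[OF X] Y stableD(1)[OF Z] m YY' S t b] ..
  qed
qed

abbreviation "TN X \<equiv> condensed_tensor_bimodule (group_ring R G H) N (lin_bimodule R G X)"

lemma TN_simps:
  "carrier (sec (TN X) S) = carrier (TM X S)" "ring.add (sec (TN X) S) = monoid.mult (TM X S)"
  "ring.zero (sec (TN X) S) = \<one>\<^bsub>TM X S\<^esub>" "smult (sec (TN X) S) = ract X S"
  by (simp_all add: condensed_tensor_bimodule_def condensed_tensor_def TM_def pm_def ract_def fun_eq_iff)

lemma TN_res: "res (TN X) S T f = tensor_lift (TM X S) (\<lambda>m t. pm X S (res N S T f m) (res (lin R G X) S T f t))"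
  by (simp add: condensed_tensor_bimodule_def condensed_tensor_def TM_def pm_def)

section \<open>Pullback of the tensor products along a continuous map\<close>

context
  fixes S T :: "'s topology" and f :: "'s \<Rightarrow> 's"
  assumes S: "S \<in> CHED" and T: "T \<in> CHED" and f: "continuous_map S T f"
begin

private lemma rc: "n \<in> carrier (sec N T) \<Longrightarrow> res N S T f n \<in> carrier (sec N S)"
  using hom_in_carrier[OF N_res[OF S T f], of n] by simp

lemma res_TN:
  assumes X: "stable X"
  shows res_TN_hom: "res (TN X) S T f \<in> hom (TM X T) (TM X S)"
    and res_TN_pm: "\<And>n t. n \<in> carrier (sec N T) \<Longrightarrow> t \<in> carrier (sec (lin R G X) T) \<Longrightarrow>
      res (TN X) S T f (pm X T n t) = pm X S (res N S T f n) (res (lin R G X) S T f t)"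
proof -
  note lh = res_lin_hom[OF R stableD(1)[OF X] S T f]
  have 1: "(\<lambda>t. pm X S (res N S T f n) (res (lin R G X) S T f t)) \<in> hom (sec (lin R G X) T) (TM X S)" if "n \<in> carrier (sec N T)" for n
    using hom_compose[OF lh pm_hom[OF X S rc[OF that]]] by (simp add: comp_def)
  have 2: "(\<lambda>n. pm X S (res N S T f n) (res (lin R G X) S T f t)) \<in> hom (add_monoid (sec N T)) (TM X S)" if "t \<in> carrier (sec (lin R G X) T)" for t
    using hom_compose[OF N_res[OF S T f] pm_hom_left[OF X S hom_in_carrier[OF lh that]]] by (simp add: comp_def)
  have 3: "pm X S (res N S T f (smult (sec N T) a n)) (res (lin R G X) S T f t) =
      pm X S (res N S T f n) (res (lin R G X) S T f (lin_mult R G X T a t))"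
    if "n \<in> carrier (sec N T)" "a \<in> carrier (sec (lin R G H) T)" "t \<in> carrier (sec (lin R G X) T)" for n a t
    unfolding N_res_smult[OF S T f that(2,1)] res_lin_mult[OF R G H stableD(1)[OF X] stableD(1)[OF X] stableD(2)[OF X] S T f that(2,3)]
    by (rule pm_balanced[OF X S rc[OF that(1)] hom_in_carrier[OF res_lin_hom[OF R H S T f] that(2)] hom_in_carrier[OF lh that(3)]])
  show "res (TN X) S T f \<in> hom (TM X T) (TM X S)"
    unfolding TN_res by (rule TM_lift_hom[OF X T comm_group_TM[OF X S] 1 2 3])
  show "\<And>n t. n \<in> carrier (sec N T) \<Longrightarrow> t \<in> carrier (sec (lin R G X) T) \<Longrightarrow>
      res (TN X) S T f (pm X T n t) = pm X S (res N S T f n) (res (lin R G X) S T f t)"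
    unfolding TN_res by (rule TM_lift_pm[OF X T comm_group_TM[OF X S] 1 2 3])
qed

lemma res_ract:
  assumes X: "stable X" and Z: "stable Z" and Y: "condensed_subset G Y" and m: "mult_into G X Y Z"
    and b: "b \<in> carrier (sec (lin R G Y) T)" and z: "z \<in> carrier (TM X T)"
  shows "res (TN Z) S T f (ract Z T b z) = ract Z S (res (lin R G Y) S T f b) (res (TN X) S T f z)"
proof -
  note fb = hom_in_carrier[OF res_lin_hom[OF R Y S T f] b]
  have "(res (TN Z) S T f \<circ> ract Z T b) z = (ract Z S (res (lin R G Y) S T f b) \<circ> res (TN X) S T f) z"
  proof (rule TM_hom_eq[OF X T group_TM[OF Z S] hom_compose[OF ract_hom[OF X Z Y m T b] res_TN_hom[OF Z]]
        hom_compose[OF res_TN_hom[OF X] ract_hom[OF X Z Y m S fb]] z])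
    fix n t assume n: "n \<in> carrier (sec N T)" and t: "t \<in> carrier (sec (lin R G X) T)"
    note tb = lin_mult_closed[OF R G stableD(1)[OF X] Y stableD(1)[OF Z] m T t b]
    show "(res (TN Z) S T f \<circ> ract Z T b) (pm X T n t) = (ract Z S (res (lin R G Y) S T f b) \<circ> res (TN X) S T f) (pm X T n t)"
      unfolding comp_apply ract_pm[OF X Z Y m T b n t] res_TN_pm[OF Z n tb] res_TN_pm[OF X n t]
        ract_pm[OF X Z Y m S fb rc[OF n] hom_in_carrier[OF res_lin_hom[OF R stableD(1)[OF X] S T f] t]]
        res_lin_mult[OF R G stableD(1)[OF X] Y stableD(1)[OF Z] m S T f t b] ..
  qed
  then show ?thesis by simp
qed

end

end

section \<open>A single double coset\<close>

lemma comm_group_copy [simp]: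
  "comm_group \<lparr>carrier = carrier Q, monoid.mult = monoid.mult Q, one = \<one>\<^bsub>Q\<^esub>, \<dots> = u\<rparr> \<longleftrightarrow> comm_group Q"
  unfolding comm_group_def comm_monoid_def comm_monoid_axioms_def group_def monoid_def group_axioms_def Units_def by simp

lemma hom_into_copy [simp]:
  "hom A \<lparr>carrier = carrier Q, monoid.mult = monoid.mult Q, one = \<one>\<^bsub>Q\<^esub>, \<dots> = u\<rparr> = hom A Q"
  by (simp add: hom_def)

lemma condensed_subsetI:
  fixes G :: "('s, 'g, ('g, 'z) partial_object_scheme) presheaf"
  assumes G: "functorial G" and sub: "\<And>T. T \<in> CHED \<Longrightarrow> X T \<subseteq> carrier (sec G T)"
    and res: "\<And>S T f x. S \<in> CHED \<Longrightarrow> T \<in> CHED \<Longrightarrow> continuous_map S T f \<Longrightarrow> x \<in> X T \<Longrightarrow> res G S T f x \<in> X S"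
  shows "condensed_subset G X"
  unfolding condensed_subset_def functorial_def carrier_sub_presheaf res_sub_presheaf
proof (intro conjI ballI allI impI)
  fix S T :: "'s topology" and f f' x assume "S \<in> CHED" "T \<in> CHED" "continuous_map S T f" "continuous_map S T f'" "\<forall>s\<in>topspace S. f s = f' s" "x \<in> X T"
  then show "res G S T f x = res G S T f' x" using sub by (intro res_cong[OF G]) auto
next
  fix S :: "'s topology" and x assume "S \<in> CHED" "x \<in> X S"
  then show "res G S S id x = x" using sub by (intro res_id[OF G]) auto
next
  fix S T U :: "'s topology" and f h x assume "S \<in> CHED" "T \<in> CHED" "U \<in> CHED" "continuous_map S T f" "continuous_map T U h" "x \<in> X U"
  then show "res G S U (h \<circ> f) x = res G S T f (res G T U h x)" using sub by (intro res_comp[OF G, symmetric]) auto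
qed (use sub res in auto)

lemma condensed_subset_subgroup:
  assumes "condensed_subgroup G H"
  shows "condensed_subset G H"
  using assms unfolding condensed_subset_def condensed_subgroup_def condensed_group_def condensed_set_def
  by (auto dest: subgroup.subset)

lemma res_in:
  "condensed_subset G X \<Longrightarrow> S \<in> CHED \<Longrightarrow> T \<in> CHED \<Longrightarrow> continuous_map S T f \<Longrightarrow> x \<in> X T \<Longrightarrow> res G S T f x \<in> X S"
  using res_closed[of "sub_presheaf G X" S T f x] by (simp add: condensed_subset_def)

lemma continuous_map_pt: "continuous_map T pt (\<lambda>_. undefined)"
  by (simp add: pt_def)

lemma const_sec_closed:
  assumes "condensed_group G" "x \<in> carrier (sec G pt)" "T \<in> CHED"
  shows "const_sec G x T \<in> carrier (sec G T)"
  unfolding const_sec_def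
  by (rule res_closed[OF functorial_group[OF assms(1)] assms(3) pt_CHED continuous_map_pt assms(2)])

lemma res_const_sec:
  assumes "condensed_group G" "x \<in> carrier (sec G pt)" "S \<in> CHED" "T \<in> CHED" "continuous_map S T f"
  shows "res G S T f (const_sec G x T) = const_sec G x S"
  using res_comp[OF functorial_group[OF assms(1)] assms(3,4) pt_CHED assms(5) continuous_map_pt assms(2)]
  by (simp add: const_sec_def comp_def)

lemma rs_const_sec:
  assumes "condensed_group G" "x \<in> carrier (sec G pt)" "S \<in> CHED" "clopen S U" "clopen S V" "V \<subseteq> U"
  shows "rs G S U V (const_sec G x (subtopology S U)) = const_sec G x (subtopology S V)"
  unfolding rs_def by (rule res_const_sec[OF assms(1,2) sub_CHED[OF assms(3,5)] sub_CHED[OF assms(3,4)] continuous_map_sub_id[OF assms(6)]])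

lemma lgen_empty:
  assumes "condensed_ring R" "condensed_subset G X" "S \<in> CHED" "r \<in> carrier (sec R S)" "x \<in> X (subtopology S {})"
  shows "lgen R G X S r {} x = \<one>\<^bsub>sec (lin R G X) S\<^esub>"
proof -
  have X: "functorial (sub_presheaf G X)" using assms(2) by (simp add: condensed_subset_def)
  show ?thesis unfolding lgen_def
    using gen_empty[OF X assms(3), of x] assms(5) hom_one[OF lin_pure_hom[OF assms(1) X assms(3,4)]
        comm_group.axioms(2)[OF comm_group_Zfree[OF X assms(3)]] comm_group.axioms(2)[OF comm_group_lin[OF assms(1) X assms(3)]]]
    by simp
qed

lemma right_group_module_condensed:
  assumes R: "condensed_ring R" and G: "condensed_group G" and H: "condensed_subset G H"
    and M: "condensed_right_module (group_ring R G H) M"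
  shows "right_group_module R G H M"
proof (rule right_group_module.intro)
  have rm: "right_module (sec (group_ring R G H) S) (sec M S)" if "S \<in> CHED" for S
    using M that by (simp add: condensed_right_module_def)
  show "comm_group (add_monoid (sec M S))" if "S \<in> CHED" for S
    using rm[OF that] by (auto simp: right_module_def intro: abelian_group.a_comm_group)
  show "smult (sec M S) a \<in> hom (add_monoid (sec M S)) (add_monoid (sec M S))"
    if "S \<in> CHED" "a \<in> carrier (sec (lin R G H) S)" for S a
    using rm[OF that(1)] that(2) by (auto simp: right_module_def hom_def)
  have F: "functorial M" using M by (simp add: condensed_right_module_def condensed_set_def)
  show "res M S T f \<in> hom (add_monoid (sec M T)) (add_monoid (sec M S))"
    if "S \<in> CHED" "T \<in> CHED" "continuous_map S T f" for S T f
    using M that res_closed[OF F that] by (auto simp: condensed_right_module_def hom_def)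
  show "res M S T f (smult (sec M T) a n) = smult (sec M S) (res (lin R G H) S T f a) (res M S T f n)"
    if "S \<in> CHED" "T \<in> CHED" "continuous_map S T f" "a \<in> carrier (sec (lin R G H) T)" "n \<in> carrier (sec M T)" for S T f a n
    using M that by (auto simp: condensed_right_module_def)
qed (rule R G H)+

text \<open>Here \<open>g\<close> is any point of \<open>G\<close>, not yet a chosen representative:
  the summand, its multiplication map and the elements attached to products \<open>h g k\<close>
  make sense for one point by itself.\<close>

locale mackey_coset =
  fixes R :: "('s, 'r) ring_presheaf" and G :: "('s, 'g) group_presheaf"
    and H K :: "'s topology \<Rightarrow> 'g set"
    and M :: "('s, ('s, 'r, 'g) lin, 'm) module_presheaf" and g :: 'g
  assumes R: "condensed_ring R" and G: "condensed_group G"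
    and H: "condensed_subgroup G H" and K: "condensed_subgroup G K"
    and M: "condensed_right_module (group_ring R G H) M"
    and g: "g \<in> carrier (sec G pt)"
begin

abbreviation "W \<equiv> whole G"
abbreviation "X \<equiv> translate G H g"
abbreviation "C \<equiv> conjugate G H g"
abbreviation "L \<equiv> intersection K C"
abbreviation "c \<equiv> const_sec G g"

lemma csH: "condensed_subset G H" and csK: "condensed_subset G K"
  using condensed_subset_subgroup[OF H] condensed_subset_subgroup[OF K] .

sublocale M: right_group_module R G H M
  by (rule right_group_module_condensed[OF R G csH M])

lemma subgroup_H: "T \<in> CHED \<Longrightarrow> subgroup (H T) (sec G T)" and subgroup_K: "T \<in> CHED \<Longrightarrow> subgroup (K T) (sec G T)"
  using H K by (simp_all add: condensed_subgroup_def)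

lemma c_closed: "T \<in> CHED \<Longrightarrow> c T \<in> carrier (sec G T)"
  by (rule const_sec_closed[OF G g])

lemma in_X: "x \<in> X T \<longleftrightarrow> (\<exists>h\<in>H T. x = h \<otimes>\<^bsub>sec G T\<^esub> c T)"
  by (auto simp: translate_def r_coset_def)

lemma in_C: "x \<in> C T \<longleftrightarrow> (\<exists>h\<in>H T. x = inv\<^bsub>sec G T\<^esub> c T \<otimes>\<^bsub>sec G T\<^esub> (h \<otimes>\<^bsub>sec G T\<^esub> c T))"
  by (auto simp: conjugate_def r_coset_def l_coset_def)

lemma in_L: "x \<in> L T \<longleftrightarrow> x \<in> K T \<and> x \<in> C T"
  by (simp add: intersection_def)

lemma H_car: "T \<in> CHED \<Longrightarrow> h \<in> H T \<Longrightarrow> h \<in> carrier (sec G T)" and K_car: "T \<in> CHED \<Longrightarrow> k \<in> K T \<Longrightarrow> k \<in> carrier (sec G T)"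
  using subgroup.mem_carrier[OF subgroup_H] subgroup.mem_carrier[OF subgroup_K] by blast+

lemma csW: "condensed_subset G W"
  by (rule condensed_subsetI[OF functorial_group[OF G]]) (auto simp: whole_def intro: res_closed[OF functorial_group[OF G]])

lemma csX: "condensed_subset G X"
proof (rule condensed_subsetI[OF functorial_group[OF G]])
  fix T :: "'s topology" assume T: "T \<in> CHED"
  interpret T: group "sec G T" by (rule group_sec[OF G T])
  show "X T \<subseteq> carrier (sec G T)" using c_closed[OF T] H_car[OF T] by (auto simp: in_X)
next
  fix S T :: "'s topology" and f x assume *: "S \<in> CHED" "T \<in> CHED" "continuous_map S T f" "x \<in> X T"
  then obtain h where h: "h \<in> H T" "x = h \<otimes>\<^bsub>sec G T\<^esub> c T" by (auto simp: in_X)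
  have "res G S T f x = res G S T f h \<otimes>\<^bsub>sec G S\<^esub> c S"
    unfolding h(2) hom_mult[OF res_group_hom[OF G *(1-3)] H_car[OF *(2) h(1)] c_closed[OF *(2)]] res_const_sec[OF G g *(1-3)] ..
  then show "res G S T f x \<in> X S" using res_in[OF csH *(1-3) h(1)] by (auto simp: in_X)
qed

lemma csC: "condensed_subset G C"
proof (rule condensed_subsetI[OF functorial_group[OF G]])
  fix T :: "'s topology" assume T: "T \<in> CHED"
  interpret T: group "sec G T" by (rule group_sec[OF G T])
  show "C T \<subseteq> carrier (sec G T)" using c_closed[OF T] H_car[OF T] by (auto simp: in_C)
next
  fix S T :: "'s topology" and f x assume *: "S \<in> CHED" "T \<in> CHED" "continuous_map S T f" "x \<in> C T"
  interpret T: group "sec G T" by (rule group_sec[OF G *(2)])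
  from * obtain h where h: "h \<in> H T" "x = inv\<^bsub>sec G T\<^esub> c T \<otimes>\<^bsub>sec G T\<^esub> (h \<otimes>\<^bsub>sec G T\<^esub> c T)" by (auto simp: in_C)
  note rh = res_group_hom[OF G *(1-3)]
  have "res G S T f x = inv\<^bsub>sec G S\<^esub> c S \<otimes>\<^bsub>sec G S\<^esub> (res G S T f h \<otimes>\<^bsub>sec G S\<^esub> c S)"
    using H_car[OF *(2) h(1)] c_closed[OF *(2)] res_const_sec[OF G g *(1-3)]
    by (simp add: h(2) hom_mult[OF rh] hom_inv[OF T.is_group group_sec[OF G *(1)] rh])
  then show "res G S T f x \<in> C S" using res_in[OF csH *(1-3) h(1)] by (auto simp: in_C)
qed

lemma csL: "condensed_subset G L"
proof (rule condensed_subsetI[OF functorial_group[OF G]])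
  fix T :: "'s topology" assume T: "T \<in> CHED"
  show "L T \<subseteq> carrier (sec G T)" using K_car[OF T] by (auto simp: in_L)
next
  fix S T :: "'s topology" and f x assume "S \<in> CHED" "T \<in> CHED" "continuous_map S T f" "x \<in> L T"
  then show "res G S T f x \<in> L S" using res_in[OF csK] res_in[OF csC] by (auto simp: in_L)
qed

text \<open>These inclusions make the products below land in the intended group rings and
  translates. The right action of the conjugate, \<open>XC\<close>, rests on
  \<open>(h g) (g^-1 k g) = (h k) g\<close>.\<close>

lemma mult_rules:
  shows HX: "mult_into G H X X" and XK: "mult_into G X K W" and XC: "mult_into G X C X" and LK: "mult_into G L K K"
    and KK: "mult_into G K K K" and WK: "mult_into G W K W" and HW: "mult_into G H W W" and WW: "mult_into G W W W"
    and XL: "mult_into G X L X"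
proof -
  have "(\<forall>x\<in>H T. \<forall>y\<in>X T. x \<otimes>\<^bsub>sec G T\<^esub> y \<in> X T) \<and> (\<forall>x\<in>X T. \<forall>y\<in>K T. x \<otimes>\<^bsub>sec G T\<^esub> y \<in> W T) \<and>
    (\<forall>x\<in>X T. \<forall>y\<in>C T. x \<otimes>\<^bsub>sec G T\<^esub> y \<in> X T) \<and> (\<forall>x\<in>K T. \<forall>y\<in>K T. x \<otimes>\<^bsub>sec G T\<^esub> y \<in> K T) \<and>
    (\<forall>x\<in>W T. \<forall>y\<in>K T. x \<otimes>\<^bsub>sec G T\<^esub> y \<in> W T) \<and> (\<forall>x\<in>H T. \<forall>y\<in>W T. x \<otimes>\<^bsub>sec G T\<^esub> y \<in> W T) \<and>
    (\<forall>x\<in>W T. \<forall>y\<in>W T. x \<otimes>\<^bsub>sec G T\<^esub> y \<in> W T)" if T: "T \<in> CHED" for T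
  proof -
    interpret T: group "sec G T" by (rule group_sec[OF G T])
    note cT = c_closed[OF T]
    have X: "X T \<subseteq> carrier (sec G T)" using csX T by (simp add: condensed_subset_def)
    have "x \<otimes>\<^bsub>sec G T\<^esub> y \<in> X T" if "x \<in> H T" "y \<in> X T" for x y
    proof -
      from that obtain h where h: "h \<in> H T" "y = h \<otimes>\<^bsub>sec G T\<^esub> c T" by (auto simp: in_X)
      have "x \<otimes>\<^bsub>sec G T\<^esub> y = (x \<otimes>\<^bsub>sec G T\<^esub> h) \<otimes>\<^bsub>sec G T\<^esub> c T" using H_car[OF T] that h cT by (simp add: T.m_assoc)
      then show ?thesis using subgroup.m_closed[OF subgroup_H[OF T] that(1) h(1)] by (auto simp: in_X)
    qed
    moreover have "x \<otimes>\<^bsub>sec G T\<^esub> y \<in> X T" if "x \<in> X T" "y \<in> C T" for x y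
    proof -
      from that obtain h k where h: "h \<in> H T" "x = h \<otimes>\<^bsub>sec G T\<^esub> c T" and k: "k \<in> H T" "y = inv\<^bsub>sec G T\<^esub> c T \<otimes>\<^bsub>sec G T\<^esub> (k \<otimes>\<^bsub>sec G T\<^esub> c T)"
        by (auto simp: in_X in_C)
      have hk: "h \<in> carrier (sec G T)" "k \<in> carrier (sec G T)" using H_car[OF T] h k by auto
      have "x \<otimes>\<^bsub>sec G T\<^esub> y = h \<otimes>\<^bsub>sec G T\<^esub> ((c T \<otimes>\<^bsub>sec G T\<^esub> inv\<^bsub>sec G T\<^esub> c T) \<otimes>\<^bsub>sec G T\<^esub> (k \<otimes>\<^bsub>sec G T\<^esub> c T))"
        unfolding h(2) k(2) using hk cT by (simp only: T.m_assoc T.m_closed T.inv_closed)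
      also have "\<dots> = (h \<otimes>\<^bsub>sec G T\<^esub> k) \<otimes>\<^bsub>sec G T\<^esub> c T" using hk cT by (simp add: T.m_assoc)
      finally show ?thesis using subgroup.m_closed[OF subgroup_H[OF T] h(1) k(1)] by (auto simp: in_X)
    qed
    ultimately show ?thesis
      using X H_car[OF T] K_car[OF T] subgroup.m_closed[OF subgroup_K[OF T]] by (auto simp: whole_def)
  qed
  note * = this
  show "mult_into G H X X" "mult_into G X K W" "mult_into G X C X" "mult_into G K K K" "mult_into G W K W" "mult_into G H W W" "mult_into G W W W"
    unfolding mult_into_def using * by blast+
  then show "mult_into G L K K" "mult_into G X L X" unfolding mult_into_def by (auto simp: in_L)
qed

lemma LC: "\<forall>T\<in>CHED. L T \<subseteq> C T" and KW: "\<forall>T\<in>CHED. K T \<subseteq> W T"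
  using K_car by (auto simp: in_L whole_def)

lemma stX: "M.stable X" and stW: "M.stable W"
  using csX csW HX HW by (simp_all add: M.stable_def)

abbreviation "N \<equiv> Res R G C L (condensed_tensor_bimodule (group_ring R G H) M (lin_bimodule R G X))"

lemma N_simps:
  "carrier (sec N S) = carrier (M.TM X S)" "ring.add (sec N S) = monoid.mult (M.TM X S)" "ring.zero (sec N S) = \<one>\<^bsub>M.TM X S\<^esub>"
  "smult (sec N S) a = M.ract X S (lin_incl R G C S a)"
  "res N = res (M.TN X)"
  by (simp_all add: Res_def M.TN_simps)

lemma N_smult:
  "S \<in> CHED \<Longrightarrow> a \<in> carrier (sec (lin R G L) S) \<Longrightarrow> z \<in> carrier (M.TM X S) \<Longrightarrow> smult (sec N S) a z = M.ract X S a z"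
  unfolding N_simps by (rule M.ract_incl[OF stX stX csL csC XC LC])

lemma add_N: "hom (add_monoid (sec N S)) B = hom (M.TM X S) B" "hom B (add_monoid (sec N S)) = hom B (M.TM X S)"
   "comm_group (add_monoid (sec N S)) \<longleftrightarrow> comm_group (M.TM X S)" "generates (add_monoid (sec N S)) Q \<longleftrightarrow> generates (M.TM X S) Q"
  unfolding N_simps by simp_all

text \<open>With the inner tensor product as a module over the group ring of the intersection,
  induction to \<open>K\<close> becomes a second use of the same construction.\<close>

sublocale N: right_group_module R G L N
proof (rule right_group_module.intro)
  fix S :: "'s topology" assume S: "S \<in> CHED"
  show "comm_group (add_monoid (sec N S))" unfolding add_N by (rule M.comm_group_TM[OF stX S])
  fix a assume a: "a \<in> carrier (sec (lin R G L) S)"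
  show "smult (sec N S) a \<in> hom (add_monoid (sec N S)) (add_monoid (sec N S))"
    unfolding add_N unfolding N_simps
    by (rule M.ract_hom[OF stX stX csC XC S hom_in_carrier[OF lin_incl_hom[OF R csL csC LC S] a]])
next
  fix S T :: "'s topology" and f assume *: "S \<in> CHED" "T \<in> CHED" "continuous_map S T f"
  show "res N S T f \<in> hom (add_monoid (sec N T)) (add_monoid (sec N S))"
    unfolding add_N unfolding N_simps by (rule M.res_TN_hom[OF * stX])
  fix a n assume a: "a \<in> carrier (sec (lin R G L) T)" and "n \<in> carrier (sec N T)"
  then have n: "n \<in> carrier (M.TM X T)" unfolding N_simps by simp
  note ra = hom_in_carrier[OF res_lin_hom[OF R csL *] a]
  have rn: "res (M.TN X) S T f n \<in> carrier (M.TM X S)" by (rule hom_in_carrier[OF M.res_TN_hom[OF * stX] n])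
  show "res N S T f (smult (sec N T) a n) = smult (sec N S) (res (lin R G L) S T f a) (res N S T f n)"
    unfolding N_smult[OF *(2) a n] N_simps(5) N_smult[OF *(1) ra rn] by (rule M.res_ract[OF * stX stX csL XL a n])
qed (rule R G csL)+

lemma stK: "N.stable K" using csK LK by (simp add: N.stable_def)

section \<open>The summand of \<open>g\<close> and its multiplication map\<close>

definition U :: "'s topology \<Rightarrow> (('m, ('s, 'r, 'g) lin) tensor, ('s, 'r, 'g) lin) tensor monoid" where
  "U S = N.TM K S"

text \<open>The map \<open>(m \<otimes> a) \<otimes> b \<mapsto> m \<otimes> a b\<close>.\<close>

definition psi :: "'s topology \<Rightarrow> (('m, ('s, 'r, 'g) lin) tensor, ('s, 'r, 'g) lin) tensor \<Rightarrow> ('m, ('s, 'r, 'g) lin) tensor" where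
  "psi S = tensor_lift (M.TM W S) (\<lambda>t b. M.ract W S b t)"

lemma comm_group_U: "S \<in> CHED \<Longrightarrow> comm_group (U S)"
  unfolding U_def by (rule N.comm_group_TM[OF stK])

lemma group_U: "S \<in> CHED \<Longrightarrow> group (U S)"
  using comm_group_U comm_group.axioms(2) by blast

text \<open>Balancedness over the group ring of the intersection is
  \<open>(t a) b = t (a b)\<close>, an instance of \<open>ract_ract\<close>.\<close>

lemma psi_lift:
  assumes S: "S \<in> CHED"
  shows psi_hom: "psi S \<in> hom (U S) (M.TM W S)"
    and psi_pm: "\<And>t b. t \<in> carrier (M.TM X S) \<Longrightarrow> b \<in> carrier (sec (lin R G K) S) \<Longrightarrow> psi S (N.pm K S t b) = M.ract W S b t"
proof -
  have 1: "(\<lambda>b. M.ract W S b t) \<in> hom (sec (lin R G K) S) (M.TM W S)" if "t \<in> carrier (sec N S)" for t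
    using M.ract_hom_left[OF stX stW csK XK S] that unfolding N_simps by blast
  have 2: "M.ract W S b \<in> hom (add_monoid (sec N S)) (M.TM W S)" if "b \<in> carrier (sec (lin R G K) S)" for b
    unfolding add_N by (rule M.ract_hom[OF stX stW csK XK S that])
  have 3: "M.ract W S b (smult (sec N S) a t) = M.ract W S (lin_mult R G K S a b) t"
    if "t \<in> carrier (sec N S)" "a \<in> carrier (sec (lin R G L) S)" "b \<in> carrier (sec (lin R G K) S)" for t a b
  proof -
    have t: "t \<in> carrier (M.TM X S)" using that(1) unfolding N_simps .
    show ?thesis unfolding N_smult[OF S that(2) t]
      by (rule M.ract_ract[OF stX stX stW csL csK csK XL XK LK XK S that(2,3) t])
  qed
  note l = N.TM_lift[OF stK S M.comm_group_TM[OF stW S], of "\<lambda>t b. M.ract W S b t", OF 1 2 3]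
  show "psi S \<in> hom (U S) (M.TM W S)" unfolding psi_def U_def using l(1) by blast
  show "\<And>t b. t \<in> carrier (M.TM X S) \<Longrightarrow> b \<in> carrier (sec (lin R G K) S) \<Longrightarrow> psi S (N.pm K S t b) = M.ract W S b t"
    unfolding psi_def using l(2) unfolding N_simps by blast
qed

lemma psi_ract:
  assumes S: "S \<in> CHED" and a: "a \<in> carrier (sec (lin R G K) S)" and z: "z \<in> carrier (U S)"
  shows "psi S (N.ract K S a z) = M.ract W S a (psi S z)"
proof -
  note nr = N.ract_hom[OF stK stK csK KK S a]
  have "(psi S \<circ> N.ract K S a) z = (M.ract W S a \<circ> psi S) z"
  proof (rule N.TM_hom_eq[OF stK S M.group_TM[OF stW S]])
    show "psi S \<circ> N.ract K S a \<in> hom (N.TM K S) (M.TM W S)"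
      by (rule hom_compose[OF nr psi_hom[OF S, unfolded U_def]])
    show "M.ract W S a \<circ> psi S \<in> hom (N.TM K S) (M.TM W S)"
      by (rule hom_compose[OF psi_hom[OF S, unfolded U_def] M.ract_hom[OF stW stW csK WK S a]])
    show "z \<in> carrier (N.TM K S)" using z by (simp add: U_def)
    fix t b assume "t \<in> carrier (sec N S)" and b: "b \<in> carrier (sec (lin R G K) S)"
    then have t: "t \<in> carrier (M.TM X S)" and t': "t \<in> carrier (sec N S)" unfolding N_simps by simp_all
    note ba = lin_mult_closed[OF R G csK csK csK KK S b a]
    show "(psi S \<circ> N.ract K S a) (N.pm K S t b) = (M.ract W S a \<circ> psi S) (N.pm K S t b)"
      unfolding comp_apply N.ract_pm[OF stK stK csK KK S a t' b] psi_pm[OF S t ba] psi_pm[OF S t b]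
      by (rule M.ract_ract[OF stX stW stW csK csK csK XK WK KK XK S b a t, symmetric])
  qed
  then show ?thesis by simp
qed

lemma psi_res:
  assumes S: "S \<in> CHED" and T: "T \<in> CHED" and f: "continuous_map S T f" and z: "z \<in> carrier (U T)"
  shows "psi S (res (N.TN K) S T f z) = res (M.TN W) S T f (psi T z)"
proof -
  have "(psi S \<circ> res (N.TN K) S T f) z = (res (M.TN W) S T f \<circ> psi T) z"
  proof (rule N.TM_hom_eq[OF stK T M.group_TM[OF stW S]])
    show "psi S \<circ> res (N.TN K) S T f \<in> hom (N.TM K T) (M.TM W S)"
      by (rule hom_compose[OF N.res_TN_hom[OF S T f stK] psi_hom[OF S, unfolded U_def]])
    show "res (M.TN W) S T f \<circ> psi T \<in> hom (N.TM K T) (M.TM W S)"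
      by (rule hom_compose[OF psi_hom[OF T, unfolded U_def] M.res_TN_hom[OF S T f stW]])
    show "z \<in> carrier (N.TM K T)" using z by (simp add: U_def)
    fix t b assume t': "t \<in> carrier (sec N T)" and b: "b \<in> carrier (sec (lin R G K) T)"
    then have t: "t \<in> carrier (M.TM X T)" unfolding N_simps by simp
    note rt = hom_in_carrier[OF M.res_TN_hom[OF S T f stX] t]
    note rb = hom_in_carrier[OF res_lin_hom[OF R csK S T f] b]
    show "(psi S \<circ> res (N.TN K) S T f) (N.pm K T t b) = (res (M.TN W) S T f \<circ> psi T) (N.pm K T t b)"
      unfolding comp_apply N.res_TN_pm[OF S T f stK t' b] N_simps(5) psi_pm[OF S rt rb] psi_pm[OF T t b]
      by (rule M.res_ract[OF S T f stX stW csK XK b t, symmetric])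
  qed
  then show ?thesis by simp
qed

text \<open>A preimage under \<open>psi\<close> of \<open>m\<close> tensor \<open>r h g k\<close>,
  supported on \<open>V\<close> (see \<open>psi_val\<close>). The coefficient is kept in the inner
  factor and both factors have the same support, which fixes one form among many equal
  tensors.\<close>

definition val :: "'s topology \<Rightarrow> 'm \<Rightarrow> 'r \<Rightarrow> 's set \<Rightarrow> 'g \<Rightarrow> 'g \<Rightarrow>
    (('m, ('s, 'r, 'g) lin) tensor, ('s, 'r, 'g) lin) tensor" where
  "val S m r V h k = N.pm K S (M.pm X S m (lgen R G X S r V (h \<otimes>\<^bsub>sec G (subtopology S V)\<^esub> c (subtopology S V))))
     (lgen R G K S \<one>\<^bsub>sec R S\<^esub> V k)"

section \<open>Elements of the summand attached to products \<open>h g k\<close>\<close>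

context
  fixes S :: "'s topology" assumes S: "S \<in> CHED"
begin

interpretation RS: ring "sec R S" by (rule ring_sec[OF R S])

private abbreviation "sb V \<equiv> subtopology S V"

private lemma fX: "functorial (sub_presheaf G X)" and fK: "functorial (sub_presheaf G K)" and fL: "functorial (sub_presheaf G L)"
  using csX csK csL by (simp_all add: condensed_subset_def)

private lemma T: "clopen S V \<Longrightarrow> sb V \<in> CHED" by (rule sub_CHED[OF S])

private lemma hc_in: "clopen S V \<Longrightarrow> h \<in> H (sb V) \<Longrightarrow> h \<otimes>\<^bsub>sec G (sb V)\<^esub> c (sb V) \<in> X (sb V)"
  by (auto simp: in_X)

private lemma rs_hc:
  assumes "clopen S V" "clopen S V'" "V' \<subseteq> V" "h \<in> H (sb V)"
  shows "rs G S V V' (h \<otimes>\<^bsub>sec G (sb V)\<^esub> c (sb V)) = rs G S V V' h \<otimes>\<^bsub>sec G (sb V')\<^esub> c (sb V')"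
  using rs_mult[OF R G S assms(1-3) H_car[OF T[OF assms(1)] assms(4)] c_closed[OF T[OF assms(1)]]]
    rs_const_sec[OF G g S assms(1-3)] by simp

private lemma rsH: "clopen S V \<Longrightarrow> clopen S V' \<Longrightarrow> V' \<subseteq> V \<Longrightarrow> h \<in> H (sb V) \<Longrightarrow> rs G S V V' h \<in> H (sb V')"
  and rsK: "clopen S V \<Longrightarrow> clopen S V' \<Longrightarrow> V' \<subseteq> V \<Longrightarrow> k \<in> K (sb V) \<Longrightarrow> rs G S V V' k \<in> K (sb V')"
  and rsX: "clopen S V \<Longrightarrow> clopen S V' \<Longrightarrow> V' \<subseteq> V \<Longrightarrow> x \<in> X (sb V) \<Longrightarrow> rs G S V V' x \<in> X (sb V')"
  using rs_in[OF R G csH S] rs_in[OF R G csK S] rs_in[OF R G csX S] by blast+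

private lemma lgenX: "r \<in> carrier (sec R S) \<Longrightarrow> clopen S V \<Longrightarrow> y \<in> X (sb V) \<Longrightarrow> lgen R G X S r V y \<in> carrier (sec (lin R G X) S)"
  and lgenK: "r \<in> carrier (sec R S) \<Longrightarrow> clopen S V \<Longrightarrow> k \<in> K (sb V) \<Longrightarrow> lgen R G K S r V k \<in> carrier (sec (lin R G K) S)"
  and lgenL: "r \<in> carrier (sec R S) \<Longrightarrow> clopen S V \<Longrightarrow> l \<in> L (sb V) \<Longrightarrow> lgen R G L S r V l \<in> carrier (sec (lin R G L) S)"
  using lgen_closed[OF R fX S] lgen_closed[OF R fK S] lgen_closed[OF R fL S] by blast+

private lemma one_L: "clopen S V \<Longrightarrow> \<one>\<^bsub>sec G (sb V)\<^esub> \<in> L (sb V)"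
proof -
  assume V: "clopen S V"
  interpret group "sec G (sb V)" by (rule group_sec[OF G T[OF V]])
  have "\<one>\<^bsub>sec G (sb V)\<^esub> = inv\<^bsub>sec G (sb V)\<^esub> c (sb V) \<otimes>\<^bsub>sec G (sb V)\<^esub> (\<one>\<^bsub>sec G (sb V)\<^esub> \<otimes>\<^bsub>sec G (sb V)\<^esub> c (sb V))"
    using c_closed[OF T[OF V]] by simp
  then show ?thesis unfolding in_L in_C
    using subgroup.one_closed[OF subgroup_H[OF T[OF V]]] subgroup.one_closed[OF subgroup_K[OF T[OF V]]] by blast
qed

text \<open>The balancing relation of the outer tensor product, on generators. With
  \<open>l = 1\<close> it transfers supports and coefficients between the factors; with general
  \<open>l\<close> it gives independence of the decomposition.\<close>

private lemma move:
  assumes m: "m \<in> carrier (sec M S)" and r: "r \<in> carrier (sec R S)" "r' \<in> carrier (sec R S)" "r'' \<in> carrier (sec R S)"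
    and V: "clopen S V" "y \<in> X (sb V)" and V': "clopen S V'" "l \<in> L (sb V')" and V'': "clopen S V''" "k \<in> K (sb V'')"
  shows "N.pm K S (M.pm X S m (lgen R G X S (r \<otimes>\<^bsub>sec R S\<^esub> r') (V \<inter> V')
      (rs G S V (V \<inter> V') y \<otimes>\<^bsub>sec G (sb (V \<inter> V'))\<^esub> rs G S V' (V \<inter> V') l))) (lgen R G K S r'' V'' k) =
    N.pm K S (M.pm X S m (lgen R G X S r V y)) (lgen R G K S (r' \<otimes>\<^bsub>sec R S\<^esub> r'') (V' \<inter> V'')
      (rs G S V' (V' \<inter> V'') l \<otimes>\<^bsub>sec G (sb (V' \<inter> V''))\<^esub> rs G S V'' (V' \<inter> V'') k))"
proof -
  have lx: "lgen R G X S r V y \<in> carrier (sec (lin R G X) S)" by (rule lgenX[OF r(1) V])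
  have ll: "lgen R G L S r' V' l \<in> carrier (sec (lin R G L) S)" by (rule lgenL[OF r(2) V'])
  have lk: "lgen R G K S r'' V'' k \<in> carrier (sec (lin R G K) S)" by (rule lgenK[OF r(3) V''])
  have n: "M.pm X S m (lgen R G X S r V y) \<in> carrier (M.TM X S)" by (rule M.pm_closed[OF stX S m lx])
  then have n': "M.pm X S m (lgen R G X S r V y) \<in> carrier (sec N S)" unfolding N_simps .
  from N.pm_balanced[OF stK S n' ll lk]
  show ?thesis
    unfolding N_smult[OF S ll n] M.ract_pm[OF stX stX csL XL S ll m lx]
      lin_mult_lgen[OF R G csX csL csX XL S r(1,2) V V'] lin_mult_lgen[OF R G csL csK csK LK S r(2,3) V' V''] .
qed

private lemma normal_form:
  assumes m: "m \<in> carrier (sec M S)" and r: "r \<in> carrier (sec R S)" "r' \<in> carrier (sec R S)"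
    and V: "clopen S V" "y \<in> X (sb V)" and V': "clopen S V'" "k \<in> K (sb V')"
  shows "N.pm K S (M.pm X S m (lgen R G X S r V y)) (lgen R G K S r' V' k) =
    N.pm K S (M.pm X S m (lgen R G X S (r \<otimes>\<^bsub>sec R S\<^esub> r') (V \<inter> V') (rs G S V (V \<inter> V') y)))
      (lgen R G K S \<one>\<^bsub>sec R S\<^esub> (V \<inter> V') (rs G S V' (V \<inter> V') k))"
proof -
  let ?I = "V \<inter> V'"
  have I: "clopen S ?I" "?I \<subseteq> V" "?I \<subseteq> V'" using V V' clopen_Int by auto
  interpret GV: group "sec G (sb V)" by (rule group_sec[OF G T[OF V(1)]])
  interpret GI: group "sec G (sb ?I)" by (rule group_sec[OF G T[OF I(1)]])
  have rs1: "rs G S V ?I \<one>\<^bsub>sec G (sb V)\<^esub> = \<one>\<^bsub>sec G (sb ?I)\<^esub>"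
    by (rule hom_one[OF rs_group_hom[OF G S V(1) I(1,2)] GV.is_group GI.is_group])
  have yV: "y \<in> carrier (sec G (sb V))" by (rule cs_car[OF R G csX S V])
  have kI: "rs G S V' ?I k \<in> K (sb ?I)" by (rule rsK[OF V'(1) I(1,3) V'(2)])
  have kIc: "rs G S V' ?I k \<in> carrier (sec G (sb ?I))" by (rule K_car[OF T[OF I(1)] kI])
  have yI: "rs G S V ?I y \<in> carrier (sec G (sb ?I))" by (rule cs_car[OF R G csX S I(1) rsX[OF V(1) I(1,2) V(2)]])
  have i: "V \<inter> ?I = ?I" "?I \<inter> ?I = ?I" by auto
  \<comment> \<open>Here \<open>l = 1\<close> on \<open>V\<close>, with coefficient one: the support
    of the second factor shrinks to \<open>V \<inter> V'\<close>.\<close>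
  have 1: "N.pm K S (M.pm X S m (lgen R G X S r V y)) (lgen R G K S r' V' k) =
      N.pm K S (M.pm X S m (lgen R G X S r V y)) (lgen R G K S r' ?I (rs G S V' ?I k))"
    using move[OF m r(1) RS.one_closed r(2) V V(1) one_L[OF V(1)] V'] V r yV kIc rs_self[OF functorial_group[OF G] S V(1)]
    by (simp add: rs1)
  \<comment> \<open>Here \<open>l = 1\<close> on \<open>V \<inter> V'\<close>, with coefficient
    \<open>r'\<close>: the first support shrinks too, and \<open>r'\<close> passes to the first
    factor.\<close>
  have 2: "N.pm K S (M.pm X S m (lgen R G X S (r \<otimes>\<^bsub>sec R S\<^esub> r') ?I (rs G S V ?I y))) (lgen R G K S \<one>\<^bsub>sec R S\<^esub> ?I (rs G S V' ?I k)) =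
      N.pm K S (M.pm X S m (lgen R G X S r V y)) (lgen R G K S r' ?I (rs G S V' ?I k))"
    using move[OF m r RS.one_closed V I(1) one_L[OF I(1)] I(1) kI] r yI kIc rs_self[OF functorial_group[OF G] S I(1)]
    by (simp add: i)
  show ?thesis using 1 2 by simp
qed

private lemma pm_N_hom: "n \<in> carrier (M.TM X S) \<Longrightarrow> N.pm K S n \<in> hom (sec (lin R G K) S) (U S)"
  and pm_N_hom_left: "t \<in> carrier (sec (lin R G K) S) \<Longrightarrow> (\<lambda>n. N.pm K S n t) \<in> hom (M.TM X S) (U S)"
  using N.pm_hom[OF stK S, of n] N.pm_hom_left[OF stK S, of t] unfolding add_N unfolding N_simps U_def by blast+

lemma val_closed:
  assumes "m \<in> carrier (sec M S)" "r \<in> carrier (sec R S)" "clopen S V" "h \<in> H (subtopology S V)" "k \<in> K (subtopology S V)"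
  shows "val S m r V h k \<in> carrier (U S)"
  unfolding val_def
  by (rule hom_in_carrier[OF pm_N_hom[OF M.pm_closed[OF stX S assms(1) lgenX[OF assms(2,3) hc_in[OF assms(3,4)]]]] lgenK[OF RS.one_closed assms(3,5)]])

lemma val_hom_r:
  assumes m: "m \<in> carrier (sec M S)" and V: "clopen S V" "h \<in> H (subtopology S V)" "k \<in> K (subtopology S V)"
  shows "(\<lambda>r. val S m r V h k) \<in> hom (add_monoid (sec R S)) (U S)"
  using hom_compose[OF hom_compose[OF lgen_hom[OF R fX S V(1) hc_in[OF V(1,2)]] M.pm_hom[OF stX S m]] pm_N_hom_left[OF lgenK[OF RS.one_closed V(1,3)]]]
  by (simp add: val_def comp_def)

lemma val_hom_m:
  assumes r: "r \<in> carrier (sec R S)" and V: "clopen S V" "h \<in> H (subtopology S V)" "k \<in> K (subtopology S V)"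
  shows "(\<lambda>m. val S m r V h k) \<in> hom (add_monoid (sec M S)) (U S)"
  using hom_compose[OF M.pm_hom_left[OF stX S lgenX[OF r V(1) hc_in[OF V(1,2)]]] pm_N_hom_left[OF lgenK[OF RS.one_closed V(1,3)]]]
  by (simp add: val_def comp_def)

lemma pm_pm_eq_val:
  assumes m: "m \<in> carrier (sec M S)" and r: "r \<in> carrier (sec R S)" "r' \<in> carrier (sec R S)"
    and V: "clopen S V" "h \<in> H (subtopology S V)" and V': "clopen S V'" "k \<in> K (subtopology S V')"
  shows "N.pm K S (M.pm X S m (lgen R G X S r V (h \<otimes>\<^bsub>sec G (subtopology S V)\<^esub> c (subtopology S V)))) (lgen R G K S r' V' k) =
    val S m (r \<otimes>\<^bsub>sec R S\<^esub> r') (V \<inter> V') (rs G S V (V \<inter> V') h) (rs G S V' (V \<inter> V') k)"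
  unfolding val_def normal_form[OF m r V(1) hc_in[OF V] V']
  using rs_hc[OF V(1) clopen_Int[OF V(1) V'(1)] _ V(2)] by simp

lemma val_union:
  assumes m: "m \<in> carrier (sec M S)" and r: "r \<in> carrier (sec R S)"
    and V: "clopen S V1" "clopen S V2" "V1 \<inter> V2 = {}" and h: "h \<in> H (subtopology S (V1 \<union> V2))" and k: "k \<in> K (subtopology S (V1 \<union> V2))"
  shows "val S m r (V1 \<union> V2) h k = val S m r V1 (rs G S (V1 \<union> V2) V1 h) (rs G S (V1 \<union> V2) V1 k) \<otimes>\<^bsub>U S\<^esub>
    val S m r V2 (rs G S (V1 \<union> V2) V2 h) (rs G S (V1 \<union> V2) V2 k)"
proof -
  let ?V = "V1 \<union> V2"
  have c12: "clopen S ?V" using V clopen_Un by blast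
  have h12: "rs G S ?V V1 h \<in> H (sb V1)" "rs G S ?V V2 h \<in> H (sb V2)" using rsH[OF c12 V(1) _ h] rsH[OF c12 V(2) _ h] by auto
  have e: "rs G S ?V V1 (h \<otimes>\<^bsub>sec G (sb ?V)\<^esub> c (sb ?V)) = rs G S ?V V1 h \<otimes>\<^bsub>sec G (sb V1)\<^esub> c (sb V1)"
     "rs G S ?V V2 (h \<otimes>\<^bsub>sec G (sb ?V)\<^esub> c (sb ?V)) = rs G S ?V V2 h \<otimes>\<^bsub>sec G (sb V2)\<^esub> c (sb V2)"
    using rs_hc[OF c12 V(1) _ h] rs_hc[OF c12 V(2) _ h] by auto
  note l1 = lgenX[OF r V(1) hc_in[OF V(1) h12(1)]] and l2 = lgenX[OF r V(2) hc_in[OF V(2) h12(2)]]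
  note lk = lgenK[OF RS.one_closed c12 k]
  have i: "V1 \<inter> ?V = V1" "V2 \<inter> ?V = V2" by auto
  \<comment> \<open>Only the first factor is split; normalising each summand then restricts the
    second factor to the same piece.\<close>
  have "val S m r ?V h k = N.pm K S (M.pm X S m (lgen R G X S r V1 (rs G S ?V V1 h \<otimes>\<^bsub>sec G (sb V1)\<^esub> c (sb V1)))) (lgen R G K S \<one>\<^bsub>sec R S\<^esub> ?V k) \<otimes>\<^bsub>U S\<^esub>
    N.pm K S (M.pm X S m (lgen R G X S r V2 (rs G S ?V V2 h \<otimes>\<^bsub>sec G (sb V2)\<^esub> c (sb V2)))) (lgen R G K S \<one>\<^bsub>sec R S\<^esub> ?V k)"
    unfolding val_def lgen_union[OF R fX S r V hc_in[OF c12 h]] e hom_mult[OF M.pm_hom[OF stX S m] l1 l2]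
    by (rule hom_mult[OF pm_N_hom_left[OF lk] M.pm_closed[OF stX S m l1] M.pm_closed[OF stX S m l2]])
  then show ?thesis
    unfolding pm_pm_eq_val[OF m r RS.one_closed V(1) h12(1) c12 k] pm_pm_eq_val[OF m r RS.one_closed V(2) h12(2) c12 k] i
    using r rs_self[OF functorial_group[OF G] S V(1) H_car[OF T[OF V(1)] h12(1)]] rs_self[OF functorial_group[OF G] S V(2) H_car[OF T[OF V(2)] h12(2)]]
    by simp
qed

lemma val_local:
  assumes "r \<in> carrier (sec R S)" "r' \<in> carrier (sec R S)" "clopen S V" "Rtop R S V r = Rtop R S V r'" "h \<in> H (subtopology S V)"
  shows "val S m r V h k = val S m r' V h k"
  unfolding val_def lgen_local[OF R fX S assms(3,1,2,4) hc_in[OF assms(3,5)]] ..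

text \<open>The element \<open>h'\<close> passes through the inner tensor sign and is absorbed by
  \<open>h\<close>; the support shrinks to the part on which \<open>h'\<close> lives.\<close>

lemma val_smult:
  assumes m: "m \<in> carrier (sec M S)" and r: "r \<in> carrier (sec R S)" "r' \<in> carrier (sec R S)"
    and V: "clopen S V" "h \<in> H (subtopology S V)" "k \<in> K (subtopology S V)" and V': "clopen S V'" "h' \<in> H (subtopology S V')"
  shows "val S (smult (sec M S) (lgen R G H S r' V' h') m) r V h k =
    val S m (r' \<otimes>\<^bsub>sec R S\<^esub> r) (V' \<inter> V) (rs G S V' (V' \<inter> V) h' \<otimes>\<^bsub>sec G (subtopology S (V' \<inter> V))\<^esub> rs G S V (V' \<inter> V) h) (rs G S V (V' \<inter> V) k)"
proof -
  let ?I = "V' \<inter> V"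
  have I: "clopen S ?I" "?I \<subseteq> V" "?I \<subseteq> V'" "?I \<inter> V = ?I" using V V' clopen_Int by auto
  interpret GI: group "sec G (sb ?I)" by (rule group_sec[OF G T[OF I(1)]])
  have fH: "functorial (sub_presheaf G H)" using csH by (simp add: condensed_subset_def)
  have lh: "lgen R G H S r' V' h' \<in> carrier (sec (lin R G H) S)" by (rule lgen_closed[OF R fH S r(2) V'])
  note lx = lgenX[OF r(1) V(1) hc_in[OF V(1,2)]]
  have hI: "rs G S V ?I h \<in> H (sb ?I)" "rs G S V' ?I h' \<in> H (sb ?I)"
    using rsH[OF V(1) I(1,2) V(2)] rsH[OF V'(1) I(1,3) V'(2)] .
  have hh: "rs G S V' ?I h' \<otimes>\<^bsub>sec G (sb ?I)\<^esub> rs G S V ?I h \<in> H (sb ?I)"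
    by (rule subgroup.m_closed[OF subgroup_H[OF T[OF I(1)]] hI(2,1)])
  have as: "rs G S V' ?I h' \<otimes>\<^bsub>sec G (sb ?I)\<^esub> (rs G S V ?I h \<otimes>\<^bsub>sec G (sb ?I)\<^esub> c (sb ?I)) =
     (rs G S V' ?I h' \<otimes>\<^bsub>sec G (sb ?I)\<^esub> rs G S V ?I h) \<otimes>\<^bsub>sec G (sb ?I)\<^esub> c (sb ?I)"
    using hI H_car[OF T[OF I(1)]] c_closed[OF T[OF I(1)]] by (simp add: GI.m_assoc)
  have "val S (smult (sec M S) (lgen R G H S r' V' h') m) r V h k =
      N.pm K S (M.pm X S m (lgen R G X S (r' \<otimes>\<^bsub>sec R S\<^esub> r) ?I ((rs G S V' ?I h' \<otimes>\<^bsub>sec G (sb ?I)\<^esub> rs G S V ?I h) \<otimes>\<^bsub>sec G (sb ?I)\<^esub> c (sb ?I)))) (lgen R G K S \<one>\<^bsub>sec R S\<^esub> V k)"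
    unfolding val_def M.pm_balanced[OF stX S m lh lx] lin_mult_lgen[OF R G csH csX csX HX S r(2,1) V' V(1) hc_in[OF V(1,2)]]
      rs_hc[OF V(1) I(1,2) V(2)] as ..
  also have "\<dots> = val S m (r' \<otimes>\<^bsub>sec R S\<^esub> r) ?I (rs G S V' ?I h' \<otimes>\<^bsub>sec G (sb ?I)\<^esub> rs G S V ?I h) (rs G S V ?I k)"
    unfolding pm_pm_eq_val[OF m RS.m_closed[OF r(2,1)] RS.one_closed I(1) hh V(1,3)] I(4)
    using r rs_self[OF functorial_group[OF G] S I(1) H_car[OF T[OF I(1)] hh]] by simp
  finally show ?thesis .
qed

lemma val_unique:
  assumes m: "m \<in> carrier (sec M S)" and r: "r \<in> carrier (sec R S)" and V: "clopen S V"
    and h: "h \<in> H (subtopology S V)" "h' \<in> H (subtopology S V)" and k: "k \<in> K (subtopology S V)" "k' \<in> K (subtopology S V)"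
    and eq: "h \<otimes>\<^bsub>sec G (subtopology S V)\<^esub> c (subtopology S V) \<otimes>\<^bsub>sec G (subtopology S V)\<^esub> k =
      h' \<otimes>\<^bsub>sec G (subtopology S V)\<^esub> c (subtopology S V) \<otimes>\<^bsub>sec G (subtopology S V)\<^esub> k'"
  shows "val S m r V h k = val S m r V h' k'"
proof -
  interpret GV: group "sec G (sb V)" by (rule group_sec[OF G T[OF V]])
  let ?c = "c (sb V)"
  \<comment> \<open>The element to be moved. It lies in \<open>K\<close> by its form, and in the
    conjugate of \<open>H\<close> because the two decompositions give
    \<open>l = g^-1 (h'^-1 h) g\<close>.\<close>
  define l where "l = k' \<otimes>\<^bsub>sec G (sb V)\<^esub> inv\<^bsub>sec G (sb V)\<^esub> k"
  note hk = H_car[OF T[OF V] h(1)] H_car[OF T[OF V] h(2)] K_car[OF T[OF V] k(1)] K_car[OF T[OF V] k(2)] and cc = c_closed[OF T[OF V]]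
  have lK: "l \<in> K (sb V)" unfolding l_def
    by (rule subgroup.m_closed[OF subgroup_K[OF T[OF V]] k(2) subgroup.m_inv_closed[OF subgroup_K[OF T[OF V]] k(1)]])
  note lc = K_car[OF T[OF V] lK]
  have hcl: "h \<otimes>\<^bsub>sec G (sb V)\<^esub> ?c = h' \<otimes>\<^bsub>sec G (sb V)\<^esub> ?c \<otimes>\<^bsub>sec G (sb V)\<^esub> l"
  proof -
    have "h \<otimes>\<^bsub>sec G (sb V)\<^esub> ?c = (h \<otimes>\<^bsub>sec G (sb V)\<^esub> ?c \<otimes>\<^bsub>sec G (sb V)\<^esub> k) \<otimes>\<^bsub>sec G (sb V)\<^esub> inv\<^bsub>sec G (sb V)\<^esub> k"
      using hk cc by (simp add: GV.m_assoc)
    then show ?thesis unfolding eq l_def using hk cc by (simp add: GV.m_assoc)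
  qed
  have lk: "l \<otimes>\<^bsub>sec G (sb V)\<^esub> k = k'" unfolding l_def using hk by (simp add: GV.m_assoc)
  have "l = inv\<^bsub>sec G (sb V)\<^esub> ?c \<otimes>\<^bsub>sec G (sb V)\<^esub> ((inv\<^bsub>sec G (sb V)\<^esub> h' \<otimes>\<^bsub>sec G (sb V)\<^esub> h) \<otimes>\<^bsub>sec G (sb V)\<^esub> ?c)"
  proof -
    have "(inv\<^bsub>sec G (sb V)\<^esub> h' \<otimes>\<^bsub>sec G (sb V)\<^esub> h) \<otimes>\<^bsub>sec G (sb V)\<^esub> ?c = inv\<^bsub>sec G (sb V)\<^esub> h' \<otimes>\<^bsub>sec G (sb V)\<^esub> (h' \<otimes>\<^bsub>sec G (sb V)\<^esub> ?c \<otimes>\<^bsub>sec G (sb V)\<^esub> l)"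
      using hk cc by (simp add: GV.m_assoc hcl[symmetric])
    also have "\<dots> = (inv\<^bsub>sec G (sb V)\<^esub> h' \<otimes>\<^bsub>sec G (sb V)\<^esub> h') \<otimes>\<^bsub>sec G (sb V)\<^esub> (?c \<otimes>\<^bsub>sec G (sb V)\<^esub> l)"
      using hk cc lc by (simp only: GV.m_assoc GV.m_closed GV.inv_closed)
    finally have "(inv\<^bsub>sec G (sb V)\<^esub> h' \<otimes>\<^bsub>sec G (sb V)\<^esub> h) \<otimes>\<^bsub>sec G (sb V)\<^esub> ?c = ?c \<otimes>\<^bsub>sec G (sb V)\<^esub> l" using hk cc lc by simp
    moreover have "inv\<^bsub>sec G (sb V)\<^esub> ?c \<otimes>\<^bsub>sec G (sb V)\<^esub> (?c \<otimes>\<^bsub>sec G (sb V)\<^esub> l) = (inv\<^bsub>sec G (sb V)\<^esub> ?c \<otimes>\<^bsub>sec G (sb V)\<^esub> ?c) \<otimes>\<^bsub>sec G (sb V)\<^esub> l"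
      using cc lc by (simp only: GV.m_assoc GV.m_closed GV.inv_closed)
    ultimately show ?thesis using cc lc by simp
  qed
  moreover have "inv\<^bsub>sec G (sb V)\<^esub> h' \<otimes>\<^bsub>sec G (sb V)\<^esub> h \<in> H (sb V)"
    by (rule subgroup.m_closed[OF subgroup_H[OF T[OF V]] subgroup.m_inv_closed[OF subgroup_H[OF T[OF V]] h(2)] h(1)])
  ultimately have lL: "l \<in> L (sb V)" using lK unfolding in_L in_C by blast
  note s = rs_self[OF functorial_group[OF G] S V]
  have hc: "h' \<otimes>\<^bsub>sec G (sb V)\<^esub> ?c \<in> carrier (sec G (sb V))" using hk cc by simp
  from move[OF m r RS.one_closed RS.one_closed V hc_in[OF V h(2)] V lL V k(1)]
  show ?thesis unfolding val_def hcl using r by (simp add: s[OF hc] s[OF lc] s[OF hk(3)] lk)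
qed

lemma val_empty:
  assumes m: "m \<in> carrier (sec M S)" and r: "r \<in> carrier (sec R S)" and h: "h \<in> H (subtopology S {})" and k: "k \<in> K (subtopology S {})"
  shows "val S m r {} h k = \<one>\<^bsub>U S\<^esub>"
proof -
  have "lgen R G K S \<one>\<^bsub>sec R S\<^esub> {} k = \<one>\<^bsub>sec (lin R G K) S\<^esub>" by (rule lgen_empty[OF R csK S RS.one_closed k])
  then show ?thesis unfolding val_def
    using hom_one[OF pm_N_hom[OF M.pm_closed[OF stX S m lgenX[OF r clopen_simps(1) hc_in[OF clopen_simps(1) h]]]] group_lin[OF R G csK S] group_U[OF S]]
    by simp
qed

lemma psi_val:
  assumes m: "m \<in> carrier (sec M S)" and r: "r \<in> carrier (sec R S)"
    and V: "clopen S V" "h \<in> H (subtopology S V)" "k \<in> K (subtopology S V)"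
  shows "psi S (val S m r V h k) = M.pm W S m (lgen R G W S r V
    (h \<otimes>\<^bsub>sec G (subtopology S V)\<^esub> c (subtopology S V) \<otimes>\<^bsub>sec G (subtopology S V)\<^esub> k))"
proof -
  note lx = lgenX[OF r V(1) hc_in[OF V(1,2)]] and lk = lgenK[OF RS.one_closed V(1,3)]
  interpret GV: group "sec G (sb V)" by (rule group_sec[OF G T[OF V(1)]])
  have "h \<otimes>\<^bsub>sec G (sb V)\<^esub> c (sb V) \<in> carrier (sec G (sb V))" using H_car[OF T[OF V(1)] V(2)] c_closed[OF T[OF V(1)]] by simp
  then show ?thesis
    unfolding val_def psi_pm[OF S M.pm_closed[OF stX S m lx] lk] M.ract_pm[OF stX stW csK XK S lk m lx]
      lin_mult_lgen[OF R G csX csK csW XK S r RS.one_closed V(1) hc_in[OF V(1,2)] V(1,3)]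
    using r rs_self[OF functorial_group[OF G] S V(1)] K_car[OF T[OF V(1)] V(3)] by simp
qed

text \<open>Generators of the two tensor factors come with unrelated supports and coefficients;
  \<open>pm_pm_eq_val\<close> brings each of their tensors into the form \<open>val\<close>.\<close>

lemma val_generates:
  "generates (U S) {val S m r V h k |m r V h k. m \<in> carrier (sec M S) \<and> r \<in> carrier (sec R S) \<and>
     clopen S V \<and> h \<in> H (subtopology S V) \<and> k \<in> K (subtopology S V)}" (is "generates _ ?Q")
proof (rule generatesI[OF group_U[OF S]])
  let ?P = "{M.pm X S m t |m t. m \<in> carrier (sec M S) \<and> t \<in> lgens R G X S}"
  have "generates (add_monoid (sec N S)) ?P" unfolding add_N
    by (rule M.TM_generates[OF stX S lin_generates_all[OF R G csX S]])
  from N.TM_generates_left[OF stK S this lin_generates_all[OF R G csK S]]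
  show "generates (U S) {N.pm K S n t |n t. n \<in> ?P \<and> t \<in> lgens R G K S}" unfolding U_def .
  show "?Q \<subseteq> carrier (U S)" using val_closed by blast
  show "{N.pm K S n t |n t. n \<in> ?P \<and> t \<in> lgens R G K S} \<subseteq> generate (U S) ?Q"
  proof
    fix z assume "z \<in> {N.pm K S n t |n t. n \<in> ?P \<and> t \<in> lgens R G K S}"
    then obtain m t' t where z: "z = N.pm K S (M.pm X S m t') t" "m \<in> carrier (sec M S)" "t' \<in> lgens R G X S" "t \<in> lgens R G K S" by blast
    obtain r V y where t': "t' = lgen R G X S r V y" "r \<in> carrier (sec R S)" "clopen S V" "y \<in> X (sb V)"
      by (rule lgensE[OF R G z(3)])
    obtain r' V' k where t: "t = lgen R G K S r' V' k" "r' \<in> carrier (sec R S)" "clopen S V'" "k \<in> K (sb V')"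
      by (rule lgensE[OF R G z(4)])
    obtain h where h: "h \<in> H (sb V)" "y = h \<otimes>\<^bsub>sec G (sb V)\<^esub> c (sb V)" using t'(4) by (auto simp: in_X)
    have I: "clopen S (V \<inter> V')" using t t' clopen_Int by blast
    have "z = val S m (r \<otimes>\<^bsub>sec R S\<^esub> r') (V \<inter> V') (rs G S V (V \<inter> V') h) (rs G S V' (V \<inter> V') k)"
      unfolding z(1) t(1) t'(1) h(2) by (rule pm_pm_eq_val[OF z(2) t'(2) t(2) t'(3) h(1) t(3,4)])
    moreover have "rs G S V (V \<inter> V') h \<in> H (sb (V \<inter> V'))" "rs G S V' (V \<inter> V') k \<in> K (sb (V \<inter> V'))"
      using rsH[OF t'(3) I _ h(1)] rsK[OF t(3) I _ t(4)] by auto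
    ultimately have "z \<in> ?Q" using z(2) RS.m_closed[OF t'(2) t(2)] I by blast
    then show "z \<in> generate (U S) ?Q" by (rule generate.incl)
  qed
qed

end

abbreviation "J \<equiv> Ind R G K L N"

lemma J_simps:
  "carrier (sec J S) = carrier (U S)" "ring.add (sec J S) = monoid.mult (U S)" "ring.zero (sec J S) = \<one>\<^bsub>U S\<^esub>"
  by (simp_all add: Ind_def N.TN_simps U_def)

context
  fixes S :: "'s topology" and a assumes S: "S \<in> CHED" and a: "a \<in> carrier (sec (lin R G K) S)"
begin

lemma J_smult_hom: "smult (sec J S) a \<in> hom (U S) (U S)"
  unfolding Ind_def N.TN_simps U_def by (rule N.ract_hom[OF stK stK csK KK S a])

lemma psi_smult: "z \<in> carrier (U S) \<Longrightarrow> psi S (smult (sec J S) a z) = M.ract W S a (psi S z)"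
  unfolding Ind_def N.TN_simps by (rule psi_ract[OF S a])

end

context
  fixes S T :: "'s topology" and f assumes S: "S \<in> CHED" and T: "T \<in> CHED" and f: "continuous_map S T f"
begin

lemma J_res_hom: "res J S T f \<in> hom (U T) (U S)"
  unfolding Ind_def U_def by (rule N.res_TN_hom[OF S T f stK])

lemma psi_J_res: "z \<in> carrier (U T) \<Longrightarrow> psi S (res J S T f z) = res (M.TN W) S T f (psi T z)"
  unfolding Ind_def by (rule psi_res[OF S T f])

end

end

section \<open>Direct sums\<close>

definition sum_inj :: "'i set \<Rightarrow> ('i \<Rightarrow> ('a, 'x) monoid_scheme) \<Rightarrow> 'i \<Rightarrow> 'a \<Rightarrow> 'i \<Rightarrow> 'a" where
  "sum_inj I A i u = (\<lambda>j\<in>I. if j = i then u else \<one>\<^bsub>A j\<^esub>)"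

context
  fixes I :: "'i set" and A :: "'i \<Rightarrow> ('a, 'x) monoid_scheme"
  assumes A: "\<And>i. i \<in> I \<Longrightarrow> comm_group (A i)"
begin

private lemma grp: "i \<in> I \<Longrightarrow> group (A i)"
  using A comm_group.axioms(2) by blast

lemma comm_group_sum_group: "comm_group (sum_group I A)"
proof (rule group.group_comm_groupI[OF sum_group[OF grp]])
  fix x y assume "x \<in> carrier (sum_group I A)" "y \<in> carrier (sum_group I A)"
  then have "x i \<otimes>\<^bsub>A i\<^esub> y i = y i \<otimes>\<^bsub>A i\<^esub> x i" if "i \<in> I" for i
    using that carrier_sum_group[of I A, OF grp] by (intro comm_monoid.m_comm[OF comm_group.axioms(1)[OF A]]) auto
  then show "x \<otimes>\<^bsub>sum_group I A\<^esub> y = y \<otimes>\<^bsub>sum_group I A\<^esub> x" by (simp add: restrict_def fun_eq_iff)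
qed

lemma sum_inj_hom:
  assumes i: "i \<in> I"
  shows "sum_inj I A i \<in> hom (A i) (sum_group I A)"
proof (rule homI)
  fix u assume u: "u \<in> carrier (A i)"
  have "{j \<in> I. sum_inj I A i u j \<noteq> \<one>\<^bsub>A j\<^esub>} \<subseteq> {i}" by (auto simp: sum_inj_def)
  then have "finite {j \<in> I. sum_inj I A i u j \<noteq> \<one>\<^bsub>A j\<^esub>}" using finite_subset by blast
  then show "sum_inj I A i u \<in> carrier (sum_group I A)"
    using u grp by (auto simp: carrier_sum_group[OF grp] sum_inj_def PiE_def Pi_def monoid.one_closed[OF group.is_monoid])
next
  fix u v assume "u \<in> carrier (A i)" "v \<in> carrier (A i)"
  have "\<one>\<^bsub>A j\<^esub> = \<one>\<^bsub>A j\<^esub> \<otimes>\<^bsub>A j\<^esub> \<one>\<^bsub>A j\<^esub>" if "j \<in> I" for j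
  proof -
    interpret group "A j" by (rule grp[OF that])
    show ?thesis by simp
  qed
  then show "sum_inj I A i (u \<otimes>\<^bsub>A i\<^esub> v) = sum_inj I A i u \<otimes>\<^bsub>sum_group I A\<^esub> sum_inj I A i v"
    by (auto simp: sum_inj_def restrict_def fun_eq_iff)
qed

text \<open>Induction on a finite set containing the support, with one coordinate split off at a
  time.\<close>

lemma sum_group_subgroup:
  assumes T: "subgroup T (sum_group I A)" and inj: "\<And>i u. i \<in> I \<Longrightarrow> u \<in> carrier (A i) \<Longrightarrow> sum_inj I A i u \<in> T"
  shows "carrier (sum_group I A) \<subseteq> T"
proof
  have "x \<in> T" if "finite J" "x \<in> carrier (sum_group I A)" "{i \<in> I. x i \<noteq> \<one>\<^bsub>A i\<^esub>} \<subseteq> J" for J x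
    using that
  proof (induction J arbitrary: x rule: finite_induct)
    case empty
    then have "x = \<one>\<^bsub>sum_group I A\<^esub>"
      by (auto simp: carrier_sum_group[OF grp] PiE_def extensional_def restrict_def fun_eq_iff)
    show ?case unfolding \<open>x = \<one>\<^bsub>sum_group I A\<^esub>\<close> by (rule subgroup.one_closed[OF T])
  next
    case (insert j J)
    have x: "x \<in> (\<Pi>\<^sub>E i\<in>I. carrier (A i))" using insert.prems by (simp add: carrier_sum_group[OF grp])
    show ?case
    proof (cases "j \<in> I")
      case True
      define y where "y = (\<lambda>i\<in>I. if i = j then \<one>\<^bsub>A i\<^esub> else x i)"
      have sub: "{i \<in> I. y i \<noteq> \<one>\<^bsub>A i\<^esub>} \<subseteq> J" using insert.prems by (auto simp: y_def)
      have "y \<in> (\<Pi>\<^sub>E i\<in>I. carrier (A i))"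
        using x by (auto simp: y_def intro: monoid.one_closed[OF group.is_monoid[OF grp]])
      moreover have "finite {i \<in> I. y i \<noteq> \<one>\<^bsub>A i\<^esub>}" using sub insert.hyps(1) finite_subset by blast
      ultimately have "y \<in> T" using sub by (intro insert.IH) (simp_all add: carrier_sum_group[OF grp])
      moreover have "sum_inj I A j (x j) \<in> T" using True x by (intro inj) auto
      ultimately have "sum_inj I A j (x j) \<otimes>\<^bsub>sum_group I A\<^esub> y \<in> T" using T by (simp add: subgroup.m_closed del: mult_sum_group)
      moreover have "sum_inj I A j (x j) \<otimes>\<^bsub>sum_group I A\<^esub> y = x"
      proof
        fix i
        show "(sum_inj I A j (x j) \<otimes>\<^bsub>sum_group I A\<^esub> y) i = x i"
        proof (cases "i \<in> I")
          case i: True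
          interpret group "A i" by (rule grp[OF i])
          have "x i \<in> carrier (A i)" using x i by auto
          then show ?thesis using i r_one[of "x i"] l_one[of "x i"] by (cases "i = j") (simp_all add: sum_inj_def y_def del: r_one)
        next
          case False then show ?thesis using x by (auto simp: PiE_def extensional_def)
        qed
      qed
      ultimately show ?thesis by simp
    next
      case False
      then show ?thesis using insert.prems by (intro insert.IH) auto
    qed
  qed
  then show "x \<in> T" if "x \<in> carrier (sum_group I A)" for x
    using that by (auto simp: carrier_sum_group[OF grp])
qed

text \<open>The criterion behind the final isomorphism. The homomorphism \<open>\<Psi>\<close>
  assembled from the \<open>p i\<close> satisfies \<open>\<Psi> (\<phi> y) = y\<close> on the
  generators coming from the summands, hence everywhere; and the image of \<open>\<phi>\<close> is a
  subgroup containing every summand.\<close>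

lemma bij_betw_sum_group:
  fixes Q :: "('q, 'y) monoid_scheme"
  assumes Q: "comm_group Q" and \<phi>: "\<phi> \<in> hom Q (sum_group I A)" and p: "\<And>i. i \<in> I \<Longrightarrow> p i \<in> hom (A i) Q"
    and \<phi>p: "\<And>i u. i \<in> I \<Longrightarrow> u \<in> carrier (A i) \<Longrightarrow> \<phi> (p i u) = sum_inj I A i u"
    and gen: "generates Q (\<Union>i\<in>I. p i ` carrier (A i))"
  shows "bij_betw \<phi> (carrier Q) (carrier (sum_group I A))"
proof -
  interpret Q: comm_group Q by fact
  have B: "group (sum_group I A)" by (rule sum_group[OF grp])
  define \<Psi> where "\<Psi> = (\<lambda>x. gfinprod Q (\<lambda>i. p i (x i)) I)"
  have \<Psi>: "\<Psi> \<in> hom (sum_group I A) Q" unfolding \<Psi>_def by (rule Q.hom_group_sum[OF p grp])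
  have \<Psi>_inj: "\<Psi> (sum_inj I A i u) = p i u" if i: "i \<in> I" and u: "u \<in> carrier (A i)" for i u
  proof -
    have c: "p i u \<in> carrier Q" by (rule hom_in_carrier[OF p[OF i] u])
    have "\<Psi> (sum_inj I A i u) = gfinprod Q (\<lambda>j. if j = i then p i u else \<one>\<^bsub>Q\<^esub>) I"
      unfolding \<Psi>_def
      by (rule Q.gfinprod_cong) (use c hom_one[OF p grp Q.is_group] in \<open>auto simp: sum_inj_def simp_implies_def\<close>)
    also have "\<dots> = gfinprod Q (\<lambda>j. if j = i then p i u else \<one>\<^bsub>Q\<^esub>) {i}"
      by (rule Q.gfinprod_mono_neutral_cong_right) (use i c in auto)
    also have "\<dots> = p i u"
      using c by (subst Q.gfinprod_eq_finprod) auto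
    finally show ?thesis .
  qed
  have "\<Psi> (\<phi> y) = y" if "y \<in> carrier Q" for y
  proof -
    have "(\<Psi> \<circ> \<phi>) y = id y"
    proof (rule hom_eq_on_generators[OF Q.is_group Q.is_group gen hom_compose[OF \<phi> \<Psi>] _ _ that])
      show "id \<in> hom Q Q" by (auto simp: hom_def)
      fix q assume "q \<in> (\<Union>i\<in>I. p i ` carrier (A i))"
      then show "(\<Psi> \<circ> \<phi>) q = id q" using \<phi>p \<Psi>_inj by auto
    qed
    then show ?thesis by simp
  qed
  then have "inj_on \<phi> (carrier Q)" by (metis inj_onI)
  moreover have "carrier (sum_group I A) \<subseteq> \<phi> ` carrier Q"
  proof (rule sum_group_subgroup)
    show "subgroup (\<phi> ` carrier Q) (sum_group I A)"
      using group_hom.img_is_subgroup[of Q "sum_group I A" \<phi>] \<phi> Q.is_group B by (simp add: group_hom_def group_hom_axioms_def)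
    show "sum_inj I A i u \<in> \<phi> ` carrier Q" if "i \<in> I" "u \<in> carrier (A i)" for i u
      using \<phi>p[OF that, symmetric] hom_in_carrier[OF p[OF that(1)] that(2)] by blast
  qed
  moreover have "\<phi> ` carrier Q \<subseteq> carrier (sum_group I A)" using hom_in_carrier[OF \<phi>] by blast
  ultimately show ?thesis by (auto simp: bij_betw_def)
qed

end

lemma sum_group_map_hom:
  assumes A: "\<And>i. i \<in> I \<Longrightarrow> group (A i)" and B: "\<And>i. i \<in> I \<Longrightarrow> group (B i)"
    and f: "\<And>i. i \<in> I \<Longrightarrow> f i \<in> hom (A i) (B i)"
  shows "(\<lambda>x. \<lambda>i\<in>I. f i (x i)) \<in> hom (sum_group I A) (sum_group I B)"
proof (rule homI)
  fix x assume "x \<in> carrier (sum_group I A)"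
  then have x: "x \<in> (\<Pi>\<^sub>E i\<in>I. carrier (A i))" "finite {i \<in> I. x i \<noteq> \<one>\<^bsub>A i\<^esub>}" by (simp_all add: carrier_sum_group[OF A])
  have "{i \<in> I. (\<lambda>i\<in>I. f i (x i)) i \<noteq> \<one>\<^bsub>B i\<^esub>} \<subseteq> {i \<in> I. x i \<noteq> \<one>\<^bsub>A i\<^esub>}"
    using hom_one[OF f A B] by auto
  then have "finite {i \<in> I. (\<lambda>i\<in>I. f i (x i)) i \<noteq> \<one>\<^bsub>B i\<^esub>}" using x(2) finite_subset by blast
  moreover have "(\<lambda>i\<in>I. f i (x i)) \<in> (\<Pi>\<^sub>E i\<in>I. carrier (B i))" using x(1) hom_in_carrier[OF f] by auto
  ultimately show "(\<lambda>i\<in>I. f i (x i)) \<in> carrier (sum_group I B)" by (simp add: carrier_sum_group[OF B])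
next
  fix x y assume "x \<in> carrier (sum_group I A)" "y \<in> carrier (sum_group I A)"
  then have "x i \<in> carrier (A i)" "y i \<in> carrier (A i)" if "i \<in> I" for i using that by (auto simp: carrier_sum_group[OF A])
  then show "(\<lambda>i\<in>I. f i ((x \<otimes>\<^bsub>sum_group I A\<^esub> y) i)) = (\<lambda>i\<in>I. f i (x i)) \<otimes>\<^bsub>sum_group I B\<^esub> (\<lambda>i\<in>I. f i (y i))"
    using hom_mult[OF f] by (auto simp: restrict_def fun_eq_iff)
qed

lemma sum_group_map_inj:
  assumes "\<And>i. i \<in> I \<Longrightarrow> group (A i)" "\<And>i. i \<in> I \<Longrightarrow> group (B i)" "\<And>i. i \<in> I \<Longrightarrow> f i \<in> hom (A i) (B i)"
  shows "(\<lambda>j\<in>I. f j (sum_inj I A i u j)) = sum_inj I B i (f i u)"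
  using hom_one[OF assms(3,1,2)] by (auto simp: sum_inj_def restrict_def fun_eq_iff)

text \<open>The same summand occurs as the group \<open>U\<close> and as the additive part of a
  module record; the direct sum sees only the operations.\<close>

lemma sum_group_eqI:
  assumes "\<And>i. i \<in> I \<Longrightarrow> carrier (A i) = carrier (B i)" "\<And>i. i \<in> I \<Longrightarrow> monoid.mult (A i) = monoid.mult (B i)"
    "\<And>i. i \<in> I \<Longrightarrow> \<one>\<^bsub>A i\<^esub> = \<one>\<^bsub>B i\<^esub>"
  shows "sum_group I A = sum_group I B"
proof -
  have "product_group I A = product_group I B"
    using assms by (auto simp: product_group_def restrict_def fun_eq_iff cong: PiE_cong)
  moreover have "{x \<in> \<Pi>\<^sub>E i\<in>I. carrier (A i). finite {i \<in> I. x i \<noteq> \<one>\<^bsub>A i\<^esub>}} =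
      {x \<in> \<Pi>\<^sub>E i\<in>I. carrier (B i). finite {i \<in> I. x i \<noteq> \<one>\<^bsub>B i\<^esub>}}"
    using assms by (auto cong: PiE_cong conj_cong)
  ultimately show ?thesis by (simp add: sum_group_def)
qed

section \<open>The double coset decomposition\<close>

definition eval_at :: "('s, 'a, 'x) presheaf \<Rightarrow> 's topology \<Rightarrow> 's \<Rightarrow> 'a \<Rightarrow> 'a" where
  "eval_at G S s = res G pt S (\<lambda>_. s)"

lemma continuous_map_point: "s \<in> topspace S \<Longrightarrow> continuous_map pt S (\<lambda>_. s)"
  by simp

lemma eval_at_hom:
  "condensed_group G \<Longrightarrow> S \<in> CHED \<Longrightarrow> s \<in> topspace S \<Longrightarrow> eval_at G S s \<in> hom (sec G S) (sec G pt)"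
  unfolding eval_at_def by (intro res_group_hom pt_CHED continuous_map_point)

lemma const_sec_pt:
  assumes "condensed_group G" "x \<in> carrier (sec G pt)"
  shows "const_sec G x pt = x"
proof -
  have "res G pt pt (\<lambda>_. undefined) x = res G pt pt id x"
    by (rule res_cong[OF functorial_group[OF assms(1)] pt_CHED pt_CHED continuous_map_pt _ _ assms(2)]) (auto simp: pt_def)
  then show ?thesis using res_id[OF functorial_group[OF assms(1)] pt_CHED assms(2)] by (simp add: const_sec_def)
qed

lemma eval_at_const_sec:
  "condensed_group G \<Longrightarrow> x \<in> carrier (sec G pt) \<Longrightarrow> S \<in> CHED \<Longrightarrow> s \<in> topspace S \<Longrightarrow> eval_at G S s (const_sec G x S) = x"
  unfolding eval_at_def by (simp only: res_const_sec[OF _ _ pt_CHED _ continuous_map_point] const_sec_pt)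

text \<open>By Yoneda a section \<open>x\<close> over \<open>T\<close> is a map from
  \<open>underline T\<close> to \<open>G\<close>, so openness yields an open \<open>P\<close> over
  which \<open>x\<close> lies in \<open>A\<close>. The point \<open>s\<close> is in \<open>P\<close>
  because the value there is in \<open>A\<close>, and a clopen neighbourhood inside \<open>P\<close>
  is again a test space.\<close>

lemma open_condensed_nhd:
  fixes G :: "('s, 'g) group_presheaf"
  assumes G: "condensed_group G" and A: "open_in_condensed G A" and T: "T \<in> CHED" and s: "s \<in> topspace T"
    and x: "x \<in> carrier (sec G T)" and xs: "eval_at G T s x \<in> A pt"
  obtains W where "clopen T W" "s \<in> W" "rs G T (topspace T) W x \<in> A (subtopology T W)"
proof -
  note F = functorial_group[OF G]
  have cm: "condensed_map (underline T) G (\<lambda>S f. res G S T f x)"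
    unfolding condensed_map_def
  proof (intro conjI ballI allI impI)
    fix S :: "'s topology" assume S: "S \<in> CHED"
    show "(\<lambda>f. res G S T f x) \<in> carrier (sec (underline T) S) \<rightarrow> carrier (sec G S)"
      using res_closed[OF F S T _ x] by (auto simp: underline_def)
  next
    fix S S' :: "'s topology" and f h assume *: "S \<in> CHED" "S' \<in> CHED" "continuous_map S S' f" "h \<in> carrier (sec (underline T) S')"
    then have h: "continuous_map S' T h" by (simp add: underline_def)
    have "continuous_map S T (compose (topspace S) h f)"
      using continuous_map_compose[OF *(3) h] by (rule continuous_map_eq) (simp add: compose_def)
    then have "res G S T (compose (topspace S) h f) x = res G S T (h \<circ> f) x"
      using continuous_map_compose[OF *(3) h] by (rule res_cong[OF F *(1) T _ _ _ x]) (simp add: compose_def)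
    also have "\<dots> = res G S S' f (res G S' T h x)" by (rule res_comp[OF F *(1,2) T *(3) h x, symmetric])
    finally show "res G S T (res (underline T) S S' f h) x = res G S S' f (res G S' T h x)" by (simp add: underline_def)
  qed
  obtain P where P: "openin T P" and eq: "\<forall>S\<in>CHED. {f \<in> carrier (sec (underline T) S). res G S T f x \<in> A S} =
      carrier (sec (underline (subtopology T P)) S)"
    using A[unfolded open_in_condensed_def, rule_format, OF T cm] by blast
  \<comment> \<open>Sections of \<open>underline T\<close> are extensional functions, hence the
    restricted forms of the constant map here and of the inclusion \<open>?i\<close> below.\<close>
  let ?f = "\<lambda>(_::'s)\<in>topspace pt. s"
  have f: "continuous_map pt T ?f" by (rule continuous_map_eq[OF continuous_map_point[OF s]]) simp
  have "res G pt T ?f x = eval_at G T s x"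
    unfolding eval_at_def by (rule res_cong[OF F pt_CHED T f continuous_map_point[OF s] _ x]) simp
  then have "?f \<in> {f \<in> carrier (sec (underline T) pt). res G pt T f x \<in> A pt}"
    using f xs by (auto simp: underline_def)
  then have "?f \<in> carrier (sec (underline (subtopology T P)) pt)"
    using eq pt_CHED by blast
  then have "s \<in> P" by (auto simp: underline_def continuous_map_def pt_def)
  then obtain W where W: "clopen T W" "s \<in> W" "W \<subseteq> P" using clopen_base[OF T P] by blast
  let ?i = "restrict id W"
  have T': "subtopology T W \<in> CHED" by (rule sub_CHED[OF T W(1)])
  have tW: "topspace (subtopology T W) = W" by (rule topspace_sub_clopen[OF W(1)])
  have i: "continuous_map (subtopology T W) (subtopology T P) ?i"
    by (rule continuous_map_eq[OF continuous_map_sub_id[OF W(3)]]) (simp add: tW)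
  then have iT: "continuous_map (subtopology T W) T ?i" by (simp add: continuous_map_in_subtopology)
  have "?i \<in> carrier (sec (underline (subtopology T P)) (subtopology T W))" using i unfolding underline_def by (simp add: tW del: topspace_subtopology)
  then have "res G (subtopology T W) T ?i x \<in> A (subtopology T W)" using eq T' by blast
  moreover have "res G (subtopology T W) T ?i x = rs G T (topspace T) W x"
    unfolding rs_def subtopology_topspace
    by (rule res_cong[OF F T' T iT _ _ x]) (auto simp: tW)
  ultimately show ?thesis using that W by simp
qed

section \<open>All double cosets together: decomposition of sections of \<open>G\<close>\<close>

locale mackey =
  fixes R :: "('s, 'r) ring_presheaf"
    and G :: "('s, 'g) group_presheaf"
    and H K :: "'s topology \<Rightarrow> 'g set"
    and M :: "('s, ('s, 'r, 'g) lin, 'm) module_presheaf"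
    and g :: "'g set \<Rightarrow> 'g"
  assumes R: "condensed_ring R"
    and G: "condensed_group G"
    and H: "condensed_subgroup G H"
    and K: "condensed_subgroup G K"
    and open_HK: "open_in_condensed G H \<or> open_in_condensed G K"
    and M: "condensed_right_module (group_ring R G H) M"
    and g: "\<And>D. D \<in> carrier (sec (double_quotient G H K) pt) \<Longrightarrow> g D \<in> D"
begin

abbreviation "I \<equiv> carrier (sec (double_quotient G H K) pt)"
abbreviation "W \<equiv> whole G"
abbreviation "c D \<equiv> const_sec G (g D)"

lemma csH: "condensed_subset G H" and csK: "condensed_subset G K"
  using condensed_subset_subgroup[OF H] condensed_subset_subgroup[OF K] .

sublocale M: right_group_module R G H M
  by (rule right_group_module_condensed[OF R G csH M])

lemma subgroup_H: "T \<in> CHED \<Longrightarrow> subgroup (H T) (sec G T)" and subgroup_K: "T \<in> CHED \<Longrightarrow> subgroup (K T) (sec G T)"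
  using H K by (simp_all add: condensed_subgroup_def)

lemma H_car: "T \<in> CHED \<Longrightarrow> h \<in> H T \<Longrightarrow> h \<in> carrier (sec G T)" and K_car: "T \<in> CHED \<Longrightarrow> k \<in> K T \<Longrightarrow> k \<in> carrier (sec G T)"
  using subgroup.mem_carrier[OF subgroup_H] subgroup.mem_carrier[OF subgroup_K] by blast+

definition dc :: "'g \<Rightarrow> 'g set" where
  "dc x = {h \<otimes>\<^bsub>sec G pt\<^esub> x \<otimes>\<^bsub>sec G pt\<^esub> k |h k. h \<in> H pt \<and> k \<in> K pt}"

lemma I_eq: "I = dc ` carrier (sec G pt)"
proof -
  have "(H pt #>\<^bsub>sec G pt\<^esub> x) <#>\<^bsub>sec G pt\<^esub> K pt = dc x" for x
    by (auto simp: dc_def r_coset_def set_mult_def)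
  then show ?thesis by (simp add: double_quotient_def)
qed

interpretation Gpt: group "sec G pt" by (rule group_sec[OF G pt_CHED])

lemma dc_car: "x \<in> carrier (sec G pt) \<Longrightarrow> dc x \<subseteq> carrier (sec G pt)"
  unfolding dc_def using H_car[OF pt_CHED] K_car[OF pt_CHED] by auto

lemma dc_sym:
  assumes x: "x \<in> carrier (sec G pt)" and y: "y \<in> dc x"
  obtains h k where "h \<in> H pt" "k \<in> K pt" "x = h \<otimes>\<^bsub>sec G pt\<^esub> y \<otimes>\<^bsub>sec G pt\<^esub> k"
proof -
  obtain h k where hk: "h \<in> H pt" "k \<in> K pt" "y = h \<otimes>\<^bsub>sec G pt\<^esub> x \<otimes>\<^bsub>sec G pt\<^esub> k" using y by (auto simp: dc_def)
  note c = H_car[OF pt_CHED hk(1)] K_car[OF pt_CHED hk(2)]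
  have "inv\<^bsub>sec G pt\<^esub> h \<otimes>\<^bsub>sec G pt\<^esub> y \<otimes>\<^bsub>sec G pt\<^esub> inv\<^bsub>sec G pt\<^esub> k =
      (inv\<^bsub>sec G pt\<^esub> h \<otimes>\<^bsub>sec G pt\<^esub> h) \<otimes>\<^bsub>sec G pt\<^esub> x \<otimes>\<^bsub>sec G pt\<^esub> (k \<otimes>\<^bsub>sec G pt\<^esub> inv\<^bsub>sec G pt\<^esub> k)"
    unfolding hk(3) using c x by (simp only: Gpt.m_assoc Gpt.m_closed Gpt.inv_closed)
  then have "x = inv\<^bsub>sec G pt\<^esub> h \<otimes>\<^bsub>sec G pt\<^esub> y \<otimes>\<^bsub>sec G pt\<^esub> inv\<^bsub>sec G pt\<^esub> k" using c x by simp
  then show ?thesis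
    using that subgroup.m_inv_closed[OF subgroup_H[OF pt_CHED] hk(1)] subgroup.m_inv_closed[OF subgroup_K[OF pt_CHED] hk(2)] by blast
qed

lemma dc_mono:
  assumes x: "x \<in> carrier (sec G pt)" and y: "y \<in> dc x"
  shows "dc y \<subseteq> dc x"
proof
  fix z assume "z \<in> dc y"
  then obtain h k where hk: "h \<in> H pt" "k \<in> K pt" "z = h \<otimes>\<^bsub>sec G pt\<^esub> y \<otimes>\<^bsub>sec G pt\<^esub> k" by (auto simp: dc_def)
  obtain h' k' where hk': "h' \<in> H pt" "k' \<in> K pt" "y = h' \<otimes>\<^bsub>sec G pt\<^esub> x \<otimes>\<^bsub>sec G pt\<^esub> k'" using y by (auto simp: dc_def)
  have "z = (h \<otimes>\<^bsub>sec G pt\<^esub> h') \<otimes>\<^bsub>sec G pt\<^esub> x \<otimes>\<^bsub>sec G pt\<^esub> (k' \<otimes>\<^bsub>sec G pt\<^esub> k)"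
    unfolding hk(3) hk'(3) using x H_car[OF pt_CHED hk(1)] K_car[OF pt_CHED hk(2)] H_car[OF pt_CHED hk'(1)] K_car[OF pt_CHED hk'(2)]
    by (simp add: Gpt.m_assoc)
  then show "z \<in> dc x" unfolding dc_def
    using subgroup.m_closed[OF subgroup_H[OF pt_CHED] hk(1) hk'(1)] subgroup.m_closed[OF subgroup_K[OF pt_CHED] hk'(2) hk(2)] by blast
qed

lemma dc_eq:
  assumes x: "x \<in> carrier (sec G pt)" and y: "y \<in> dc x"
  shows "dc y = dc x"
proof
  have yc: "y \<in> carrier (sec G pt)" using dc_car[OF x] y by blast
  obtain h k where "h \<in> H pt" "k \<in> K pt" "x = h \<otimes>\<^bsub>sec G pt\<^esub> y \<otimes>\<^bsub>sec G pt\<^esub> k" by (rule dc_sym[OF x y])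
  then have "x \<in> dc y" by (auto simp: dc_def)
  then show "dc x \<subseteq> dc y" by (rule dc_mono[OF yc])
qed (rule dc_mono[OF x y])

lemma g_car: "D \<in> I \<Longrightarrow> g D \<in> carrier (sec G pt)" and dc_g: "D \<in> I \<Longrightarrow> dc (g D) = D"
proof -
  assume D: "D \<in> I"
  then obtain x where x: "x \<in> carrier (sec G pt)" "D = dc x" by (auto simp: I_eq)
  have gx: "g D \<in> dc x" using g[OF D] x(2) by simp
  show "g D \<in> carrier (sec G pt)" using dc_car[OF x(1)] gx by blast
  show "dc (g D) = D" using dc_eq[OF x(1) gx] x(2) by simp
qed

lemma coset: "D \<in> I \<Longrightarrow> mackey_coset R G H K M (g D)"
  by (rule mackey_coset.intro[OF R G H K M g_car])

abbreviation "L D \<equiv> intersection K (conjugate G H (g D))"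
abbreviation "N D \<equiv> Res R G (conjugate G H (g D)) (L D) (condensed_tensor_bimodule (group_ring R G H) M (lin_bimodule R G (translate G H (g D))))"
abbreviation "U S D \<equiv> mackey_coset.U R G H K M (g D) S"
abbreviation "psi \<equiv> mackey_coset.psi R G H M"
abbreviation "val D \<equiv> mackey_coset.val R G H K M (g D)"
abbreviation "inc S \<equiv> sum_inj I (U S)"
abbreviation "B S \<equiv> sum_group I (U S)"

definition dec :: "'s topology \<Rightarrow> 's set \<Rightarrow> 'g \<Rightarrow> 'g set \<Rightarrow> 'g \<Rightarrow> 'g \<Rightarrow> bool" where
  "dec S V x D h k \<longleftrightarrow> D \<in> I \<and> h \<in> H (subtopology S V) \<and> k \<in> K (subtopology S V) \<and>
     x = h \<otimes>\<^bsub>sec G (subtopology S V)\<^esub> c D (subtopology S V) \<otimes>\<^bsub>sec G (subtopology S V)\<^esub> k"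

definition dec_pairs :: "'s topology \<Rightarrow> ('s set \<times> 'g) set" where
  "dec_pairs S = {(V, x). clopen S V \<and> (\<exists>D h k. dec S V x D h k)}"

context
  fixes S :: "'s topology" assumes S: "S \<in> CHED"
begin

private abbreviation "sb V \<equiv> subtopology S V"
private lemma T: "clopen S V \<Longrightarrow> sb V \<in> CHED" by (rule sub_CHED[OF S])

lemma c_car: "D \<in> I \<Longrightarrow> clopen S V \<Longrightarrow> c D (subtopology S V) \<in> carrier (sec G (subtopology S V))"
  by (rule const_sec_closed[OF G g_car T])

lemma dec_car: "clopen S V \<Longrightarrow> dec S V x D h k \<Longrightarrow> x \<in> carrier (sec G (subtopology S V))"
proof -
  assume V: "clopen S V" and d: "dec S V x D h k"
  interpret group "sec G (sb V)" by (rule group_sec[OF G T[OF V]])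
  show ?thesis using d H_car[OF T[OF V]] K_car[OF T[OF V]] c_car[OF _ V] by (auto simp: dec_def)
qed

lemma dec_mult:
  assumes V: "clopen S V" and h': "h' \<in> H (subtopology S V)" and d: "dec S V x D h k"
  shows "dec S V (h' \<otimes>\<^bsub>sec G (subtopology S V)\<^esub> x) D (h' \<otimes>\<^bsub>sec G (subtopology S V)\<^esub> h) k"
proof -
  interpret group "sec G (sb V)" by (rule group_sec[OF G T[OF V]])
  show ?thesis using d h' H_car[OF T[OF V]] K_car[OF T[OF V]] c_car[OF _ V] subgroup.m_closed[OF subgroup_H[OF T[OF V]] h']
    by (auto simp: dec_def m_assoc)
qed

lemma dec_rs:
  assumes V: "clopen S V" "clopen S V'" "V' \<subseteq> V" and d: "dec S V x D h k"
  shows "dec S V' (rs G S V V' x) D (rs G S V V' h) (rs G S V V' k)"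
proof -
  have D: "D \<in> I" and h: "h \<in> H (sb V)" and k: "k \<in> K (sb V)"
    and x: "x = h \<otimes>\<^bsub>sec G (sb V)\<^esub> c D (sb V) \<otimes>\<^bsub>sec G (sb V)\<^esub> k" using d by (auto simp: dec_def)
  note hc = H_car[OF T[OF V(1)] h] and kc = K_car[OF T[OF V(1)] k] and cc = c_car[OF D V(1)]
  interpret group "sec G (sb V)" by (rule group_sec[OF G T[OF V(1)]])
  show ?thesis unfolding dec_def x
    using D rs_in[OF R G csH S V h] rs_in[OF R G csK S V k] rs_const_sec[OF G g_car[OF D] S V]
    by (simp add: rs_mult[OF R G S V] hc kc cc)
qed

lemma eval_H: "clopen S V \<Longrightarrow> s \<in> V \<Longrightarrow> h \<in> H (subtopology S V) \<Longrightarrow> eval_at G (subtopology S V) s h \<in> H pt"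
  and eval_K: "clopen S V \<Longrightarrow> s \<in> V \<Longrightarrow> k \<in> K (subtopology S V) \<Longrightarrow> eval_at G (subtopology S V) s k \<in> K pt"
  unfolding eval_at_def
  using res_in[OF csH pt_CHED T continuous_map_point, of V s h] res_in[OF csK pt_CHED T continuous_map_point, of V s k] topspace_sub_clopen[of S V] by auto

lemma dec_eval:
  assumes V: "clopen S V" "s \<in> V" and d: "dec S V x D h k"
  shows "eval_at G (subtopology S V) s x \<in> D"
proof -
  have D: "D \<in> I" and h: "h \<in> H (sb V)" and k: "k \<in> K (sb V)"
    and x: "x = h \<otimes>\<^bsub>sec G (sb V)\<^esub> c D (sb V) \<otimes>\<^bsub>sec G (sb V)\<^esub> k" using d by (auto simp: dec_def)
  note hc = H_car[OF T[OF V(1)] h] and kc = K_car[OF T[OF V(1)] k] and cc = c_car[OF D V(1)]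
  have s: "s \<in> topspace (sb V)" using V topspace_sub_clopen[of S V] by simp
  interpret group "sec G (sb V)" by (rule group_sec[OF G T[OF V(1)]])
  have "eval_at G (sb V) s x = eval_at G (sb V) s h \<otimes>\<^bsub>sec G pt\<^esub> g D \<otimes>\<^bsub>sec G pt\<^esub> eval_at G (sb V) s k"
    unfolding x using hc kc cc eval_at_const_sec[OF G g_car[OF D] T[OF V(1)] s]
    by (simp add: hom_mult[OF eval_at_hom[OF G T[OF V(1)] s]])
  then have "eval_at G (sb V) s x \<in> dc (g D)" unfolding dc_def using eval_H[OF V h] eval_K[OF V k] by blast
  then show ?thesis using dc_g[OF D] by simp
qed

text \<open>The value at \<open>s\<close> lies in both double cosets, and double cosets with a
  common element are equal. A point of \<open>V\<close> is essential: over the empty set all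
  sections coincide.\<close>

lemma dec_unique:
  assumes V: "clopen S V" "s \<in> V" and d: "dec S V x D h k" "dec S V x D' h' k'"
  shows "D = D'"
proof -
  have D: "D \<in> I" "D' \<in> I" using d by (auto simp: dec_def)
  have "eval_at G (sb V) s x \<in> dc (g D)" "eval_at G (sb V) s x \<in> dc (g D')"
    using dec_eval[OF V d(1)] dec_eval[OF V d(2)] dc_g[OF D(1)] dc_g[OF D(2)] by simp_all
  then have "dc (g D) = dc (g D')" using dc_eq[OF g_car[OF D(1)]] dc_eq[OF g_car[OF D(2)]] by metis
  then show ?thesis using dc_g[OF D(1)] dc_g[OF D(2)] by simp
qed

text \<open>
  If \<open>H\<close> is open, a section \<open>x\<close> of \<open>G\<close> differs from the constant section through \<open>x(s)\<close> near \<open>s\<close> by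
  a section of \<open>H\<close>; likewise for \<open>K\<close> on the other side.
\<close>

lemma dec_local:
  assumes V: "clopen S V" and x: "x \<in> carrier (sec G (subtopology S V))" and s: "s \<in> V"
  obtains V' D h k where "clopen S V'" "s \<in> V'" "V' \<subseteq> V" "dec S V' (rs G S V V' x) D h k"
proof -
  let ?T = "sb V"
  note TV = T[OF V] and F = functorial_group[OF G]
  have tV: "topspace ?T = V" by (rule topspace_sub_clopen[OF V])
  have s': "s \<in> topspace ?T" using s tV by simp
  interpret GV: group "sec G ?T" by (rule group_sec[OF G TV])
  note eh = eval_at_hom[OF G TV s']
  \<comment> \<open>The value of \<open>x\<close> at \<open>s\<close> selects the double coset. Its
    decomposition \<open>h0 g k0\<close> is spread over every test space by constant
    sections.\<close>
  define y where "y = eval_at G ?T s x"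
  have y: "y \<in> carrier (sec G pt)" unfolding y_def by (rule hom_in_carrier[OF eh x])
  define D where "D = dc y"
  have D: "D \<in> I" using y by (auto simp: I_eq D_def)
  obtain h0 k0 where hk0: "h0 \<in> H pt" "k0 \<in> K pt" "y = h0 \<otimes>\<^bsub>sec G pt\<^esub> g D \<otimes>\<^bsub>sec G pt\<^esub> k0"
    using dc_sym[OF y, of "g D"] g[OF D] D_def by metis
  note h0c = H_car[OF pt_CHED hk0(1)] and k0c = K_car[OF pt_CHED hk0(2)] and gc = g_car[OF D]
  let ?y = "const_sec G y ?T"
  have yc: "?y \<in> carrier (sec G ?T)" by (rule const_sec_closed[OF G y TV])
  have ey: "eval_at G ?T s ?y = y" by (rule eval_at_const_sec[OF G y TV s'])
  have dec_y: "const_sec G y Q = const_sec G h0 Q \<otimes>\<^bsub>sec G Q\<^esub> c D Q \<otimes>\<^bsub>sec G Q\<^esub> const_sec G k0 Q"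
    and h0Q: "const_sec G h0 Q \<in> H Q" and k0Q: "const_sec G k0 Q \<in> K Q" if Q: "Q \<in> CHED" for Q
  proof -
    note ch = res_group_hom[OF G Q pt_CHED continuous_map_pt]
    show "const_sec G y Q = const_sec G h0 Q \<otimes>\<^bsub>sec G Q\<^esub> c D Q \<otimes>\<^bsub>sec G Q\<^esub> const_sec G k0 Q"
      unfolding const_sec_def hk0(3) using h0c k0c gc by (simp add: hom_mult[OF ch])
    show "const_sec G h0 Q \<in> H Q" "const_sec G k0 Q \<in> K Q"
      unfolding const_sec_def by (rule res_in[OF csH Q pt_CHED continuous_map_pt hk0(1)], rule res_in[OF csK Q pt_CHED continuous_map_pt hk0(2)])
  qed
  have rs_T: "rs G ?T (topspace ?T) V' z = rs G S V V' z" if "V' \<subseteq> V" for V' z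
    unfolding tV using rs_sub[of V V V' G S] that by simp
  from open_HK show ?thesis
  proof
    assume oH: "open_in_condensed G H"
    have x': "x \<otimes>\<^bsub>sec G ?T\<^esub> inv\<^bsub>sec G ?T\<^esub> ?y \<in> carrier (sec G ?T)" using x yc by simp
    have "eval_at G ?T s (x \<otimes>\<^bsub>sec G ?T\<^esub> inv\<^bsub>sec G ?T\<^esub> ?y) = \<one>\<^bsub>sec G pt\<^esub>"
      using x yc y ey by (simp add: hom_mult[OF eh] hom_inv[OF GV.is_group Gpt.is_group eh] y_def[symmetric])
    then have "eval_at G ?T s (x \<otimes>\<^bsub>sec G ?T\<^esub> inv\<^bsub>sec G ?T\<^esub> ?y) \<in> H pt" using subgroup.one_closed[OF subgroup_H[OF pt_CHED]] by simp
    then obtain V' where V': "clopen ?T V'" "s \<in> V'" "rs G ?T (topspace ?T) V' (x \<otimes>\<^bsub>sec G ?T\<^esub> inv\<^bsub>sec G ?T\<^esub> ?y) \<in> H (subtopology ?T V')"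
      using open_condensed_nhd[OF G oH TV s' x'] by blast
    have V'2: "clopen S V'" "V' \<subseteq> V" using V'(1) V by (simp_all add: clopen_subtopology)
    note TV' = T[OF V'2(1)]
    interpret GV': group "sec G (sb V')" by (rule group_sec[OF G TV'])
    note rh = rs_group_hom[OF G S V V'2]
    define h' where "h' = rs G S V V' (x \<otimes>\<^bsub>sec G ?T\<^esub> inv\<^bsub>sec G ?T\<^esub> ?y)"
    have h': "h' \<in> H (sb V')" using V'(3) V'2 unfolding rs_T[OF V'2(2)] h'_def by (simp add: subtopology_subtopology Int_absorb1)
    have ry: "rs G S V V' ?y = const_sec G y (sb V')" by (rule rs_const_sec[OF G y S V V'2])
    have yc': "const_sec G y (sb V') \<in> carrier (sec G (sb V'))" by (rule const_sec_closed[OF G y TV'])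
    have rx: "rs G S V V' x \<in> carrier (sec G (sb V'))" by (rule hom_in_carrier[OF rh x])
    have h'_eq: "h' = rs G S V V' x \<otimes>\<^bsub>sec G (sb V')\<^esub> inv\<^bsub>sec G (sb V')\<^esub> const_sec G y (sb V')"
      unfolding h'_def using x yc ry by (simp add: hom_mult[OF rh] hom_inv[OF GV.is_group GV'.is_group rh])
    have "rs G S V V' x = h' \<otimes>\<^bsub>sec G (sb V')\<^esub> const_sec G y (sb V')"
      unfolding h'_eq using rx yc' by (simp add: GV'.m_assoc)
    \<comment> \<open>The correction \<open>h'\<close> stands next to \<open>h0\<close> and is
      absorbed into the factor from \<open>H\<close>.\<close>
    also have "\<dots> = (h' \<otimes>\<^bsub>sec G (sb V')\<^esub> const_sec G h0 (sb V')) \<otimes>\<^bsub>sec G (sb V')\<^esub> c D (sb V') \<otimes>\<^bsub>sec G (sb V')\<^esub> const_sec G k0 (sb V')"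
      unfolding dec_y[OF TV'] using H_car[OF TV' h'] H_car[OF TV' h0Q[OF TV']] K_car[OF TV' k0Q[OF TV']] c_car[OF D V'2(1)]
      by (simp add: GV'.m_assoc)
    finally have "dec S V' (rs G S V V' x) D (h' \<otimes>\<^bsub>sec G (sb V')\<^esub> const_sec G h0 (sb V')) (const_sec G k0 (sb V'))"
      unfolding dec_def using D subgroup.m_closed[OF subgroup_H[OF TV'] h' h0Q[OF TV']] k0Q[OF TV'] by blast
    then show ?thesis using that V'(2) V'2 by blast
  next
    assume oK: "open_in_condensed G K"
    \<comment> \<open>For \<open>K\<close> the comparison is made on the other side, so that the
      correction ends up next to \<open>k0\<close>.\<close>
    have x': "inv\<^bsub>sec G ?T\<^esub> ?y \<otimes>\<^bsub>sec G ?T\<^esub> x \<in> carrier (sec G ?T)" using x yc by simp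
    have "eval_at G ?T s (inv\<^bsub>sec G ?T\<^esub> ?y \<otimes>\<^bsub>sec G ?T\<^esub> x) = \<one>\<^bsub>sec G pt\<^esub>"
      using x yc y ey by (simp add: hom_mult[OF eh] hom_inv[OF GV.is_group Gpt.is_group eh] y_def[symmetric])
    then have "eval_at G ?T s (inv\<^bsub>sec G ?T\<^esub> ?y \<otimes>\<^bsub>sec G ?T\<^esub> x) \<in> K pt" using subgroup.one_closed[OF subgroup_K[OF pt_CHED]] by simp
    then obtain V' where V': "clopen ?T V'" "s \<in> V'" "rs G ?T (topspace ?T) V' (inv\<^bsub>sec G ?T\<^esub> ?y \<otimes>\<^bsub>sec G ?T\<^esub> x) \<in> K (subtopology ?T V')"
      using open_condensed_nhd[OF G oK TV s' x'] by blast
    have V'2: "clopen S V'" "V' \<subseteq> V" using V'(1) V by (simp_all add: clopen_subtopology)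
    note TV' = T[OF V'2(1)]
    interpret GV': group "sec G (sb V')" by (rule group_sec[OF G TV'])
    note rh = rs_group_hom[OF G S V V'2]
    define k' where "k' = rs G S V V' (inv\<^bsub>sec G ?T\<^esub> ?y \<otimes>\<^bsub>sec G ?T\<^esub> x)"
    have k': "k' \<in> K (sb V')" using V'(3) V'2 unfolding rs_T[OF V'2(2)] k'_def by (simp add: subtopology_subtopology Int_absorb1)
    have ry: "rs G S V V' ?y = const_sec G y (sb V')" by (rule rs_const_sec[OF G y S V V'2])
    have yc': "const_sec G y (sb V') \<in> carrier (sec G (sb V'))" by (rule const_sec_closed[OF G y TV'])
    have rx: "rs G S V V' x \<in> carrier (sec G (sb V'))" by (rule hom_in_carrier[OF rh x])
    have k'_eq: "k' = inv\<^bsub>sec G (sb V')\<^esub> const_sec G y (sb V') \<otimes>\<^bsub>sec G (sb V')\<^esub> rs G S V V' x"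
      unfolding k'_def using x yc ry by (simp add: hom_mult[OF rh] hom_inv[OF GV.is_group GV'.is_group rh])
    have "rs G S V V' x = const_sec G y (sb V') \<otimes>\<^bsub>sec G (sb V')\<^esub> k'"
      unfolding k'_eq using rx yc' by (simp add: GV'.m_assoc[symmetric])
    also have "\<dots> = const_sec G h0 (sb V') \<otimes>\<^bsub>sec G (sb V')\<^esub> c D (sb V') \<otimes>\<^bsub>sec G (sb V')\<^esub> (const_sec G k0 (sb V') \<otimes>\<^bsub>sec G (sb V')\<^esub> k')"
      unfolding dec_y[OF TV'] using K_car[OF TV' k'] H_car[OF TV' h0Q[OF TV']] K_car[OF TV' k0Q[OF TV']] c_car[OF D V'2(1)]
      by (simp add: GV'.m_assoc)
    finally have "dec S V' (rs G S V V' x) D (const_sec G h0 (sb V')) (const_sec G k0 (sb V') \<otimes>\<^bsub>sec G (sb V')\<^esub> k')"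
      unfolding dec_def using D subgroup.m_closed[OF subgroup_K[OF TV'] k0Q[OF TV'] k'] h0Q[OF TV'] by blast
    then show ?thesis using that V'(2) V'2 by blast
  qed
qed

text \<open>The local decomposition is the covering clause of a basis, so homomorphisms out of
  \<open>R[G]\<close> may now be prescribed on products \<open>h g k\<close>.\<close>

lemma section_basis_dec: "section_basis (sub_presheaf G W) S (dec_pairs S)"
  unfolding section_basis_def carrier_sub_presheaf rs_sub_presheaf
proof (intro conjI allI impI)
  fix V x assume "(V, x) \<in> dec_pairs S"
  then show "clopen S V" "x \<in> W (sb V)" using dec_car by (auto simp: dec_pairs_def whole_def)
next
  fix V x V' assume "(V, x) \<in> dec_pairs S" "clopen S V'" "V' \<subseteq> V"
  then show "(V', rs G S V V' x) \<in> dec_pairs S" using dec_rs unfolding dec_pairs_def by blast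
next
  fix V x s assume V: "clopen S V" and x: "x \<in> W (sb V)" and s: "s \<in> V"
  have x': "x \<in> carrier (sec G (sb V))" using x by (simp add: whole_def)
  obtain V' D h k where "clopen S V'" "s \<in> V'" "V' \<subseteq> V" "dec S V' (rs G S V V' x) D h k" by (rule dec_local[OF V x' s])
  then show "\<exists>V'. clopen S V' \<and> s \<in> V' \<and> V' \<subseteq> V \<and> (V', rs G S V V' x) \<in> dec_pairs S" unfolding dec_pairs_def by blast
qed

end

section \<open>The isomorphism\<close>

abbreviation "lhs \<equiv> Res R G W K (Ind R G W H M)"
abbreviation "rhs \<equiv> condensed_direct_sum I (\<lambda>D. Ind R G K (L D) (N D))"

text \<open>The facts about \<open>whole G\<close> proved for a single point do not mention that
  point; the identity supplies an instance from which to extract them.\<close>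

lemma coset_one: "mackey_coset R G H K M \<one>\<^bsub>sec G pt\<^esub>"
  by (rule mackey_coset.intro[OF R G H K M]) (rule monoid.one_closed[OF group.is_monoid[OF group_sec[OF G pt_CHED]]])

lemmas csW = mackey_coset.csW[OF coset_one]
  and stW = mackey_coset.stW[OF coset_one]
  and HW = mackey_coset.HW[OF coset_one]
  and WK = mackey_coset.WK[OF coset_one]
  and WW = mackey_coset.WW[OF coset_one]
  and KW = mackey_coset.KW[OF coset_one]

lemma M_smult_hom_left:
  assumes S: "S \<in> CHED" and m: "m \<in> carrier (sec M S)"
  shows "(\<lambda>a. smult (sec M S) a m) \<in> hom (sec (lin R G H) S) (add_monoid (sec M S))"
proof -
  have "right_module (sec (group_ring R G H) S) (sec M S)"
    using M S by (simp add: condensed_right_module_def)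
  then show ?thesis using m by (simp add: right_module_def hom_def)
qed

text \<open>
  The choice does not matter: \<open>x\<close> determines \<open>D\<close> if \<open>V\<close> is nonempty, \<open>val\<close> depends on \<open>h\<close> and \<open>k\<close>
  only through \<open>x\<close>, and over \<open>V = {}\<close> all values are trivial.
\<close>

definition gval :: "'s topology \<Rightarrow> 'm \<Rightarrow> 'r \<Rightarrow> 's set \<Rightarrow> 'g \<Rightarrow> 'g set \<Rightarrow> (('m, ('s, 'r, 'g) lin) tensor, ('s, 'r, 'g) lin) tensor" where
  "gval S m r V x = (SOME b. \<exists>D h k. dec S V x D h k \<and> b = inc S D (val D S m r V h k))"

text \<open>One homomorphism is chosen for each \<open>m\<close>, its existence coming from
  \<open>lin_universal\<close>. The choices turn out additive in \<open>m\<close> because the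
  prescribed values fix a homomorphism on generators.\<close>

definition lift :: "'s topology \<Rightarrow> 'm \<Rightarrow> ('s, 'r, 'g) lin \<Rightarrow> 'g set \<Rightarrow> (('m, ('s, 'r, 'g) lin) tensor, ('s, 'r, 'g) lin) tensor" where
  "lift S m = (SOME F. F \<in> hom (sec (lin R G W) S) (B S) \<and>
     (\<forall>r\<in>carrier (sec R S). \<forall>V x D h k. clopen S V \<longrightarrow> dec S V x D h k \<longrightarrow> F (lgen R G W S r V x) = inc S D (val D S m r V h k)))"

definition to_sum :: "'s topology \<Rightarrow> ('m, ('s, 'r, 'g) lin) tensor \<Rightarrow> 'g set \<Rightarrow> (('m, ('s, 'r, 'g) lin) tensor, ('s, 'r, 'g) lin) tensor" where
  "to_sum S = tensor_lift (B S) (lift S)"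

context
  fixes S :: "'s topology" assumes S: "S \<in> CHED"
begin

interpretation RS: ring "sec R S" by (rule ring_sec[OF R S])

lemma comm_group_U: "D \<in> I \<Longrightarrow> comm_group (U S D)"
  by (rule mackey_coset.comm_group_U[OF coset S])

lemma group_U: "D \<in> I \<Longrightarrow> group (U S D)"
  by (rule mackey_coset.group_U[OF coset S])

lemma comm_group_B: "comm_group (B S)"
  by (rule comm_group_sum_group[OF comm_group_U])

lemma group_B: "group (B S)"
  by (rule comm_group.axioms(2)[OF comm_group_B])

lemma inc_hom: "D \<in> I \<Longrightarrow> inc S D \<in> hom (U S D) (B S)"
  by (rule sum_inj_hom[OF comm_group_U])

lemma gval_eq:
  assumes m: "m \<in> carrier (sec M S)" and r: "r \<in> carrier (sec R S)" and V: "clopen S V" and d: "dec S V x D h k"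
  shows "gval S m r V x = inc S D (val D S m r V h k)"
proof -
  have eq: "inc S D' (val D' S m r V h' k') = inc S D (val D S m r V h k)" if d': "dec S V x D' h' k'" for D' h' k'
  proof (cases "V = {}")
    case True
    have "inc S D (val D S m r V h k) = \<one>\<^bsub>B S\<^esub>" if "dec S V x D h k" for D h k
    proof -
      have D: "D \<in> I" and hk: "h \<in> H (subtopology S {})" "k \<in> K (subtopology S {})" using that True by (auto simp: dec_def)
      show ?thesis unfolding True mackey_coset.val_empty[OF coset[OF D] S m r hk]
        by (rule hom_one[OF inc_hom[OF D] group_U[OF D] group_B])
    qed
    then show ?thesis using d d' by metis
  next
    case False
    then obtain s where s: "s \<in> V" by blast
    have DD: "D' = D" by (rule dec_unique[OF S V s d' d])
    have "val D S m r V h' k' = val D S m r V h k"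
      using d d' unfolding DD dec_def by (intro mackey_coset.val_unique[OF coset S m r V]) auto
    then show ?thesis unfolding DD by simp
  qed
  have "\<exists>b D h k. dec S V x D h k \<and> b = inc S D (val D S m r V h k)" using d by blast
  from someI_ex[OF this, folded gval_def] show ?thesis using eq by metis
qed

lemma dec_pairsE:
  assumes "(V, x) \<in> dec_pairs S"
  obtains D h k where "clopen S V" "dec S V x D h k" "D \<in> I" "h \<in> H (subtopology S V)" "k \<in> K (subtopology S V)"
    "x = h \<otimes>\<^bsub>sec G (subtopology S V)\<^esub> c D (subtopology S V) \<otimes>\<^bsub>sec G (subtopology S V)\<^esub> k"
  using assms unfolding dec_pairs_def dec_def by blast

lemma dec_pairsI: "clopen S V \<Longrightarrow> dec S V x D h k \<Longrightarrow> (V, x) \<in> dec_pairs S"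
  unfolding dec_pairs_def by blast

text \<open>The hypotheses of \<open>lin_universal\<close> come from \<open>val_hom_r\<close>,
  \<open>val_union\<close> and \<open>val_local\<close>, carried into the summand of
  \<open>D\<close>. Restricting a decomposition keeps its \<open>D\<close>, so both parts of a
  partition stay in one summand.\<close>

lemma lift:
  assumes m: "m \<in> carrier (sec M S)"
  shows lift_hom: "lift S m \<in> hom (sec (lin R G W) S) (B S)"
    and lift_lgen: "\<And>r V x D h k. r \<in> carrier (sec R S) \<Longrightarrow> clopen S V \<Longrightarrow> dec S V x D h k \<Longrightarrow>
      lift S m (lgen R G W S r V x) = inc S D (val D S m r V h k)"
proof -
  have "\<exists>F. F \<in> hom (sec (lin R G W) S) (B S) \<and> (\<forall>r U x. r \<in> carrier (sec R S) \<longrightarrow> (U, x) \<in> dec_pairs S \<longrightarrow>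
      F (lgen R G W S r U x) = gval S m r U x)"
  proof (rule lin_universal[OF R M.stableD(3)[OF stW] S section_basis_dec[OF S] comm_group_B, of "gval S m"])
    fix V x assume "(V, x) \<in> dec_pairs S"
    then obtain D h k where *: "clopen S V" "dec S V x D h k" "D \<in> I" "h \<in> H (subtopology S V)" "k \<in> K (subtopology S V)"
      by (rule dec_pairsE)
    note vh = hom_compose[OF mackey_coset.val_hom_r[OF coset[OF *(3)] S m *(1,4,5)] inc_hom[OF *(3)]]
    show "(\<lambda>r. gval S m r V x) \<in> hom (add_monoid (sec R S)) (B S)"
      by (rule group.hom_restrict[OF RS.a_group vh]) (simp add: gval_eq[OF m _ *(1,2)])
    fix r r' assume r: "r \<in> carrier (sec R S)" "r' \<in> carrier (sec R S)" "Rtop R S V r = Rtop R S V r'"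
    show "gval S m r V x = gval S m r' V x"
      unfolding gval_eq[OF m r(1) *(1,2)] gval_eq[OF m r(2) *(1,2)]
        mackey_coset.val_local[OF coset[OF *(3)] S r(1,2) *(1) r(3) *(4)] ..
  next
    fix r V1 V2 x assume r: "r \<in> carrier (sec R S)" and V: "clopen S V1" "clopen S V2" "V1 \<inter> V2 = {}" and "(V1 \<union> V2, x) \<in> dec_pairs S"
    then obtain D h k where *: "clopen S (V1 \<union> V2)" "dec S (V1 \<union> V2) x D h k" "D \<in> I"
      "h \<in> H (subtopology S (V1 \<union> V2))" "k \<in> K (subtopology S (V1 \<union> V2))"
      by (auto elim: dec_pairsE)
    have d1: "dec S V1 (rs G S (V1 \<union> V2) V1 x) D (rs G S (V1 \<union> V2) V1 h) (rs G S (V1 \<union> V2) V1 k)"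
      by (rule dec_rs[OF S *(1) V(1) _ *(2)]) simp
    have d2: "dec S V2 (rs G S (V1 \<union> V2) V2 x) D (rs G S (V1 \<union> V2) V2 h) (rs G S (V1 \<union> V2) V2 k)"
      by (rule dec_rs[OF S *(1) V(2) _ *(2)]) simp
    have "val D S m r V1 (rs G S (V1 \<union> V2) V1 h) (rs G S (V1 \<union> V2) V1 k) \<in> carrier (U S D)"
      "val D S m r V2 (rs G S (V1 \<union> V2) V2 h) (rs G S (V1 \<union> V2) V2 k) \<in> carrier (U S D)"
      using d1 d2 unfolding dec_def
      by (intro mackey_coset.val_closed[OF coset[OF *(3)] S m r V(1)], simp, simp, intro mackey_coset.val_closed[OF coset[OF *(3)] S m r V(2)]) simp_all
    then show "gval S m r (V1 \<union> V2) x = gval S m r V1 (rs G S (V1 \<union> V2) V1 x) \<otimes>\<^bsub>B S\<^esub> gval S m r V2 (rs G S (V1 \<union> V2) V2 x)"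
      unfolding gval_eq[OF m r *(1,2)] gval_eq[OF m r V(1) d1] gval_eq[OF m r V(2) d2]
        mackey_coset.val_union[OF coset[OF *(3)] S m r V *(4,5)]
      by (rule hom_mult[OF inc_hom[OF *(3)]])
  qed blast
  then obtain F where F: "F \<in> hom (sec (lin R G W) S) (B S)"
    "\<And>r U x. r \<in> carrier (sec R S) \<Longrightarrow> (U, x) \<in> dec_pairs S \<Longrightarrow> F (lgen R G W S r U x) = gval S m r U x" by blast
  have "F (lgen R G W S r V x) = inc S D (val D S m r V h k)"
    if "r \<in> carrier (sec R S)" "clopen S V" "dec S V x D h k" for r V x D h k
    using F(2)[OF that(1) dec_pairsI[OF that(2,3)]] gval_eq[OF m that] by simp
  then have "\<exists>F. F \<in> hom (sec (lin R G W) S) (B S) \<and>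
     (\<forall>r\<in>carrier (sec R S). \<forall>V x D h k. clopen S V \<longrightarrow> dec S V x D h k \<longrightarrow> F (lgen R G W S r V x) = inc S D (val D S m r V h k))"
    by (intro exI[of _ F] conjI[OF F(1)]) simp
  from someI_ex[OF this, folded lift_def]
  show "lift S m \<in> hom (sec (lin R G W) S) (B S)"
    "\<And>r V x D h k. r \<in> carrier (sec R S) \<Longrightarrow> clopen S V \<Longrightarrow> dec S V x D h k \<Longrightarrow>
      lift S m (lgen R G W S r V x) = inc S D (val D S m r V h k)" by blast+
qed

abbreviation "dgens \<equiv> {lgen R G W S r V x |r V x. r \<in> carrier (sec R S) \<and> (V, x) \<in> dec_pairs S}"

lemma dgens: "generates (sec (lin R G W) S) dgens"
  by (rule lin_generates[OF R M.stableD(3)[OF stW] S section_basis_dec[OF S]])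

lemma lift_hom_left:
  assumes t: "t \<in> carrier (sec (lin R G W) S)"
  shows "(\<lambda>m. lift S m t) \<in> hom (add_monoid (sec M S)) (B S)"
proof (rule homI)
  interpret MS: comm_group "add_monoid (sec M S)" by (rule M.N_add[OF S])
  fix m m' assume "m \<in> carrier (add_monoid (sec M S))" "m' \<in> carrier (add_monoid (sec M S))"
  then have m: "m \<in> carrier (sec M S)" "m' \<in> carrier (sec M S)" and mm: "m \<oplus>\<^bsub>sec M S\<^esub> m' \<in> carrier (sec M S)"
    using MS.m_closed by simp_all
  have "lift S (m \<oplus>\<^bsub>sec M S\<^esub> m') t = lift S m t \<otimes>\<^bsub>B S\<^esub> lift S m' t"
  proof (rule hom_eq_on_generators[OF group_lin[OF R G csW S] group_B dgens lift_hom[OF mm]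
        hom_pointwise_mult[OF comm_group_B lift_hom[OF m(1)] lift_hom[OF m(2)]] _ t])
    fix q assume "q \<in> dgens"
    then obtain r V x where q: "q = lgen R G W S r V x" "r \<in> carrier (sec R S)" "(V, x) \<in> dec_pairs S" by blast
    from q(3) obtain D h k where *: "clopen S V" "dec S V x D h k" "D \<in> I" "h \<in> H (subtopology S V)" "k \<in> K (subtopology S V)"
      by (rule dec_pairsE)
    note hm = hom_compose[OF mackey_coset.val_hom_m[OF coset[OF *(3)] S q(2) *(1,4,5)] inc_hom[OF *(3)]]
    show "lift S (m \<oplus>\<^bsub>sec M S\<^esub> m') q = lift S m q \<otimes>\<^bsub>B S\<^esub> lift S m' q"
      unfolding q(1) lift_lgen[OF m(1) q(2) *(1,2)] lift_lgen[OF m(2) q(2) *(1,2)] lift_lgen[OF mm q(2) *(1,2)]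
      using hom_mult[OF hm, of m m'] m by simp
  qed
  then show "lift S (m \<otimes>\<^bsub>add_monoid (sec M S)\<^esub> m') t = lift S m t \<otimes>\<^bsub>B S\<^esub> lift S m' t" by simp
qed (use hom_in_carrier[OF lift_hom t] in simp)

text \<open>Left multiplication of \<open>h g k\<close> by \<open>h'\<close> changes only the factor
  from \<open>H\<close>, so the summand stays the same and \<open>val_smult\<close> matches the two
  sides.\<close>

lemma lift_balanced:
  assumes m: "m \<in> carrier (sec M S)" and a: "a \<in> carrier (sec (lin R G H) S)" and t: "t \<in> carrier (sec (lin R G W) S)"
  shows "lift S (smult (sec M S) a m) t = lift S m (lin_mult R G W S a t)"
proof (rule bihom_eq_on_generators[OF group_lin[OF R G csH S] lin_generates_all[OF R G csH S] group_lin[OF R G csW S] dgens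
      group_B _ _ _ _ _ a t])
  show "lift S (smult (sec M S) a m) \<in> hom (sec (lin R G W) S) (B S)" if "a \<in> carrier (sec (lin R G H) S)" for a
    by (rule lift_hom[OF M.N_smult_closed[OF S that m]])
  show "(\<lambda>a. lift S (smult (sec M S) a m) t) \<in> hom (sec (lin R G H) S) (B S)" if "t \<in> carrier (sec (lin R G W) S)" for t
    using hom_compose[OF M_smult_hom_left[OF S m] lift_hom_left[OF that]] by (simp add: comp_def)
  show "(\<lambda>t. lift S m (lin_mult R G W S a t)) \<in> hom (sec (lin R G W) S) (B S)" if "a \<in> carrier (sec (lin R G H) S)" for a
    using hom_compose[OF lin_mult_hom_right[OF R G csH csW csW HW S that] lift_hom[OF m]] by (simp add: comp_def)
  show "(\<lambda>a. lift S m (lin_mult R G W S a t)) \<in> hom (sec (lin R G H) S) (B S)" if "t \<in> carrier (sec (lin R G W) S)" for t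
    using hom_compose[OF lin_mult_hom_left[OF R G csH csW csW HW S that] lift_hom[OF m]] by (simp add: comp_def)
  fix p q assume p: "p \<in> lgens R G H S" and "q \<in> dgens"
  then obtain r V x where q: "q = lgen R G W S r V x" "r \<in> carrier (sec R S)" "(V, x) \<in> dec_pairs S" by blast
  from q(3) obtain D h k where *: "clopen S V" "dec S V x D h k" "D \<in> I" "h \<in> H (subtopology S V)" "k \<in> K (subtopology S V)"
    by (rule dec_pairsE)
  obtain r' V' h' where p': "p = lgen R G H S r' V' h'" "r' \<in> carrier (sec R S)" "clopen S V'" "h' \<in> H (subtopology S V')"
    by (rule lgensE[OF R G p])
  have pc: "p \<in> carrier (sec (lin R G H) S)" using lin_generates_all[OF R G csH S] p by (auto simp: generates_def)
  have I: "clopen S (V' \<inter> V)" "V' \<inter> V \<subseteq> V'" "V' \<inter> V \<subseteq> V" using p'(3) *(1) clopen_Int by auto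
  have xW: "x \<in> W (subtopology S V)" using dec_car[OF S *(1,2)] by (simp add: whole_def)
  have rr: "r' \<otimes>\<^bsub>sec R S\<^esub> r \<in> carrier (sec R S)" using p' q by simp
  note d = dec_mult[OF S I(1) rs_in[OF R G csH S p'(3) I(1,2) p'(4)] dec_rs[OF S *(1) I(1,3) *(2)]]
  show "lift S (smult (sec M S) p m) q = lift S m (lin_mult R G W S p q)"
    unfolding q(1) lift_lgen[OF M.N_smult_closed[OF S pc m] q(2) *(1,2)]
    unfolding p'(1) mackey_coset.val_smult[OF coset[OF *(3)] S m q(2) p'(2) *(1,4,5) p'(3,4)]
      lin_mult_lgen[OF R G csH csW csW HW S p'(2) q(2) p'(3,4) *(1) xW] lift_lgen[OF m rr I(1) d] ..
qed

lemma to_sum_hom: "to_sum S \<in> hom (M.TM W S) (B S)"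
  and to_sum_pm: "\<And>m t. m \<in> carrier (sec M S) \<Longrightarrow> t \<in> carrier (sec (lin R G W) S) \<Longrightarrow> to_sum S (M.pm W S m t) = lift S m t"
  unfolding to_sum_def
  using M.TM_lift[OF stW S comm_group_B, of "lift S", OF lift_hom lift_hom_left lift_balanced] by blast+

text \<open>On a generator \<open>val\<close> the map \<open>psi\<close> multiplies out to
  \<open>h g k\<close>, and \<open>lift\<close> may evaluate this product by means of that very
  decomposition.\<close>

lemma to_sum_psi:
  assumes D: "D \<in> I" and z: "z \<in> carrier (U S D)"
  shows "to_sum S (psi S z) = inc S D z"
proof -
  have "(to_sum S \<circ> psi S) z = inc S D z"
  proof (rule hom_eq_on_generators[OF group_U[OF D] group_B mackey_coset.val_generates[OF coset[OF D] S]
        hom_compose[OF mackey_coset.psi_hom[OF coset[OF D] S] to_sum_hom] inc_hom[OF D] _ z], clarify)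
    fix m r V h k assume m: "m \<in> carrier (sec M S)" and r: "r \<in> carrier (sec R S)" and V: "clopen S V"
      and h: "h \<in> H (subtopology S V)" and k: "k \<in> K (subtopology S V)"
    let ?x = "h \<otimes>\<^bsub>sec G (subtopology S V)\<^esub> c D (subtopology S V) \<otimes>\<^bsub>sec G (subtopology S V)\<^esub> k"
    have d: "dec S V ?x D h k" using D h k by (simp add: dec_def)
    have "lgen R G W S r V ?x \<in> carrier (sec (lin R G W) S)"
      using dec_car[OF S V d] by (intro lgen_closed[OF R M.stableD(3)[OF stW] S r V]) (simp add: whole_def)
    then show "(to_sum S \<circ> psi S) (val D S m r V h k) = inc S D (val D S m r V h k)"
      unfolding comp_apply mackey_coset.psi_val[OF coset[OF D] S m r V h k]
      by (simp only: to_sum_pm[OF m] lift_lgen[OF m r V d])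
  qed
  then show ?thesis by simp
qed

text \<open>A generator built from \<open>x = h g k\<close> is the image under \<open>psi\<close> of
  the corresponding \<open>val\<close>, and by \<open>dgens\<close> such generators are
  enough.\<close>

lemma psi_generates: "generates (M.TM W S) (\<Union>D\<in>I. psi S ` carrier (U S D))"
proof (rule generatesI[OF M.group_TM[OF stW S] M.TM_generates[OF stW S dgens]])
  show "(\<Union>D\<in>I. psi S ` carrier (U S D)) \<subseteq> carrier (M.TM W S)"
    using hom_in_carrier[OF mackey_coset.psi_hom[OF coset S]] by blast
  show "{M.pm W S m t |m t. m \<in> carrier (sec M S) \<and> t \<in> dgens} \<subseteq> generate (M.TM W S) (\<Union>D\<in>I. psi S ` carrier (U S D))"
  proof clarify
    fix m r V x assume m: "m \<in> carrier (sec M S)" and r: "r \<in> carrier (sec R S)" and "(V, x) \<in> dec_pairs S"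
    then obtain D h k where *: "clopen S V" "D \<in> I" "h \<in> H (subtopology S V)" "k \<in> K (subtopology S V)"
      "x = h \<otimes>\<^bsub>sec G (subtopology S V)\<^esub> c D (subtopology S V) \<otimes>\<^bsub>sec G (subtopology S V)\<^esub> k"
      by (auto elim: dec_pairsE)
    have "M.pm W S m (lgen R G W S r V x) = psi S (val D S m r V h k)"
      unfolding mackey_coset.psi_val[OF coset[OF *(2)] S m r *(1,3,4)] *(5) ..
    then show "M.pm W S m (lgen R G W S r V x) \<in> generate (M.TM W S) (\<Union>D\<in>I. psi S ` carrier (U S D))"
      using mackey_coset.val_closed[OF coset[OF *(2)] S m r *(1,3,4)] *(2) by (intro generate.incl) auto
  qed
qed

lemma to_sum_bij: "bij_betw (to_sum S) (carrier (M.TM W S)) (carrier (B S))"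
  by (rule bij_betw_sum_group[OF comm_group_U M.comm_group_TM[OF stW S] to_sum_hom
        mackey_coset.psi_hom[OF coset S] to_sum_psi psi_generates])

text \<open>Since \<open>to_sum\<close> involves a choice, its behaviour is not visible from its
  definition. On images of \<open>psi\<close> it is the inclusion of a summand, so linearity and
  naturality are tested there and inherited from \<open>psi\<close>.\<close>

lemma to_sum_eq:
  assumes "group Q" "p \<in> hom (M.TM W S) Q" "p' \<in> hom (M.TM W S) Q"
    and "\<And>D z. D \<in> I \<Longrightarrow> z \<in> carrier (U S D) \<Longrightarrow> p (psi S z) = p' (psi S z)" and "x \<in> carrier (M.TM W S)"
  shows "p x = p' x"
  by (rule hom_eq_on_generators[OF M.group_TM[OF stW S] assms(1) psi_generates assms(2,3) _ assms(5)]) (use assms(4) in blast)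

end

section \<open>Linearity over \<open>R[K]\<close> and naturality of the isomorphism\<close>

lemma lhs_simps:
  "carrier (sec lhs S) = carrier (M.TM W S)" "ring.add (sec lhs S) = monoid.mult (M.TM W S)"
  "smult (sec lhs S) a = M.ract W S (lin_incl R G W S a)" "res lhs = res (M.TN W)"
  by (simp_all add: Res_def Ind_def M.TN_simps)

lemma lhs_smult:
  "S \<in> CHED \<Longrightarrow> a \<in> carrier (sec (lin R G K) S) \<Longrightarrow> x \<in> carrier (M.TM W S) \<Longrightarrow> smult (sec lhs S) a x = M.ract W S a x"
  unfolding lhs_simps by (rule M.ract_incl[OF stW stW csK csW WW KW])

lemma rhs_simps:
  "carrier (sec rhs S) = carrier (B S)" "ring.add (sec rhs S) = monoid.mult (B S)"
  "smult (sec rhs S) a = (\<lambda>x. \<lambda>D\<in>I. smult (sec (Ind R G K (L D) (N D)) S) a (x D))"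
  "res rhs S T f = (\<lambda>x. \<lambda>D\<in>I. res (Ind R G K (L D) (N D)) S T f (x D))"
proof -
  have "sum_group I (\<lambda>D. add_monoid (sec (Ind R G K (L D) (N D)) S)) = B S"
    by (rule sum_group_eqI) (simp_all add: mackey_coset.J_simps[OF coset])
  then show "carrier (sec rhs S) = carrier (B S)" "ring.add (sec rhs S) = monoid.mult (B S)"
    by (simp_all add: condensed_direct_sum_def)
qed (simp_all add: condensed_direct_sum_def)

lemma to_sum_smult:
  assumes S: "S \<in> CHED" and a: "a \<in> carrier (sec (lin R G K) S)" and x: "x \<in> carrier (M.TM W S)"
  shows "to_sum S (M.ract W S a x) = smult (sec rhs S) a (to_sum S x)"
proof -
  let ?f = "\<lambda>D. smult (sec (Ind R G K (L D) (N D)) S) a"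
  note f = mackey_coset.J_smult_hom[OF coset S a] and U = group_U[OF S]
  have "(to_sum S \<circ> M.ract W S a) x = ((\<lambda>x. \<lambda>D\<in>I. ?f D (x D)) \<circ> to_sum S) x"
  proof (rule to_sum_eq[OF S group_B[OF S] hom_compose[OF M.ract_hom[OF stW stW csK WK S a] to_sum_hom[OF S]]
      hom_compose[OF to_sum_hom[OF S] sum_group_map_hom[OF U U f]] _ x])
    fix D z assume D: "D \<in> I" and z: "z \<in> carrier (U S D)"
    show "(to_sum S \<circ> M.ract W S a) (psi S z) = ((\<lambda>x. \<lambda>D\<in>I. ?f D (x D)) \<circ> to_sum S) (psi S z)"
      \<comment> \<open>Linearity of \<open>psi\<close>, read backwards, moves the action into the
        summand, after which both sides are inclusions of the same element.\<close>
      unfolding comp_apply mackey_coset.psi_smult[OF coset[OF D] S a z, symmetric] to_sum_psi[OF S D z]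
        to_sum_psi[OF S D hom_in_carrier[OF f[OF D] z]]
      by (rule sum_group_map_inj[OF U U f, symmetric])
  qed
  then show ?thesis by (simp add: rhs_simps)
qed

lemma to_sum_res:
  assumes S: "S \<in> CHED" and T: "T \<in> CHED" and \<tau>: "continuous_map S T \<tau>" and x: "x \<in> carrier (M.TM W T)"
  shows "to_sum S (res (M.TN W) S T \<tau> x) = res rhs S T \<tau> (to_sum T x)"
proof -
  let ?f = "\<lambda>D. res (Ind R G K (L D) (N D)) S T \<tau>"
  note f = mackey_coset.J_res_hom[OF coset S T \<tau>]
  have "(to_sum S \<circ> res (M.TN W) S T \<tau>) x = ((\<lambda>x. \<lambda>D\<in>I. ?f D (x D)) \<circ> to_sum T) x"
  proof (rule to_sum_eq[OF T group_B[OF S] hom_compose[OF M.res_TN_hom[OF S T \<tau> stW] to_sum_hom[OF S]]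
      hom_compose[OF to_sum_hom[OF T] sum_group_map_hom[OF group_U[OF T] group_U[OF S] f]] _ x])
    fix D z assume D: "D \<in> I" and z: "z \<in> carrier (U T D)"
    show "(to_sum S \<circ> res (M.TN W) S T \<tau>) (psi T z) = ((\<lambda>x. \<lambda>D\<in>I. ?f D (x D)) \<circ> to_sum T) (psi T z)"
      unfolding comp_apply mackey_coset.psi_J_res[OF coset[OF D] S T \<tau> z, symmetric] to_sum_psi[OF T D z]
        to_sum_psi[OF S D hom_in_carrier[OF f[OF D] z]]
      by (rule sum_group_map_inj[OF group_U[OF T] group_U[OF S] f, symmetric])
  qed
  then show ?thesis by (simp add: rhs_simps)
qed

theorem mackey_formula: "condensed_module_isomorphic (group_ring R G K) lhs rhs"
  unfolding condensed_module_isomorphic_def condensed_map_def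
proof (intro exI[of _ to_sum] conjI ballI allI impI)
  fix S :: "'s topology" assume S: "S \<in> CHED"
  show "to_sum S \<in> carrier (sec lhs S) \<rightarrow> carrier (sec rhs S)"
    unfolding lhs_simps rhs_simps using hom_in_carrier[OF to_sum_hom[OF S]] by blast
  show "bij_betw (to_sum S) (carrier (sec lhs S)) (carrier (sec rhs S))"
    unfolding lhs_simps rhs_simps by (rule to_sum_bij[OF S])
  fix x assume "x \<in> carrier (sec lhs S)"
  then have x: "x \<in> carrier (M.TM W S)" unfolding lhs_simps .
  show "to_sum S (x \<oplus>\<^bsub>sec lhs S\<^esub> y) = to_sum S x \<oplus>\<^bsub>sec rhs S\<^esub> to_sum S y" if "y \<in> carrier (sec lhs S)" for y
    using that unfolding lhs_simps rhs_simps by (rule hom_mult[OF to_sum_hom[OF S] x])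
  show "to_sum S (smult (sec lhs S) a x) = smult (sec rhs S) a (to_sum S x)" if "a \<in> carrier (sec (group_ring R G K) S)" for a
    using that lhs_smult[OF S _ x] to_sum_smult[OF S _ x] by simp
next
  fix S T :: "'s topology" and f x assume "S \<in> CHED" "T \<in> CHED" "continuous_map S T f" "x \<in> carrier (sec lhs T)"
  then show "to_sum S (res lhs S T f x) = res rhs S T f (to_sum T x)"
    unfolding lhs_simps by (intro to_sum_res)
qed

end

theorem theorem5p5:
  fixes R :: "('s, 'r) ring_presheaf"
    and G :: "('s, 'g) group_presheaf"
    and H K :: "'s topology \<Rightarrow> 'g set"
    and M :: "('s, ('s, 'r, 'g) lin, 'm) module_presheaf"
    and g :: "'g set \<Rightarrow> 'g"
  assumes "condensed_ring R"
    and "condensed_group G"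
    and "condensed_subgroup G H"
    and "condensed_subgroup G K"
    and "open_in_condensed G H \<or> open_in_condensed G K"
    and "condensed_right_module (group_ring R G H) M"
    and "\<And>D. D \<in> carrier (sec (double_quotient G H K) pt) \<Longrightarrow> g D \<in> D"
  shows "condensed_module_isomorphic (group_ring R G K)
    (Res R G (whole G) K (Ind R G (whole G) H M))
    (condensed_direct_sum (carrier (sec (double_quotient G H K) pt))
      (\<lambda>D. Ind R G K (intersection K (conjugate G H (g D)))
        (Res R G (conjugate G H (g D)) (intersection K (conjugate G H (g D)))
          (condensed_tensor_bimodule (group_ring R G H) M
            (lin_bimodule R G (translate G H (g D)))))))"
  by (rule mackey.mackey_formula[OF mackey.intro[OF assms]])

end
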